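(* For any $q\ge0$, $a>0$ and $x\le a$, $$\mathbb{E}_x\left(e^{-qT_a^+}\right)=\frac{r^{(q)}(x)}{r^{(q)}(a)},\qquad\text{where } r^{(q)}(x):=Z^{(q)}(x)+q\delta\int_b^x\mathbb{W}^{(q)}(x-y)W^{(q)}(y)\,dy,\quad x\in\mathbb{R}.$$ In particular, $T_a^+<\infty$ $\mathbb{P}_x$-a.s.
   Context: Let $X=(X_t)_{t\ge0}$ be a spectrally negative Lévy process (no positive jumps, not the negative of a subordinator); $\mathbb{P}_x$ is its law when $X_0=x$, with expectation $\mathbb{E}_x$. Its Laplace exponent is $\psi(\theta)=\log\mathbb{E}_0[e^{\theta X_1}]=\gamma\theta+\frac{\sigma^2}{2}\theta^2+\int_{(-\infty,0)}(e^{\theta x}-1-\theta x1_{\{x>-1\}})\Pi(dx)$, $\theta\ge0$, with $\gamma\in\mathbb{R}$, $\sigma\ge0$ and Lévy measure $\Pi$ on $(-\infty,0)$, $\int(1\wedge x^2)\Pi(dx)<\infty$. If $X$ has paths of bounded variation, then $X_t=X_0+ct-S_t$ with $c:=\gamma-\int_{(-1,0)}x\,\Pi(dx)>0$ and $S$ a driftless subordinator. Fix $b>0$ and $\delta\ge0$, and assume $\delta<c$ whenever $X$ has paths of bounded variation. Put $Y_t:=X_t-\delta t$, a spectrally negative Lévy process with Laplace exponent $\psi_Y(\theta)=\psi(\theta)-\delta\theta$. Refracted-reflected process $V$ under $\mathbb{P}_x$ (reflected at $0$, refracted above $b$): Step 0: set $V_{0-}=x$; if $x\ge0$ set $\underline\tau:=0$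 and go to Step 1, otherwise set $\overline\tau:=0$ and go to Step 2. Step 1: let $(\widetilde A_t)_{t\ge\underline\tau}$ be the refracted Lévy process started at time $\underline\tau$ at level $x$, i.e. the unique strong solution of $d\widetilde A_t=dX_t-\delta1_{\{\widetilde A_t>b\}}dt$ with $\widetilde A_{\underline\tau}=x$; let $\overline\tau:=\inf\{t>\underline\tau:\widetilde A_t<0\}$, set $V_t=\widetilde A_t$ for $\underline\tau\le t<\overline\tau$, and go to Step 2. Step 2: let $\widetilde U_t=(X_t-X_{\overline\tau})+\sup_{\overline\tau\le s\le t}(-(X_s-X_{\overline\tau}))\vee0$, $t\ge\overline\tau$, be the process reflected at $0$ started at time $\overline\tau$ at $0$; let $\underline\tau:=\inf\{t>\overline\tau:\widetilde U_t>b\}$, set $V_t=\widetilde U_t$ for $\overline\tau\le t<\underline\tau$, set $x=b$, and go to Step 1. For $a>0$, $T_a^+:=\inf\{t>0:V_t>a\}$ ($\inf\varnothing=\infty$). Scale functions: for $q\ge0$, $\Phi(q):=\sup\{\lambda\ge0:\psi(\lambda)=q\}$ and $\varphi(q):=\sup\{\lambda\ge0:\psi_Y(\lambda)=q\}$. $W^{(q)}$ (resp. $\mathbb{W}^{(q)}$) is the scale function of $X$ (resp. $Y$): zero on $(-\infty,0)$, continuous and increasing on $[0,\infty)$, with $\int_0^\infty e^{-\theta x}W^{(q)}(x)dx=1/(\psi(\theta)-q)$ for $\theta>\Phi(q)$ (resp. $\int_0^\infty e^{-\theta x}\mathbb{W}^{(q)}(x)dx=1/(\psi_Y(\theta)-q)$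 for $\theta>\varphi(q)$). Also $Z^{(q)}(x):=1+q\int_0^xW^{(q)}(y)dy$, $x\in\mathbb{R}$. Integrals $\int_b^x\mathbb{W}^{(q)}(x-y)\cdots dy$ vanish for $x\le b$. *)

theory Defs
  imports "HOL-Probability.Probability"
begin

section \<open>Spectrally negative Levy processes\<close>

text \<open>
  Processes are functions \<open>X t \<omega>\<close> of a real time \<open>t\<close>; only times \<open>t \<ge> 0\<close> matter.
  A Levy process \<open>X\<close> starts at \<open>0\<close>, and its law under \<open>P\<^sub>x\<close> is realised as the law of
  \<open>x + X\<close> under \<open>M\<close>.
\<close>

definition cadlag :: "(real \<Rightarrow> real) \<Rightarrow> bool" where
  "cadlag \<xi> \<longleftrightarrow>
     (\<forall>t\<ge>0. (\<xi> \<longlongrightarrow> \<xi> t) (at_right t)) \<and> (\<forall>t>0. \<exists>l. (\<xi> \<longlongrightarrow> l) (at_left t))"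

definition levy_process :: "'a measure \<Rightarrow> (real \<Rightarrow> 'a \<Rightarrow> real) \<Rightarrow> bool" where
  "levy_process M X \<longleftrightarrow>
     prob_space M \<and>
     (\<forall>t\<ge>0. X t \<in> borel_measurable M) \<and>
     (AE \<omega> in M. X 0 \<omega> = 0) \<and>
     (AE \<omega> in M. cadlag (\<lambda>t. X t \<omega>)) \<and>
     (\<forall>(t :: nat \<Rightarrow> real) n. 0 \<le> t 0 \<longrightarrow> mono t \<longrightarrow>
        prob_space.indep_vars M (\<lambda>_. borel) (\<lambda>i \<omega>. X (t (Suc i)) \<omega> - X (t i) \<omega>) {..<n}) \<and>
     (\<forall>s t. 0 \<le> s \<longrightarrow> s \<le> t \<longrightarrow>
        distr M borel (\<lambda>\<omega>. X t \<omega> - X s \<omega>) = distr M borel (X (t - s)))"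

definition subordinator :: "'a measure \<Rightarrow> (real \<Rightarrow> 'a \<Rightarrow> real) \<Rightarrow> bool" where
  "subordinator M S \<longleftrightarrow> levy_process M S \<and> (AE \<omega> in M. mono_on {0..} (\<lambda>t. S t \<omega>))"

definition spectrally_negative :: "'a measure \<Rightarrow> (real \<Rightarrow> 'a \<Rightarrow> real) \<Rightarrow> bool" where
  "spectrally_negative M X \<longleftrightarrow>
     levy_process M X \<and>
     (AE \<omega> in M. \<forall>t>0. \<forall>l. ((\<lambda>s. X s \<omega>) \<longlongrightarrow> l) (at_left t) \<longrightarrow> X t \<omega> \<le> l) \<and>
     \<not> subordinator M (\<lambda>t \<omega>. - X t \<omega>)"

definition laplace_exponent :: "'a measure \<Rightarrow> (real \<Rightarrow> 'a \<Rightarrow> real) \<Rightarrow> real \<Rightarrow> real" where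
  "laplace_exponent M X \<theta> = ln (LINT \<omega>|M. exp (\<theta> * X 1 \<omega>))"

definition levy_measure_neg :: "real measure \<Rightarrow> bool" where
  "levy_measure_neg \<nu> \<longleftrightarrow>
     sets \<nu> = sets borel \<and> emeasure \<nu> {0..} = 0 \<and> integrable \<nu> (\<lambda>x. min 1 (x\<^sup>2))"

definition levy_triplet ::
  "'a measure \<Rightarrow> (real \<Rightarrow> 'a \<Rightarrow> real) \<Rightarrow> real \<Rightarrow> real \<Rightarrow> real measure \<Rightarrow> bool" where
  "levy_triplet M X \<gamma> \<sigma> \<nu> \<longleftrightarrow>
     0 \<le> \<sigma> \<and> levy_measure_neg \<nu> \<and>
     (\<forall>\<theta>\<ge>0. laplace_exponent M X \<theta> =
        \<gamma> * \<theta> + \<sigma>\<^sup>2 / 2 * \<theta>\<^sup>2 +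
        (LINT x:{..<0}|\<nu>. exp (\<theta> * x) - 1 - \<theta> * x * indicator {-1<..} x))"

definition finite_variation_on :: "real \<Rightarrow> real \<Rightarrow> (real \<Rightarrow> real) \<Rightarrow> bool" where
  "finite_variation_on u v \<xi> \<longleftrightarrow>
     bdd_above {(\<Sum>i<n. \<bar>\<xi> (s (Suc i)) - \<xi> (s i)\<bar>) | (n :: nat) (s :: nat \<Rightarrow> real).
                 mono s \<and> range s \<subseteq> {u..v}}"

definition bounded_variation_paths :: "'a measure \<Rightarrow> (real \<Rightarrow> 'a \<Rightarrow> real) \<Rightarrow> bool" where
  "bounded_variation_paths M X \<longleftrightarrow>
     (AE \<omega> in M. \<forall>T\<ge>0. finite_variation_on 0 T (\<lambda>t. X t \<omega>))"

text \<open>The constant \<open>c\<close>; it is used only when \<open>X\<close> has paths of bounded variation, in which case the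
  integral converges.\<close>
definition bv_drift :: "real \<Rightarrow> real measure \<Rightarrow> real" where
  "bv_drift \<gamma> \<nu> = \<gamma> - (LINT x:{-1<..<0}|\<nu>. x)"

section \<open>Scale functions\<close>

definition laplace_inverse :: "'a measure \<Rightarrow> (real \<Rightarrow> 'a \<Rightarrow> real) \<Rightarrow> real \<Rightarrow> real" where
  "laplace_inverse M X q = Sup {\<theta>. 0 \<le> \<theta> \<and> laplace_exponent M X \<theta> = q}"

text \<open>These properties determine the \<open>q\<close>-scale function of \<open>X\<close> uniquely.\<close>
definition is_scale_function ::
  "'a measure \<Rightarrow> (real \<Rightarrow> 'a \<Rightarrow> real) \<Rightarrow> real \<Rightarrow> (real \<Rightarrow> real) \<Rightarrow> bool" where
  "is_scale_function M X q W \<longleftrightarrow>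
     (\<forall>x<0. W x = 0) \<and> continuous_on {0..} W \<and> mono_on {0..} W \<and>
     (\<forall>\<theta> > laplace_inverse M X q.
        set_integrable lborel {0..} (\<lambda>x. exp (- \<theta> * x) * W x) \<and>
        (LINT x:{0..}|lborel. exp (- \<theta> * x) * W x) = 1 / (laplace_exponent M X \<theta> - q))"

definition Z_fun :: "real \<Rightarrow> (real \<Rightarrow> real) \<Rightarrow> real \<Rightarrow> real" where
  "Z_fun q W x = 1 + q * (LINT y:{0..x}|lborel. W y)"

definition r_fun ::
  "real \<Rightarrow> real \<Rightarrow> real \<Rightarrow> (real \<Rightarrow> real) \<Rightarrow> (real \<Rightarrow> real) \<Rightarrow> real \<Rightarrow> real" where
  "r_fun q \<delta> b W WW x =
     Z_fun q W x + q * \<delta> * (LINT y:{b..x}|lborel. WW (x - y) * W y)"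

section \<open>The refracted-reflected process\<close>

text \<open>
  The construction is pathwise, in terms of a path \<open>\<xi>\<close> of the driving process.
  As \<open>\<delta> \<ge> 0\<close>, a solution of the refraction equation is unique on \<open>{\<tau>..}\<close> for each
  path (the squared difference of two solutions is nonincreasing), so the strong solution of the
  stochastic equation is, path by path, the solution selected by \<open>refracted\<close>; the values
  before time \<open>\<tau>\<close> are irrelevant.
\<close>

definition refracted_solution ::
  "real \<Rightarrow> real \<Rightarrow> (real \<Rightarrow> real) \<Rightarrow> real \<Rightarrow> real \<Rightarrow> (real \<Rightarrow> real) \<Rightarrow> bool" where
  "refracted_solution \<delta> b \<xi> \<tau> x A \<longleftrightarrow>
     (\<forall>t\<ge>\<tau>. set_integrable lborel {\<tau>..t} (\<lambda>s. indicat_real {b<..} (A s)) \<and>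
        A t = x + (\<xi> t - \<xi> \<tau>) - \<delta> * (LINT s:{\<tau>..t}|lborel. indicat_real {b<..} (A s)))"

definition refracted ::
  "real \<Rightarrow> real \<Rightarrow> (real \<Rightarrow> real) \<Rightarrow> real \<Rightarrow> real \<Rightarrow> real \<Rightarrow> real" where
  "refracted \<delta> b \<xi> \<tau> x = (SOME A. refracted_solution \<delta> b \<xi> \<tau> x A)"

definition reflected :: "(real \<Rightarrow> real) \<Rightarrow> real \<Rightarrow> real \<Rightarrow> real" where
  "reflected \<xi> \<tau> t = (\<xi> t - \<xi> \<tau>) + max (SUP s\<in>{\<tau>..t}. - (\<xi> s - \<xi> \<tau>)) 0"

text \<open>
  A stage is one execution of Step 1 (with its starting time and starting level) or of Step 2
  (with its starting time; the starting level is \<open>0\<close>). Starting time \<open>\<infinity>\<close> means that the stage is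
  never reached.
\<close>

datatype stage = Refract ereal real | Reflect ereal

primrec start_time :: "stage \<Rightarrow> ereal" where
  "start_time (Refract \<tau> x) = \<tau>"
| "start_time (Reflect \<tau>) = \<tau>"

primrec stage_path :: "real \<Rightarrow> real \<Rightarrow> (real \<Rightarrow> real) \<Rightarrow> stage \<Rightarrow> real \<Rightarrow> real" where
  "stage_path \<delta> b \<xi> (Refract \<tau> x) = refracted \<delta> b \<xi> (real_of_ereal \<tau>) x"
| "stage_path \<delta> b \<xi> (Reflect \<tau>) = reflected \<xi> (real_of_ereal \<tau>)"

primrec next_stage :: "real \<Rightarrow> real \<Rightarrow> (real \<Rightarrow> real) \<Rightarrow> stage \<Rightarrow> stage" where
  "next_stage \<delta> b \<xi> (Refract \<tau> x) =
     Reflect (Inf (ereal ` {t. \<tau> < ereal t \<and> stage_path \<delta> b \<xi> (Refract \<tau> x) t < 0}))"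
| "next_stage \<delta> b \<xi> (Reflect \<tau>) =
     Refract (Inf (ereal ` {t. \<tau> < ereal t \<and> stage_path \<delta> b \<xi> (Reflect \<tau>) t > b})) b"

primrec stages :: "real \<Rightarrow> real \<Rightarrow> (real \<Rightarrow> real) \<Rightarrow> nat \<Rightarrow> stage" where
  "stages \<delta> b \<xi> 0 = (if 0 \<le> \<xi> 0 then Refract 0 (\<xi> 0) else Reflect 0)"
| "stages \<delta> b \<xi> (Suc n) = next_stage \<delta> b \<xi> (stages \<delta> b \<xi> n)"

text \<open>The starting times are nondecreasing in \<open>n\<close>, so at most one stage is active at time \<open>t\<close>.\<close>
definition refracted_reflected :: "real \<Rightarrow> real \<Rightarrow> (real \<Rightarrow> real) \<Rightarrow> real \<Rightarrow> real" where
  "refracted_reflected \<delta> b \<xi> t =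
     stage_path \<delta> b \<xi>
       (stages \<delta> b \<xi> (THE n. start_time (stages \<delta> b \<xi> n) \<le> ereal t \<and>
                              ereal t < start_time (stages \<delta> b \<xi> (Suc n)))) t"

definition passage_above :: "real \<Rightarrow> (real \<Rightarrow> real) \<Rightarrow> ereal" where
  "passage_above a v = Inf (ereal ` {t. 0 < t \<and> v t > a})"

text \<open>\<open>exp (- q T)\<close>, which is read as \<open>0\<close> on \<open>T = \<infinity>\<close>, also for \<open>q = 0\<close>.\<close>
definition exp_discount :: "real \<Rightarrow> ereal \<Rightarrow> real" where
  "exp_discount q T = (if T = \<infinity> then 0 else exp (- q * real_of_ereal T))"

text \<open>
  \<open>T\<^sub>a\<^sup>+\<close> under \<open>P\<^sub>x\<close>. The refraction equation is solvable only for almost every path, so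
  this is a random variable with respect to the completion of the underlying probability space.
\<close>
definition T_plus ::
  "(real \<Rightarrow> 'a \<Rightarrow> real) \<Rightarrow> real \<Rightarrow> real \<Rightarrow> real \<Rightarrow> real \<Rightarrow> 'a \<Rightarrow> ereal" where
  "T_plus X \<delta> b x a \<omega> = passage_above a (refracted_reflected \<delta> b (\<lambda>t. x + X t \<omega>))"

end

theory Submission imports Defs "HOL-Complex_Analysis.Complex_Analysis"
begin

text \<open>
No stochastic calculus is used. The relations between Laplace transforms that characterise the scale functions
are inverted to Dynkin formulas over deterministic time intervals, for \<open>Z\<close> under \<open>X\<close> and for \<open>r\<close> under
\<open>X\<^sub>t - \<delta> t\<close>. Path by path, \<open>V\<close> is a limit of Euler schemes whose increments lie between those of
\<open>X\<^sub>t - \<delta> t\<close> and the climbs of \<open>X\<close>. Comparing with \<open>X\<^sub>t - \<delta> t\<close> between grid points shows that \<open>V\<close> spends no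
time at any given level, in particular at \<open>b\<close>. Since \<open>r = 1\<close> on the negative half-line, the shifted function
\<open>r(y - \<epsilon>)\<close> does not see reflection over steps on which \<open>X\<close> climbs by at most \<open>\<epsilon>\<close>. So, on a grid, the discounted
process \<open>r(V - \<epsilon>)\<close> stopped at the passage above \<open>a\<close> is a martingale up to errors controlled by the occupation times of
neighbourhoods of \<open>0\<close> and \<open>b\<close>. Refining the grid and then letting \<open>\<epsilon>\<close> tend to \<open>0\<close> gives the formula; passage is
certain because \<open>X\<^sub>t - \<delta> t\<close> almost surely climbs by any given amount over some block of time.
\<close>

text \<open>The scale functions are known through their Laplace transforms only: they need not be
  differentiable and may jump at \<open>0\<close>. So the statement that a generator maps one
  function to another is replaced by an identity between transforms in the space variable. In this
  sense (generator of \<open>X\<close>) - \<open>q\<close> sends \<open>Z\<close> to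
  \<open>- q\<close> below \<open>0\<close> and to \<open>0\<close> elsewhere, while (generator of
  \<open>X t - dl t\<close>) - \<open>q\<close> sends \<open>r\<close> to \<open>- q\<close> below
  \<open>0\<close>, to \<open>- q dl W\<close> on \<open>[0, b)\<close> and to \<open>0\<close> from
  \<open>b\<close> on. As \<open>Z = r\<close> up to \<open>b\<close>, each function is used on the
  side of \<open>b\<close> where it is harmonic. The discontinuous drift is the main obstacle. The
  Euler schemes converge because the drift decreases in the position, but the limit solves the
  equation only if it avoids \<open>b\<close> at almost all times. The occupation bound must
  therefore rest on increments alone: they dominate those of \<open>X t - dl t\<close>, and the
  primitive of the scale function of that process is convex. All stopping takes place at grid times,
  so that the past of a deterministic time is always independent of what follows.\<close>

lemmas integrable_add = Bochner_Integration.integrable_add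
	and integrable_bound = Bochner_Integration.integrable_bound
	and integrable_cong = Bochner_Integration.integrable_cong
	and integrable_diff = Bochner_Integration.integrable_diff
	and integrable_sum = Bochner_Integration.integrable_sum
	and integral_add = Bochner_Integration.integral_add
	and integral_cong = Bochner_Integration.integral_cong
	and integral_diff = Bochner_Integration.integral_diff
	and integral_indicator = Bochner_Integration.integral_indicator
	and integral_sum = Bochner_Integration.integral_sum
	and integral_zero = Bochner_Integration.integral_zero

notation LIMSEQ (infix "---->" 60)
notation pair_measure (infixr "\<Otimes>" 80)

abbreviation mesh :: "nat => real" where "mesh n == 1 / real (Suc n)"

abbreviation disc :: "real set => real => real => real" where "disc A q s == indicator A s * exp (- q * s)"

section \<open>Paths without positive jumps\<close>

lemma dist_small_left:
	fixes f :: "real => real"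
	assumes "(f \<longlongrightarrow> l) (at_left x)" "e > 0"
	obtains d where "d > 0" "!!y. x - d < y ==> y < x ==> \<bar>f y - l\<bar> < e"
proof -
	have "eventually (%y. dist (f y) l < e) (at_left x)"
		using assms by (rule tendstoD)
	then obtain c where "c < x" "!!y. c < y ==> y < x ==> dist (f y) l < e"
		unfolding eventually_at_left_field by blast
	thus ?thesis
		by (intro that[of "x - c"]) (auto simp: dist_real_def)
qed

lemma dist_small_right:
	fixes f :: "real => real"
	assumes "(f \<longlongrightarrow> l) (at_right x)" "e > 0"
	obtains d where "d > 0" "!!y. x < y ==> y < x + d ==> \<bar>f y - l\<bar> < e"
proof -
	have "eventually (%y. dist (f y) l < e) (at_right x)"
		using assms by (rule tendstoD)
	then obtain c where "x < c" "!!y. x < y ==> y < c ==> dist (f y) l < e"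
		unfolding eventually_at_right_field by blast
	thus ?thesis
		by (intro that[of "c - x"]) (auto simp: dist_real_def)
qed

lemma cadlag_local_bound:
	assumes "cadlag xi" "0 <= x"
	shows "EX d>0. EX B. ALL y>=0. \<bar>y - x\<bar> < d --> \<bar>xi y\<bar> <= B"
proof -
	obtain d1 where d1: "d1 > 0" "!!y. x < y ==> y < x + d1 ==> \<bar>xi y - xi x\<bar> < 1"
		using assms dist_small_right[of xi "xi x" x 1] unfolding cadlag_def by auto
	obtain d2 l where d2: "d2 > 0" "!!y. 0 <= y ==> x - d2 < y ==> y < x ==> \<bar>xi y - l\<bar> < 1"
	proof (cases "x = 0")
		case True
		thus ?thesis using that[of 1 0] by auto
	next
		case False
		then obtain l where "(xi \<longlongrightarrow> l) (at_left x)"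
			using assms unfolding cadlag_def by (metis order_less_le)
		from dist_small_left[OF this, of 1] show ?thesis using that by (metis zero_less_one)
	qed
	have "\<bar>xi y\<bar> <= \<bar>xi x\<bar> + \<bar>l\<bar> + 1" if "0 <= y" "\<bar>y - x\<bar> < min d1 d2" for y
		using d1(2)[of y] d2(2)[of y] that by (cases "y < x"; cases "y = x") (auto simp: abs_if split: if_splits)
	thus ?thesis
		using d1(1) d2(1) by (intro exI[of _ "min d1 d2"]) auto
qed


lemma cadlag_bounded:
	assumes "cadlag xi"
	shows "EX B. ALL t:{0..N}. \<bar>xi t\<bar> <= B"
proof (cases "0 <= N")
	case True
	hence "EX B. ALL t. 0 <= t --> t \<in> {0..N} --> \<bar>xi t\<bar> <= B"
	proof (rule Bolzano[where P = "%u v. EX B. ALL t. 0 <= t --> t \<in> {u..v} --> \<bar>xi t\<bar> <= B"], goal_cases)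
		case (1 a b c)
		then obtain B B' where B: "ALL t. 0 <= t --> t\<in>{a..b} --> \<bar>xi t\<bar> <= B"
			"ALL t. 0 <= t --> t\<in>{b..c} --> \<bar>xi t\<bar> <= B'" by blast
		have "\<bar>xi t\<bar> <= max B B'" if "0 <= t" "t \<in> {a..c}" for t
			using B that by (cases "t <= b") (auto simp: le_max_iff_disj)
		thus ?case by blast
	next
		case (2 x)
		then obtain d B where d: "d > 0" "ALL y>=0. \<bar>y - x\<bar> < d --> \<bar>xi y\<bar> <= B"
			using cadlag_local_bound[OF assms, of x] by auto
		show ?case
			using d by (intro exI[of _ d] conjI allI impI exI[of _ B]) auto
	qed
	then obtain B where "ALL t. 0 <= t --> t \<in> {0..N} --> \<bar>xi t\<bar> <= B" by blast
	thus ?thesis by (intro exI[of _ B]) auto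
qed auto

text \<open>Required of every path, not of almost every one;
  \<open>spectrally_negative_modification\<close> supplies such a version of
  \<open>X\<close>.\<close>

definition good_path :: "(real => real) => bool" where
	"good_path xi \<longleftrightarrow> cadlag xi & xi 0 = 0 & (ALL t>0. ALL l. (xi \<longlongrightarrow> l) (at_left t) --> xi t <= l)"

text \<open>Two times on the same side of \<open>x\<close> see values close to the same one-sided
  limit. If \<open>s\<close> lies before \<open>x\<close> and \<open>t\<close> does not, the jump at
  \<open>x\<close> lies between them, and it points downwards: \<open>xi x <= l\<close>.\<close>

lemma good_path_local:
	assumes "good_path xi" "0 <= x" "e > 0"
	shows "EX d>0. ALL s t. 0 <= s --> s <= t --> \<bar>s - x\<bar> < d --> \<bar>t - x\<bar> < d --> xi t - xi s < e"
proof -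
	have c: "cadlag xi" using assms by (simp add: good_path_def)
	obtain d1 where d1: "d1 > 0" "!!y. x < y ==> y < x + d1 ==> \<bar>xi y - xi x\<bar> < e / 2"
		using c assms dist_small_right[of xi "xi x" x "e/2"] unfolding cadlag_def by auto
	obtain d2 l where d2: "d2 > 0" "!!y. 0 <= y ==> x - d2 < y ==> y < x ==> \<bar>xi y - l\<bar> < e / 2" "xi x <= l"
	proof (cases "x = 0")
		case True
		thus ?thesis using that[of 1 "xi x"] by auto
	next
		case False
		then obtain l where l: "(xi \<longlongrightarrow> l) (at_left x)"
			using c assms unfolding cadlag_def by (metis order_less_le)
		hence "xi x <= l" using assms False by (auto simp: good_path_def)
		with dist_small_left[OF l, of "e/2"] assms(3) show ?thesis using that by (metis half_gt_zero)
	qed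
	have "xi t - xi s < e"
		if "0 <= s" "s <= t" "\<bar>s - x\<bar> < min d1 d2" "\<bar>t - x\<bar> < min d1 d2" for s t
	proof -
		have A: "\<bar>xi y - xi x\<bar> < e / 2" if "x <= y" "\<bar>y - x\<bar> < min d1 d2" for y
			using that d1(2)[of y] assms(3) by (cases "y = x") auto
		have B: "\<bar>xi y - l\<bar> < e / 2" if "0 <= y" "y < x" "\<bar>y - x\<bar> < min d1 d2" for y
			using that d2(2)[of y] by auto
		consider "t < x" | "s < x" "x <= t" | "x <= s" by linarith
		thus ?thesis
		proof cases
			case 1
			hence "\<bar>xi s - l\<bar> < e / 2" "\<bar>xi t - l\<bar> < e / 2" using B that by auto
			thus ?thesis by linarith
		next
			case 2
			hence "\<bar>xi s - l\<bar> < e / 2" "\<bar>xi t - xi x\<bar> < e / 2" using A B that by auto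
			thus ?thesis using d2(3) by linarith
		next
			case 3
			hence "\<bar>xi s - xi x\<bar> < e / 2" "\<bar>xi t - xi x\<bar> < e / 2" using A that by auto
			thus ?thesis by linarith
		qed
	qed
	thus ?thesis
		using d1(1) d2(1) by (intro exI[of _ "min d1 d2"]) auto
qed

text \<open>A path with jumps has no uniform modulus of continuity, but the absence of positive
  jumps gives one for climbs. It bounds the number of passages from \<open>0\<close> to
  \<open>b\<close>, rules out jumping over \<open>a\<close>, and makes all grid steps good once the
  mesh is fine.\<close>

lemma good_path_up_modulus:
	assumes "good_path xi" "e > 0" "0 <= N"
	shows "EX d>0. ALL s t. 0 <= s --> s <= N --> s <= t --> t < s + d --> xi t - xi s < e"
proof -
	have "EX d>0. ALL s t. 0 <= s --> s \<in> {0..N} --> s <= t --> t < s + d --> xi t - xi s < e"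
		using assms(3)
	proof (rule Bolzano[where P = "%u v. EX d>0. ALL s t. 0 <= s --> s \<in> {u..v} --> s <= t --> t < s + d --> xi t - xi s < e"], goal_cases)
		case (1 a b c)
		then obtain d d' where d: "d > 0" "d' > 0"
			"ALL s t. 0 <= s --> s \<in> {a..b} --> s <= t --> t < s + d --> xi t - xi s < e"
			"ALL s t. 0 <= s --> s \<in> {b..c} --> s <= t --> t < s + d' --> xi t - xi s < e" by blast
		have "xi t - xi s < e" if "0 <= s" "s \<in> {a..c}" "s <= t" "t < s + min d d'" for s t
			using d that by (cases "s <= b") auto
		thus ?case using d by (intro exI[of _ "min d d'"]) auto
	next
		case (2 x)
		then obtain d where d: "d > 0"
			"ALL s t. 0 <= s --> s <= t --> \<bar>s - x\<bar> < d --> \<bar>t - x\<bar> < d --> xi t - xi s < e"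
			using good_path_local[OF assms(1) _ assms(2), of x] by auto
		show ?case
			using d(1) by (intro exI[of _ "d/2"] conjI allI impI) (auto intro!: d(2)[rule_format])
	qed
	thus ?thesis by auto
qed

lemma cadlag_big_jumps_finite:
	assumes "cadlag xi" "e > 0"
	shows "finite {t. 0 < t & t <= N & (EX l. (xi \<longlongrightarrow> l) (at_left t) & e < \<bar>xi t - l\<bar>)}" (is "finite (?S N)")
proof (cases "0 <= N")
	case True
	define J where "J = {t. 0 < t & (EX l. (xi \<longlongrightarrow> l) (at_left t) & e < \<bar>xi t - l\<bar>)}"
	\<comment> \<open>If the path stays within \<open>e / 2\<close> of one value on an interval ending
	  at \<open>t\<close>, its jump at \<open>t\<close> is at most \<open>e\<close>. Such intervals
	  exist on either side of every \<open>x\<close>, so big jumps do not accumulate.\<close>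
	have key: "\<bar>xi t - l\<bar> <= e" if "(xi \<longlongrightarrow> l) (at_left t)" "u < t" "!!y. u < y ==> y <= t ==> \<bar>xi y - k\<bar> < e / 2" for t l u k
	proof -
		have "eventually (%y. y \<in> {u<..<t}) (at_left t)"
			using that(2) by (rule eventually_at_leftI[rotated]) auto
		hence "eventually (%y. \<bar>xi t - xi y\<bar> <= e) (at_left t)"
		proof eventually_elim
			case (elim y)
			hence "\<bar>xi y - k\<bar> < e / 2" "\<bar>xi t - k\<bar> < e / 2" using that(3)[of y] that(3)[of t] by auto
			thus ?case by linarith
		qed
		thus ?thesis
			by (intro tendsto_upperbound[of "%y. \<bar>xi t - xi y\<bar>" _ "at_left t"] tendsto_intros that) auto
	qed
	from True have "finite (J \<inter> {0..N})"
	proof (induction rule: Bolzano)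
		case (trans a b c)
		thus ?case
			by (metis (no_types, lifting) Int_Un_distrib finite_UnI ivl_disj_un_two_touch(4))
	next
		case (local x)
		obtain d1 where d1: "d1 > 0" "!!y. x < y ==> y < x + d1 ==> \<bar>xi y - xi x\<bar> < e / 2"
			using assms local dist_small_right[of xi "xi x" x "e/2"] unfolding cadlag_def by auto
		obtain d2 l where d2: "d2 > 0" "!!y. 0 <= y ==> x - d2 < y ==> y < x ==> \<bar>xi y - l\<bar> < e / 2"
		proof (cases "x = 0")
			case True
			thus ?thesis using that[of 1 "xi x"] by auto
		next
			case False
			then obtain l where l: "(xi \<longlongrightarrow> l) (at_left x)"
				using assms local unfolding cadlag_def by (metis order_less_le)
			with dist_small_left[OF l, of "e/2"] assms(2) show ?thesis using that by (metis half_gt_zero)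
		qed
		have "t = x" if "t \<in> J" "\<bar>t - x\<bar> < min d1 d2" for t
		proof (rule ccontr)
			assume "t ~= x"
			from that obtain k where k: "0 < t" "(xi \<longlongrightarrow> k) (at_left t)" "e < \<bar>xi t - k\<bar>" by (auto simp: J_def)
			show False
			proof (cases "x < t")
				case True
				thus False using key[OF k(2) True, of "xi x"] d1(2) that k(3) by auto
			next
				case False
				hence "\<bar>xi t - k\<bar> <= e"
					by (intro key[OF k(2), of "max 0 (x - d2)" l] d2(2)) (use that k `t ~= x` in auto)
				thus False using k by simp
			qed
		qed
		hence "J \<inter> {u..v} <= {x}" if "u <= x & x <= v & v - u < min d1 d2" for u v
			using that by fastforce
		thus ?case
			using d1(1) d2(1) by (intro exI[of _ "min d1 d2"]) (auto intro: finite_subset)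
	qed
	moreover have "?S N <= J \<inter> {0..N}" by (auto simp: J_def)
	ultimately show ?thesis by (rule rev_finite_subset)
next
	case False
	hence "?S N <= {}" by auto
	thus ?thesis by (rule finite_subset) simp
qed

lemma cadlag_countable_discont:
	assumes "cadlag xi"
	shows "countable {t. 0 < t & ~ isCont xi t}"
proof -
	have "{t. 0 < t & ~ isCont xi t} <= (\<Union>n::nat. \<Union>N::nat.
		{t. 0 < t & t <= real N & (EX l. (xi \<longlongrightarrow> l) (at_left t) & inverse (real (Suc n)) < \<bar>xi t - l\<bar>)})"
	proof safe
		fix t :: real assume t: "0 < t" "~ isCont xi t"
		obtain l where l: "(xi \<longlongrightarrow> l) (at_left t)" using assms t by (auto simp: cadlag_def)
		have r: "(xi \<longlongrightarrow> xi t) (at_right t)" using assms t by (auto simp: cadlag_def)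
		have "l ~= xi t" using l r t by (auto simp: isCont_def filterlim_split_at)
		then obtain n where "inverse (real (Suc n)) < \<bar>xi t - l\<bar>"
			using reals_Archimedean[of "\<bar>xi t - l\<bar>"] by auto
		moreover obtain N where "t <= real N" using real_arch_simple by blast
		ultimately show "t \<in> (\<Union>n::nat. \<Union>N::nat.
		{t. 0 < t & t <= real N & (EX l. (xi \<longlongrightarrow> l) (at_left t) & inverse (real (Suc n)) < \<bar>xi t - l\<bar>)})"
			using l t by blast
	qed
	thus ?thesis
		by (rule countable_subset) (intro countable_UN countable_finite cadlag_big_jumps_finite[OF assms] countableI_type; simp)
qed

lemma AE_isCont_cadlag:
	assumes "cadlag xi"
	shows "AE t in lborel. 0 < t --> isCont xi t"
	using cadlag_countable_discont[OF assms]
	by (intro AE_I'[of "{t. 0 < t & ~ isCont xi t}"] countable_imp_null_set_lborel) auto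

text \<open>Reflection takes place during \<open>K\<close> only. Besides \<open>K = {0..}\<close>, the sets \<open>K = {0..r}\<close> are needed: a process reflected
	until \<open>r\<close> continues as a refracted path.\<close>
definition down :: "real set => bool" where
	"down K \<longleftrightarrow> 0 \<in> K & (ALL u:K. 0 <= u & {0..u} <= K)"

text \<open>The Skorokhod map at \<open>0\<close>: the push is the running maximum of the negative
  part of \<open>z\<close> over the times in \<open>K\<close>.\<close>

definition refl :: "real set => (real => real) => real => real" where
	"refl K z t = z t + (SUP s\<in>K \<inter> {0..t}. max 0 (- z s))"

lemma refl_cong: "(!!s. s \<in> {0..t} ==> z s = z' s) ==> 0 <= t ==> refl K z t = refl K z' t"
	unfolding refl_def by (intro arg_cong2[where f = "(+)"] SUP_cong) auto

context
	fixes K :: "real set" and z :: "real => real" and t :: real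
	assumes K: "down K" and t: "0 <= t" and z: "bounded (z ` {0..t})"
begin

lemma refl_bdd: "bdd_above ((%s. max 0 (- z s)) ` (K \<inter> {0..t}))"
proof -
	obtain B where "ALL s:{0..t}. \<bar>z s\<bar> <= B" using z by (auto simp: bounded_iff)
	thus ?thesis by (intro bdd_aboveI2[of _ _ "max 0 B"]) (auto simp: abs_le_iff le_max_iff_disj)
qed

lemma refl_ge': "s \<in> K ==> s <= t ==> z t + max 0 (- z s) <= refl K z t"
	using refl_bdd K unfolding refl_def down_def by (intro add_left_mono cSUP_upper) auto

lemma refl_ge_diff: "s \<in> K ==> s <= t ==> z t - z s <= refl K z t"
	using refl_ge'[of s] by simp

lemma refl_ge: "z t <= refl K z t"
	using refl_ge'[of 0] K t by (auto simp: down_def)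

lemma refl_approx:
	assumes "e > 0"
	obtains s where "s \<in> K" "0 <= s" "s <= t" "refl K z t < z t + max 0 (- z s) + e"
proof -
	let ?S = "SUP s\<in>K \<inter> {0..t}. max 0 (- z s)"
	have "K \<inter> {0..t} ~= {}" using K t by (auto simp: down_def)
	moreover have "?S - e < ?S" using assms by simp
	ultimately have "EX s:K \<inter> {0..t}. ?S - e < max 0 (- z s)"
		using less_cSUP_iff[OF _ refl_bdd] by blast
	thus ?thesis using that unfolding refl_def by (auto simp: algebra_simps)
qed

lemma refl_nonneg: "t \<in> K ==> 0 <= refl K z t"
	using refl_ge'[of t] by auto

end

lemma bounded_image_le: "bounded (z ` {0..t::real}) ==> s <= t ==> bounded (z ` {0..s})"
	by (rule bounded_subset) auto

context
	fixes K :: "real set" and z :: "real => real" and s t :: real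
	assumes K: "down K" and s: "0 <= s" and st: "s <= t" and z: "bounded (z ` {0..t})"
begin

lemma refl_push: "z t - z s <= refl K z t - refl K z s"
proof -
	have "(SUP s\<in>K \<inter> {0..s}. max 0 (- z s)) <= (SUP s\<in>K \<inter> {0..t}. max 0 (- z s))"
		using K s st z by (intro cSUP_subset_mono refl_bdd) (auto simp: down_def)
	thus ?thesis by (simp add: refl_def)
qed

text \<open>If the push changed after \<open>s\<close>, its supremum up to \<open>t\<close> exceeds
  the one up to \<open>s\<close> and is therefore approached at times between \<open>s\<close> and
  \<open>t\<close>.\<close>

lemma refl_pushed:
	assumes "refl K z t - z t ~= refl K z s - z s" "e > 0"
	obtains u where "u \<in> K" "s < u" "u <= t" "- z u > refl K z t - z t - e"
proof -
	have gt: "refl K z t - z t > refl K z s - z s" using assms refl_push by linarith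
	obtain u where u: "u \<in> K" "0 <= u" "u <= t"
		"refl K z t < z t + max 0 (- z u) + min e (refl K z t - z t - (refl K z s - z s))"
		using refl_approx[OF K _ z, of "min e (refl K z t - z t - (refl K z s - z s))"] gt assms s st by auto
	have *: "z s + max 0 (- z v) <= refl K z s" if "v \<in> K" "v <= s" for v
		using refl_ge'[OF K s bounded_image_le[OF z st] that] .
	have 1: "max 0 (- z u) > refl K z s - z s" using u(4) by linarith
	hence 2: "s < u" using *[OF u(1)] by force
	have "0 <= refl K z s - z s" using refl_ge[OF K s bounded_image_le[OF z st]] by simp
	hence "max 0 (- z u) = - z u" using 1 by linarith
	thus ?thesis using that[OF u(1) 2 u(3)] u(4) by linarith
qed

text \<open>When pushing occurs, the reflected path is near \<open>0\<close> at some time of pushing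
  and can rise from there only by the climb of \<open>z\<close>. This confines the effect of
  reflection to low levels.\<close>

lemma refl_pushed_le:
	assumes "refl K z t - z t ~= refl K z s - z s" "!!u. s <= u ==> u <= t ==> z t - z u <= D"
	shows "refl K z t <= D"
proof (rule field_le_epsilon)
	fix e :: real assume "e > 0"
	obtain u where u: "u \<in> K" "s < u" "u <= t" "- z u > refl K z t - z t - e"
		using refl_pushed[OF assms(1) `e > 0`] .
	have "z t - z u <= D" using u by (intro assms(2)) auto
	thus "refl K z t <= D + e" using u(4) by linarith
qed

lemma refl_upper:
	assumes "!!u. s <= u ==> u <= t ==> z t - z u <= D"
	shows "refl K z t - refl K z s <= D"
proof (cases "refl K z t - z t = refl K z s - z s")
	case True
	thus ?thesis using assms[of s] st by simp
next
	case False
	obtain u where u: "u \<in> K" "s < u" using refl_pushed[OF False, of 1] by auto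
	hence "s \<in> K" using K s by (force simp: down_def)
	hence "0 <= refl K z s" using refl_nonneg[OF K s bounded_image_le[OF z st]] by simp
	with refl_pushed_le[OF False assms] show ?thesis by simp
qed

end

text \<open>The path and the push each move by at most \<open>e\<close>, hence the factor
  \<open>2\<close>.\<close>

lemma refl_Lipschitz:
	assumes "down K" "0 <= t" "bounded (z ` {0..t})" "bounded (z' ` {0..t})"
		and "!!s. 0 <= s ==> s <= t ==> \<bar>z s - z' s\<bar> <= e"
	shows "\<bar>refl K z t - refl K z' t\<bar> <= 2 * e"
proof -
	have "refl K x t <= refl K y t + 2 * e"
		if xy: "bounded (x ` {0..t})" "bounded (y ` {0..t})" "!!s. 0 <= s ==> s <= t ==> \<bar>x s - y s\<bar> <= e" for x y
	proof (rule field_le_epsilon)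
		fix d :: real assume "d > 0"
		obtain s where s: "s \<in> K" "0 <= s" "s <= t" "refl K x t < x t + max 0 (- x s) + d"
			using refl_approx[OF assms(1,2) xy(1) `d > 0`] .
		have "y t + max 0 (- y s) <= refl K y t"
			by (rule refl_ge'[OF assms(1,2) xy(2) s(1,3)])
		with s xy(3)[of s] xy(3)[of t] assms(2) show "refl K x t <= refl K y t + 2 * e + d"
			by (auto simp: max_def split: if_splits)
	qed
	from this[of z z'] this[of z' z] assms show ?thesis by (auto simp: abs_le_iff abs_minus_commute)
qed

text \<open>The comparison principle behind both convergence and uniqueness. A gap between two
  reflected paths can only come from the difference of the drivers: over a final interval on which
  the gap exceeds half its size, that difference must grow by a quarter of it. Continuity is asked
  of \<open>z - z'\<close> alone; the paths themselves may jump.\<close>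

lemma refl_compare:
	assumes K: "down K" and t: "0 <= t" and z: "bounded (z ` {0..t})" and z': "bounded (z' ` {0..t})"
		and eq: "z 0 = z' 0" and cont: "continuous_on {0..t} (%u. z u - z' u)"
		and d: "d > 0" "d <= refl K z t - refl K z' t"
	obtains v where "0 <= v" "v <= t" "!!u. v < u ==> u <= t ==> d / 2 < refl K z u - refl K z' u"
		"d / 4 <= (z t - z' t) - (z v - z' v)"
proof -
	define D where "D u = refl K z u - refl K z' u" for u
	define ww where "ww u = z u - z' u" for u
	have z'le: "z' t - z' u <= refl K z' t - refl K z' u" if "0 <= u" "u <= t" for u
		by (rule refl_push[OF K that z'])
	\<comment> \<open>\<open>s\<close> is a time where the push of \<open>z\<close> up to
	  \<open>t\<close> is nearly attained, or \<open>0\<close> if that push is below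
	  \<open>d / 4\<close>. In the first case \<open>refl K z s\<close> is close to \<open>0\<close>
	  while \<open>refl K z' s\<close> is nonnegative, so the gap is small; after \<open>s\<close> the
	  push of \<open>z\<close> grows by at most \<open>d / 4\<close>.\<close>
	obtain s where s: "0 <= s" "s <= t" "D s <= d / 4"
		"!!u. s <= u ==> u <= t ==> refl K z t - refl K z u <= z t - z u + d / 4"
	proof -
		obtain s where s: "s \<in> K" "0 <= s" "s <= t" "refl K z t < z t + max 0 (- z s) + d / 4"
			using refl_approx[OF K t z, of "d / 4"] d(1) by auto
		have b: "bounded (z ` {0..u})" "bounded (z' ` {0..u})" if "u <= t" for u
			using bounded_image_le[OF z that] bounded_image_le[OF z' that] by auto
		show ?thesis
		proof (cases "- z s <= 0")
			case True
			have "K \<inter> {0..0} = {0}" using K by (auto simp: down_def)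
			hence "D 0 = 0" by (simp add: D_def refl_def eq)
			moreover have "refl K z t - refl K z u <= z t - z u + d / 4" if "0 <= u" "u <= t" for u
				using refl_ge[OF K that(1) b(1)[OF that(2)]] s(4) True by simp
			ultimately show ?thesis using that[of 0] t d(1) by auto
		next
			case False
			have le: "refl K z t - refl K z u <= z t - z u + d / 4" if "s <= u" "u <= t" for u
				using refl_ge_diff[OF K _ b(1)[OF that(2)] s(1) that(1)] s(2,4) False that(1) by linarith
			have "refl K z s - z s <= refl K z t - z t" using refl_push[OF K s(2,3) z] by linarith
			moreover have "0 <= refl K z' s" using refl_nonneg[OF K s(2) b(2)[OF s(3)] s(1)] .
			ultimately have "D s <= d / 4" using s(4) False by (simp add: D_def)
			thus ?thesis using that[OF s(2,3)] le by blast
		qed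
	qed
	define U where "U = {u \<in> {s..t}. D u <= d / 2}"
	have sU: "s \<in> U" using s d(1) by (simp add: U_def)
	\<comment> \<open>The budget: from \<open>u\<close> to \<open>t\<close> the gap grows by at least
	  \<open>d - d / 2\<close>, the push of \<open>z\<close> accounts for at most \<open>d / 4\<close>
	  of this, and the push of \<open>z'\<close> only narrows the gap.\<close>
	have Uw: "d / 4 <= ww t - ww u" if "u \<in> U" for u
		using s(4)[of u] z'le[of u] that s(1) d(2) by (auto simp: U_def D_def ww_def)
	define v where "v = Sup U"
	have bdd: "bdd_above U" unfolding U_def by (intro bdd_aboveI[of _ t]) auto
	have v: "s <= v" "v <= t"
		using sU bdd unfolding v_def U_def by (auto intro!: cSup_upper cSup_least)
	have "d / 2 < D u" if "v < u" "u <= t" for u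
		using that v cSup_upper[OF _ bdd, of u] by (force simp: v_def U_def)
	\<comment> \<open>The gap may jump, so \<open>v\<close> need not belong to \<open>U\<close>; the
	  inequality for points of \<open>U\<close> close to \<open>v\<close> passes to \<open>v\<close> by
	  continuity of \<open>z - z'\<close>.\<close>
	moreover have "d / 4 <= ww t - ww v"
	proof (rule field_le_epsilon)
		fix e :: real assume "e > 0"
		have "continuous_on {0..t} ww" using cont by (simp add: ww_def[abs_def])
		then obtain r where r: "r > 0" "!!u. u \<in> {0..t} ==> dist u v < r ==> dist (ww u) (ww v) < e"
			using v s(1) `e > 0` unfolding continuous_on_iff by (metis atLeastAtMost_iff order_trans)
		obtain u where u: "u \<in> U" "v - r < u" "u <= v"
			using less_cSup_iff[of U "v - r"] sU bdd r(1) cSup_upper[OF _ bdd] unfolding v_def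
			by (metis diff_less_eq empty_iff less_add_same_cancel1)
		have "dist (ww u) (ww v) < e"
			using u s(1) by (intro r(2)) (auto simp: U_def dist_real_def)
		thus "d / 4 <= ww t - ww v + e" using Uw[OF u(1)] by (auto simp: dist_real_def)
	qed
	ultimately show ?thesis using that[of v] v s(1) by (auto simp: D_def ww_def)
qed

section \<open>Uniform grids and measurability of right-continuous functions\<close>

definition grid :: "nat => real => real" where
	"grid n s = real_of_int \<lfloor>real (Suc n) * s\<rfloor> / real (Suc n)"

lemma grid_le: "grid n s <= s"
	unfolding grid_def by (simp add: divide_le_eq mult.commute del: of_nat_Suc)

lemma grid_gt: "s < grid n s + mesh n"
proof -
	have "real (Suc n) * s < real_of_int \<lfloor>real (Suc n) * s\<rfloor> + 1" by linarith
	thus ?thesis unfolding grid_def by (simp add: field_simps del: of_nat_Suc)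
qed

lemma grid_nonneg: "0 <= s ==> 0 <= grid n s"
	unfolding grid_def by simp

lemma grid_less: "s < real k / real (Suc n) ==> grid n s <= (real k - 1) / real (Suc n)"
proof -
	assume "s < real k / real (Suc n)"
	hence "real (Suc n) * s < real k" by (simp add: field_simps del: of_nat_Suc)
	hence "real_of_int \<lfloor>real (Suc n) * s\<rfloor> < real k" by linarith
	hence "\<lfloor>real (Suc n) * s\<rfloor> < int k" by linarith
	hence "real_of_int \<lfloor>real (Suc n) * s\<rfloor> <= real k - 1" by linarith
	thus ?thesis unfolding grid_def by (simp add: divide_right_mono del: of_nat_Suc)
qed

lemma grid_eqI: "real k / real (Suc n) <= s ==> s < real (Suc k) / real (Suc n) ==> grid n s = real k / real (Suc n)"
proof -
	assume "real k / real (Suc n) <= s" "s < real (Suc k) / real (Suc n)"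
	hence "real k <= real (Suc n) * s" "real (Suc n) * s < real k + 1"
		by (simp_all add: field_simps)
	hence "\<lfloor>real (Suc n) * s\<rfloor> = int k" by linarith
	thus ?thesis unfolding grid_def by (simp del: of_nat_Suc)
qed

lemma grid_measurable [measurable]: "(%s. f (grid n s)) \<in> borel_measurable borel"
proof -
	have "(%s::real. \<lfloor>real (Suc n) * s\<rfloor>) \<in> measurable borel (count_space UNIV)" by measurable
	hence "(%s. (%i. f (real_of_int i / real (Suc n))) \<lfloor>real (Suc n) * s\<rfloor>) \<in> borel_measurable borel"
		by (rule measurable_compose) simp
	thus ?thesis by (simp add: grid_def)
qed

lemma grid_tendsto: "(%n. grid n s) ----> s"
proof (rule tendsto_sandwich)
	show "\<forall>\<^sub>F n in sequentially. s - 1 / real (Suc n) <= grid n s"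
		using grid_gt by (intro always_eventually allI) (simp add: algebra_simps less_imp_le)
	show "\<forall>\<^sub>F n in sequentially. grid n s <= s" using grid_le by auto
	have "(%n. s - 1 / real (Suc n)) ----> s - 0"
		by (intro tendsto_intros LIMSEQ_Suc lim_1_over_n)
	thus "(%n. s - 1 / real (Suc n)) ----> s" by simp
qed simp

lemma mesh_tendsto: "(%n. mesh n) ----> 0"
	by (intro LIMSEQ_Suc lim_1_over_n)

lemma grid_up_tendsto: "(%n. grid n s + mesh n) ----> s"
	using tendsto_add[OF grid_tendsto mesh_tendsto] by simp

text \<open>\<open>grid n s + mesh n\<close> exceeds \<open>s\<close> strictly and so approaches it
  within \<open>at_right\<close>; rounding down would call for left limits.\<close>

lemma grid_up_right_cont: "(f \<longlongrightarrow> l) (at_right s) ==> (%n. f (grid n s + mesh n)) ----> l"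
	by (erule filterlim_compose)
		(auto simp: filterlim_at grid_up_tendsto less_imp_neq[OF grid_gt, symmetric] grid_gt simp del: of_nat_Suc intro!: always_eventually)

text \<open>\<open>max 0\<close> because paths are controlled at nonnegative times only; the same
  clipping recurs wherever measurability on the whole line is claimed.\<close>

lemma right_cont_borel:
	fixes f :: "real => real"
	assumes "!!t. 0 <= t ==> (f \<longlongrightarrow> f t) (at_right t)"
	shows "(%t. f (max 0 t)) \<in> borel_measurable borel"
proof (rule borel_measurable_LIMSEQ_real[where u = "%n t. f (grid n (max 0 t) + mesh n)"])
	show "(%n. f (grid n (max 0 t) + mesh n)) ----> f (max 0 t)" for t
		by (intro grid_up_right_cont assms) simp
next
	fix n show "(%t. f (grid n (max 0 t) + mesh n)) \<in> borel_measurable borel"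
		by (rule measurable_compose[where g = "%s. f (grid n s + mesh n)"])
			(rule borel_measurable_max borel_measurable_const measurable_ident_sets[OF refl] grid_measurable)+
qed

section \<open>Euler schemes\<close>

text \<open>An oscillation bound shared by all processes in the construction: downward moves are at worst those of
	\<open>xi - dl t\<close>, upward moves at most those of \<open>xi\<close> reflected at its running minimum.\<close>
definition tame :: "(real => real) => real => (real => real) => bool" where
	"tame xi dl V \<longleftrightarrow> (ALL s t. 0 <= s --> s <= t -->
		xi t - xi s - dl * (t - s) <= V t - V s &
		(ALL D. (ALL u. s <= u --> u <= t --> xi t - xi u <= D) --> V t - V s <= D))"

lemma tame_lower: "tame xi dl V ==> 0 <= s ==> s <= t ==> xi t - xi s - dl * (t - s) <= V t - V s"
	unfolding tame_def by blast

lemma tame_upper: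
	"tame xi dl V ==> 0 <= s ==> s <= t ==> (!!u. s <= u ==> u <= t ==> xi t - xi u <= D) ==> V t - V s <= D"
	unfolding tame_def by blast

text \<open>The radius \<open>d\<close> is the same for all tame \<open>V\<close>: at continuity
  points of \<open>xi\<close> these processes are equicontinuous, so one \<open>d\<close> serves all
  Euler schemes at once.\<close>

lemma tame_lag:
	assumes "isCont xi u" "0 < u" "e > 0" "0 <= dl"
	obtains d where "d > 0" "!!V s. tame xi dl V ==> \<bar>s - u\<bar> < d ==> \<bar>V s - V u\<bar> <= e"
proof -
	obtain d0 where d0: "d0 > 0" "!!y. \<bar>y - u\<bar> < d0 ==> \<bar>xi y - xi u\<bar> < e / 2"
		using assms(1) assms(3) unfolding continuous_at_eps_delta by (metis half_gt_zero dist_real_def)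
	define d where "d = min (min d0 u) (e / (2 * (dl + 1)))"
	have pos: "d > 0" using d0 assms by (simp add: d_def)
	have de: "dl * r <= e / 2" if "0 <= r" "r < d" for r
	proof -
		have "r * (2 * (dl + 1)) < e" using that assms by (simp add: d_def field_simps)
		thus ?thesis using that assms(4) by (simp add: field_simps)
	qed
	have "\<bar>V s - V u\<bar> <= e" if V: "tame xi dl V" and s: "\<bar>s - u\<bar> < d" for V s
	proof (cases "s <= u")
		case True
		have s0: "0 <= s" using s by (simp add: d_def abs_if split: if_splits)
		have "V u - V s <= e"
		proof (rule tame_upper[OF V s0 True])
			fix y assume "s <= y" "y <= u"
			hence "\<bar>xi y - xi u\<bar> < e / 2" using s True by (intro d0(2)) (auto simp: d_def)
			thus "xi u - xi y <= e" using assms(3) by linarith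
		qed
		moreover have "\<bar>xi s - xi u\<bar> < e / 2" using s by (intro d0(2)) (auto simp: d_def)
		moreover have "dl * (u - s) <= e / 2" using s True by (intro de) auto
		ultimately show ?thesis using tame_lower[OF V s0 True] by linarith
	next
		case False
		hence le: "u <= s" by simp
		have "V s - V u <= e"
		proof (rule tame_upper[OF V _ le])
			fix y assume "u <= y" "y <= s"
			hence "\<bar>xi y - xi u\<bar> < e / 2" "\<bar>xi s - xi u\<bar> < e / 2" using s le by (intro d0(2); simp add: d_def)+
			thus "xi s - xi y <= e" by linarith
		qed (use assms in auto)
		moreover have "\<bar>xi s - xi u\<bar> < e / 2" using s by (intro d0(2)) (auto simp: d_def)
		moreover have "dl * (s - u) <= e / 2" using s le by (intro de) auto
		ultimately show ?thesis using tame_lower[OF V _ le] assms(2) by linarith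
	qed
	thus ?thesis using that pos by blast
qed

lemma tame_isCont:
	assumes "tame xi dl V" "isCont xi u" "0 < u" "0 <= dl"
	shows "isCont V u"
	unfolding continuous_at_eps_delta
proof (intro allI impI)
	fix e :: real assume "e > 0"
	obtain d where d: "d > 0" "!!V s. tame xi dl V ==> \<bar>s - u\<bar> < d ==> \<bar>V s - V u\<bar> <= e / 2"
		using tame_lag[OF assms(2,3), of "e/2" dl] `e > 0` assms(4) by auto
	show "EX d>0. ALL x'. dist x' u < d --> dist (V x') (V u) < e"
		using d(1) d(2)[OF assms(1)] `e > 0` by (intro exI[of _ d]) (fastforce simp: dist_real_def)
qed

lemma tame_right_cont:
	assumes V: "tame xi dl V" and c: "cadlag xi" and t: "0 <= t" and d: "0 <= dl"
	shows "(V \<longlongrightarrow> V t) (at_right t)"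
proof (rule tendstoI)
	fix e :: real assume "e > 0"
	have "(xi \<longlongrightarrow> xi t) (at_right t)" using c t by (auto simp: cadlag_def)
	from dist_small_right[OF this, of "e/4"] `e > 0` obtain d0 where
		d0: "d0 > 0" "!!y. t < y ==> y < t + d0 ==> \<bar>xi y - xi t\<bar> < e / 4" by (metis zero_less_divide_iff zero_less_numeral)
	define r where "r = min d0 (e / (4 * (dl + 1)))"
	have r: "r > 0" using d0 `e > 0` d by (simp add: r_def)
	have "dist (V s) (V t) < e" if s: "t < s" "s < t + r" for s
	proof -
		have *: "\<bar>xi y - xi t\<bar> < e / 4" if "t <= y" "y <= s" for y
			using d0(2)[of y] that s `e > 0` by (cases "y = t") (auto simp: r_def)
		have "V s - V t <= e / 2"
		proof (rule tame_upper[OF V t])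
			fix y assume "t <= y" "y <= s"
			thus "xi s - xi y <= e / 2" using *[of y] *[of s] s by linarith
		qed (use s in auto)
		moreover have "s - t < e / (4 * (dl + 1))" using s by (simp add: r_def)
		hence "(s - t) * (4 * (dl + 1)) < e" using d by (subst (asm) pos_less_divide_eq) auto
		hence "dl * (s - t) <= e / 4" using s d by (simp add: field_simps)
		moreover have "\<bar>xi s - xi t\<bar> < e / 4" using *[of s] s by simp
		moreover have "xi s - xi t - dl * (s - t) <= V s - V t" using tame_lower[OF V t] s by simp
		ultimately show ?thesis using `e > 0` unfolding dist_real_def by linarith
	qed
	thus "\<forall>\<^sub>F x in at_right t. dist (V x) (V t) < e"
		using r unfolding eventually_at_right_field by (intro exI[of _ "t + r"]) auto
qed

lemma tame_borel:
	assumes "tame xi dl V" "cadlag xi" "0 <= dl"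
	shows "(%t. V (max 0 t)) \<in> borel_measurable borel"
	using tame_right_cont[OF assms(1,2) _ assms(3)] by (intro right_cont_borel)

section \<open>Occupation integrals as refraction drifts\<close>

text \<open>Half-open, so that the value at \<open>t\<close> involves \<open>h\<close> strictly
  before \<open>t\<close>; the recursion \<open>eop\<close> then looks back no further than the last
  grid point before \<open>t\<close>.\<close>

definition occ :: "(real => real) => real => real" where
	"occ h t = (LINT s:{0..<t}|lborel. h s)"

definition density01 :: "(real => real) => bool" where
	"density01 h \<longleftrightarrow> (%t. h (max 0 t)) \<in> borel_measurable borel & (ALL s>=0. 0 <= h s & h s <= 1)"

lemma density01_measurable: "density01 h ==> (%t. h (max 0 t)) \<in> borel_measurable borel"
	by (simp add: density01_def)

lemma density01_bounds: "density01 h ==> 0 <= s ==> 0 <= h s" "density01 h ==> 0 <= s ==> h s <= 1"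
	by (simp_all add: density01_def)

lemma density01_integrable:
	assumes "density01 h" "0 <= s"
	shows "set_integrable lborel {s..<t} h"
proof -
	note [measurable] = density01_measurable[OF assms(1)]
	have "set_integrable lborel {s..<t} (%u. h (max 0 u))"
		unfolding set_integrable_def
	proof (rule integrable_bound[of lborel "indicat_real {s..<t}"])
		show "integrable lborel (indicat_real {s..<t})"
			by (cases "s <= t") (auto intro!: integrable_real_indicator)
		show "AE x in lborel. norm (indicat_real {s..<t} x *\<^sub>R h (max 0 x)) <= norm (indicat_real {s..<t} x)"
			using density01_bounds[OF assms(1)] by (intro AE_I2) (simp add: indicator_def)
	qed measurable
	moreover have "(%u. indicat_real {s..<t} u *\<^sub>R h (max 0 u)) = (%u. indicat_real {s..<t} u *\<^sub>R h u)"
		using assms(2) by (auto simp: fun_eq_iff indicator_def max_def)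
	ultimately show ?thesis unfolding set_integrable_def by simp
qed

lemma occ_diff:
	assumes "density01 h" "0 <= s" "s <= t"
	shows "occ h t - occ h s = (LINT u:{s..<t}|lborel. h u)"
proof -
	have "{0..<t} = {0..<s} \<union> {s..<t}" using assms by auto
	hence "occ h t = (LINT u:{0..<s}|lborel. h u) + (LINT u:{s..<t}|lborel. h u)"
		unfolding occ_def using density01_integrable[OF assms(1)] assms(2)
		by (simp add: set_integral_Un)
	thus ?thesis by (simp add: occ_def)
qed

lemma occ_mono:
	assumes "density01 h" "0 <= s" "s <= t"
	shows "0 <= occ h t - occ h s" "occ h t - occ h s <= t - s"
proof -
	show "0 <= occ h t - occ h s"
		unfolding occ_diff[OF assms] set_lebesgue_integral_def
		using assms(2) density01_bounds[OF assms(1)] by (intro integral_nonneg_AE AE_I2) (simp add: indicator_def)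
	have "(LINT u:{s..<t}|lborel. h u) <= (LINT u:{s..<t}|lborel. 1)"
		using assms density01_integrable[OF assms(1,2)] density01_bounds[OF assms(1)]
		by (intro set_integral_mono) (auto simp: set_integrable_def intro!: integrable_real_indicator)
	also have "... = t - s" using assms(3) by (simp add: set_lebesgue_integral_def)
	finally show "occ h t - occ h s <= t - s" using occ_diff[OF assms] by simp
qed

lemma occ_0 [simp]: "occ h 0 = 0" by (simp add: occ_def set_lebesgue_integral_def)

lemma occ_continuous:
	assumes "density01 h" "density01 h'"
	shows "continuous_on {0..t} (%u. occ h u - occ h' u)"
proof -
	have "continuous_on {0..t} (occ g)" if g: "density01 g" for g
	proof (rule continuous_on_iff[THEN iffD2], intro ballI allI impI)
		fix x e :: real assume "x \<in> {0..t}" "e > 0"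
		have "\<bar>occ g y - occ g x\<bar> <= \<bar>y - x\<bar>" if "y \<in> {0..t}" for y
			using occ_mono[OF g, of x y] occ_mono[OF g, of y x] `x \<in> {0..t}` that by (cases "x <= y") auto
		thus "EX d>0. ALL x':{0..t}. dist x' x < d --> dist (occ g x') (occ g x) < e"
			using `e > 0` by (intro exI[of _ e]) (fastforce simp: dist_real_def intro: le_less_trans)
	qed
	thus ?thesis using assms by (intro continuous_intros) auto
qed

definition proc :: "real set => (real => real) => real => real => (real => real) => real => real" where
	"proc K xi x dl H = refl K (%u. x + xi u - dl * H u)"

lemma proc_bounded:
	assumes "cadlag xi" "density01 h" "0 <= dl"
	shows "bounded ((%u. x + xi u - dl * occ h u) ` {0..t})"
proof -
	obtain B where B: "ALL s:{0..t}. \<bar>xi s\<bar> <= B" using cadlag_bounded[OF assms(1)] by blast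
	have "\<bar>x + xi u - dl * occ h u\<bar> <= \<bar>x\<bar> + B + dl * t" if "u \<in> {0..t}" for u
	proof -
		have "0 <= occ h u" "occ h u <= t" using occ_mono[OF assms(2), of 0 u] that by auto
		hence "0 <= dl * occ h u" "dl * occ h u <= dl * t" using assms(3) by (auto intro: mult_left_mono)
		moreover have "\<bar>xi u\<bar> <= B" using B that by blast
		ultimately show ?thesis by linarith
	qed
	thus ?thesis by (intro boundedI[of _ "\<bar>x\<bar> + B + dl * t"]) auto
qed

lemma proc_tame:
	assumes "cadlag xi" "density01 h" "0 <= dl" "down K"
	shows "tame xi dl (proc K xi x dl (occ h))"
	unfolding tame_def
proof (intro allI impI conjI)
	fix s t :: real assume st: "0 <= s" "s <= t"
	have "dl * (occ h t - occ h s) <= dl * (t - s)" using occ_mono[OF assms(2) st] assms(3) by (intro mult_left_mono)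
	thus "xi t - xi s - dl * (t - s) <= proc K xi x dl (occ h) t - proc K xi x dl (occ h) s"
		unfolding proc_def using refl_push[OF assms(4) st proc_bounded[OF assms(1,2,3)], of x]
		by (simp add: algebra_simps)
	fix D assume D: "ALL u. s <= u --> u <= t --> xi t - xi u <= D"
	show "proc K xi x dl (occ h) t - proc K xi x dl (occ h) s <= D"
		unfolding proc_def
	proof (rule refl_upper[OF assms(4) st proc_bounded[OF assms(1,2,3)]])
		fix u assume u: "s <= u" "u <= t"
		have "0 <= dl * (occ h t - occ h u)" using occ_mono[OF assms(2), of u t] assms(3) st u by simp
		moreover have "xi t - xi u <= D" using D u by blast
		ultimately show "x + xi t - dl * occ h t - (x + xi u - dl * occ h u) <= D"
			by (simp add: algebra_simps)
	qed
qed

text \<open>\<open>refl_compare\<close> for drivers that differ in their drift: growth of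
  \<open>z - z'\<close> becomes an integral of \<open>h' - h\<close>. When \<open>h\<close> and
  \<open>h'\<close> indicate that the respective process exceeds \<open>b\<close>, this integrand is
  nonpositive wherever the first process is the higher one.\<close>

lemma proc_compare:
	assumes "cadlag xi" "density01 h" "density01 h'" "0 <= dl" "down K" "0 <= t"
		and d: "d > 0" "d <= proc K xi x dl (occ h) t - proc K xi x dl (occ h') t"
	obtains v where "0 <= v" "v <= t"
		"!!u. v < u ==> u <= t ==> d / 2 < proc K xi x dl (occ h) u - proc K xi x dl (occ h') u"
		"d / 4 <= dl * (LINT u:{v..<t}|lborel. h' u - h u)"
proof -
	let ?z = "%h u. x + xi u - dl * occ h u"
	have eq: "(%u. ?z h u - ?z h' u) = (%u. - dl * (occ h u - occ h' u))" by (auto simp: algebra_simps)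
	have c: "continuous_on {0..t} (%u. ?z h u - ?z h' u)"
		unfolding eq by (intro continuous_intros occ_continuous assms)
	obtain v where v: "0 <= v" "v <= t"
		"!!u. v < u ==> u <= t ==> d / 2 < proc K xi x dl (occ h) u - proc K xi x dl (occ h') u"
		"d / 4 <= (?z h t - ?z h' t) - (?z h v - ?z h' v)"
		using refl_compare[OF assms(5,6) proc_bounded[OF assms(1,2,4)] proc_bounded[OF assms(1,3,4)] _ c d(1) d(2)[unfolded proc_def]]
		unfolding proc_def by auto
	have I: "(LINT u:{v..<t}|lborel. h' u - h u) = (occ h' t - occ h' v) - (occ h t - occ h v)"
		using occ_diff[OF assms(2) v(1,2)] occ_diff[OF assms(3) v(1,2)] density01_integrable assms v(1)
		by (simp add: set_integral_diff)
	have "(?z h t - ?z h' t) - (?z h v - ?z h' v) = dl * (LINT u:{v..<t}|lborel. h' u - h u)"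
		unfolding I by (simp add: algebra_simps)
	thus ?thesis using that[OF v(1,2)] v(3,4) by simp
qed

section \<open>Convergence of the Euler schemes\<close>

definition eop :: "real set => (real => real) => real => real => real => nat => (real => real) => real => real" where
	"eop K xi x dl b n H = occ (%s. indicat_real {b<..} (proc K xi x dl H (grid n s)))"

text \<open>The Euler scheme of mesh \<open>1/(n + 1)\<close>: the drift is frozen between grid points, so that iterating \<open>eop\<close>
	\<open>k\<close> times determines it up to time \<open>k/(n + 1)\<close>.\<close>
definition euH :: "real set => (real => real) => real => real => real => nat => real => real" where
	"euH K xi x dl b n t = (eop K xi x dl b n ^^ nat \<lceil>real (Suc n) * t\<rceil>) (%_. 0) t"

definition euV :: "real set => (real => real) => real => real => real => nat => real => real" where
	"euV K xi x dl b n = proc K xi x dl (euH K xi x dl b n)"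

definition euh :: "real set => (real => real) => real => real => real => nat => real => real" where
	"euh K xi x dl b n s = indicat_real {b<..} (euV K xi x dl b n (grid n s))"

definition limV :: "real set => (real => real) => real => real => real => real => real" where
	"limV K xi x dl b t = lim (%n. euV K xi x dl b n t)"

lemma proc_cong: "(!!s. 0 <= s ==> s <= t ==> H s = H' s) ==> 0 <= t ==> proc K xi x dl H t = proc K xi x dl H' t"
	unfolding proc_def by (intro refl_cong) auto

lemma occ_cong: "(!!s. 0 <= s ==> s < t ==> h s = h' s) ==> occ h t = occ h' t"
	unfolding occ_def by (intro set_lebesgue_integral_cong) auto

lemma eop_cong:
	assumes "!!s u. 0 <= s ==> s < t ==> 0 <= u ==> u <= grid n s ==> H u = H' u"
	shows "eop K xi x dl b n H t = eop K xi x dl b n H' t"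
	unfolding eop_def
	by (intro occ_cong arg_cong[where f = "indicat_real {b<..}"] proc_cong assms grid_nonneg)

text \<open>\<open>eop\<close> at time \<open>t\<close> reads its argument only up to the last grid
  point before \<open>t\<close>, so each iteration extends by one step the interval on which the
  value is final.\<close>

lemma eop_stable_Suc:
	"0 <= t ==> t <= real k / real (Suc n) ==>
		(eop K xi x dl b n ^^ Suc k) (%_. 0) t = (eop K xi x dl b n ^^ k) (%_. 0) t"
proof (induction k arbitrary: t)
	case 0
	hence "t = 0" by simp
	thus ?case by (simp add: eop_def)
next
	case (Suc k)
	have "eop K xi x dl b n ((eop K xi x dl b n ^^ Suc k) (%_. 0)) t = eop K xi x dl b n ((eop K xi x dl b n ^^ k) (%_. 0)) t"
	proof (rule eop_cong)
		fix s u assume "0 <= s" "s < t" "0 <= u" "u <= grid n s"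
		moreover have "grid n s <= real k / real (Suc n)"
			using grid_less[of s "Suc k" n] `s < t` Suc.prems by simp
		ultimately show "(eop K xi x dl b n ^^ Suc k) (%_. 0) u = (eop K xi x dl b n ^^ k) (%_. 0) u"
			by (intro Suc.IH) auto
	qed
	thus ?case by simp
qed

lemma eop_stable:
	assumes "k <= j" "0 <= t" "t <= real k / real (Suc n)"
	shows "(eop K xi x dl b n ^^ j) (%_. 0) t = (eop K xi x dl b n ^^ k) (%_. 0) t"
	using assms(1)
proof (induction j rule: dec_induct)
	case (step j)
	have "t <= real j / real (Suc n)"
		using assms(3) step.hyps(1) by (meson divide_right_mono of_nat_0_le_iff of_nat_le_iff order_trans)
	thus ?case using eop_stable_Suc[OF assms(2)] step.IH by metis
qed simp

lemma euH_eq: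
	assumes "0 <= t" "t <= real k / real (Suc n)"
	shows "euH K xi x dl b n t = (eop K xi x dl b n ^^ k) (%_. 0) t"
proof -
	let ?k = "nat \<lceil>real (Suc n) * t\<rceil>"
	have "real (Suc n) * t <= real k" using assms(2) by (simp add: field_simps)
	hence "?k <= k" by (simp add: ceiling_le_iff nat_le_iff)
	moreover have "real (Suc n) * t <= real ?k" by linarith
	hence "t <= real ?k / real (Suc n)" by (simp add: field_simps)
	ultimately show ?thesis unfolding euH_def using eop_stable[of ?k k t n] assms(1) by metis
qed

lemma euH_fix:
	assumes "0 <= t"
	shows "euH K xi x dl b n t = occ (euh K xi x dl b n) t"
proof -
	obtain k :: nat where "real (Suc n) * t <= real k" using real_arch_simple by blast
	hence k: "t <= real k / real (Suc n)" by (simp add: field_simps)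
	have "euH K xi x dl b n t = (eop K xi x dl b n ^^ Suc k) (%_. 0) t"
		using euH_eq[OF assms k] eop_stable_Suc[OF assms k] by metis
	also have "... = eop K xi x dl b n ((eop K xi x dl b n ^^ k) (%_. 0)) t" by simp
	also have "... = eop K xi x dl b n (euH K xi x dl b n) t"
	proof (rule eop_cong)
		fix s u assume "0 <= s" "s < t" "0 <= u" "u <= grid n s"
		hence "u <= real k / real (Suc n)" using grid_le[of n s] k by linarith
		thus "(eop K xi x dl b n ^^ k) (%_. 0) u = euH K xi x dl b n u"
			using euH_eq `0 <= u` by metis
	qed
	finally show ?thesis by (simp add: eop_def euh_def[abs_def] euV_def)
qed

lemma density01_grid: "density01 (%s. indicat_real A (f (grid n s)))"
proof -
	have "(%t. indicat_real A (f (grid n (max 0 t)))) \<in> borel_measurable borel"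
		by (rule measurable_compose[where g = "%s. indicat_real A (f (grid n s))"])
			(rule borel_measurable_max borel_measurable_const measurable_ident_sets[OF refl] grid_measurable)+
	thus ?thesis by (simp add: density01_def indicator_def)
qed

lemma euh_density: "density01 (euh K xi x dl b n)"
	unfolding euh_def[abs_def] by (rule density01_grid)

lemma euV_eq: "0 <= t ==> euV K xi x dl b n t = proc K xi x dl (occ (euh K xi x dl b n)) t"
	unfolding euV_def by (intro proc_cong euH_fix)

lemma euV_tame: "cadlag xi ==> 0 <= dl ==> down K ==> tame xi dl (euV K xi x dl b n)"
	using proc_tame[OF _ euh_density, of xi dl K x K xi x dl b n] unfolding tame_def by (simp add: euV_eq)

lemma euV_Cauchy:
	assumes xi: "cadlag xi" and dl: "0 <= dl" and K: "down K" and N: "0 <= N" and "et > 0"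
	shows "EX n0. ALL n>=n0. ALL m>=n0. ALL t. 0 <= t --> t <= N --> euV K xi x dl b n t - euV K xi x dl b m t < et"
proof (rule ccontr)
	let ?V = "euV K xi x dl b" and ?h = "euh K xi x dl b"
	assume "~ ?thesis"
	hence "ALL j. EX n m t. j <= n & j <= m & 0 <= t & t <= N & et <= ?V n t - ?V m t"
		by (meson not_le)
	then obtain n m t where nm: "!!j. j <= n j" "!!j. j <= m j" "!!j. 0 <= t j" "!!j. t j <= N"
		"!!j. et <= ?V (n j) (t j) - ?V (m j) (t j)" by metis
	define ww where "ww j u = indicat_real ({0..N} \<inter> {u. et / 2 < ?V (n j) (max 0 u) - ?V (m j) (max 0 u)}) u
		* (?h (m j) (max 0 u) * (1 - ?h (n j) (max 0 u)))" for j u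
	note meas = tame_borel[OF euV_tame[OF xi dl K] xi dl]
	have w_meas [measurable]: "ww j \<in> borel_measurable borel" for j
	proof -
		note [measurable] = meas[of x b "n j"] meas[of x b "m j"] density01_measurable[OF euh_density]
		show ?thesis unfolding ww_def by measurable
	qed
	have w01: "0 <= ww j u" "ww j u <= indicat_real {0..N} u" for j u
		using density01_bounds[OF euh_density, of "max 0 u"]
		by (auto simp: ww_def indicator_def euh_def)
	have lower: "et / 4 <= dl * (LINT u|lborel. ww j u)" for j
	proof -
		obtain v where v: "0 <= v" "v <= t j"
			"!!u. v < u ==> u <= t j ==> et / 2 < proc K xi x dl (occ (?h (n j))) u - proc K xi x dl (occ (?h (m j))) u"
			"et / 4 <= dl * (LINT u:{v..<t j}|lborel. ?h (m j) u - ?h (n j) u)"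
			using proc_compare[OF xi euh_density[of K xi x dl b "n j"] euh_density[of K xi x dl b "m j"] dl K nm(3)[of j] `et > 0`, of x]
				nm(5)[of j] nm(3)[of j] by (auto simp: euV_eq)
		have "(LINT u:{v..<t j}|lborel. ?h (m j) u - ?h (n j) u) <= (LINT u|lborel. ww j u)"
			unfolding set_lebesgue_integral_def
		proof (rule integral_mono_AE)
			show "integrable lborel (%u. indicat_real {v..<t j} u *\<^sub>R (?h (m j) u - ?h (n j) u))"
				using set_integral_diff(1)[OF density01_integrable[OF euh_density v(1)] density01_integrable[OF euh_density v(1)]]
				by (simp add: set_integrable_def)
			show "integrable lborel (ww j)"
				by (rule integrable_bound[of lborel "indicat_real {0..N}"])
					(use w01 N in "auto simp: integrable_real_indicator")
			show "AE u in lborel. indicat_real {v..<t j} u *\<^sub>R (?h (m j) u - ?h (n j) u) <= ww j u"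
				using AE_lborel_singleton[of v]
			proof eventually_elim
				case (elim u)
				show ?case
				proof (cases "v < u & u < t j")
					case True
					hence u: "0 <= u" "u <= N" using v nm(4)[of j] by auto
					have "et / 2 < ?V (n j) u - ?V (m j) u" using v(3)[of u] True u by (simp add: euV_eq)
					hence "ww j u = ?h (m j) u * (1 - ?h (n j) u)" using u by (simp add: ww_def)
					thus ?thesis using True by (simp add: euh_def indicator_def)
				next
					case False
					thus ?thesis using elim w01(1)[of j u] by (auto simp: indicator_def)
				qed
			qed
		qed
		hence "dl * (LINT u:{v..<t j}|lborel. ?h (m j) u - ?h (n j) u) <= dl * (LINT u|lborel. ww j u)"
			using dl by (rule mult_left_mono)
		thus ?thesis using v(4) by linarith
	qed
	have "(%j. LINT u|lborel. ww j u) ----> integral\<^sup>L lborel (%u :: real. 0 :: real)"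
	proof (rule integral_dominated_convergence[where w = "indicat_real {0..N}"])
		show "integrable lborel (indicat_real {0..N})" using N by (simp add: integrable_real_indicator)
		show "AE u in lborel. norm (ww j u) <= indicat_real {0..N} u" for j using w01[of j] by auto
		show "AE u in lborel. (%j. ww j u) ----> 0"
			using AE_isCont_cadlag[OF xi] AE_lborel_singleton[of 0]
		proof eventually_elim
			case (elim u)
			show ?case
			proof (cases "0 < u")
				case False
				hence "ww j u = 0" for j using elim by (simp add: ww_def)
				thus ?thesis by simp
			next
				case True
				hence c: "isCont xi u" using elim by simp
				\<comment> \<open>Two lags of \<open>et / 4\<close> cannot bridge the gap \<open>et / 2\<close>
				  built into \<open>ww\<close>.\<close>
				have "et / 4 > 0" using `et > 0` by simp
				from tame_lag[OF c True this dl] obtain d where d: "d > 0"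
					"!!V s. tame xi dl V ==> \<bar>s - u\<bar> < d ==> \<bar>V s - V u\<bar> <= et / 4" by blast
				have "eventually (%k. dist (grid k u) u < d) sequentially"
					using grid_tendsto d(1) by (rule tendstoD)
				then obtain k0 where k0: "!!k. k >= k0 ==> \<bar>grid k u - u\<bar> < d"
					by (auto simp: eventually_sequentially dist_real_def)
				have "ww j u = 0" if "j >= k0" for j
				proof (rule ccontr)
					assume "ww j u ~= 0"
					hence A: "et / 2 < ?V (n j) u - ?V (m j) u" "?V (n j) (grid (n j) u) <= b" "b < ?V (m j) (grid (m j) u)"
						using True by (auto simp: ww_def euh_def indicator_def split: if_splits)
					have "\<bar>?V (n j) (grid (n j) u) - ?V (n j) u\<bar> <= et / 4"
						using nm(1)[of j] that by (intro d(2) k0 euV_tame[OF xi dl K]) simp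
					moreover have "\<bar>?V (m j) (grid (m j) u) - ?V (m j) u\<bar> <= et / 4"
						using nm(2)[of j] that by (intro d(2) k0 euV_tame[OF xi dl K]) simp
					ultimately show False using A by linarith
				qed
				thus ?thesis by (intro tendsto_eventually) (auto simp: eventually_sequentially)
			qed
		qed
	qed (use w_meas in auto)
	hence "(%j. dl * (LINT u|lborel. ww j u)) ----> dl * 0" by (intro tendsto_intros) simp
	hence "et / 4 <= dl * 0" using lower by (intro LIMSEQ_le_const) auto
	thus False using `et > 0` by simp
qed

lemma euV_tendsto:
	assumes "cadlag xi" "0 <= dl" "down K" "0 <= t"
	shows "(%n. euV K xi x dl b n t) ----> limV K xi x dl b t"
proof -
	have "Cauchy (%n. euV K xi x dl b n t)"
	proof (rule metric_CauchyI)
		fix e :: real assume "e > 0"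
		obtain n0 where n0: "!!n m. n >= n0 ==> m >= n0 ==> euV K xi x dl b n t - euV K xi x dl b m t < e"
			using euV_Cauchy[OF assms `e > 0`, of x b] assms(4) by blast
		have "dist (euV K xi x dl b m t) (euV K xi x dl b n t) < e" if "m >= n0" "n >= n0" for m n
			using n0[of n m] n0[of m n] that by (simp add: dist_real_def abs_less_iff)
		thus "EX M. ALL m>=M. ALL n>=M. dist (euV K xi x dl b m t) (euV K xi x dl b n t) < e" by blast
	qed
	thus ?thesis unfolding limV_def by (simp add: Cauchy_convergent convergent_LIMSEQ_iff[symmetric])
qed

lemma limV_tame:
	assumes "cadlag xi" "0 <= dl" "down K"
	shows "tame xi dl (limV K xi x dl b)"
	unfolding tame_def
proof (intro allI impI conjI)
	fix s t :: real assume st: "0 <= s" "s <= t"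
	have lim: "(%n. euV K xi x dl b n t - euV K xi x dl b n s) ----> limV K xi x dl b t - limV K xi x dl b s"
		using st by (intro tendsto_diff euV_tendsto assms) auto
	show "xi t - xi s - dl * (t - s) <= limV K xi x dl b t - limV K xi x dl b s"
		by (rule LIMSEQ_le_const[OF lim]) (use tame_lower[OF euV_tame[OF assms] st] in auto)
	fix D assume D: "ALL u. s <= u --> u <= t --> xi t - xi u <= D"
	thus "limV K xi x dl b t - limV K xi x dl b s <= D"
		by (intro LIMSEQ_le_const2[OF lim] exI[of _ 0] allI impI tame_upper[OF euV_tame[OF assms] st]) auto
qed

lemma limV_solves:
	assumes xi: "cadlag xi" and dl: "0 <= dl" and K: "down K" and t: "0 <= t"
		and null: "AE u in lborel. 0 <= u --> u <= t --> limV K xi x dl b u ~= b"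
	shows "limV K xi x dl b t = proc K xi x dl (occ (%s. indicat_real {b<..} (limV K xi x dl b s))) t"
proof -
	let ?V = "euV K xi x dl b" and ?h = "euh K xi x dl b" and ?L = "limV K xi x dl b"
	let ?k = "%s. indicat_real {b<..} (?L s)"
	have Lm [measurable]: "(%u. ?L (max 0 u)) \<in> borel_measurable borel"
		by (rule tame_borel[OF limV_tame[OF xi dl K] xi dl])
	have "(%u. indicat_real {b<..} (?L (max 0 u))) \<in> borel_measurable borel" by measurable
	hence dk: "density01 ?k" by (simp add: density01_def indicator_def)
	define g where "g n u = indicat_real {0..<t} u * \<bar>?h n (max 0 u) - ?k (max 0 u)\<bar>" for n u
	have gm [measurable]: "g n \<in> borel_measurable borel" for n
	proof -
		note [measurable] = density01_measurable[OF euh_density] density01_measurable[OF dk]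
		show ?thesis unfolding g_def by measurable
	qed
	have g01: "0 <= g n u" "g n u <= indicat_real {0..<t} u" for n u
		by (auto simp: g_def indicator_def euh_def)
	have it: "integrable lborel (indicat_real {0..<t})" using t by (simp add: integrable_real_indicator)
	have gi: "integrable lborel (g n)" for n
		by (rule integrable_bound[OF it]) (use g01 in auto)
	have g0: "(%n. LINT u|lborel. g n u) ----> integral\<^sup>L lborel (%u :: real. 0 :: real)"
	proof (rule integral_dominated_convergence[where w = "indicat_real {0..<t}"])
		show "AE u in lborel. (%n. g n u) ----> 0"
			using AE_isCont_cadlag[OF xi] AE_lborel_singleton[of 0] null
		proof eventually_elim
			case (elim u)
			show ?case
			proof (cases "0 < u & u < t")
				case False
				hence "g n u = 0" for n using elim by (auto simp: g_def)
				thus ?thesis by simp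
			next
				case True
				hence c: "isCont xi u" and ne: "?L u ~= b" using elim by auto
				\<comment> \<open>A third of the distance to \<open>b\<close>: the lag and the distance to the
				  limit use up at most the other two thirds.\<close>
				define e where "e = \<bar>?L u - b\<bar> / 3"
				have "e > 0" using ne by (simp add: e_def)
				from tame_lag[OF c _ this dl] True obtain d where d: "d > 0"
					"!!V s. tame xi dl V ==> \<bar>s - u\<bar> < d ==> \<bar>V s - V u\<bar> <= e" by blast
				have "eventually (%n. dist (grid n u) u < d) sequentially"
					using grid_tendsto d(1) by (rule tendstoD)
				moreover have "eventually (%n. dist (?V n u) (?L u) < e) sequentially"
					using euV_tendsto[OF xi dl K] True `e > 0` by (intro tendstoD) auto
				ultimately have "eventually (%n. g n u = 0) sequentially"
				proof eventually_elim
					case (elim n)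
					hence "\<bar>?V n (grid n u) - ?V n u\<bar> <= e" by (intro d(2) euV_tame[OF xi dl K]) (simp add: dist_real_def)
					moreover have "\<bar>?V n u - ?L u\<bar> < e" using elim by (simp add: dist_real_def)
					moreover have "?L u - b = 3 * e | b - ?L u = 3 * e" by (auto simp: e_def abs_if)
					ultimately have "(b < ?V n (grid n u)) = (b < ?L u)" using `e > 0` by linarith
					thus ?case using True by (simp add: g_def euh_def indicator_def)
				qed
				thus ?thesis by (rule tendsto_eventually)
			qed
		qed
		show "AE u in lborel. norm (g n u) <= indicat_real {0..<t} u" for n using g01 by auto
	qed (use it in auto)
	have le: "\<bar>?V n t - proc K xi x dl (occ ?k) t\<bar> <= 2 * (dl * (LINT u|lborel. g n u))" for n
	proof -
		have "\<bar>(x + xi s - dl * occ (?h n) s) - (x + xi s - dl * occ ?k s)\<bar> <= dl * (LINT u|lborel. g n u)"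
			if s: "0 <= s" "s <= t" for s
		proof -
			have i: "set_integrable lborel {0..<s} (?h n)" "set_integrable lborel {0..<s} ?k"
				by (rule density01_integrable euh_density dk order_refl)+
			have "\<bar>occ (?h n) s - occ ?k s\<bar> = \<bar>LINT u:{0..<s}|lborel. ?h n u - ?k u\<bar>"
				unfolding occ_def by (simp add: set_integral_diff[OF i])
			also have "... <= (LINT u:{0..<s}|lborel. \<bar>?h n u - ?k u\<bar>)"
				using set_integral_norm_bound[OF set_integral_diff(1)[OF i]] by simp
			also have "... <= (LINT u|lborel. g n u)"
				unfolding set_lebesgue_integral_def
			proof (rule integral_mono)
				show "integrable lborel (%u. indicat_real {0..<s} u *\<^sub>R \<bar>?h n u - ?k u\<bar>)"
					using set_integrable_abs[OF set_integral_diff(1)[OF i]] by (simp add: set_integrable_def)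
				show "indicat_real {0..<s} u *\<^sub>R \<bar>?h n u - ?k u\<bar> <= g n u" for u
					using s by (cases "0 <= u & u < s") (auto simp: g_def)
			qed (rule gi)
			finally have "dl * \<bar>occ (?h n) s - occ ?k s\<bar> <= dl * (LINT u|lborel. g n u)" using dl by (rule mult_left_mono)
			moreover have "\<bar>(x + xi s - dl * occ (?h n) s) - (x + xi s - dl * occ ?k s)\<bar> = dl * \<bar>occ (?h n) s - occ ?k s\<bar>"
			proof -
				have "(x + xi s - dl * occ (?h n) s) - (x + xi s - dl * occ ?k s) = - (dl * (occ (?h n) s - occ ?k s))"
					by (simp add: algebra_simps)
				thus ?thesis using dl by (simp only: abs_minus_cancel abs_mult abs_of_nonneg)
			qed
			ultimately show ?thesis by simp
		qed
		thus ?thesis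
			unfolding euV_eq[OF t] proc_def
			by (intro refl_Lipschitz[OF K t] proc_bounded[OF xi _ dl] euh_density dk)
	qed
	have "(%n. 2 * (dl * (LINT u|lborel. g n u))) ----> 2 * (dl * 0)"
		using g0 by (intro tendsto_intros) simp
	hence lim0: "(%n. 2 * (dl * (LINT u|lborel. g n u))) ----> 0" by simp
	have "ALL n. norm (?V n t - proc K xi x dl (occ ?k) t) <= 2 * (dl * (LINT u|lborel. g n u))"
		unfolding real_norm_def using le by blast
	from Lim_null_comparison[OF always_eventually[OF this] lim0]
	have "(%n. ?V n t) ----> proc K xi x dl (occ ?k) t" by (rule LIM_zero_cancel)
	with euV_tendsto[OF xi dl K t] show ?thesis by (rule LIMSEQ_unique)
qed

lemma borel_max0:
	fixes f :: "real => real"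
	assumes [measurable]: "f \<in> borel_measurable borel"
	shows "(%t. f (max 0 t)) \<in> borel_measurable borel"
	by measurable

text \<open>Bridges the half-open integrals of \<open>occ\<close> and the closed ones of
  \<open>refracted_solution\<close>.\<close>

lemma set_integral_Ico_Icc:
	fixes f :: "real => real"
	assumes "set_integrable lborel {a..t} f"
	shows "(LINT s:{a..<t}|lborel. f s) = (LINT s:{a..t}|lborel. f s)"
proof -
	have "set_integrable lborel {a..<t} f" by (rule set_integrable_subset[OF assms]) auto
	thus ?thesis
		using assms unfolding set_lebesgue_integral_def set_integrable_def
		by (intro integral_cong_AE borel_measurable_integrable)
			(use AE_lborel_singleton[of t] in "auto elim!: eventually_mono simp: indicator_def")
qed

section \<open>Uniqueness for the refracted and reflected equation\<close>

definition above :: "real => (real => real) => real => real" where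
	"above b V s = indicat_real {b<..} (V s)"

lemma above_density: "(%t. V (max 0 t)) \<in> borel_measurable borel ==> density01 (above b V)"
	unfolding density01_def above_def by (auto simp: indicator_def)

text \<open>One inequality suffices by symmetry. If \<open>V\<close> exceeded \<open>V'\<close> at
  \<open>T\<close>, it would do so on a whole interval before \<open>T\<close>; there its drift is
  at most that of \<open>V'\<close>, so the drift cannot have opened the gap.\<close>

lemma proc_unique:
	assumes xi: "cadlag xi" and d: "density01 (above b V)" "density01 (above b V')" and "0 <= dl" "down K" "0 <= T"
		and V: "!!t. 0 <= t ==> t <= T ==> V t = proc K xi x dl (occ (above b V)) t"
		and V': "!!t. 0 <= t ==> t <= T ==> V' t = proc K xi x dl (occ (above b V')) t"
	shows "V T <= V' T"
proof (rule ccontr)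
	assume "~ ?thesis"
	hence pos: "V T - V' T > 0" by simp
	have eq: "V T - V' T <= proc K xi x dl (occ (above b V)) T - proc K xi x dl (occ (above b V')) T"
		using V[of T] V'[of T] `0 <= T` by simp
	obtain v where v: "0 <= v" "v <= T"
		"!!u. v < u ==> u <= T ==> (V T - V' T) / 2 < proc K xi x dl (occ (above b V)) u - proc K xi x dl (occ (above b V')) u"
		"(V T - V' T) / 4 <= dl * (LINT u:{v..<T}|lborel. above b V' u - above b V u)"
		using proc_compare[OF xi d `0 <= dl` `down K` `0 <= T` pos eq] by blast
	have "(LINT u:{v..<T}|lborel. above b V' u - above b V u) <= integral\<^sup>L lborel (%u :: real. 0 :: real)"
		unfolding set_lebesgue_integral_def
	proof (rule integral_mono_AE)
		show "integrable lborel (%u. indicat_real {v..<T} u *\<^sub>R (above b V' u - above b V u))"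
			using set_integral_diff(1)[OF density01_integrable[OF d(2) v(1)] density01_integrable[OF d(1) v(1)]]
			by (simp add: set_integrable_def)
		show "AE u in lborel. indicat_real {v..<T} u *\<^sub>R (above b V' u - above b V u) <= 0"
			using AE_lborel_singleton[of v]
		proof eventually_elim
			case (elim u)
			show ?case
			proof (cases "v < u & u < T")
				case True
				hence "V' u < V u" using v(3)[of u] V[of u] V'[of u] pos v(1) by simp
				thus ?thesis using True by (simp add: above_def indicator_def)
			qed (use elim in "auto simp: indicator_def")
		qed
	qed simp
	hence "(LINT u:{v..<T}|lborel. above b V' u - above b V u) <= 0" by simp
	hence "dl * (LINT u:{v..<T}|lborel. above b V' u - above b V u) <= 0"
		using `0 <= dl` by (simp add: mult_nonneg_nonpos)
	with v(4) pos show False by simp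
qed

lemma refl_horizon:
	assumes "0 <= s"
	shows "t <= s ==> refl {0..s} z t = refl {0..} z t"
		and "s <= t ==> refl {0..s} z t = z t - z s + refl {0..} z s"
proof -
	assume "t <= s"
	hence "{0..s} \<inter> {0..t} = {0..} \<inter> {0..t}" by auto
	thus "refl {0..s} z t = refl {0..} z t" by (simp only: refl_def)
next
	assume "s <= t"
	hence "{0..s} \<inter> {0..t} = {0..} \<inter> {0..s}" by auto
	thus "refl {0..s} z t = z t - z s + refl {0..} z s" unfolding refl_def by (simp only:)
qed

lemma down_simps [simp]: "down {0..}" "0 <= s ==> down {0..s}"
	by (auto simp: down_def)

section \<open>The pathwise construction\<close>

text \<open>A path \<open>xi\<close> for which the Euler limits reflected on \<open>[0, \<infinity>)\<close>, and on \<open>[0, r]\<close> for rational \<open>r\<close>, spend no time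
	at \<open>b\<close>. The latter continue as refracted paths after time \<open>r\<close>, and provide the solutions required by Step 1.\<close>
locale regular_path =
	fixes xi :: "real => real" and x dl b :: real
	assumes good: "good_path xi" and dl: "0 <= dl" and b: "0 < b"
		and null_V: "AE u in lborel. 0 <= u --> limV {0..} xi (max x 0) dl b u ~= b"
		and null_A: "!!r. r \<in> \<rat> ==> 0 <= r ==> AE u in lborel. 0 <= u --> limV {0..r} xi (max x 0) dl b u ~= b"
begin

abbreviation "V \<equiv> limV {0..} xi (max x 0) dl b"
abbreviation "sh \<equiv> (%t. x + xi t)"
abbreviation "PP K h \<equiv> proc K xi (max x 0) dl (occ h)"
abbreviation "Z h \<equiv> (%u. max x 0 + xi u - dl * occ h u)"

lemma cadlag: "cadlag xi" and xi0: "xi 0 = 0" using good by (auto simp: good_path_def)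

lemma PP_unfold: "PP K h t = refl K (Z h) t" by (simp add: proc_def)

lemma Z_bounded: "density01 h ==> bounded (Z h ` {0..t})"
	using proc_bounded[OF cadlag _ dl] .

lemma PP_tame: "density01 h ==> down K ==> tame xi dl (PP K h)"
	using proc_tame[OF cadlag _ dl] .

lemma V_tame: "tame xi dl V" by (rule limV_tame[OF cadlag dl]) simp

lemma V_density: "density01 (above b V)"
	by (rule above_density[OF tame_borel[OF V_tame cadlag dl]])

lemma limV_eq:
	assumes "down K" "AE u in lborel. 0 <= u --> limV K xi (max x 0) dl b u ~= b" "0 <= t"
	shows "limV K xi (max x 0) dl b t = PP K (above b (limV K xi (max x 0) dl b)) t"
proof -
	have "AE u in lborel. 0 <= u --> u <= t --> limV K xi (max x 0) dl b u ~= b"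
		using assms(2) by (rule eventually_mono) auto
	from limV_solves[OF cadlag dl assms(1,3) this] show ?thesis by (simp only: above_def[abs_def])
qed

lemma V_eq: "0 <= t ==> V t = PP {0..} (above b V) t"
	by (rule limV_eq[OF _ null_V]) auto

lemma V_nonneg: "0 <= t ==> 0 <= V t"
	using refl_nonneg[OF _ _ Z_bounded[OF V_density], of "{0..}" t] V_eq[of t] by (simp add: PP_unfold)

lemma V_unique:
	assumes "0 <= T" "0 <= s" "density01 (above b V')" "K = {0..} | K = {0..s}"
		and "!!t. 0 <= t ==> t <= T ==> V' t = PP K (above b V') t"
		and "!!t. 0 <= t ==> t <= T ==> V t = PP K (above b V) t"
	shows "V' T = V T"
proof -
	have K: "down K" using assms(2,4) by auto
	show ?thesis
		by (rule antisym; rule proc_unique[OF cadlag _ _ dl K assms(1)]; rule V_density assms; assumption)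
qed

text \<open>After \<open>r\<close> the push is constant and increments are those of the driver. This
  is how solutions of the refraction equation are produced, with the starting value
  \<open>A s\<close> dictated by the scheme.\<close>

lemma refracted_solution_horizon:
	assumes r: "r \<in> \<rat>" "0 <= r" "r <= s"
	defines "A \<equiv> limV {0..r} xi (max x 0) dl b"
	shows "refracted_solution dl b sh s (A s) A"
		and "!!t. 0 <= t ==> A t = PP {0..r} (above b A) t" "density01 (above b A)"
proof -
	have K: "down {0..r}" using r by simp
	have tm: "tame xi dl A" unfolding A_def by (rule limV_tame[OF cadlag dl K])
	show dens: "density01 (above b A)"
		by (rule above_density[OF tame_borel[OF tm cadlag dl]])
	show A_eq: "A t = PP {0..r} (above b A) t" if "0 <= t" for t
		unfolding A_def by (rule limV_eq[OF K null_A[OF r(1,2)] that])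
	show "refracted_solution dl b sh s (A s) A"
		unfolding refracted_solution_def above_def[symmetric]
	proof (intro allI impI conjI)
		fix t assume t: "s <= t"
		have s0: "0 <= s" using r by simp
		show int: "set_integrable lborel {s..t} (above b A)"
			by (rule set_integrable_subset[OF density01_integrable[OF dens s0, of "t + 1"]]) auto
		have "A t - A s = Z (above b A) t - Z (above b A) s"
			using A_eq[of t] A_eq[of s] refl_horizon(2)[OF r(2), of t] refl_horizon(2)[OF r(2), of s] r t by (simp add: PP_unfold)
		thus "A t = A s + (x + xi t - (x + xi s)) - dl * (LINT s:{s..t}|lborel. above b A s)"
			using occ_diff[OF dens s0 t] set_integral_Ico_Icc[OF int] by (simp add: algebra_simps)
	qed
qed

text \<open>\<open>A\<close> is an arbitrary solution, since \<open>SOME\<close> may select any.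
  Glued to \<open>V\<close> at \<open>s\<close> it becomes a process \<open>B\<close> that is pushed
  only up to \<open>s\<close>. As long as \<open>A\<close> stays nonnegative, \<open>B\<close> also
  satisfies the equation with unrestricted reflection, and uniqueness identifies it with
  \<open>V\<close>.\<close>

lemma refract_step:
	assumes s: "0 <= s" and A: "refracted_solution dl b sh s (V s) A"
		and T: "T = Inf (ereal ` {t. ereal s < ereal t & A t < 0})"
	shows "ereal s <= T" "!!t. s <= t ==> ereal t < T ==> A t = V t"
		"T = \<infinity> | (EX T'>=s. T = ereal T' & V T' = 0)"
proof -
	have Ai: "set_integrable lborel {s..t} (above b A)"
		and Aeq: "A t = V s + (xi t - xi s) - dl * (LINT u:{s..t}|lborel. above b A u)" if "s <= t" for t
		using A that unfolding refracted_solution_def above_def[symmetric] by auto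
	define h where "h u = (if u < s then above b V u else above b A u)" for u
	have hd: "density01 h"
		unfolding density01_def
	proof
		show "ALL s>=0. 0 <= h s & h s <= 1" by (simp add: h_def above_def indicator_def)
		\<comment> \<open>Measurability of the indicator along \<open>A\<close> comes only from the
		  integrability contained in \<open>refracted_solution\<close>, on bounded intervals after
		  \<open>s\<close>; \<open>h\<close> is the pointwise limit of the pieces
		  \<open>g n\<close>.\<close>
		define g where "g n y = indicat_real {..<s} y * above b V (max 0 y) + indicat_real {s..s + real n} y * above b A y" for n y
		have g_eq: "g n y = h y" if "0 <= y" "y - s <= real n" for n y
		proof (cases "y < s")
			case True
			hence "y \<notin> {s..s + real n}" by auto
			thus ?thesis using True that(1) by (simp add: g_def h_def)
		next
			case False
			hence "y \<in> {s..s + real n}" using that by auto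
			thus ?thesis using False by (simp add: g_def h_def)
		qed
		have "g n \<in> borel_measurable borel" for n
		proof -
			have "(%y. indicat_real {s..s + real n} y * above b A y) \<in> borel_measurable borel"
				using borel_measurable_integrable[OF Ai[of "s + real n", unfolded set_integrable_def]] by simp
			from borel_measurable_add[OF borel_measurable_times[OF _ density01_measurable[OF V_density]] this]
			show ?thesis unfolding g_def[abs_def] by simp
		qed
		hence "(%t. g n (max 0 t)) \<in> borel_measurable borel" for n by (rule borel_max0)
		moreover have "(%n. g n (max 0 t)) ----> h (max 0 t)" for t
		proof -
			obtain n0 :: nat where "max 0 t - s <= real n0" using real_arch_simple by blast
			hence "g n (max 0 t) = h (max 0 t)" if "n0 <= n" for n
				using that by (intro g_eq) (simp, linarith)
			thus ?thesis by (intro tendsto_eventually) (unfold eventually_sequentially, blast)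
		qed
		ultimately show "(%t. h (max 0 t)) \<in> borel_measurable borel"
			by (rule borel_measurable_LIMSEQ_real[rotated])
	qed
	have occ_le: "occ h t = occ (above b V) t" if "t <= s" for t
		using that by (intro occ_cong) (simp add: h_def)
	have V_le: "refl {0..} (Z h) t = V t" if "0 <= t" "t <= s" for t
		unfolding V_eq[OF that(1)] PP_unfold
		by (rule refl_cong) (use that occ_le in auto)
	define B where "B = PP {0..s} h"
	have B_le: "B t = V t" if "0 <= t" "t <= s" for t
		using refl_horizon(1)[OF s that(2)] V_le[OF that] by (simp add: B_def PP_unfold)
	have B_Z: "B t = Z h t - Z h s + V s" if "s <= t" for t
		using refl_horizon(2)[OF s that] V_le[of s] s by (simp add: B_def PP_unfold)
	have BA: "B t = A t" if "s <= t" for t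
	proof -
		have "(LINT u:{s..<t}|lborel. h u) = (LINT u:{s..<t}|lborel. above b A u)"
			by (intro set_lebesgue_integral_cong) (auto simp: h_def)
		hence "occ h t - occ h s = (LINT u:{s..t}|lborel. above b A u)"
			using occ_diff[OF hd s that] set_integral_Ico_Icc[OF Ai[OF that]] by simp
		thus ?thesis using B_Z[OF that] Aeq[OF that] by (simp add: algebra_simps)
	qed
	have Bt: "tame xi dl B" unfolding B_def by (rule PP_tame[OF hd]) (use s in simp)
	have occB: "occ (above b B) t = occ h t" if "0 <= t" for t
		using B_le BA by (intro occ_cong) (auto simp: h_def above_def)
	have Bd: "density01 (above b B)" by (rule above_density[OF tame_borel[OF Bt cadlag dl]])
	have VA: "A t = V t" if t: "s <= t" and nn: "!!u. s < u ==> u <= t ==> 0 <= A u" for t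
	proof -
		have B_sol: "B t' = PP {0..} (above b B) t'" if t': "0 <= t'" "t' <= t" for t'
		proof -
			have eq: "PP {0..} (above b B) t' = refl {0..} (Z h) t'"
				unfolding PP_unfold using t' occB by (intro refl_cong) auto
			show ?thesis
			proof (cases "t' <= s")
				case True
				thus ?thesis using eq V_le B_le t' by simp
			next
				case False
				have "refl {0..} (Z h) t' - Z h t' = refl {0..} (Z h) s - Z h s"
				proof (rule ccontr)
					assume ne: "~ ?thesis"
					have st': "s <= t'" using False by simp
					have "Z h t' - Z h s <= refl {0..} (Z h) t' - refl {0..} (Z h) s"
						by (rule refl_push[OF _ s st' Z_bounded[OF hd]]) simp
					hence pos: "refl {0..} (Z h) t' - Z h t' - (refl {0..} (Z h) s - Z h s) > 0"
						using ne by linarith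
					\<comment> \<open>The tolerance is the whole increase of the push, so that
					  \<open>- Z h u\<close> exceeds the push at \<open>s\<close>, which means
					  \<open>B u < 0\<close>.\<close>
					obtain u where u: "s < u" "u <= t'"
						"- Z h u > refl {0..} (Z h) t' - Z h t' - (refl {0..} (Z h) t' - Z h t' - (refl {0..} (Z h) s - Z h s))"
						using refl_pushed[OF down_simps(1) s st' Z_bounded[OF hd] ne pos] .
					have "B u < 0" using B_Z[of u] V_le[OF s order_refl] u by linarith
					hence "A u < 0" using BA[of u] u(1) by simp
					thus False using nn[of u] u t' by simp
				qed
				thus ?thesis using eq B_Z[of t'] V_le[of s] s False by simp
			qed
		qed
		have "B t = V t"
			by (rule V_unique[OF order_trans[OF s t] s Bd disjI1[OF refl]]) (rule B_sol V_eq; assumption)+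
		thus ?thesis using BA[OF t] by simp
	qed
	show T_ge: "ereal s <= T" unfolding T by (rule Inf_greatest) auto
	have nn: "0 <= A u" if "s < u" "ereal u < T" for u
	proof (rule ccontr)
		assume "~ 0 <= A u"
		hence "T <= ereal u" unfolding T using that by (intro Inf_lower) auto
		thus False using that by simp
	qed
	show AV: "A t = V t" if "s <= t" "ereal t < T" for t
	proof (rule VA[OF that(1)])
		fix u assume u: "s < u" "u <= t"
		hence "ereal u < T" using le_less_trans[OF _ that(2), of "ereal u"] by simp
		thus "0 <= A u" using nn u by blast
	qed
	show "T = \<infinity> | (EX T'>=s. T = ereal T' & V T' = 0)"
	proof (cases T)
		case (real T')
		hence sT: "s <= T'" using T_ge by simp
		have "V T' = 0"
		proof (cases "0 <= A T'")
			case True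
			have "A T' = V T'"
			proof (rule VA[OF sT])
				fix u assume "s < u" "u <= T'"
				thus "0 <= A u" using nn[of u] True real by (cases "u = T'") auto
			qed
			moreover have "A T' <= 0"
			proof (rule field_le_epsilon)
				fix e :: real assume "e > 0"
				from dist_small_right[OF tame_right_cont[OF Bt cadlag _ dl, of T'] this] sT s
				obtain d where d: "d > 0" "!!y. T' < y ==> y < T' + d ==> \<bar>B y - B T'\<bar> < e" by auto
				have "T < ereal (T' + d)" using real d by simp
				then obtain t where t: "s < t" "A t < 0" "t < T' + d"
					unfolding T Inf_less_iff by auto
				have "T <= ereal t" unfolding T using t by (intro Inf_lower) auto
				hence "T' <= t" using real by simp
				hence "\<bar>A t - A T'\<bar> < e"
					using d(2)[of t] BA[of t] BA[of T'] t sT `e > 0` by (cases "t = T'") auto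
				thus "A T' <= 0 + e" using t by linarith
			qed
			ultimately show ?thesis using True by simp
		next
			\<comment> \<open>\<open>A\<close> jumps below \<open>0\<close> at \<open>T'\<close>; then
			  \<open>V\<close> is pushed at exactly this time and restarts from \<open>0\<close>.\<close>
			case False
			have "Z (above b V) u = Z h u" if "0 <= u" "u <= T'" for u
			proof -
				have "above b V ww = h ww" if "0 <= ww" "ww < u" for ww
					using AV[of ww] that `u <= T'` real by (cases "ww < s") (auto simp: h_def above_def)
				hence "occ (above b V) u = occ h u" by (intro occ_cong) auto
				thus ?thesis by simp
			qed
			hence VT: "V T' = refl {0..} (Z h) T'"
				unfolding V_eq[OF order_trans[OF s sT]] PP_unfold using sT s by (intro refl_cong) auto
			have VT0: "0 <= V T'" using V_nonneg sT s by simp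
			have AZ: "A u = Z h u - Z h s + V s" if "s <= u" for u using BA[OF that] B_Z[OF that] by simp
			have ne: "refl {0..} (Z h) T' - Z h T' ~= refl {0..} (Z h) s - Z h s"
				using VT VT0 False AZ[OF sT] V_le[of s] s by auto
			have gt: "refl {0..} (Z h) T' - Z h T' - (refl {0..} (Z h) s - Z h s) > 0"
				using refl_push[OF down_simps(1) s sT Z_bounded[OF hd]] ne by linarith
			have "V T' <= 0"
			proof (rule field_le_epsilon)
				fix e :: real assume "e > 0"
				define d where "d = min e (refl {0..} (Z h) T' - Z h T' - (refl {0..} (Z h) s - Z h s))"
				have d: "0 < d" "d <= e" "d <= refl {0..} (Z h) T' - Z h T' - (refl {0..} (Z h) s - Z h s)"
					using gt `e > 0` by (auto simp: d_def)
				obtain u where u: "s < u" "u <= T'" "- Z h u > refl {0..} (Z h) T' - Z h T' - d"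
					using refl_pushed[OF down_simps(1) s sT Z_bounded[OF hd] ne d(1)] .
				have "A u < 0" using u(1,3) AZ[of u] V_le[OF s order_refl] d(3) by linarith
				hence "u = T'" using nn[of u] u real by force
				thus "V T' <= 0 + e" using u(3)[unfolded `u = T'`] VT d(2) by linarith
			qed
			with VT0 show ?thesis by simp
		qed
		thus ?thesis using real sT by auto
	qed (use T_ge in auto)
qed


text \<open>With the refraction drift switched off after \<open>s\<close>, \<open>B\<close> is the
  path reflected from level \<open>0\<close> at time \<open>s\<close>, and it agrees with
  \<open>V\<close> until \<open>b\<close> is exceeded. As there are no positive jumps, the crossing
  happens at level \<open>b\<close> exactly. The existence of a refracted path from there is what
  the next execution of Step 1 needs.\<close>

lemma reflect_step:
	assumes s: "0 <= s" and Vs: "V s = 0"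
		and T: "T = Inf (ereal ` {t. ereal s < ereal t & reflected sh s t > b})"
	shows "ereal s <= T" "!!t. s <= t ==> ereal t < T ==> reflected sh s t = V t"
		"T = \<infinity> | (EX T'>s. T = ereal T' & V T' = b & (EX A. refracted_solution dl b sh T' b A))"
proof -
	define U where "U = reflected sh s"
	have U_def': "U t = xi t - xi s + max (SUP u\<in>{s..t}. - (xi u - xi s)) 0" for t
		by (simp add: U_def reflected_def)
	define h where "h u = indicat_real {..<s} u * above b V u" for u
	have "(%t. indicat_real {..<s} (max 0 t) * above b V (max 0 t)) \<in> borel_measurable borel"
		by (intro borel_measurable_times density01_measurable[OF V_density] borel_max0 borel_measurable_indicator) simp
	moreover have "ALL u>=0. 0 <= h u & h u <= 1" by (simp add: h_def above_def indicator_def)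
	ultimately have hd: "density01 h" unfolding density01_def h_def by (rule conjI)
	define B where "B = PP {0..} h"
	have Bt: "tame xi dl B" unfolding B_def by (rule PP_tame[OF hd]) simp
	have Bd: "density01 (above b B)" by (rule above_density[OF tame_borel[OF Bt cadlag dl]])
	have B_le: "B t = V t" if "0 <= t" "t <= s" for t
	proof -
		have "occ h u = occ (above b V) u" if "u <= t" for u
			using that `t <= s` by (intro occ_cong) (simp add: h_def)
		thus ?thesis unfolding V_eq[OF that(1)] B_def PP_unfold using that by (intro refl_cong) auto
	qed
	have Bs: "B s = 0" using B_le[of s] s Vs by simp
	have Zd: "Z h t - Z h u = xi t - xi u" if "s <= u" "u <= t" for u t
	proof -
		have "(LINT y:{u..<t}|lborel. h y) = (LINT y:{u..<t}|lborel. 0)"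
			using that by (intro set_lebesgue_integral_cong) (auto simp: h_def)
		thus ?thesis using occ_diff[OF hd _ that(2)] s that by simp
	qed
	have BU: "B t = U t" if t: "s <= t" for t
	proof (rule antisym)
		obtain C where C: "ALL u:{0..t}. \<bar>xi u\<bar> <= C" using cadlag_bounded[OF cadlag] by blast
		have bdd: "bdd_above ((%u. - (xi u - xi s)) ` {s..t})"
		proof (rule bdd_aboveI2)
			fix u assume "u \<in> {s..t}"
			hence "\<bar>xi u\<bar> <= C" using C s by auto
			thus "- (xi u - xi s) <= C + xi s" by linarith
		qed
		show "B t <= U t"
		proof (cases "refl {0..} (Z h) t - Z h t = refl {0..} (Z h) s - Z h s")
			case True
			hence "B t = xi t - xi s"
				using Zd[OF order_refl t] Bs unfolding B_def PP_unfold by linarith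
			thus ?thesis by (simp add: U_def')
		next
			case False
			have "refl {0..} (Z h) t <= U t"
			proof (rule refl_pushed_le[OF _ s t Z_bounded[OF hd] False])
				fix u assume u: "s <= u" "u <= t"
				hence "- (xi u - xi s) <= (SUP u\<in>{s..t}. - (xi u - xi s))" by (intro cSUP_upper bdd) auto
				thus "Z h t - Z h u <= U t" unfolding Zd[OF u] U_def' by linarith
			qed simp
			thus ?thesis by (simp add: B_def PP_unfold)
		qed
		have "xi t - xi s <= B t"
			using refl_push[OF _ s t Z_bounded[OF hd], of "{0..}"] Zd[OF order_refl t] Bs by (simp add: B_def PP_unfold)
		moreover have "(SUP u\<in>{s..t}. - (xi u - xi s)) <= B t - (xi t - xi s)"
		proof (rule cSUP_least)
			fix u assume u: "u \<in> {s..t}"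
			hence "Z h t - Z h u <= B t"
				unfolding B_def PP_unfold using s t by (intro refl_ge_diff Z_bounded[OF hd]) auto
			thus "- (xi u - xi s) <= B t - (xi t - xi s)" using Zd[of u t] u unfolding atLeastAtMost_iff by linarith
		qed (use t in auto)
		ultimately show "U t <= B t" by (simp add: U_def')
	qed
	have VB: "V t = B t" if t: "s <= t" and le: "!!u. s <= u ==> u < t ==> B u <= b" for t
	proof -
		have "B t' = PP {0..} (above b B) t'" if t': "0 <= t'" "t' <= t" for t'
		proof -
			have "occ h ww = occ (above b B) ww" if "ww <= t'" for ww
			proof (rule occ_cong)
				fix u assume u: "0 <= u" "u < ww"
				show "h u = above b B u"
				proof (cases "u < s")
					case True
					thus ?thesis using B_le[of u] u by (simp add: h_def above_def)
				next
					case False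
					hence "B u <= b" using u that t' by (intro le) auto
					thus ?thesis using False by (simp add: h_def above_def)
				qed
			qed
			thus ?thesis unfolding B_def PP_unfold using t' by (intro refl_cong) (auto simp: B_def)
		qed
		hence "B t = V t"
			by (intro V_unique[OF order_trans[OF s t] s Bd disjI1[OF refl]] V_eq)
		thus ?thesis by simp
	qed
	show T_ge: "ereal s <= T" unfolding T by (rule Inf_greatest) auto
	have Ble: "B u <= b" if "s <= u" "ereal u < T" for u
	proof (cases "u = s")
		case True
		thus ?thesis using Bs b by simp
	next
		case False
		show ?thesis
		proof (rule ccontr)
			assume "~ B u <= b"
			hence "b < reflected sh s u" using BU[OF that(1)] by (simp add: U_def)
			hence "T <= ereal u" unfolding T using that False by (intro Inf_lower) auto
			thus False using that by simp
		qed
	qed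
	show "reflected sh s t = V t" if "s <= t" "ereal t < T" for t
	proof -
		have "V t = B t"
		proof (rule VB[OF that(1)])
			fix u assume u: "s <= u" "u < t"
			hence "ereal u < T" using less_trans[OF _ that(2), of "ereal u"] by simp
			thus "B u <= b" using Ble u by blast
		qed
		thus ?thesis using BU[OF that(1)] by (simp add: U_def)
	qed
	show "T = \<infinity> | (EX T'>s. T = ereal T' & V T' = b & (EX A. refracted_solution dl b sh T' b A))"
	proof (cases T)
		case (real T')
		hence sT: "s <= T'" using T_ge by simp
		hence T0: "0 <= T'" using s by simp
		have VT: "V T' = B T'" using Ble real by (intro VB[OF sT]) auto
		have ge: "b <= B T'"
		proof (rule field_le_epsilon)
			fix e :: real assume "e > 0"
			from dist_small_right[OF tame_right_cont[OF Bt cadlag T0 dl] this]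
			obtain d where d: "d > 0" "!!y. T' < y ==> y < T' + d ==> \<bar>B y - B T'\<bar> < e" by blast
			have "T < ereal (T' + d)" using real d by simp
			then obtain t where t: "s < t" "b < reflected sh s t" "t < T' + d"
				unfolding T Inf_less_iff by auto
			have "T <= ereal t" unfolding T using t by (intro Inf_lower) auto
			hence "T' <= t" using real by simp
			hence "\<bar>B t - B T'\<bar> < e" using d(2)[of t] t(3) `e > 0` by (cases "t = T'") auto
			moreover have "b < B t" using BU[of t] t by (simp add: U_def)
			ultimately show "b <= B T' + e" by linarith
		qed
		hence sT': "s < T'" using sT Bs b by (cases "s = T'") auto
		have near: "EX d>0. ALL u. s <= u --> T' - d < u --> u <= T' --> V T' - V u <= e" if e: "e > 0" for e
		proof -
			obtain d where d: "d > 0"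
				"ALL s t. 0 <= s --> s <= t --> \<bar>s - T'\<bar> < d --> \<bar>t - T'\<bar> < d --> xi t - xi s < e"
				using good_path_local[OF good T0 e] by (elim exE conjE)
			have "V T' - V u <= e" if "s <= u" "T' - d < u" "u <= T'" for u
			proof (rule tame_upper[OF V_tame _ that(3)])
				fix y assume "u <= y" "y <= T'"
				hence "xi T' - xi y < e" using that s d(1) by (intro d(2)[rule_format]) linarith+
				thus "xi T' - xi y <= e" by simp
			qed (use s that in simp)
			thus ?thesis using d(1) by (intro exI[of _ d]) simp
		qed
		have "V T' <= b"
		proof (rule field_le_epsilon)
			fix e :: real assume "e > 0"
			obtain d where d: "d > 0" "ALL u. s <= u --> T' - d < u --> u <= T' --> V T' - V u <= e"
				using near[OF `e > 0`] by (elim exE conjE)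
			define u where "u = max s (T' - d / 2)"
			have u: "s <= u" "T' - d < u" "u < T'" unfolding u_def using d(1) sT' by linarith+
			have "V u = B u"
			proof (rule VB[OF u(1)])
				fix y assume "s <= y" "y < u"
				thus "B y <= b" using Ble[of y] u(3) real by simp
			qed
			moreover have "B u <= b" by (rule Ble) (use u real in simp_all)
			moreover have "V T' - V u <= e" using u by (intro d(2)[rule_format]) linarith+
			ultimately show "V T' <= b + e" by linarith
		qed
		with ge VT have Vb: "V T' = b" by linarith
		\<comment> \<open>Shortly before \<open>T'\<close> the process is at least \<open>b / 2\<close>,
		  hence not pushed. For a horizon \<open>r\<close> in that period, unrestricted reflection and
		  reflection until \<open>r\<close> agree up to \<open>T'\<close>, so the limit with horizon
		  \<open>r\<close> has the value \<open>b\<close> there and continues as a refracted path.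
		  \<open>r\<close> is rational because only countably many null sets can be discarded.\<close>
		obtain d where d: "d > 0" "ALL u. s <= u --> T' - d < u --> u <= T' --> V T' - V u <= b / 2"
			using near[OF half_gt_zero[OF b]] by (elim exE conjE)
		define ww where "ww = max s (T' - d)"
		have ww: "s <= ww" "T' - d <= ww" "ww < T'" using sT' d(1) by (simp_all add: ww_def)
		obtain r where r: "r \<in> \<rat>" "ww < r" "r < T'"
			using Rats_dense_in_real[OF ww(3)] by blast
		have r0: "0 <= r" using r(2) ww(1) s by linarith
		have pos: "b / 2 <= V u" if "r <= u" "u <= T'" for u
		proof -
			have "V T' - V u <= b / 2" using that r(2) ww by (intro d(2)[rule_format]) linarith+
			thus ?thesis using Vb by linarith
		qed
		let ?A = "limV {0..r} xi (max x 0) dl b"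
		note A = refracted_solution_horizon[OF r(1) r0]
		have "V t = PP {0..r} (above b V) t" if t: "0 <= t" "t <= T'" for t
		proof (cases "t <= r")
			case True
			thus ?thesis using V_eq[OF t(1)] refl_horizon(1)[OF r0] by (simp add: PP_unfold)
		next
			case False
			hence rt: "r <= t" by simp
			let ?z = "Z (above b V)"
			have Vz: "V u = refl {0..} ?z u" if "0 <= u" for u using V_eq[OF that] by (simp add: PP_unfold)
			have "refl {0..} ?z t - ?z t = refl {0..} ?z r - ?z r"
			proof (rule ccontr)
				assume ne: "~ ?thesis"
				have b2: "b / 2 > 0" using b by simp
				obtain u where u: "r < u" "u <= t" "- ?z u > refl {0..} ?z t - ?z t - b / 2"
					using refl_pushed[OF down_simps(1) r0 rt Z_bounded[OF V_density] ne b2] .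
				have u0: "0 <= u" using u r0 by simp
				have "?z t - ?z u <= refl {0..} ?z t - refl {0..} ?z u"
					using refl_push[OF down_simps(1) u0 u(2) Z_bounded[OF V_density]] .
				hence "V u < b / 2" using u(3) Vz[OF u0] by linarith
				thus False using pos[of u] u t by simp
			qed
			thus ?thesis
				using refl_horizon(2)[OF r0 rt, of ?z] Vz[OF t(1)] by (simp add: PP_unfold)
		qed
		hence "?A T' = V T'"
			by (intro V_unique[OF T0 r0 A(3)[OF less_imp_le[OF r(3)]] disjI2[OF refl]] A(2)[OF less_imp_le[OF r(3)]])
		hence "refracted_solution dl b sh T' b ?A" using A(1)[of T'] r Vb by simp
		thus ?thesis using real sT' Vb by blast
	qed (use T_ge in auto)
qed

section \<open>Identification of the Euler limit with the staged construction\<close>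

abbreviation "stg \<equiv> stages dl b sh"

text \<open>The existence clause is what makes the choice in \<open>refracted\<close> yield a
  solution.\<close>

primrec stage_inv :: "stage => bool" where
	"stage_inv (Refract ta y) \<longleftrightarrow> ta = \<infinity> | 
		(EX s>=0. ta = ereal s & V s = y & (EX A. refracted_solution dl b sh s y A))"
| "stage_inv (Reflect ta) \<longleftrightarrow> ta = \<infinity> | (EX s>=0. ta = ereal s & V s = 0)"

lemma stage_step:
	assumes "stage_inv st"
	shows "stage_inv (next_stage dl b sh st)" (is ?A)
		"start_time st <= start_time (next_stage dl b sh st)" (is ?B)
		"!!t. start_time st <= ereal t ==> ereal t < start_time (next_stage dl b sh st) ==>
			stage_path dl b sh st t = V t" (is "!!t. ?C t ==> ?D t ==> ?E t")
proof -
	have "?A & ?B & (ALL t. ?C t --> ?D t --> ?E t)"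
	proof (cases st)
		case (Refract ta y)
		show ?thesis
		proof (cases "ta = \<infinity>")
			case True
			thus ?thesis using Refract by (simp add: top_ereal_def)
		next
			case False
			then obtain s A where s: "0 <= s" "ta = ereal s" "V s = y" "refracted_solution dl b sh s (V s) A"
				using assms Refract by auto
			have "refracted_solution dl b sh s (V s) (refracted dl b sh s (V s))"
				unfolding refracted_def by (rule someI[of "refracted_solution dl b sh s (V s)"]) (rule s(4))
			from refract_step[OF s(1) this refl] show ?thesis using s(1-3) Refract by fastforce
		qed
	next
		case (Reflect ta)
		show ?thesis
		proof (cases "ta = \<infinity>")
			case True
			thus ?thesis using Reflect by (simp add: top_ereal_def)
		next
			case False
			then obtain s where s: "0 <= s" "ta = ereal s" "V s = 0"
				using assms Reflect by auto
			from reflect_step[OF s(1,3) refl] show ?thesis using s Reflect by fastforce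
		qed
	qed
	thus ?A ?B "!!t. ?C t ==> ?D t ==> ?E t" by auto
qed

lemma V_0: "V 0 = max x 0"
proof -
	have "{0..} \<inter> {0..0::real} = {0}" by auto
	thus ?thesis using V_eq[of 0] by (simp add: PP_unfold refl_def xi0)
qed

lemma stage_inv_all: "stage_inv (stg n)"
proof (induction n)
	case 0
	have "refracted_solution dl b sh 0 (limV {0..0} xi (max x 0) dl b 0) (limV {0..0} xi (max x 0) dl b)"
		by (rule refracted_solution_horizon) auto
	moreover have "limV {0..0} xi (max x 0) dl b 0 = max x 0"
		using refracted_solution_horizon(2)[of 0 0 0] by (simp add: PP_unfold refl_def xi0)
	ultimately show ?case using V_0 xi0 by auto
next
	case (Suc n)
	thus ?case using stage_step(1) by simp
qed

lemma start_0: "start_time (stg 0) = 0" by simp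

lemma start_mono: "m <= n ==> start_time (stg m) <= start_time (stg n)"
	by (rule lift_Suc_mono_le) (use stage_step(2)[OF stage_inv_all] in auto)

text \<open>A reflecting stage climbs from \<open>0\<close> to \<open>b\<close>, which takes at
  least the time \<open>d\<close> allotted to climbs of \<open>b / 2\<close>. Every second stage
  reflects, so any two consecutive stages last at least \<open>d\<close> together.\<close>

lemma start_exceeds: "EX n. ereal t < start_time (stg n)"
proof (rule ccontr)
	assume "~ ?thesis"
	hence le: "start_time (stg n) <= ereal t" for n by (simp add: not_less)
	have t0: "0 <= t" using le[of 0] start_0 by simp
	define s where "s n = real_of_ereal (start_time (stg n))" for n
	have s: "start_time (stg n) = ereal (s n)" "0 <= s n" "s n <= t" for n
	proof -
		have "0 <= start_time (stg n)" using start_mono[of 0 n] start_0 by simp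
		thus "start_time (stg n) = ereal (s n)" "0 <= s n" "s n <= t"
			using le[of n] unfolding s_def by (cases "start_time (stg n)"; simp)+
	qed
	obtain d where d: "d > 0" "ALL u v. 0 <= u --> u <= t --> u <= v --> v < u + d --> xi v - xi u < b / 2"
		using good_path_up_modulus[OF good, of "b/2" t] b t0 by auto
	have gap: "s n + d <= s (Suc n)" if n: "stg n = Reflect ta" for n ta
	proof (rule ccontr)
		assume "~ ?thesis"
		hence lt: "s (Suc n) < s n + d" by simp
		have V0: "V (s n) = 0" using stage_inv_all[of n] s(1)[of n] n by auto
		have sm: "s n <= s (Suc n)" using start_mono[of n "Suc n"] s(1)[of n] s(1)[of "Suc n"] by simp
		obtain T where T: "stg (Suc n) = Refract T b" using n by simp
		have "T = ereal (s (Suc n))" using s(1)[of "Suc n"] unfolding T by simp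
		hence Vb: "V (s (Suc n)) = b" using stage_inv_all[of "Suc n"] unfolding T by auto
		have "V (s (Suc n)) - V (s n) <= b / 2"
		proof (rule tame_upper[OF V_tame s(2) sm])
			fix u assume u: "s n <= u" "u <= s (Suc n)"
			have "xi (s (Suc n)) - xi u < b / 2"
				using u lt s(2)[of n] s(3)[of "Suc n"] by (intro d(2)[rule_format]) auto
			thus "xi (s (Suc n)) - xi u <= b / 2" by simp
		qed
		thus False using V0 Vb b by simp
	qed
	have step: "s n + d <= s (Suc (Suc n))" for n
	proof -
		have m: "s n <= s (Suc n)" "s (Suc n) <= s (Suc (Suc n))"
			using start_mono[of n "Suc n"] start_mono[of "Suc n" "Suc (Suc n)"] s(1)[of n] s(1)[of "Suc n"] s(1)[of "Suc (Suc n)"]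
			by (metis ereal_less_eq(3) le_SucI order_refl)+
		show ?thesis
		proof (cases "stg n")
			case (Reflect ta)
			thus ?thesis using gap[OF Reflect] m by simp
		next
			case (Refract ta y)
			then obtain ta' where "stg (Suc n) = Reflect ta'" by simp
			thus ?thesis using gap[of "Suc n"] m by fastforce
		qed
	qed
	have "real n * d <= s (2 * n)" for n
	proof (induction n)
		case 0
		thus ?case using s(2) by simp
	next
		case (Suc n)
		thus ?case using step[of "2 * n"] by (simp add: algebra_simps)
	qed
	moreover obtain n where "t < real n * d" using d(1) reals_Archimedean3 by blast
	ultimately show False using s(3) by (meson leD order_trans)
qed

lemma refracted_reflected_eq:
	assumes "0 <= t"
	shows "refracted_reflected dl b sh t = V t"
proof -
	define S where "S n = start_time (stg n)" for n
	define m where "m = (LEAST n. ereal t < S n)"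
	have "EX n. ereal t < S n" unfolding S_def by (rule start_exceeds)
	hence m: "ereal t < S m" unfolding m_def by (rule LeastI_ex)
	have "S 0 <= ereal t" using start_0 assms by (simp only: S_def) simp
	hence "m ~= 0" using m by (metis not_le)
	then obtain n where n: "m = Suc n" using not0_implies_Suc by blast
	have "~ ereal t < S n" using n not_less_Least[of n "%n. ereal t < S n"] unfolding m_def by simp
	hence Pn: "S n <= ereal t & ereal t < S (Suc n)" using m n by (simp add: not_less)
	have mono: "S i <= S j" if "i <= j" for i j unfolding S_def by (rule start_mono[OF that])
	have uniq: "k = n" if k: "S k <= ereal t & ereal t < S (Suc k)" for k
	proof (rule ccontr)
		assume "k ~= n"
		then consider "Suc k <= n" | "Suc n <= k" by linarith
		thus False
		proof cases
			case 1
			thus False using mono[OF 1] Pn k by (metis leD order_trans)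
		next
			case 2
			thus False using mono[OF 2] Pn k by (metis leD order_trans)
		qed
	qed
	have "(THE n. S n <= ereal t & ereal t < S (Suc n)) = n"
		by (rule the_equality) (rule Pn, rule uniq)
	hence "refracted_reflected dl b sh t = stage_path dl b sh (stg n) t"
		unfolding refracted_reflected_def S_def by (simp only:)
	also have "... = V t"
		by (rule stage_step(3)[OF stage_inv_all])
			(use Pn in "simp_all only: S_def stages.simps simp_thms")
	finally show ?thesis .
qed

end

section \<open>Independent increments\<close>

text \<open>Independence of finitely many variables is a property of their joint law, and changes on
  null sets do not affect the law.\<close>

lemma (in prob_space) indep_vars_cong_AE:
	assumes X: "indep_vars N X I" and I: "finite I"
		and rv: "!!i. i \<in> I ==> random_variable (N i) (Y i)"
		and eq: "!!i. i \<in> I ==> AE w in M. X i w = Y i w"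
	shows "indep_vars N Y I"
proof (cases "I = {}")
	case True
	thus ?thesis by (simp add: indep_vars_def indep_sets_def)
next
	case False
	have rvX: "random_variable (N i) (X i)" if "i \<in> I" for i using X that by (auto simp: indep_vars_def)
	have "AE w in M. ALL i:I. X i w = Y i w" using I eq by (intro AE_finite_allI) auto
	hence "AE w in M. (\<lambda>i\<in>I. X i w) = (\<lambda>i\<in>I. Y i w)" by eventually_elim (auto simp: fun_eq_iff)
	hence "distr M (PiM I N) (%w. \<lambda>i\<in>I. Y i w) = distr M (PiM I N) (%w. \<lambda>i\<in>I. X i w)"
		using rv rvX by (intro distr_cong_AE measurable_restrict) (auto elim: eventually_mono)
	also have "... = PiM I (%i. distr M (N i) (X i))"
		using indep_vars_iff_distr_eq_PiM'[OF False rvX] X by simp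
	also have "... = PiM I (%i. distr M (N i) (Y i))"
		by (intro PiM_cong distr_cong_AE refl rv rvX eq)
	finally show ?thesis using indep_vars_iff_distr_eq_PiM'[OF False rv] by simp
qed

locale good_levy = prob_space M for M :: "'a measure" +
	fixes X :: "real => 'a => real"
	assumes X_meas [measurable]: "X t \<in> borel_measurable M"
		and good: "good_path (%t. X t w)"
		and indep: "0 <= u 0 ==> mono u ==>
			indep_vars (%_. borel) (%i w. X (u (Suc i)) w - X (u i) w) {..<n::nat}"
		and stat: "0 <= s ==> s <= t' ==> distr M borel (%w. X t' w - X s w) = distr M borel (X (t' - s))"

text \<open>On a null set and at negative times the path is replaced by \<open>0\<close>, which is a
  good path. From then on pathwise arguments hold everywhere and the uncompleted filtration
  \<open>F\<close> can be used.\<close>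

lemma spectrally_negative_modification:
	assumes X: "spectrally_negative M X"
	obtains X' where "good_levy M X'" "AE w in M. ALL t>=0. X t w = X' t w"
proof -
	have levy: "levy_process M X" using X by (simp add: spectrally_negative_def)
	then interpret prob_space M by (simp add: levy_process_def)
	have Xm: "X t \<in> borel_measurable M" if "0 <= t" for t using levy that by (simp add: levy_process_def)
	have "AE w in M. X 0 w = 0 & cadlag (%t. X t w) &
			(ALL t>0. ALL l. ((%s. X s w) \<longlongrightarrow> l) (at_left t) --> X t w <= l)"
		using X by (simp add: spectrally_negative_def levy_process_def)
	hence "AE w in M. good_path (%t. X t w)" by (rule eventually_mono) (auto simp: good_path_def)
	then obtain N where N: "{w \<in> space M. ~ good_path (%t. X t w)} <= N" "emeasure M N = 0" "N \<in> sets M"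
		by (rule AE_E)
	define X' where "X' t w = (if w \<in> space M - N & 0 <= t then X t w else 0)" for t w
	have AE_N: "AE w in M. w \<notin> N" using N by (intro AE_not_in) (auto simp: null_sets_def)
	have eq: "AE w in M. ALL t>=0. X t w = X' t w"
		using AE_N AE_space by eventually_elim (simp add: X'_def)
	have X'm: "X' t \<in> borel_measurable M" for t
	proof (cases "0 <= t")
		case True
		note [measurable] = Xm[OF True] N(3)
		have "(%w. if w \<in> space M - N then X t w else 0) \<in> borel_measurable M" by measurable
		thus ?thesis using True by (simp add: X'_def[abs_def])
	qed (simp add: X'_def[abs_def])
	have good0: "good_path (%t. 0)" by (auto simp: good_path_def cadlag_def intro!: exI[of _ 0] dest: tendsto_unique[OF _ tendsto_const, rotated])
	have "good_path (%t. X' t w)" for w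
	proof (cases "w \<in> space M - N")
		case False
		hence "(%t. X' t w) = (%t. 0)" by (auto simp: X'_def)
		thus ?thesis using good0 by simp
	next
		case True
		hence g: "good_path (%t. X t w)" using N(1) by auto
		have same: "X' t w = X t w" if "0 <= t" for t using True that by (simp add: X'_def)
		have R: "((%s. X' s w) \<longlongrightarrow> l) (at_right t) \<longleftrightarrow> ((%s. X s w) \<longlongrightarrow> l) (at_right t)" if "0 <= t" for t l
			using that by (intro filterlim_cong refl) (auto simp: eventually_at_right_field same intro!: exI[of _ "t + 1"])
		have L: "((%s. X' s w) \<longlongrightarrow> l) (at_left t) \<longleftrightarrow> ((%s. X s w) \<longlongrightarrow> l) (at_left t)" if "0 < t" for t l
			using that by (intro filterlim_cong refl) (auto simp: eventually_at_left_field same intro!: exI[of _ 0])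
		show ?thesis using g unfolding good_path_def cadlag_def by (simp add: same R L)
	qed
	moreover have "indep_vars (%_. borel) (%i w. X' (t (Suc i)) w - X' (t i) w) {..<n}"
		if t: "0 <= t 0" "mono t" for t :: "nat => real" and n
	proof (rule indep_vars_cong_AE)
		show "indep_vars (%_. borel) (%i w. X (t (Suc i)) w - X (t i) w) {..<n}"
			using levy t by (simp add: levy_process_def)
		have "0 <= t i" for i using t by (meson monoD order_trans zero_le)
		thus "AE w in M. X (t (Suc i)) w - X (t i) w = X' (t (Suc i)) w - X' (t i) w" for i
			using eq by (auto elim!: eventually_mono)
		show "random_variable borel (%w. X' (t (Suc i)) w - X' (t i) w)" for i
			using X'm by (intro borel_measurable_diff)
	qed simp
	moreover have "distr M borel (%w. X' t w - X' s w) = distr M borel (X' (t - s))" if "0 <= s" "s <= t" for s t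
	proof -
		have "distr M borel (%w. X' t w - X' s w) = distr M borel (%w. X t w - X s w)"
			using that eq X'm Xm by (intro distr_cong_AE borel_measurable_diff) (auto elim!: eventually_mono)
		also have "... = distr M borel (X (t - s))" using levy that by (simp add: levy_process_def)
		also have "... = distr M borel (X' (t - s))"
			using that eq X'm Xm by (intro distr_cong_AE) (auto elim!: eventually_mono)
		finally show ?thesis .
	qed
	ultimately have "good_levy M X'" using X'm by unfold_locales auto
	with that eq show ?thesis by blast
qed

context good_levy
begin

lemma X_cadlag: "cadlag (%t. X t w)" and X_0 [simp]: "X 0 w = 0"
	using good[of w] by (auto simp: good_path_def)

section \<open>The past and the future of a fixed time\<close>

definition F :: "real => 'a measure" where
	"F t = sigma (space M) {X s -` A \<inter> space M | s A. 0 <= s & s <= t & A \<in> sets borel}"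

definition G :: "real => 'a measure" where
	"G t = sigma (space M) {(%w. X s w - X t w) -` A \<inter> space M | s A. t <= s & A \<in> sets borel}"

lemma space_F [simp]: "space (F t) = space M" and space_G [simp]: "space (G t) = space M"
	by (simp_all add: F_def G_def space_measure_of_conv)

lemma F_gen: "{X s -` A \<inter> space M | s A. 0 <= s & s <= t & A \<in> sets borel} <= Pow (space M)" by auto

lemma G_gen: "{(%w. X s w - X t w) -` A \<inter> space M | s A. t <= s & A \<in> sets borel} <= Pow (space M)" by auto

lemma X_F: "0 <= s ==> s <= t ==> X s \<in> borel_measurable (F t)"
proof (rule measurableI)
	fix A :: "real set" assume "A \<in> sets borel" "0 <= s" "s <= t"
	thus "X s -` A \<inter> space (F t) \<in> sets (F t)"
		unfolding space_F unfolding F_def sets_measure_of[OF F_gen] by (intro sigma_sets.Basic) blast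
qed simp

lemma X_G: "t <= s ==> (%w. X s w - X t w) \<in> borel_measurable (G t)"
proof (rule measurableI)
	fix A :: "real set" assume "A \<in> sets borel" "t <= s"
	thus "(%w. X s w - X t w) -` A \<inter> space (G t) \<in> sets (G t)"
		unfolding space_G unfolding G_def sets_measure_of[OF G_gen] by (intro sigma_sets.Basic) blast
qed simp

lemma X_G_diff:
	assumes "t <= s" "t <= u"
	shows "(%w. X s w - X u w) \<in> borel_measurable (G t)"
proof -
	have "(%w. (X s w - X t w) - (X u w - X t w)) \<in> borel_measurable (G t)"
		by (intro borel_measurable_diff X_G assms)
	thus ?thesis by simp
qed

lemma F_mono: "s <= t ==> sets (F s) <= sets (F t)"
	unfolding F_def sets_measure_of[OF F_gen] by (intro sigma_sets_mono') (auto intro: order_trans)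

lemma measurable_F_mono: "f \<in> measurable (F s) N ==> s <= t ==> f \<in> measurable (F t) N"
	using F_mono[of s t] by (auto simp: measurable_def)

lemma F_sub: "sets (F t) <= sets M"
	unfolding F_def sets_measure_of[OF F_gen] by (intro sets.sigma_sets_subset) auto

lemma G_sub: "sets (G t) <= sets M"
	unfolding G_def sets_measure_of[OF G_gen] by (intro sets.sigma_sets_subset) auto

lemma measurable_F: "f \<in> measurable (F t) N ==> f \<in> measurable M N"
	using F_sub by (auto simp: measurable_def)

lemma measurable_G: "f \<in> measurable (G t) N ==> f \<in> measurable M N"
	using G_sub by (auto simp: measurable_def)

text \<open>All times are sorted together with \<open>0\<close> and \<open>t\<close>. The first
  event depends on the increments before the index of \<open>t\<close>, the second on those after
  it, and these are disjoint blocks of independent variables.\<close>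

lemma indep_finite_dim:
	assumes J: "finite J" "J <= {0..t}" and J': "finite J'" "J' <= {t..}" and t: "0 <= t"
		and A: "!!s. A s \<in> sets borel" and B: "!!s. B s \<in> sets borel"
	shows "prob ({w\<in>space M. ALL s:J. X s w \<in> A s} \<inter> {w\<in>space M. ALL s:J'. X s w - X t w \<in> B s}) =
		prob {w\<in>space M. ALL s:J. X s w \<in> A s} * prob {w\<in>space M. ALL s:J'. X s w - X t w \<in> B s}"
proof -
	define S where "S = insert 0 (insert t (J \<union> J'))"
	define L where "L = sorted_list_of_set S"
	have S: "finite S" using J J' by (simp add: S_def)
	have L: "set L = S" "sorted L" using S unfolding L_def by simp_all
	hence "L ~= []" by (auto simp: S_def)
	define n where "n = length L - 1"
	define u where "u i = L ! min i n" for i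
	have len: "length L = Suc n" using `L ~= []` by (cases L) (auto simp: n_def)
	have mono: "mono u" unfolding u_def mono_def using L(2) len by (auto intro!: sorted_nth_mono)
	have uS: "u i \<in> S" for i using len L(1) by (metis u_def nth_mem less_Suc_eq_le min.cobounded2)
	have S0: "0 <= s" if "s \<in> S" for s using that J J' t by (auto simp: S_def)
	have ex: "EX i<=n. u i = s" if s: "s \<in> S" for s
	proof -
		obtain i where "i < length L" "L ! i = s" using s L(1) by (metis in_set_conv_nth)
		thus ?thesis using len by (intro exI[of _ i]) (auto simp: u_def)
	qed
	have u0: "u 0 = 0"
	proof -
		obtain i where "u i = 0" using ex[of 0] by (auto simp: S_def)
		hence "u 0 <= 0" using monoD[OF mono, of 0 i] by simp
		thus ?thesis using S0[OF uS[of 0]] by simp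
	qed
	obtain k where k: "k <= n" "u k = t" using ex[of t] by (auto simp: S_def)
	define D where "D i w = X (u (Suc i)) w - X (u i) w" for i w
	have tele: "(\<Sum>i\<in>{a..<b}. D i w) = X (u b) w - X (u a) w" if "a <= b" for a b w
		unfolding D_def using sum_Suc_diff'[OF that, of "%i. X (u i) w"] by simp
	have "EX j. j <= k & u j = s" if "s \<in> J" for s
	proof -
		obtain i where i: "i <= n" "u i = s" using ex[of s] `s \<in> J` by (auto simp: S_def)
		show ?thesis
		proof (cases "i <= k")
			case False
			hence "u k <= u i" using monoD[OF mono, of k i] by simp
			hence "s = t" using i k J `s \<in> J` by auto
			thus ?thesis using k by blast
		qed (use i in blast)
	qed
	then obtain j where j: "!!s. s \<in> J ==> j s <= k & u (j s) = s" by metis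
	have "EX j. k <= j & j <= n & u j = s" if "s \<in> J'" for s
	proof -
		obtain i where i: "i <= n" "u i = s" using ex[of s] `s \<in> J'` by (auto simp: S_def)
		show ?thesis
		proof (cases "k <= i")
			case False
			hence "u i <= u k" using monoD[OF mono, of i k] by simp
			hence "s = t" using i k J' `s \<in> J'` by auto
			thus ?thesis using k by blast
		qed (use i in blast)
	qed
	then obtain j' where j': "!!s. s \<in> J' ==> k <= j' s & j' s <= n & u (j' s) = s" by metis
	have "0 <= u 0" using u0 by simp
	from indep[OF this mono, of n] have iv: "indep_vars (%_. borel) D {..<n}" by (simp add: D_def[abs_def])
	let ?P = "PiM {..<k} (%_. borel :: real measure)" and ?Q = "PiM {k..<n} (%_. borel :: real measure)"
	have ind: "indep_var ?P (%w. restrict (%i. D i w) {..<k}) ?Q (%w. restrict (%i. D i w) {k..<n})"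
		using k by (intro indep_var_restrict[OF iv]) auto
	define SA where "SA = {f \<in> space ?P. ALL s:J. (\<Sum>i\<in>{0..<j s}. f i) \<in> A s}"
	define SB where "SB = {f \<in> space ?Q. ALL s:J'. (\<Sum>i\<in>{k..<j' s}. f i) \<in> B s}"
	have SA: "SA \<in> sets ?P"
		unfolding SA_def
	proof (rule sets.sets_Collect_finite_All[OF _ J(1)])
		fix s assume "s \<in> J"
		hence "(%f. \<Sum>i\<in>{0..<j s}. f i) \<in> borel_measurable ?P"
			using j[of s] by (intro borel_measurable_sum measurable_component_singleton) auto
		from measurable_sets[OF this A[of s]] show "{f \<in> space ?P. (\<Sum>i\<in>{0..<j s}. f i) \<in> A s} \<in> sets ?P"
			by (simp add: vimage_def Int_def conj_commute)
	qed
	have SB: "SB \<in> sets ?Q"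
		unfolding SB_def
	proof (rule sets.sets_Collect_finite_All[OF _ J'(1)])
		fix s assume "s \<in> J'"
		hence "(%f. \<Sum>i\<in>{k..<j' s}. f i) \<in> borel_measurable ?Q"
			using j'[of s] by (intro borel_measurable_sum measurable_component_singleton) auto
		from measurable_sets[OF this B[of s]] show "{f \<in> space ?Q. (\<Sum>i\<in>{k..<j' s}. f i) \<in> B s} \<in> sets ?Q"
			by (simp add: vimage_def Int_def conj_commute)
	qed
	have eqA: "(%w. restrict (%i. D i w) {..<k}) -` SA \<inter> space M = {w\<in>space M. ALL s:J. X s w \<in> A s}"
	proof -
		have "(\<Sum>i\<in>{0..<j s}. restrict (%i. D i w) {..<k} i) = X s w" if "s \<in> J" for s w
		proof -
			have "(\<Sum>i\<in>{0..<j s}. restrict (%i. D i w) {..<k} i) = (\<Sum>i\<in>{0..<j s}. D i w)"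
				using j[OF that] by (intro sum.cong) auto
			thus ?thesis using tele[of 0 "j s" w] j[OF that] u0 by simp
		qed
		thus ?thesis by (auto simp: SA_def space_PiM)
	qed
	have eqB: "(%w. restrict (%i. D i w) {k..<n}) -` SB \<inter> space M = {w\<in>space M. ALL s:J'. X s w - X t w \<in> B s}"
	proof -
		have "(\<Sum>i\<in>{k..<j' s}. restrict (%i. D i w) {k..<n} i) = X s w - X t w" if "s \<in> J'" for s w
		proof -
			have "(\<Sum>i\<in>{k..<j' s}. restrict (%i. D i w) {k..<n} i) = (\<Sum>i\<in>{k..<j' s}. D i w)"
				using j'[OF that] by (intro sum.cong) auto
			thus ?thesis using tele[of k "j' s" w] j'[OF that] k by simp
		qed
		thus ?thesis by (auto simp: SB_def space_PiM)
	qed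
	have "(%w. (restrict (%i. D i w) {..<k}, restrict (%i. D i w) {k..<n})) -` (SA \<times> SB) \<inter> space M =
		((%w. restrict (%i. D i w) {..<k}) -` SA \<inter> space M) \<inter> ((%w. restrict (%i. D i w) {k..<n}) -` SB \<inter> space M)"
		by auto
	thus ?thesis using indep_varD[OF ind SA SB] unfolding eqA eqB by simp
qed

lemma indep_set_mono: "indep_set A B ==> A' <= A ==> B' <= B ==> indep_set A' B'"
	unfolding indep_set_def by (erule indep_sets_mono_sets) (auto split: bool.split)

lemma indep_FG_set:
	assumes t: "0 <= t"
	shows "indep_set (sets (F t)) (sets (G t))"
proof -
	define AA where "AA = {{w\<in>space M. ALL s:J. X s w \<in> A s} | J (A :: real => real set). finite J & J <= {0..t} & (ALL s. A s \<in> sets (borel :: real measure))}"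
	define BB where "BB = {{w\<in>space M. ALL s:J. X s w - X t w \<in> A s} | J (A :: real => real set). finite J & J <= {t..} & (ALL s. A s \<in> sets (borel :: real measure))}"
	have meas: "{w\<in>space M. ALL s:J. f s w \<in> A s} \<in> sets M"
		if "finite J" "!!s. A s \<in> sets borel" "!!s. f s \<in> borel_measurable M" for J and A :: "real => real set" and f :: "real => 'a => real"
	proof (rule sets.sets_Collect_finite_All[OF _ that(1)])
		fix s show "{w\<in>space M. f s w \<in> A s} \<in> sets M"
			using measurable_sets[OF that(3)[of s] that(2)[of s]] by (simp add: vimage_def Int_def conj_commute)
	qed
	have ind0: "indep_set AA BB"
	proof (rule indep_setI)
		show "AA <= events" unfolding AA_def using meas[of _ _ X] by auto
		show "BB <= events" unfolding BB_def using meas[of _ _ "%s w. X s w - X t w"] by auto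
		show "prob (a \<inter> b) = prob a * prob b" if "a \<in> AA" "b \<in> BB" for a b
			using that unfolding AA_def BB_def by (auto intro!: indep_finite_dim[OF _ _ _ _ t])
	qed
	have stable: "Int_stable {{w\<in>space M. ALL s:J. f s w \<in> A s} | J (A :: real => real set). finite J & J <= T & (ALL s. A s \<in> sets (borel :: real measure))}"
		(is "Int_stable ?S") for f :: "real => 'a => real" and T
	proof (rule Int_stableI)
		fix a b assume "a \<in> ?S" "b \<in> ?S"
		from `a \<in> ?S` obtain J A where a: "a = {w\<in>space M. ALL s:J. f s w \<in> A s}" "finite J" "J <= T"
			and A: "ALL s. A s \<in> sets (borel :: real measure)" by blast
		from `b \<in> ?S` obtain J' A' where b: "b = {w\<in>space M. ALL s:J'. f s w \<in> A' s}" "finite J'" "J' <= T"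
			and A': "ALL s. A' s \<in> sets (borel :: real measure)" by blast
		define B where "B s = (if s \<in> J then A s else UNIV) \<inter> (if s \<in> J' then A' s else UNIV)" for s
		have "(ALL s:J \<union> J'. y s \<in> B s) \<longleftrightarrow> (ALL s:J. y s \<in> A s) & (ALL s:J'. y s \<in> A' s)" for y :: "real => real"
			unfolding B_def by (auto split: if_splits)
		hence "a \<inter> b = {w\<in>space M. ALL s:J \<union> J'. f s w \<in> B s}"
			unfolding a(1) b(1) by (simp only:) blast
		moreover have "finite (J \<union> J')" "J \<union> J' <= T" "ALL s. B s \<in> sets borel" using a b A A' by (simp_all add: B_def)
		ultimately show "a \<inter> b \<in> ?S" by blast
	qed
	have ind: "indep_set (sigma_sets (space M) AA) (sigma_sets (space M) BB)"
		using ind0 stable[of X "{0..t}"] stable[of "%s w. X s w - X t w" "{t..}"]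
		unfolding AA_def BB_def by (rule indep_set_sigma_sets)
	have subF: "sets (F t) <= sigma_sets (space M) AA"
		unfolding F_def sets_measure_of[OF F_gen]
	proof (intro sigma_sets_mono subsetI)
		fix a assume "a \<in> {X s -` A \<inter> space M | s A. 0 <= s & s <= t & A \<in> sets borel}"
		then obtain s A where *: "a = X s -` A \<inter> space M" "0 <= s" "s <= t" "A \<in> sets borel" by auto
		hence "a = {w\<in>space M. ALL s:{s}. X s w \<in> (%_. A) s}" by auto
		hence "a \<in> AA" unfolding AA_def using * by (intro CollectI exI[of _ "{s}"] exI[of _ "%_. A"]) auto
		thus "a \<in> sigma_sets (space M) AA" by (rule sigma_sets.Basic)
	qed
	have subG: "sets (G t) <= sigma_sets (space M) BB"
		unfolding G_def sets_measure_of[OF G_gen]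
	proof (intro sigma_sets_mono subsetI)
		fix a assume "a \<in> {(%w. X s w - X t w) -` A \<inter> space M | s A. t <= s & A \<in> sets borel}"
		then obtain s A where *: "a = (%w. X s w - X t w) -` A \<inter> space M" "t <= s" "A \<in> sets borel" by auto
		hence "a = {w\<in>space M. ALL s:{s}. X s w - X t w \<in> (%_. A) s}" by auto
		hence "a \<in> BB" unfolding BB_def using * by (intro CollectI exI[of _ "{s}"] exI[of _ "%_. A"]) auto
		thus "a \<in> sigma_sets (space M) BB" by (rule sigma_sets.Basic)
	qed
	show ?thesis by (rule indep_set_mono[OF ind subF subG])
qed

lemma indep_FG:
	assumes "0 <= t" "a \<in> sets (F t)" "b \<in> sets (G t)"
	shows "prob (a \<inter> b) = prob a * prob b"
	using indep_FG_set[OF assms(1)] assms(2,3) by (rule indep_setD)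

lemma indep_var_FG:
	assumes t: "0 <= t" and U: "U \<in> measurable (F t) N1" and Z: "Z \<in> measurable (G t) N2"
	shows "indep_var N1 U N2 Z"
	unfolding indep_var_eq
proof (intro conjI)
	show "random_variable N1 U" "random_variable N2 Z" using measurable_F[OF U] measurable_G[OF Z] by auto
	have "sigma_sets (space M) {U -` A \<inter> space M |A. A \<in> sets N1} <= sets (F t)"
		using measurable_sets[OF U] by (intro sets.sigma_sets_subset[of _ "F t", simplified]) auto
	moreover have "sigma_sets (space M) {Z -` A \<inter> space M |A. A \<in> sets N2} <= sets (G t)"
		using measurable_sets[OF Z] by (intro sets.sigma_sets_subset[of _ "G t", simplified]) auto
	ultimately show "indep_set (sigma_sets (space M) {U -` A \<inter> space M |A. A \<in> sets N1}) (sigma_sets (space M) {Z -` A \<inter> space M |A. A \<in> sets N2})"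
		by (rule indep_set_mono[OF indep_FG_set[OF t]])
qed

lemma distr_increment: "0 <= t ==> 0 <= s ==> distr M borel (%w. X (t + s) w - X t w) = distr M borel (X s)"
	using stat[of t "t + s"] by simp

text \<open>The Markov property at a fixed time, phrased with integrals: independence separates the
  event and the start \<open>U\<close> from the later increment, and stationarity replaces that
  increment by \<open>X s\<close>.\<close>

lemma expectation_increment:
	fixes f :: "real => real"
	assumes t: "0 <= t" "0 <= s" and S: "S \<in> sets (F t)" and U: "U \<in> borel_measurable (F t)"
		and f: "f \<in> borel_measurable borel"
		and int: "integrable M (%w. indicator S w * f (U w + (X (t + s) w - X t w)))"
	shows "(LINT w|M. indicator S w * f (U w + (X (t + s) w - X t w))) =
		(LINT w|M. indicator S w * (LINT w'|M. f (U w + X s w')))"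
		"integrable M (%w. indicator S w * (LINT w'|M. f (U w + X s w')))"
proof -
	\<comment> \<open>\<open>indep_var\<close> relates variables of one type, hence the dummy component
	  \<open>0\<close>.\<close>
	define Z where "Z w = (0 :: real, X (t + s) w - X t w)" for w
	define UU where "UU w = (indicat_real S w, U w)" for w
	define ph where "ph = (%(p :: real \<times> real, z :: real \<times> real). fst p * f (snd p + snd z))"
	let ?N = "borel \<Otimes> borel :: (real \<times> real) measure"
	have UU: "UU \<in> measurable (F t) ?N" unfolding UU_def using S U by (intro measurable_Pair) auto
	have Z: "Z \<in> measurable (G t) ?N" unfolding Z_def using t by (intro measurable_Pair X_G) auto
	have UUM [measurable]: "UU \<in> measurable M ?N" and ZM [measurable]: "Z \<in> measurable M ?N"
		using measurable_F[OF UU] measurable_G[OF Z] by auto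
	note f [measurable]
	have ph [measurable]: "ph \<in> borel_measurable (?N \<Otimes> ?N)" unfolding ph_def by measurable
	have iv: "indep_var ?N UU ?N Z" by (rule indep_var_FG[OF t(1) UU Z])
	hence D: "distr M ?N UU \<Otimes> distr M ?N Z = distr M (?N \<Otimes> ?N) (%w. (UU w, Z w))"
		by (simp add: indep_var_distribution_eq)
	interpret P1: prob_space "distr M ?N UU" by (rule prob_space_distr) measurable
	interpret P2: prob_space "distr M ?N Z" by (rule prob_space_distr) measurable
	interpret PP: pair_prob_space "distr M ?N UU" "distr M ?N Z" ..
	have eq1: "(%w. indicator S w * f (U w + (X (t + s) w - X t w))) = (%w. ph (UU w, Z w))"
		by (simp add: ph_def UU_def Z_def)
	have i1: "integrable (distr M ?N UU \<Otimes> distr M ?N Z) ph"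
		unfolding D by (subst integrable_distr_eq) (use int in "simp_all add: eq1[symmetric]")
	have inner: "(LINT z|distr M ?N Z. ph (p, z)) = fst p * (LINT w'|M. f (snd p + X s w'))" for p
	proof -
		have "(LINT z|distr M ?N Z. ph (p, z)) = (LINT w'|M. fst p * f (snd p + (X (t + s) w' - X t w')))"
			by (subst integral_distr) (auto simp: ph_def Z_def)
		also have "... = (LINT z|distr M borel (%w. X (t + s) w - X t w). fst p * f (snd p + z))"
			by (subst integral_distr) auto
		also have "... = (LINT w'|M. fst p * f (snd p + X s w'))"
			unfolding distr_increment[OF t] by (subst integral_distr) auto
		finally show ?thesis by simp
	qed
	have i2: "integrable (distr M ?N UU) (%p. LINT z|distr M ?N Z. ph (p, z))"
		using PP.integrable_fst'[OF i1] .
	hence "integrable M (%w. LINT z|distr M ?N Z. ph (UU w, z))"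
		by (subst (asm) integrable_distr_eq) (auto dest: borel_measurable_integrable)
	thus "integrable M (%w. indicator S w * (LINT w'|M. f (U w + X s w')))"
		unfolding inner by (simp add: UU_def)
	have "(LINT w|M. ph (UU w, Z w)) = integral\<^sup>L (distr M ?N UU \<Otimes> distr M ?N Z) ph"
		unfolding D by (subst integral_distr) auto
	also have "... = (LINT p|distr M ?N UU. LINT z|distr M ?N Z. ph (p, z))"
		using PP.integral_fst'[OF i1] by simp
	also have "... = (LINT w|M. LINT z|distr M ?N Z. ph (UU w, z))"
		using i2 by (intro integral_distr) (auto dest: borel_measurable_integrable)
	finally show "(LINT w|M. indicator S w * f (U w + (X (t + s) w - X t w))) =
		(LINT w|M. indicator S w * (LINT w'|M. f (U w + X s w')))"
		unfolding eq1 inner by (simp add: UU_def)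
qed

end

lemma pred_const: "Measurable.pred M (%_. c)"
	by simp

lemma pred_const_le:
	fixes f :: "'a => real"
	assumes [measurable]: "f \<in> borel_measurable M"
	shows "Measurable.pred M (%w. c <= f w)" "Measurable.pred M (%w. f w <= c)"
	by measurable

context good_levy
begin

lemma nn_integral_FG:
	fixes U V :: "'a => ennreal"
	assumes t: "0 <= t" and U: "U \<in> borel_measurable (F t)" and V: "V \<in> borel_measurable (G t)"
	shows "(\<integral>\<^sup>+w. U w * V w \<partial>M) = (\<integral>\<^sup>+w. U w \<partial>M) * (\<integral>\<^sup>+w. V w \<partial>M)"
proof -
	note [measurable] = measurable_F[OF U] measurable_G[OF V]
	have "indep_var borel U borel V" by (rule indep_var_FG[OF t U V])
	hence D: "distr M borel U \<Otimes> distr M borel V = distr M (borel \<Otimes> borel) (%w. (U w, V w))"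
		by (simp add: indep_var_distribution_eq)
	interpret V: prob_space "distr M borel V" by (rule prob_space_distr) measurable
	have "(\<integral>\<^sup>+w. U w * V w \<partial>M) = (\<integral>\<^sup>+p. fst p * snd p \<partial>(distr M borel U \<Otimes> distr M borel V))"
		unfolding D by (subst nn_integral_distr) auto
	also have "... = (\<integral>\<^sup>+u. \<integral>\<^sup>+v. u * v \<partial>distr M borel V \<partial>distr M borel U)"
		by (subst V.nn_integral_fst[symmetric]) auto
	also have "... = (\<integral>\<^sup>+u. u * (\<integral>\<^sup>+v. v \<partial>distr M borel V) \<partial>distr M borel U)"
		by (simp add: nn_integral_cmult)
	also have "... = (\<integral>\<^sup>+u. u \<partial>distr M borel U) * (\<integral>\<^sup>+v. v \<partial>distr M borel V)"
		by (rule nn_integral_multc) simp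
	finally show ?thesis by (simp add: nn_integral_distr)
qed

section \<open>Exponential moments of climbs\<close>

definition gt :: "real => nat => nat => real" where "gt N n j = real j * N / 2 ^ n"

definition hi :: "real => nat => nat => nat => real => 'a => bool" where
	"hi N n al be c w \<longleftrightarrow> (EX a b. al <= a & a <= b & b <= be & c <= X (gt N n b) w - X (gt N n a) w)"

definition ok :: "real => nat => nat => nat => 'a => bool" where
	"ok N n al be w \<longleftrightarrow> (ALL e. al <= e & e < be --> X (gt N n (Suc e)) w - X (gt N n e) w <= 1)"

lemma hiI: "al <= a ==> a <= b ==> b <= be ==> c <= X (gt N n b) w - X (gt N n a) w ==> hi N n al be c w"
	unfolding hi_def by blast

context
	fixes N :: real assumes N: "0 <= N"
begin

lemma gt_nonneg [simp]: "0 <= gt N n j" using N by (simp add: gt_def)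

lemma gt_mono: "i <= j ==> gt N n i <= gt N n j"
	using N by (simp add: gt_def divide_right_mono mult_right_mono)

lemma hi_pred:
	assumes "!!a b. al <= a ==> a <= b ==> b <= be ==> (%w. X (gt N n b) w - X (gt N n a) w) \<in> borel_measurable M'"
	shows "Measurable.pred M' (hi N n al be c)"
proof -
	have m: "Measurable.pred M' (%w. al <= a & a <= b & b <= be & c <= X (gt N n b) w - X (gt N n a) w)" for a b
	proof (cases "al <= a & a <= b & b <= be")
		case True
		hence "(%w. al <= a & a <= b & b <= be & c <= X (gt N n b) w - X (gt N n a) w) =
				(%w. c <= X (gt N n b) w - X (gt N n a) w)" by (auto simp: fun_eq_iff)
		thus ?thesis using True by (simp only:) (intro pred_const_le(1) assms; elim conjE; assumption)
	next
		case False
		hence "(%w. al <= a & a <= b & b <= be & c <= X (gt N n b) w - X (gt N n a) w) = (%_. False)"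
			by (auto simp: fun_eq_iff)
		thus ?thesis by (simp only: pred_const)
	qed
	show ?thesis unfolding hi_def[abs_def] by (intro pred_intros_countable(2) m)
qed

lemma ok_pred:
	assumes "!!a. al <= a ==> a < be ==> (%w. X (gt N n (Suc a)) w - X (gt N n a) w) \<in> borel_measurable M'"
	shows "Measurable.pred M' (ok N n al be)"
proof -
	have m: "Measurable.pred M' (%w. al <= e & e < be --> X (gt N n (Suc e)) w - X (gt N n e) w <= 1)" for e
	proof (cases "al <= e & e < be")
		case True
		hence "(%w. al <= e & e < be --> X (gt N n (Suc e)) w - X (gt N n e) w <= 1) =
				(%w. X (gt N n (Suc e)) w - X (gt N n e) w <= 1)" by (auto simp: fun_eq_iff)
		thus ?thesis using True by (simp only:) (intro pred_const_le(2) assms; elim conjE; assumption)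
	next
		case False
		hence "(%w. al <= e & e < be --> X (gt N n (Suc e)) w - X (gt N n e) w <= 1) = (%_. True)"
			by (auto simp: fun_eq_iff)
		thus ?thesis by (simp only: pred_const)
	qed
	show ?thesis unfolding ok_def[abs_def] by (intro pred_intros_countable(1) m)
qed

lemma hi_M [measurable]: "Measurable.pred M (hi N n al be c)" by (intro hi_pred borel_measurable_diff X_meas)
lemma ok_M [measurable]: "Measurable.pred M (ok N n al be)" by (intro ok_pred borel_measurable_diff X_meas)

lemma hi_F: "be <= j ==> Measurable.pred (F (gt N n j)) (hi N n al be c)"
	by (intro hi_pred borel_measurable_diff X_F gt_mono gt_nonneg) linarith+

lemma ok_F: "be <= j ==> Measurable.pred (F (gt N n j)) (ok N n al be)"
	by (intro ok_pred borel_measurable_diff X_F gt_mono gt_nonneg) linarith+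

lemma hi_G: "j <= al ==> Measurable.pred (G (gt N n j)) (hi N n al be c)"
	by (intro hi_pred X_G_diff gt_mono) linarith+

lemma ok_G: "j <= al ==> Measurable.pred (G (gt N n j)) (ok N n al be)"
	by (intro ok_pred X_G_diff gt_mono) linarith+

lemma pred_prob_FG:
	assumes "0 <= t" "Measurable.pred (F t) P" "Measurable.pred (G t) Q"
	shows "prob {w\<in>space M. P w & Q w} = prob {w\<in>space M. P w} * prob {w\<in>space M. Q w}"
proof -
	have "{w\<in>space M. P w} \<in> sets (F t)" using assms(2) unfolding pred_def space_F .
	moreover have "{w\<in>space M. Q w} \<in> sets (G t)" using assms(3) unfolding pred_def space_G .
	ultimately
	have "prob ({w\<in>space M. P w} \<inter> {w\<in>space M. Q w}) = prob {w\<in>space M. P w} * prob {w\<in>space M. Q w}"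
		by (rule indep_FG[OF assms(1)])
	moreover have "{w\<in>space M. P w} \<inter> {w\<in>space M. Q w} = {w\<in>space M. P w & Q w}" by auto
	ultimately show ?thesis by (simp only:)
qed

text \<open>Since there are no positive jumps, a path whose range increases by \<open>2\<close> beyond level \<open>2 r\<close> climbs by at least
	\<open>1\<close> after the first time the range reaches \<open>2 r\<close>, if the grid increments are at most \<open>1\<close>.\<close>
lemma hi_geometric:
	assumes rh: "!!j. al <= j ==> j <= be ==> prob {w\<in>space M. hi N n j be 1 w} <= rh"
		and "al <= be"
	shows "prob {w\<in>space M. EX j. al <= j & j <= be & hi N n al j (2 * real r) w & ok N n al j w} <= rh ^ r"
proof (induction r)
	case (Suc r)
	let ?S = "%i w. X (gt N n i) w"
	\<comment> \<open>\<open>j\<close> is the first index at which a climb of \<open>2 r\<close> is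
	  complete. These events are disjoint and belong to the past of \<open>gt N n j\<close>, so a climb
	  of \<open>1\<close> afterwards is independent of them.\<close>
	define B where "B j w \<longleftrightarrow> hi N n al j (2 * real r) w & ok N n al j w & (ALL i. al <= i & i < j --> ~ hi N n al i (2 * real r) w)" for j w
	have BF: "Measurable.pred (F (gt N n j)) (B j)" for j
	proof -
		have "Measurable.pred (F (gt N n j)) (%w. al <= i & i < j --> ~ hi N n al i (2 * real r) w)" for i
		proof (cases "i < j")
			case True
			hence "Measurable.pred (F (gt N n j)) (hi N n al i (2 * real r))" by (intro hi_F less_imp_le)
			thus ?thesis by (intro pred_intros_logic(4) pred_intros_logic(2) pred_intros_logic(3) pred_const)
		next
			case False
			hence "(%w. al <= i & i < j --> ~ hi N n al i (2 * real r) w) = (%_. True)"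
				by (auto simp: fun_eq_iff)
			thus ?thesis by (simp only: pred_const)
		qed
		thus ?thesis unfolding B_def[abs_def]
			by (intro pred_intros_logic(3) hi_F ok_F pred_intros_countable(1) order_refl)
	qed
	have BM [measurable]: "Measurable.pred M (B j)" for j using measurable_F[OF BF] .
	let ?B = "%j. {w\<in>space M. B j w}"
	have EM: "{w\<in>space M. B j w & hi N n j be 1 w} \<in> sets M" "?B j \<in> sets M" for j by measurable
	have disj: "disjoint_family_on ?B {al..be}"
		unfolding disjoint_family_on_def
	proof (intro ballI impI)
		have "~ (B j w & B i w)" if "i < j" "al <= i" for i j w using that by (auto simp: B_def)
		thus "?B i \<inter> ?B j = {}" if "i \<in> {al..be}" "j \<in> {al..be}" "i ~= j" for i j
			using that by (cases "i < j") (auto dest: linorder_neqE)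
	qed
	have "prob {w\<in>space M. EX j. al <= j & j <= be & hi N n al j (2 * real (Suc r)) w & ok N n al j w}
			<= prob (\<Union>j\<in>{al..be}. {w\<in>space M. B j w & hi N n j be 1 w})"
	proof (rule finite_measure_mono[OF subsetI], elim CollectE exE conjE)
		fix w j' assume w: "w \<in> space M" and j': "al <= j'" "j' <= be" "hi N n al j' (2 * real (Suc r)) w" "ok N n al j' w"
		obtain a b where ab: "al <= a" "a <= b" "b <= j'" "2 * real (Suc r) <= ?S b w - ?S a w" using j'(3) by (auto simp: hi_def)
		have ex: "al <= j' & hi N n al j' (2 * real r) w" using j'(1) ab(4) by (intro conjI hiI[OF ab(1-3)]) auto
		define j where "j = (LEAST i. al <= i & hi N n al i (2 * real r) w)"
		have j: "al <= j" "hi N n al j (2 * real r) w" using LeastI[of "%i. al <= i & hi N n al i (2 * real r) w", OF ex] by (auto simp: j_def)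
		have jj': "j <= j'" unfolding j_def by (rule Least_le) (rule ex)
		have min: "~ hi N n al i (2 * real r) w" if "al <= i" "i < j" for i
			using not_less_Least[of i] that by (auto simp: j_def)
		have okj: "ok N n al j w" using j'(4) jj' by (auto simp: ok_def)
		\<comment> \<open>Before \<open>j\<close> climbs stay below \<open>2 r\<close>, and the last
		  increment adds at most \<open>1\<close>. Out of a climb of \<open>2 r + 2\<close>, at least
		  \<open>1\<close> is left for the time after \<open>j\<close>.\<close>
		have up: "?S e w - ?S a' w <= 2 * real r + 1" if "al <= a'" "a' <= e" "e <= j" for a' e
		proof (cases "a' < e")
			case True
			define i where "i = e - 1"
			have i: "e = Suc i" "al <= i" "i < j" "a' <= i" using True that by (auto simp: i_def)
			have "?S i w - ?S a' w < 2 * real r"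
			proof (rule ccontr)
				assume "~ ?thesis"
				hence "2 * real r <= ?S i w - ?S a' w" by simp
				from hiI[OF that(1) i(4) order_refl this] show False using min[OF i(2,3)] by blast
			qed
			moreover have "?S e w - ?S i w <= 1" using okj i by (auto simp: ok_def)
			ultimately show ?thesis by simp
		next
			case False
			thus ?thesis using that by simp
		qed
		have "hi N n j be 1 w"
		proof (cases "j <= a")
			case True
			have "1 <= ?S b w - ?S a w" using ab(4) by simp
			thus ?thesis by (rule hiI[OF True ab(2) order_trans[OF ab(3) j'(2)]])
		next
			case False
			have "~ b <= j" using up[OF ab(1,2)] ab(4) by auto
			hence jb: "j <= b" by simp
			have "?S j w - ?S a w <= 2 * real r + 1" using False ab by (intro up) auto
			hence "1 <= ?S b w - ?S j w" using ab(4) by simp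
			thus ?thesis by (rule hiI[OF order_refl jb order_trans[OF ab(3) j'(2)]])
		qed
		thus "w \<in> (\<Union>j\<in>{al..be}. {w\<in>space M. B j w & hi N n j be 1 w})"
			using w j jj' j' okj min by (auto simp: B_def intro!: bexI[of _ j])
	qed (intro sets.finite_UN finite_atLeastAtMost EM)
	also have "... <= (\<Sum>j\<in>{al..be}. prob {w\<in>space M. B j w & hi N n j be 1 w})"
		by (rule finite_measure_subadditive_finite) (use EM in blast)+
	also have "... = (\<Sum>j\<in>{al..be}. prob (?B j) * prob {w\<in>space M. hi N n j be 1 w})"
		by (intro sum.cong refl pred_prob_FG[OF gt_nonneg BF hi_G] order_refl)
	also have "... <= (\<Sum>j\<in>{al..be}. prob (?B j) * rh)"
		by (intro sum_mono mult_left_mono rh) auto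
	also have "... = prob (\<Union>j\<in>{al..be}. ?B j) * rh"
		unfolding sum_distrib_right[symmetric] using EM(2)
		by (subst finite_measure_finite_Union[OF _ _ disj]) blast+
	also have "... <= rh ^ r * rh"
	proof (rule mult_right_mono)
		have "prob (\<Union>j\<in>{al..be}. ?B j) <= prob {w\<in>space M. EX j. al <= j & j <= be & hi N n al j (2 * real r) w & ok N n al j w}"
		proof (rule finite_measure_mono)
			show "(\<Union>j\<in>{al..be}. ?B j) <= {w\<in>space M. EX j. al <= j & j <= be & hi N n al j (2 * real r) w & ok N n al j w}"
				unfolding B_def by auto
		qed measurable
		thus "prob (\<Union>j\<in>{al..be}. ?B j) <= rh ^ r" using Suc.IH by linarith
		show "0 <= rh" using order_trans[OF measure_nonneg rh[OF order_refl `al <= be`]] .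
	qed
	finally show ?case by (simp add: mult.commute)
qed simp


text \<open>A weight dominating \<open>exp (th c)\<close> for every climb \<open>c\<close> between grid points of a block of good increments.\<close>
definition weight :: "real => nat => nat => nat => 'a => ennreal" where
	"weight th n al be w = (\<Sum>r. ennreal (exp (2 * th * (real r + 1))) * indicator {w. hi N n al be (2 * real r) w & ok N n al be w} w)"

lemma weight_measurable:
	assumes "!!c. Measurable.pred M' (hi N n al be c)" "Measurable.pred M' (ok N n al be)"
	shows "weight th n al be \<in> borel_measurable M'"
proof -
	note [measurable] = assms
	show ?thesis unfolding weight_def[abs_def] by measurable
qed

lemma weight_ge:
	assumes "0 <= th" "al <= a" "a <= b" "b <= be" "ok N n al be w"
	shows "ennreal (exp (th * (X (gt N n b) w - X (gt N n a) w))) <= weight th n al be w"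
proof -
	have term_le: "f r <= (\<Sum>r. f r)" for f :: "nat => ennreal" and r
		using sum_le_suminf[of f "{r}"] by (simp add: summableI)
	define c where "c = max 0 (X (gt N n b) w - X (gt N n a) w)"
	have c0: "0 <= c / 2" by (simp add: c_def)
	have "EX r :: nat. real r <= y & y <= real r + 1" if "0 <= y" for y :: real
		by (rule exI[of _ "nat \<lfloor>y\<rfloor>"]) (use that in linarith)
	from this[OF c0] obtain r :: nat where "real r <= c / 2" "c / 2 <= real r + 1" by blast
	hence r: "2 * real r <= c" "c <= 2 * (real r + 1)" by simp_all
	have hi: "hi N n al be (2 * real r) w"
	proof (cases "0 <= X (gt N n b) w - X (gt N n a) w")
		case True
		thus ?thesis using r(1) by (intro hiI[OF assms(2-4)]) (simp add: c_def)
	next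
		case False
		hence "2 * real r <= X (gt N n a) w - X (gt N n a) w" using r(1) by (simp add: c_def)
		thus ?thesis using assms by (intro hiI[of al a a]) auto
	qed
	have "th * (X (gt N n b) w - X (gt N n a) w) <= th * (2 * (real r + 1))"
		using assms(1) r(2) by (intro mult_left_mono) (auto simp: c_def)
	hence "ennreal (exp (th * (X (gt N n b) w - X (gt N n a) w))) <= ennreal (exp (2 * th * (real r + 1)))"
		by (intro ennreal_leI) (simp add: mult.assoc mult.left_commute)
	also have "... = ennreal (exp (2 * th * (real r + 1))) * indicator {w. hi N n al be (2 * real r) w & ok N n al be w} w"
		using hi assms(5) by simp
	also have "... <= weight th n al be w" unfolding weight_def by (rule term_le)
	finally show ?thesis .
qed

text \<open>A climb of \<open>2 r\<close> has probability at most \<open>rh ^ r\<close>, and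
  \<open>rh\<close> is small enough to beat the exponential weight: the series is dominated by a
  geometric one with ratio \<open>1 / 2\<close>.\<close>

lemma weight_integral:
	assumes rh: "!!j. al <= j ==> j <= be ==> prob {w\<in>space M. hi N n j be 1 w} <= rh"
		and "al <= be" "0 <= th" and small: "exp (2 * th) * rh <= 1 / 2"
	shows "(\<integral>\<^sup>+w. weight th n al be w \<partial>M) <= ennreal (2 * exp (2 * th))"
proof -
	let ?E = "%r. {w\<in>space M. hi N n al be (2 * real r) w & ok N n al be w}"
	have rh0: "0 <= rh" using order_trans[OF measure_nonneg rh[OF order_refl `al <= be`]] .
	have Em: "?E r \<in> sets M" for r by measurable
	have "(\<integral>\<^sup>+w. weight th n al be w \<partial>M) =
			(\<integral>\<^sup>+w. (\<Sum>r. ennreal (exp (2 * th * (real r + 1))) * indicator (?E r) w) \<partial>M)"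
		unfolding weight_def by (intro nn_integral_cong suminf_cong) (simp add: indicator_def)
	also have "... = (\<Sum>r. (\<integral>\<^sup>+w. ennreal (exp (2 * th * (real r + 1))) * indicator (?E r) w \<partial>M))"
		by (rule nn_integral_suminf) measurable
	also have "... = (\<Sum>r. ennreal (exp (2 * th * (real r + 1))) * emeasure M (?E r))"
		using Em by (intro suminf_cong nn_integral_cmult_indicator)
	also have "... <= (\<Sum>r. ennreal (exp (2 * th) * (1 / 2) ^ r))"
	proof (rule suminf_le)
		fix r
		have "prob (?E r) <= prob {w\<in>space M. EX j. al <= j & j <= be & hi N n al j (2 * real r) w & ok N n al j w}"
		proof (rule finite_measure_mono)
			show "?E r <= {w\<in>space M. EX j. al <= j & j <= be & hi N n al j (2 * real r) w & ok N n al j w}"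
				using `al <= be` by blast
		qed measurable
		also have "... <= rh ^ r" by (rule hi_geometric[OF rh `al <= be`])
		finally have "exp (2 * th * (real r + 1)) * prob (?E r) <= exp (2 * th * (real r + 1)) * rh ^ r" by simp
		also have "... = exp (2 * th) * (exp (2 * th) * rh) ^ r"
			by (simp add: power_mult_distrib distrib_left exp_add exp_of_nat_mult[symmetric] mult.commute mult.left_commute)
		also have "... <= exp (2 * th) * (1 / 2) ^ r"
			using small rh0 by (intro mult_left_mono power_mono) auto
		finally show "ennreal (exp (2 * th * (real r + 1))) * emeasure M (?E r) <= ennreal (exp (2 * th) * (1 / 2) ^ r)"
			by (simp add: emeasure_eq_measure ennreal_mult'[symmetric] ennreal_leI)
	qed (auto intro: summableI)
	also have "... = ennreal (\<Sum>r. exp (2 * th) * (1 / 2) ^ r)"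
		by (intro suminf_ennreal2 summable_mult summable_geometric) auto
	also have "(\<Sum>r. exp (2 * th) * (1 / 2 :: real) ^ r) = 2 * exp (2 * th)"
		by (subst suminf_mult) (auto simp: suminf_geometric)
	finally show ?thesis .
qed

definition weights :: "real => nat => nat => nat => 'a => ennreal" where
	"weights th n l k w = (\<Prod>i<k. weight th n (i * l) (Suc i * l) w)"

lemma weights_F: "weights th n l k \<in> borel_measurable (F (gt N n (k * l)))"
	unfolding weights_def[abs_def]
proof (intro borel_measurable_prod_ennreal weight_measurable hi_F ok_F)
	fix i assume "i \<in> {..<k}"
	thus "Suc i * l <= k * l" by (intro mult_le_mono1) auto
	thus "Suc i * l <= k * l" .
qed

lemma weights_M [measurable]: "weights th n l k \<in> borel_measurable M"
	using measurable_F[OF weights_F] .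

lemma weights_integral:
	assumes rh: "!!i j. i < k ==> i * l <= j ==> j <= Suc i * l ==> prob {w\<in>space M. hi N n j (Suc i * l) 1 w} <= rh"
		and "0 <= th" and small: "exp (2 * th) * rh <= 1 / 2"
	shows "(\<integral>\<^sup>+w. weights th n l k w \<partial>M) <= ennreal (2 * exp (2 * th)) ^ k"
	using rh
proof (induction k)
	case 0
	thus ?case by (simp add: weights_def emeasure_space_1)
next
	case (Suc k)
	have "(\<integral>\<^sup>+w. weights th n l (Suc k) w \<partial>M) = (\<integral>\<^sup>+w. weights th n l k w * weight th n (k * l) (Suc k * l) w \<partial>M)"
		by (simp add: weights_def mult.commute)
	also have "... = (\<integral>\<^sup>+w. weights th n l k w \<partial>M) * (\<integral>\<^sup>+w. weight th n (k * l) (Suc k * l) w \<partial>M)"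
		by (intro nn_integral_FG[OF gt_nonneg weights_F] weight_measurable hi_G ok_G order_refl)
	also have "... <= ennreal (2 * exp (2 * th)) ^ k * ennreal (2 * exp (2 * th))"
	proof (intro mult_mono Suc.IH weight_integral[OF _ _ `0 <= th` small])
		fix j assume "k * l <= j" "j <= Suc k * l"
		thus "prob {w\<in>space M. hi N n j (Suc k * l) 1 w} <= rh" by (intro Suc.prems) auto
	next
		fix i j assume "i < k" "i * l <= j" "j <= Suc i * l"
		thus "prob {w\<in>space M. hi N n j (Suc i * l) 1 w} <= rh" by (intro Suc.prems) auto
	qed auto
	finally show ?case by (simp only: power_Suc2)
qed

text \<open>Cut at the block ends, a climb is a sum of climbs within single blocks; blocks that it
  does not meet contribute a factor of at least \<open>1\<close>.\<close>

lemma weights_ge: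
	assumes "0 <= th" "a <= b" "b <= k * l" "ok N n 0 (k * l) w"
	shows "ennreal (exp (th * (X (gt N n b) w - X (gt N n a) w))) <= weights th n l k w"
	using assms(2-)
proof (induction k arbitrary: a b)
	case 0
	hence "a = 0" "b = 0" by auto
	thus ?case by (simp add: weights_def)
next
	case (Suc k)
	let ?S = "%i. X (gt N n i) w"
	have okl: "ok N n (k * l) (Suc k * l) w" and okk: "ok N n 0 (k * l) w"
		using Suc.prems(3) by (auto simp: ok_def)
	have ww: "weights th n l (Suc k) w = weights th n l k w * weight th n (k * l) (Suc k * l) w"
		by (simp add: weights_def mult.commute)
	have one: "ennreal 1 <= weight th n (k * l) (Suc k * l) w"
		using weight_ge[OF assms(1) order_refl order_refl _ okl] by simp
	have one': "ennreal 1 <= weights th n l k w"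
		using Suc.IH[OF order_refl _ okk, of 0] by simp
	consider "b <= k * l" | "k * l <= a" | "a <= k * l" "k * l <= b" by linarith
	thus ?case
	proof cases
		case 1
		have "ennreal (exp (th * (?S b - ?S a))) * ennreal 1 <= weights th n l (Suc k) w"
			unfolding ww by (intro mult_mono Suc.IH[OF Suc.prems(1) 1 okk] one) auto
		thus ?thesis by simp
	next
		case 2
		have "ennreal 1 * ennreal (exp (th * (?S b - ?S a))) <= weights th n l (Suc k) w"
			unfolding ww by (intro mult_mono one' weight_ge[OF assms(1) 2 Suc.prems(1,2) okl]) auto
		thus ?thesis by simp
	next
		case 3
		have "ennreal (exp (th * (?S b - ?S a))) = ennreal (exp (th * (?S (k * l) - ?S a))) * ennreal (exp (th * (?S b - ?S (k * l))))"
			by (simp add: ennreal_mult'[symmetric] exp_add[symmetric] algebra_simps)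
		also have "... <= weights th n l (Suc k) w"
			unfolding ww by (intro mult_mono Suc.IH[OF 3(1) order_refl okk] weight_ge[OF assms(1) order_refl 3(2) Suc.prems(2) okl]) auto
		finally show ?thesis .
	qed
qed

lemma gt_diff: "p <= n ==> b <= a + 2 ^ (n - p) ==> gt N n b - gt N n a <= N / 2 ^ p"
proof -
	assume p: "p <= n" and b: "b <= a + 2 ^ (n - p)"
	have "real b <= real (a + 2 ^ (n - p))" using b by (rule of_nat_mono)
	hence "real b <= real a + 2 ^ (n - p)" by simp
	hence "(real b - real a) * N <= 2 ^ (n - p) * N" using N by (intro mult_right_mono) auto
	hence "(real b - real a) * N / 2 ^ n <= 2 ^ (n - p) * N / 2 ^ n" by (intro divide_right_mono) auto
	also have "... = N / 2 ^ p" using p by (simp add: power_diff field_simps)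
	finally show ?thesis by (simp add: gt_def diff_divide_distrib left_diff_distrib)
qed

text \<open>All dyadic levels \<open>n\<close> are included, so the event depends on
  \<open>p\<close> alone and one choice of \<open>p\<close> serves every grid.\<close>

definition jumpy :: "nat => 'a => bool" where
	"jumpy p w \<longleftrightarrow> (EX n a b. a <= b & gt N n b - gt N n a <= N / 2 ^ p & gt N n b <= N & 1 <= X (gt N n b) w - X (gt N n a) w)"

lemma jumpy_M [measurable]: "Measurable.pred M (jumpy p)"
	unfolding jumpy_def[abs_def] by measurable

lemma jumpy_eventually_not: "eventually (%p. ~ jumpy p w) sequentially"
proof -
	obtain d where d: "d > 0" "ALL s t. 0 <= s --> s <= N --> s <= t --> t < s + d --> X t w - X s w < 1"
		using good_path_up_modulus[OF good[of w] zero_less_one N] by (elim exE conjE)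
	have "(%p. N * (1 / 2) ^ p) ----> N * 0" by (intro tendsto_mult tendsto_const LIMSEQ_power_zero) simp
	hence "eventually (%p. N * (1 / 2) ^ p < d) sequentially" using d(1) by (intro order_tendstoD(2)[of _ "N * 0"]) auto
	thus ?thesis
	proof eventually_elim
		case (elim p)
		show ?case
		proof
			assume "jumpy p w"
			then obtain n a b where *: "a <= b" "gt N n b - gt N n a <= N / 2 ^ p" "gt N n b <= N" "1 <= X (gt N n b) w - X (gt N n a) w"
				unfolding jumpy_def by (elim exE conjE)
			have "gt N n a <= gt N n b" by (rule gt_mono[OF *(1)])
			moreover have "N / 2 ^ p < d" using elim by (simp add: power_divide)
			ultimately have "X (gt N n b) w - X (gt N n a) w < 1"
				using *(2,3) by (intro d(2)[rule_format] gt_nonneg) linarith+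
			thus False using *(4) by simp
		qed
	qed
qed

lemma prob_jumpy: "(%p. prob {w\<in>space M. jumpy p w}) ----> 0"
proof -
	let ?J = "%p. {w\<in>space M. jumpy p w}"
	have Jm: "?J p \<in> sets M" for p by measurable
	have "(%p. LINT w|M. indicat_real (?J p) w) ----> integral\<^sup>L M (%w. 0)"
	proof (rule integral_dominated_convergence[where w = "%_. 1"])
		show "AE w in M. (%p. indicat_real (?J p) w) ----> 0"
		proof (rule AE_I2)
			fix w
			have "eventually (%p. indicat_real (?J p) w = 0) sequentially"
				using jumpy_eventually_not[of w] by (rule eventually_mono) simp
			thus "(%p. indicat_real (?J p) w) ----> 0"
				by (rule tendsto_eventually)
		qed
		show "AE w in M. norm (indicat_real (?J p) w) <= 1" for p by (simp add: indicator_def)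
		show "integrable M (%_. 1 :: real)" by (rule integrable_const)
	qed (rule borel_measurable_const borel_measurable_indicator[OF Jm])+
	moreover have "(LINT w|M. indicat_real (?J p) w) = prob (?J p)" for p
		using Jm[of p] by (simp only: integral_indicator) (simp add: Int_absorb2 subset_eq)
	ultimately show ?thesis by simp
qed

text \<open>By right continuity, climbs between dyadic times exhaust all climbs over \<open>[0, N]\<close>.\<close>
definition DU :: "'a => real" where
	"DU w = (SUP (n, a, b)\<in>{(n, a, b). a <= b & b <= 2 ^ n}. X (gt N n b) w - X (gt N n a) w)"

lemma gt_le: "b <= 2 ^ n ==> gt N n b <= N"
proof -
	assume "b <= 2 ^ n"
	hence "real b <= real (2 ^ n)" by (rule of_nat_mono)
	hence "real b <= 2 ^ n" by simp
	hence "real b * N <= 2 ^ n * N" using N by (rule mult_right_mono)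
	thus ?thesis by (simp add: gt_def divide_le_eq mult.commute)
qed

lemma DU_bdd: "bdd_above ((%(n, a, b). X (gt N n b) w - X (gt N n a) w) ` {(n, a, b). a <= b & b <= 2 ^ n})"
proof -
	obtain B where B: "ALL t:{0..N}. \<bar>X t w\<bar> <= B" using cadlag_bounded[OF X_cadlag] by blast
	show ?thesis
	proof (rule bdd_aboveI2)
		fix p :: "nat \<times> nat \<times> nat" assume p: "p \<in> {(n, a, b). a <= b & b <= 2 ^ n}"
		obtain n a b where nab: "p = (n, a, b)" by (cases p)
		have "a <= 2 ^ n" "b <= 2 ^ n" using p nab by auto
		hence "\<bar>X (gt N n b) w\<bar> <= B" "\<bar>X (gt N n a) w\<bar> <= B" using gt_le by (auto intro!: B[rule_format])
		thus "(case p of (n, a, b) => X (gt N n b) w - X (gt N n a) w) <= 2 * B" unfolding nab by simp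
	qed
qed

lemma DU_grid: "a <= b ==> b <= 2 ^ n ==> X (gt N n b) w - X (gt N n a) w <= DU w"
	unfolding DU_def using cSUP_upper[OF _ DU_bdd, of "(n, a, b)"] by simp

lemma DU_measurable [measurable]: "DU \<in> borel_measurable M"
	unfolding DU_def[abs_def]
proof (rule borel_measurable_cSUP)
	fix p :: "nat \<times> nat \<times> nat"
	show "(%w. case p of (n, a, b) => X (gt N n b) w - X (gt N n a) w) \<in> borel_measurable M"
		by (cases p) simp
qed (auto intro: DU_bdd)

lemma DU_ge:
	assumes st: "0 <= s" "s <= t" "t <= N"
	shows "X t w - X s w <= DU w"
proof (cases "N = 0")
	case True
	hence "s = t" using st by simp
	thus ?thesis using DU_grid[of 0 0 0] by simp
next
	case False
	hence N0: "0 < N" using N by simp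
	define c where "c n u = nat \<lceil>u * 2 ^ n / N\<rceil>" for n u
	have c1: "u <= gt N n (c n u)" "gt N n (c n u) <= u + N * (1 / 2) ^ n" if "0 <= u" for n u
	proof -
		have "0 <= u * 2 ^ n / N" using that N0 by simp
		hence "u * 2 ^ n / N <= real (c n u)" "real (c n u) <= u * 2 ^ n / N + 1" unfolding c_def by linarith+
		thus "u <= gt N n (c n u)" "gt N n (c n u) <= u + N * (1 / 2) ^ n"
			using N0 by (simp_all add: gt_def field_simps)
	qed
	have lim: "(%n. X (gt N n (c n u)) w) ----> X u w" if "0 <= u" for u
	proof -
		have "(%n. u + N * (1 / 2) ^ n) ----> u + N * 0" by (intro tendsto_intros LIMSEQ_power_zero) simp
		hence t: "(%n. gt N n (c n u)) ----> u"
			by (intro tendsto_sandwich[of "%_. u" "%n. gt N n (c n u)" _ "%n. u + N * (1 / 2) ^ n"])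
				(use c1[OF that] in "auto intro: always_eventually")
		have "((%v. X v w) \<longlongrightarrow> X u w) (at u within {u..})"
			using X_cadlag[of w] that by (simp add: cadlag_def at_within_Ici_at_right)
		hence "continuous (at u within {u..}) (%v. X v w)" by (simp add: continuous_within)
		thus ?thesis
			using t c1(1)[OF that] unfolding continuous_within_sequentially comp_def by (auto intro!: always_eventually)
	qed
	have "c n s <= c n t" "c n t <= 2 ^ n" for n
	proof -
		have "s * 2 ^ n / N <= t * 2 ^ n / N" using st N0 by (intro divide_right_mono mult_right_mono) auto
		thus "c n s <= c n t" unfolding c_def by (intro nat_mono ceiling_mono)
		have "t * 2 ^ n / N <= 2 ^ n" using st N0 by (simp add: field_simps)
		hence "\<lceil>t * 2 ^ n / N\<rceil> <= 2 ^ n" by (simp add: ceiling_le_iff)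
		thus "c n t <= 2 ^ n" unfolding c_def by (simp add: nat_le_iff)
	qed
	hence "X (gt N n (c n t)) w - X (gt N n (c n s)) w <= DU w" for n by (rule DU_grid)
	moreover have "(%n. X (gt N n (c n t)) w - X (gt N n (c n s)) w) ----> X t w - X s w"
		using st by (intro tendsto_diff lim) auto
	ultimately show ?thesis by (intro LIMSEQ_le_const2) auto
qed

lemma DU_nonneg: "0 <= DU w"
	using DU_grid[of 0 0 0] by simp

lemma gt_refine: "n <= m ==> gt N m (a * 2 ^ (m - n)) = gt N n a"
proof -
	assume "n <= m"
	hence "(2 :: real) ^ m = 2 ^ (m - n) * 2 ^ n" by (simp add: power_add[symmetric])
	thus ?thesis by (simp add: gt_def)
qed

text \<open>\<open>[0, N]\<close> is cut into \<open>2 ^ p\<close> blocks, so short that a climb of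
  \<open>1\<close> within a block is unlikely. The resulting bound on the product of block weights
  does not depend on the dyadic level, and Fatou's lemma removes the grid. These moments dominate
  the limits under the integral in the later sections.\<close>

lemma DU_exp:
	assumes th: "0 <= th"
	shows "integrable M (%w. exp (th * DU w))"
proof -
	\<comment> \<open>The largest value that the geometric series of \<open>weight_integral\<close>
	  permits.\<close>
	define rh where "rh = exp (- 2 * th) / 2"
	have "0 < rh" by (simp add: rh_def)
	have small: "exp (2 * th) * rh <= 1 / 2" by (simp add: rh_def exp_minus field_simps)
	have "eventually (%p. prob {w\<in>space M. jumpy p w} < rh) sequentially"
		using prob_jumpy `0 < rh` by (rule order_tendstoD(2))
	then obtain p where p: "prob {w\<in>space M. jumpy p w} < rh" by (auto simp: eventually_sequentially)
	define l where "l n = (2 :: nat) ^ (n - p)" for n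
	define W where "W n = weights th n (l n) (2 ^ p)" for n
	have lp: "2 ^ p * l n = 2 ^ n" if "p <= n" for n using that by (simp add: l_def power_add[symmetric])
	define K where "K = ennreal (2 * exp (2 * th)) ^ 2 ^ p"
	have WK: "(\<integral>\<^sup>+w. W n w \<partial>M) <= K" if n: "p <= n" for n
		unfolding W_def K_def
	proof (rule weights_integral[OF _ th small])
		fix i j assume ij: "i < 2 ^ p" "i * l n <= j" "j <= Suc i * l n"
		have "prob {w\<in>space M. hi N n j (Suc i * l n) 1 w} <= prob {w\<in>space M. jumpy p w}"
		proof (rule finite_measure_mono)
			have "jumpy p w" if "hi N n j (Suc i * l n) 1 w" for w
			proof -
				obtain a b where ab: "j <= a" "a <= b" "b <= Suc i * l n" "1 <= X (gt N n b) w - X (gt N n a) w"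
					using `hi N n j (Suc i * l n) 1 w` unfolding hi_def by (elim exE conjE)
				have "b <= a + 2 ^ (n - p)" using ab ij by (simp add: l_def)
				hence "gt N n b - gt N n a <= N / 2 ^ p" by (rule gt_diff[OF n])
				moreover have "Suc i * l n <= 2 ^ p * l n" using ij by (intro mult_le_mono1) simp
				hence "gt N n b <= N" using ab(3) lp[OF n] by (intro gt_le) linarith
				ultimately show ?thesis unfolding jumpy_def using ab(2,4) by blast
			qed
			thus "{w\<in>space M. hi N n j (Suc i * l n) 1 w} <= {w\<in>space M. jumpy p w}" by blast
		qed measurable
		thus "prob {w\<in>space M. hi N n j (Suc i * l n) 1 w} <= rh" using p by linarith
	qed
	have le: "ennreal (exp (th * DU w)) <= liminf (%n. W n w)" for w
	proof -
		have pair: "ennreal (exp (th * (X (gt N n0 b) w - X (gt N n0 a) w))) <= liminf (%n. W n w)"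
			if ab: "a <= b" "b <= 2 ^ n0" for n0 a b
		proof (rule Liminf_bounded)
			obtain n1 where n1: "!!n. n1 <= n ==> ~ jumpy n w"
				using jumpy_eventually_not[of w] unfolding eventually_sequentially by blast
			have "ennreal (exp (th * (X (gt N n0 b) w - X (gt N n0 a) w))) <= W n w"
				if n: "max n1 (max n0 p) <= n" for n
			proof -
				have "ok N n 0 (2 ^ p * l n) w"
					unfolding ok_def
				proof (intro allI impI)
					fix e assume e: "0 <= e & e < 2 ^ p * l n"
					have "~ jumpy n w" using n1 n by simp
					moreover have "gt N n (Suc e) - gt N n e <= N / 2 ^ n" by (rule gt_diff) auto
					moreover have "gt N n (Suc e) <= N" using e lp[of n] n by (intro gt_le) simp
					ultimately show "X (gt N n (Suc e)) w - X (gt N n e) w <= 1"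
						unfolding jumpy_def by (metis le_SucI order_refl linear)
				qed
				moreover have "b * 2 ^ (n - n0) <= 2 ^ p * l n"
				proof -
					have "b * 2 ^ (n - n0) <= 2 ^ n0 * 2 ^ (n - n0)" using ab by (intro mult_le_mono1)
					also have "... = 2 ^ n" using n by (simp add: power_add[symmetric])
					finally show ?thesis using lp[of n] n by simp
				qed
				ultimately have "ennreal (exp (th * (X (gt N n (b * 2 ^ (n - n0))) w - X (gt N n (a * 2 ^ (n - n0))) w))) <= W n w"
					unfolding W_def using ab by (intro weights_ge[OF th]) auto
				moreover have "n0 <= n" using n by simp
				ultimately show ?thesis by (simp only: gt_refine)
			qed
			thus "\<forall>\<^sub>F n in sequentially. ennreal (exp (th * (X (gt N n0 b) w - X (gt N n0 a) w))) <= W n w"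
				unfolding eventually_sequentially by blast
		qed
		have "ennreal (exp (th * (DU w - 1 / real (Suc j)))) <= liminf (%n. W n w)" for j
		proof -
			have "DU w - 1 / real (Suc j) < DU w" by simp
			then obtain q where q: "q \<in> {(n, a, b). a <= b & b <= 2 ^ n}"
				"DU w - 1 / real (Suc j) < (case q of (n, a, b) => X (gt N n b) w - X (gt N n a) w)"
			proof -
				have "(0, 0, 0) \<in> {(n :: nat, a :: nat, b :: nat). a <= b & b <= 2 ^ n}" by simp
				hence ne: "{(n :: nat, a :: nat, b :: nat). a <= b & b <= 2 ^ n} ~= {}" by blast
				from less_cSUP_iff[OF ne DU_bdd[of w], THEN iffD1, folded DU_def, OF `DU w - 1 / real (Suc j) < DU w`]
				show ?thesis using that by blast
			qed
			obtain n a b where nab: "q = (n, a, b)" by (cases q)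
			have "ennreal (exp (th * (DU w - 1 / real (Suc j)))) <= ennreal (exp (th * (X (gt N n b) w - X (gt N n a) w)))"
				using q(2) th unfolding nab by (intro ennreal_leI) (simp add: mult_left_mono)
			also have "... <= liminf (%n. W n w)" using q(1) unfolding nab by (intro pair) auto
			finally show ?thesis .
		qed
		moreover have "(%j. ennreal (exp (th * (DU w - 1 / real (Suc j))))) ----> ennreal (exp (th * (DU w - 0)))"
			by (intro tendsto_ennrealI tendsto_exp tendsto_mult tendsto_diff tendsto_const mesh_tendsto)
		ultimately show ?thesis by (intro LIMSEQ_le_const2[of "%j. ennreal (exp (th * (DU w - 1 / real (Suc j))))"]) auto
	qed
	have "(\<integral>\<^sup>+w. ennreal (exp (th * DU w)) \<partial>M) <= (\<integral>\<^sup>+w. liminf (%n. W n w) \<partial>M)"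
		by (intro nn_integral_mono le)
	also have "... <= liminf (%n. \<integral>\<^sup>+w. W n w \<partial>M)"
		by (rule nn_integral_liminf) (simp add: W_def)
	also have "... <= K"
	proof -
		have "eventually (%n. (\<integral>\<^sup>+w. W n w \<partial>M) <= K) sequentially"
			using WK unfolding eventually_sequentially by blast
		hence "liminf (%n. \<integral>\<^sup>+w. W n w \<partial>M) <= liminf (%n. K)" by (rule Liminf_mono)
		thus ?thesis by (simp add: Liminf_const)
	qed
	also have "... < \<infinity>" unfolding K_def infinity_ennreal_def by (simp add: power_less_top_ennreal)
	finally show ?thesis by (intro integrableI_bounded) auto
qed

end

end

section \<open>The Laplace exponent and the drift condition\<close>

lemma exp_quadratic_bounds:
	fixes y :: real
	assumes "y <= 0"
	shows "0 <= exp y - 1 - y" "exp y - 1 - y <= y\<^sup>2"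
proof -
	show "0 <= exp y - 1 - y" using exp_ge_add_one_self[of y] by linarith
	have "1 - y <= exp (- y)" using exp_ge_add_one_self[of "- y"] by simp
	hence "(1 - y) * exp y <= exp (- y) * exp y" by (intro mult_right_mono) auto
	hence A: "(1 - y) * exp y <= 1" by (simp add: exp_minus)
	have "0 <= exp y - 1 - y" using exp_ge_add_one_self[of y] by linarith
	hence "0 <= (- y) * (exp y - 1 - y)" using assms by (intro mult_nonneg_nonneg) auto
	hence "(exp y - 1 - y) <= (1 - y) * (exp y - 1 - y)" by (simp add: algebra_simps)
	also have "... <= y\<^sup>2" using A by (simp add: algebra_simps power2_eq_square)
	finally show "exp y - 1 - y <= y\<^sup>2" .
qed

text \<open>Divide the bound on the exponent by \<open>th = n + 1\<close> and let \<open>n\<close>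
  tend to infinity. On \<open>(-1, 0)\<close> the compensated integrand divided by \<open>th\<close>
  tends to the absolute value of \<open>x\<close>, the Gaussian term has the favourable sign, and
  the jumps up to \<open>-1\<close> contribute a bounded amount before the division. Fatou's lemma
  then bounds the integral of the absolute value by \<open>dl - ga\<close>.\<close>

lemma triplet_bv_drift_le:
	assumes nu: "levy_measure_neg nu" and dl: "!!th. 0 <= th ==>
			ga * th + si\<^sup>2 / 2 * th\<^sup>2 + (LINT x:{..<0}|nu. exp (th * x) - 1 - th * x * indicator {-1<..} x) <= dl * th"
	shows "bv_drift ga nu <= dl"
proof -
	have [measurable_cong]: "sets nu = sets borel" and m: "integrable nu (%x. min 1 (x\<^sup>2))"
		using nu by (simp_all add: levy_measure_neg_def)
	define k where "k th x = indicat_real {..<0} x * (exp (th * x) - 1 - th * x * indicator {-1<..} x)" for th x :: real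
	define C where "C = (LINT x|nu. min 1 (x\<^sup>2))"
	define f where "f n x = indicat_real {-1<..<0} x * ((exp (real (Suc n) * x) - 1 - real (Suc n) * x) / real (Suc n))" for n x
	have ki: "integrable nu (k th)" if "0 <= th" for th
	proof (rule integrable_bound[of nu "%x. (1 + th\<^sup>2) * min 1 (x\<^sup>2)"])
		show "integrable nu (%x. (1 + th\<^sup>2) * min 1 (x\<^sup>2))" by (intro integrable_mult_right m)
		show "k th \<in> borel_measurable nu" unfolding k_def by measurable
		show "AE x in nu. norm (k th x) <= norm ((1 + th\<^sup>2) * min 1 (x\<^sup>2))"
		proof (rule AE_I2)
			fix x
			have nn: "0 <= (1 + th\<^sup>2) * min 1 (x\<^sup>2)" by simp
			consider "0 <= x" | "x <= -1" | "-1 < x" "x < 0" by linarith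
			hence "\<bar>k th x\<bar> <= (1 + th\<^sup>2) * min 1 (x\<^sup>2)"
			proof cases
				case 1
				thus ?thesis using nn by (simp add: k_def)
			next
				case 2
				have "1 <= x\<^sup>2" using power_mono[of 1 "- x" 2] 2 by simp
				moreover have "0 < exp (th * x)" "exp (th * x) <= 1" using 2 that by (auto simp: mult_nonneg_nonpos)
				moreover have "0 <= th\<^sup>2" by simp
				moreover have "k th x = exp (th * x) - 1" using 2 by (simp add: k_def)
				ultimately have "\<bar>k th x\<bar> <= 1 + th\<^sup>2" by linarith
				thus ?thesis using `1 <= x\<^sup>2` by simp
			next
				case 3
				hence "th * x <= 0" using that by (simp add: mult_nonneg_nonpos)
				from exp_quadratic_bounds[OF this] have "\<bar>k th x\<bar> <= th\<^sup>2 * x\<^sup>2"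
					using 3 by (simp add: k_def power_mult_distrib)
				also have "... <= (1 + th\<^sup>2) * x\<^sup>2" by (simp add: algebra_simps)
				also have "x\<^sup>2 = min 1 (x\<^sup>2)" using 3 abs_square_le_1[of x] by simp
				finally show ?thesis .
			qed
			thus "norm (k th x) <= norm ((1 + th\<^sup>2) * min 1 (x\<^sup>2))" by simp
		qed
	qed
	have f_meas [measurable]: "f n \<in> borel_measurable nu" for n unfolding f_def by measurable
	have f0: "0 <= f n x" for n x
	proof (cases "x \<in> {-1<..<0}")
		case True
		hence "real (Suc n) * x <= 0" by (intro mult_nonneg_nonpos) auto
		thus ?thesis using exp_quadratic_bounds(1)[of "real (Suc n) * x"] True by (simp add: f_def del: of_nat_Suc)
	qed (simp add: f_def)
	\<comment> \<open>The added minimum equals \<open>1\<close> for \<open>x <= -1\<close>, where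
	  \<open>k\<close> can be as low as \<open>-1\<close>; after the division its contribution vanishes
	  in the limit.\<close>
	have fk: "f n x <= (k (real (Suc n)) x + min 1 (x\<^sup>2)) / real (Suc n)" for n x
	proof -
		consider "0 <= x" | "x <= -1" | "-1 < x" "x < 0" by linarith
		hence "real (Suc n) * f n x <= k (real (Suc n)) x + min 1 (x\<^sup>2)"
		proof cases
			case 1
			thus ?thesis by (simp add: k_def f_def)
		next
			case 2
			have "1 <= x\<^sup>2" using power_mono[of 1 "- x" 2] 2 by simp
			thus ?thesis using 2 by (simp add: k_def f_def)
		next
			case 3
			thus ?thesis by (simp add: k_def f_def del: of_nat_Suc)
		qed
		thus ?thesis by (simp add: field_simps del: of_nat_Suc)
	qed
	have fi: "integrable nu (f n)" for n
	proof (rule integrable_bound[of nu "%x. (k (real (Suc n)) x + min 1 (x\<^sup>2)) / real (Suc n)"])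
		show "integrable nu (%x. (k (real (Suc n)) x + min 1 (x\<^sup>2)) / real (Suc n))"
			by (intro integrable_divide integrable_add ki m) simp
		show "AE x in nu. norm (f n x) <= norm ((k (real (Suc n)) x + min 1 (x\<^sup>2)) / real (Suc n))"
			unfolding real_norm_def abs_of_nonneg[OF f0] by (intro AE_I2 order_trans[OF fk abs_ge_self])
	qed measurable
	have If: "(LINT x|nu. f n x) <= dl - ga + C / real (Suc n)" for n
	proof -
		let ?n = "real (Suc n)"
		have "(LINT x|nu. f n x) <= (LINT x|nu. (k ?n x + min 1 (x\<^sup>2)) / ?n)"
			by (intro integral_mono fi fk integrable_divide integrable_add ki m) simp
		also have "... = ((LINT x|nu. k ?n x) + C) / ?n"
			unfolding C_def using ki[of ?n] m by (simp add: integral_add)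
		also have "(LINT x|nu. k ?n x) <= (dl - ga) * ?n"
		proof -
			have "(LINT x|nu. k ?n x) = (LINT x:{..<0}|nu. exp (?n * x) - 1 - ?n * x * indicator {-1<..} x)"
				by (simp add: k_def set_lebesgue_integral_def)
			moreover have "0 <= si\<^sup>2 / 2 * ?n\<^sup>2" by simp
			moreover have "(dl - ga) * ?n = dl * ?n - ga * ?n" by (rule left_diff_distrib)
			moreover have "0 <= ?n" by simp
			ultimately show ?thesis using dl[of ?n] by linarith
		qed
		hence "((LINT x|nu. k ?n x) + C) / ?n <= ((dl - ga) * ?n + C) / ?n" by (intro divide_right_mono) auto
		also have "... = dl - ga + C / ?n" by (simp add: add_divide_distrib del: of_nat_Suc)
		finally show ?thesis .
	qed
	have f_lim: "(%n. f n x) ----> indicat_real {-1<..<0} x * \<bar>x\<bar>" for x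
	proof (cases "x \<in> {-1<..<0}")
		case True
		have "(%n. (exp (real (Suc n) * x) - 1) / real (Suc n)) ----> 0"
		proof (rule Lim_null_comparison[OF always_eventually[OF allI]])
			fix n
			have "real (Suc n) * x <= 0" using True by (intro mult_nonneg_nonpos) auto
			hence "\<bar>exp (real (Suc n) * x) - 1\<bar> <= 1" by (simp add: abs_if del: of_nat_Suc)
			thus "norm ((exp (real (Suc n) * x) - 1) / real (Suc n)) <= mesh n"
				by (simp add: divide_right_mono del: of_nat_Suc)
		qed (intro mesh_tendsto)
		hence "(%n. (exp (real (Suc n) * x) - 1) / real (Suc n) - x) ----> 0 - x" by (intro tendsto_diff tendsto_const)
		moreover have "f n x = (exp (real (Suc n) * x) - 1) / real (Suc n) - x" for n
			using True by (simp add: f_def diff_divide_distrib del: of_nat_Suc)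
		ultimately show ?thesis using True by simp
	qed (simp add: f_def)
	have "(\<integral>\<^sup>+x. ennreal (indicat_real {-1<..<0} x * \<bar>x\<bar>) \<partial>nu) = (\<integral>\<^sup>+x. liminf (%n. ennreal (f n x)) \<partial>nu)"
	proof (rule nn_integral_cong)
		fix x
		have "(%n. ennreal (f n x)) ----> ennreal (indicat_real {-1<..<0} x * \<bar>x\<bar>)" by (intro tendsto_ennrealI f_lim)
		from lim_imp_Liminf[OF _ this] show "ennreal (indicat_real {-1<..<0} x * \<bar>x\<bar>) = liminf (%n. ennreal (f n x))" by simp
	qed
	also have "... <= liminf (%n. \<integral>\<^sup>+x. ennreal (f n x) \<partial>nu)" by (rule nn_integral_liminf) measurable
	also have "... <= liminf (%n. ennreal (dl - ga + C / real (Suc n)))"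
		by (intro Liminf_mono always_eventually allI) (simp add: nn_integral_eq_integral[OF fi AE_I2[OF f0]] ennreal_leI If del: of_nat_Suc)
	also have "... = ennreal (dl - ga)"
	proof -
		have "(%n. C * mesh n) ----> C * 0" by (intro tendsto_mult tendsto_const mesh_tendsto)
		hence "(%n. dl - ga + C / real (Suc n)) ----> dl - ga + 0" by (intro tendsto_add tendsto_const) simp
		hence "(%n. ennreal (dl - ga + C / real (Suc n))) ----> ennreal (dl - ga)" by (intro tendsto_ennrealI) simp
		from lim_imp_Liminf[OF _ this] show ?thesis by simp
	qed
	finally have le: "(\<integral>\<^sup>+x. ennreal (indicat_real {-1<..<0} x * \<bar>x\<bar>) \<partial>nu) <= ennreal (dl - ga)" .
	have dg: "0 <= dl - ga"
	proof (rule LIMSEQ_le_const)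
		show "(%n. dl - ga + C * mesh n) ----> dl - ga"
		proof -
			have "(%n. dl - ga + C * mesh n) ----> dl - ga + C * 0" by (intro tendsto_intros mesh_tendsto)
			thus ?thesis by simp
		qed
		have "0 <= dl - ga + C * mesh n" for n
			using order_trans[OF integral_nonneg_AE[OF AE_I2[OF f0]] If[of n]] by simp
		thus "EX N. ALL n>=N. 0 <= dl - ga + C * mesh n" by blast
	qed
	have i: "integrable nu (%x. indicat_real {-1<..<0} x * \<bar>x\<bar>)"
		using le by (intro integrableI_bounded) (auto simp: abs_mult le_less_trans[OF _ ennreal_less_top])
	have "(LINT x|nu. indicat_real {-1<..<0} x * \<bar>x\<bar>) <= dl - ga"
		using le dg unfolding nn_integral_eq_integral[OF i AE_I2[of nu "%x. 0 <= indicat_real {-1<..<0} x * \<bar>x\<bar>"], simplified]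
		by (simp add: ennreal_le_iff)
	moreover have "(LINT x|nu. indicat_real {-1<..<0} x * \<bar>x\<bar>) = - (LINT x:{-1<..<0}|nu. x)"
		unfolding set_lebesgue_integral_def integral_minus[symmetric]
		by (intro integral_cong) (auto simp: indicator_def)
	ultimately show ?thesis by (simp add: bv_drift_def)
qed

context good_levy
begin

definition ps :: "real => real" where "ps th = laplace_exponent M X th"

lemma exp_integrable:
	assumes "0 <= t" "0 <= th"
	shows "integrable M (%w. exp (th * X t w))"
proof (rule integrable_bound[OF DU_exp[OF assms]])
	show "AE w in M. norm (exp (th * X t w)) <= norm (exp (th * DU t w))"
		using DU_ge[OF assms(1) order_refl assms(1) order_refl] assms(2) by (intro AE_I2) (simp add: mult_left_mono)
qed measurable

lemma exp_moment_add:
	assumes "0 <= s" "0 <= t" "0 <= th"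
	shows "(LINT w|M. exp (th * X (s + t) w)) = (LINT w|M. exp (th * X s w)) * (LINT w|M. exp (th * X t w))"
proof -
	have st: "0 <= s + t" using assms by simp
	have e: "X s w + (X (s + t) w - X s w) = X (s + t) w" for w by simp
	have sp: "space M \<in> sets (F s)" using sets.top[of "F s"] by simp
	have "(LINT w|M. indicator (space M) w * exp (th * X (s + t) w)) =
		(LINT w|M. indicator (space M) w * (LINT w'|M. exp (th * (X s w + X t w'))))"
		using expectation_increment(1)[OF assms(1,2) sp X_F[OF assms(1) order_refl], of "%x. exp (th * x)"]
			exp_integrable[OF st assms(3)] unfolding e
		by (simp add: integrable_cong[OF refl, of M "%w. indicator (space M) w * exp (th * X (s + t) w)" "%w. exp (th * X (s + t) w)"])
	also have "... = (LINT w|M. exp (th * X s w) * (LINT w'|M. exp (th * X t w')))"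
		by (intro integral_cong) (simp_all add: distrib_left exp_add)
	also have "... = (LINT w|M. exp (th * X s w)) * (LINT w|M. exp (th * X t w))" by simp
	finally show ?thesis
		by (simp add: integral_cong[OF refl, of M "%w. indicator (space M) w * exp (th * X (s + t) w)" "%w. exp (th * X (s + t) w)"])
qed

lemma exp_moment_pos:
	assumes "0 <= t" "0 <= th"
	shows "0 < (LINT w|M. exp (th * X t w))"
proof -
	have "(LINT w|M. exp (th * X t w)) ~= 0"
		using integral_nonneg_eq_0_iff_AE[OF exp_integrable[OF assms]] by (simp add: AE_False)
	moreover have "0 <= (LINT w|M. exp (th * X t w))" by (rule integral_nonneg_AE) simp
	ultimately show ?thesis by linarith
qed

text \<open>Multiplicativity in time determines the moment at rational times. Right-continuity of
  the paths, dominated by the largest climb, extends this to all times.\<close>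

lemma exp_moment:
	assumes "0 <= t" "0 <= th"
	shows "(LINT w|M. exp (th * X t w)) = exp (t * ps th)"
proof -
	define ph where "ph t = (LINT w|M. exp (th * X t w))" for t
	have pos: "0 < ph t" if "0 <= t" for t using exp_moment_pos[OF that assms(2)] by (simp add: ph_def)
	have add: "ph (s + t) = ph s * ph t" if "0 <= s" "0 <= t" for s t using exp_moment_add[OF that assms(2)] by (simp add: ph_def)
	have mult: "ph (real k * t) = ph t ^ k" if "0 <= t" for k t
	proof (induction k)
		case 0
		show ?case by (simp add: ph_def prob_space)
	next
		case (Suc k)
		have "ph (real (Suc k) * t) = ph (real k * t + t)" by (simp add: algebra_simps)
		thus ?case using add[of "real k * t" t] that Suc by simp
	qed
	have p1: "ph 1 = exp (ps th)" using pos[of 1] by (simp add: ps_def laplace_exponent_def ph_def)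
	have rat: "ph (real k / real (Suc n)) = exp (real k / real (Suc n) * ps th)" for k n
	proof -
		have "ph (mesh n) ^ Suc n = ph 1" using mult[of "mesh n" "Suc n"] by simp
		also have "... = exp (ps th / real (Suc n)) ^ Suc n" unfolding p1 exp_of_nat_mult[symmetric] by simp
		finally have "ph (mesh n) = exp (ps th / real (Suc n))"
			by (rule power_inject_base) (use pos[of "mesh n"] in simp_all)
		thus ?thesis using mult[of "mesh n" k] by (simp add: exp_of_nat_mult[symmetric])
	qed
	define k where "k n = nat \<lfloor>real (Suc n) * t\<rfloor> + 1" for n
	have kg: "real (k n) / real (Suc n) = grid n t + mesh n" for n
	proof -
		have "real (k n) = real_of_int \<lfloor>real (Suc n) * t\<rfloor> + 1" using assms(1) unfolding k_def by simp
		thus ?thesis unfolding grid_def by (simp only: add_divide_distrib)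
	qed
	have "(%n. ph (real (k n) / real (Suc n))) ----> ph t"
		unfolding ph_def
	proof (rule integral_dominated_convergence[where w = "%w. exp (th * DU (t + 1) w)"])
		show "integrable M (%w. exp (th * DU (t + 1) w))" using assms by (intro DU_exp) auto
		show "AE w in M. (%n. exp (th * X (real (k n) / real (Suc n)) w)) ----> exp (th * X t w)"
		proof (rule AE_I2)
			fix w
			have "(%n. X (real (k n) / real (Suc n)) w) ----> X t w"
				unfolding kg by (rule grid_up_right_cont) (use X_cadlag[of w] assms in "simp add: cadlag_def")
			thus "(%n. exp (th * X (real (k n) / real (Suc n)) w)) ----> exp (th * X t w)" by (intro tendsto_intros)
		qed
		fix n
		have le: "real (k n) / real (Suc n) <= t + 1"
		proof -
			have "grid n t <= t" by (rule grid_le)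
			moreover have "mesh n <= 1" by simp
			ultimately show ?thesis unfolding kg by linarith
		qed
		have "th * X (real (k n) / real (Suc n)) w <= th * DU (t + 1) w" for w
			using DU_ge[of "t + 1" 0 "real (k n) / real (Suc n)" w] le assms by (intro mult_left_mono) auto
		thus "AE w in M. norm (exp (th * X (real (k n) / real (Suc n)) w)) <= exp (th * DU (t + 1) w)" by simp
	qed measurable
	moreover have "(%n. exp (real (k n) / real (Suc n) * ps th)) ----> exp (t * ps th)"
		unfolding kg by (intro tendsto_intros grid_up_tendsto)
	ultimately show ?thesis unfolding rat ph_def[symmetric] by (rule LIMSEQ_unique)
qed

text \<open>\<open>dl t - xi t\<close> is nondecreasing, and each term of a variation sum is at most
  the corresponding increment of \<open>2 dl t - xi t\<close>.\<close>

lemma finite_variation_if_drift_bound: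
	assumes "0 <= dl" "0 <= T" and le: "!!s t. 0 <= s ==> s <= t ==> xi t - xi s <= dl * (t - s)"
	shows "finite_variation_on 0 T xi"
proof -
	have "(\<Sum>i<n. \<bar>xi (s (Suc i)) - xi (s i)\<bar>) <= 2 * (dl * T) + (dl * T + xi 0 - xi T)"
		if s: "mono s" "range s <= {0..T}" for n :: nat and s :: "nat => real"
	proof -
		have s0: "0 <= s i" "s i <= T" for i using subsetD[OF s(2) rangeI[of s i]] by auto
		have "(\<Sum>i<n. \<bar>xi (s (Suc i)) - xi (s i)\<bar>) <= (\<Sum>i<n. (2 * (dl * s (Suc i)) - xi (s (Suc i))) - (2 * (dl * s i) - xi (s i)))"
		proof (rule sum_mono)
			fix i
			have m: "s i <= s (Suc i)" using s(1) by (simp add: mono_def)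
			hence "0 <= dl * (s (Suc i) - s i)" using assms(1) by simp
			moreover have "xi (s (Suc i)) - xi (s i) <= dl * (s (Suc i) - s i)" by (rule le[OF s0(1) m])
			ultimately show "\<bar>xi (s (Suc i)) - xi (s i)\<bar> <= (2 * (dl * s (Suc i)) - xi (s (Suc i))) - (2 * (dl * s i) - xi (s i))"
				by (simp add: algebra_simps abs_le_iff)
		qed
		also have "... = (2 * (dl * s n) - xi (s n)) - (2 * (dl * s 0) - xi (s 0))" by (rule sum_lessThan_telescope)
		also have "... <= 2 * (dl * T) + (dl * T + xi 0 - xi T)"
		proof -
			have "xi (s 0) - xi 0 <= dl * s 0" using le[OF order_refl s0(1)[of 0]] by simp
			moreover have "xi T - xi (s n) <= dl * T - dl * s n"
				using le[OF s0(1)[of n] s0(2)[of n]] by (simp only: right_diff_distrib)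
			moreover have "dl * s n <= dl * T" "0 <= dl * s 0" "0 <= dl * T" using s0 assms(1,2) by (auto intro: mult_left_mono)
			ultimately show ?thesis by linarith
		qed
		finally show ?thesis .
	qed
	thus ?thesis unfolding finite_variation_on_def by (intro bdd_aboveI) blast
qed

text \<open>Chernoff's bound: \<open>X t\<close> exceeds \<open>dl t + e\<close> with probability at
  most \<open>exp (- th e)\<close> for every \<open>th >= 0\<close>, hence with probability
  \<open>0\<close>. Rational times and right-continuity give all pairs of times at once.\<close>

lemma drift_bound_if_exponent_le:
	assumes le: "!!th. 0 <= th ==> ps th <= dl * th"
	shows "AE w in M. ALL s t. 0 <= s --> s <= t --> X t w - X s w <= dl * (t - s)"
proof -
	let ?c = "%t j. dl * t + mesh j"
	let ?A = "%t j. {w\<in>space M. ?c t j <= X t w}"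
	have zero: "prob (?A t j) = 0" if "0 <= t" for t j
	proof -
		have "prob (?A t j) <= exp (- th / real (Suc j))" if th: "0 <= th" for th
		proof -
			have A: "?A t j \<in> sets M" by measurable
			have "exp (th * (?c t j)) * prob (?A t j) = (LINT w|M. exp (th * (?c t j)) * indicator (?A t j) w)"
				using A by simp
			also have "... <= (LINT w|M. exp (th * X t w))"
			proof (rule integral_mono)
				show "integrable M (%w. exp (th * (?c t j)) * indicator (?A t j) w)"
					using A by (intro integrable_mult_right integrable_real_indicator) (auto simp: emeasure_eq_measure)
				show "exp (th * (?c t j)) * indicator (?A t j) w <= exp (th * X t w)" for w
					using th by (auto simp: indicator_def intro!: mult_left_mono)
			qed (rule exp_integrable[OF `0 <= t` th])
			also have "... = exp (t * ps th)" by (rule exp_moment[OF `0 <= t` th])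
			also have "... <= exp (t * (dl * th))" using le[OF th] `0 <= t` by (simp add: mult_left_mono)
			finally have "exp (th * (?c t j)) * prob (?A t j) <= exp (t * (dl * th))" .
			moreover have "exp (th * (?c t j)) = exp (t * (dl * th)) * exp (th / real (Suc j))"
				unfolding exp_add[symmetric] by (simp add: algebra_simps)
			ultimately have "exp (th / real (Suc j)) * prob (?A t j) <= 1" by (simp add: mult.assoc)
			thus ?thesis by (simp add: exp_minus field_simps)
		qed
		hence b: "prob (?A t j) <= exp (- real m / real (Suc j))" for m :: nat by simp
		have "(%m. exp (- mesh j) ^ m) ----> 0" by (rule LIMSEQ_power_zero) simp
		moreover have "exp (- mesh j) ^ m = exp (- real m / real (Suc j))" for m
			by (simp add: exp_of_nat_mult[symmetric])
		ultimately have "(%m. exp (- real m / real (Suc j))) ----> 0" by simp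
		hence "prob (?A t j) <= 0"
			by (rule LIMSEQ_le_const) (use b in blast)
		thus ?thesis using measure_nonneg[of M "?A t j"] by linarith
	qed
	have one: "AE w in M. X t w <= dl * t" if "0 <= t" for t
	proof -
		have "AE w in M. ALL j. ~ (?c t j <= X t w)"
			unfolding AE_all_countable
		proof
			fix j
			have "?A t j \<in> null_sets M"
				using zero[OF that] by (intro null_setsI) (auto simp: emeasure_eq_measure)
			thus "AE w in M. ~ (?c t j <= X t w)"
				by (rule AE_I') auto
		qed
		thus ?thesis
		proof (rule eventually_mono)
			fix w assume *: "ALL j. ~ (?c t j <= X t w)"
			show "X t w <= dl * t"
			proof (rule ccontr)
				assume "~ ?thesis"
				hence "0 < X t w - dl * t" by simp
				from reals_Archimedean[OF this] obtain j where "inverse (real (Suc j)) < X t w - dl * t" by blast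
				thus False using *[rule_format, of j] by (simp add: inverse_eq_divide)
			qed
		qed
	qed
	have two: "AE w in M. X t w - X s w <= dl * (t - s)" if st: "0 <= s" "s <= t" for s t
	proof -
		have "AE x in distr M borel (X (t - s)). x <= dl * (t - s)"
			using one[of "t - s"] st by (subst AE_distr_iff) auto
		thus ?thesis unfolding stat[OF st, symmetric] by (subst (asm) AE_distr_iff) auto
	qed
	have "AE w in M. ALL q::rat. ALL r::rat. 0 <= real_of_rat q & real_of_rat q <= real_of_rat r -->
			X (real_of_rat r) w - X (real_of_rat q) w <= dl * (real_of_rat r - real_of_rat q)"
		unfolding AE_all_countable using two by (auto simp: AE_conj_iff)
	thus ?thesis
	proof (rule eventually_mono, intro allI impI)
		fix w and s t :: real
		assume *: "ALL q::rat. ALL r::rat. 0 <= real_of_rat q & real_of_rat q <= real_of_rat r -->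
			X (real_of_rat r) w - X (real_of_rat q) w <= dl * (real_of_rat r - real_of_rat q)"
		assume st: "0 <= s" "s <= t"
		define u where "u v n = grid n v + mesh n" for v n
		have ur: "EX q. u v n = real_of_rat q" for v n
			unfolding u_def grid_def
			by (intro exI[of _ "of_int \<lfloor>real (Suc n) * v\<rfloor> / of_nat (Suc n) + 1 / of_nat (Suc n)"])
				(simp add: of_rat_add of_rat_divide del: of_nat_Suc)
		have Xlim: "(%n. X (u v n) w) ----> X v w" if "0 <= v" for v
			unfolding u_def by (rule grid_up_right_cont) (use X_cadlag[of w] that in "simp add: cadlag_def")
		have "X (u t n) w - X (u s n) w <= dl * (u t n - u s n)" for n
		proof -
			have "0 <= u s n" using grid_nonneg[OF st(1), of n] by (simp add: u_def)
			moreover have "u s n <= u t n" unfolding u_def grid_def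
				using st by (intro add_right_mono divide_right_mono) (auto intro!: floor_mono mult_left_mono)
			ultimately show ?thesis using * ur[of s n] ur[of t n] by metis
		qed
		moreover have "(%n. X (u t n) w - X (u s n) w) ----> X t w - X s w" using st by (intro tendsto_diff Xlim) auto
		moreover have "(%n. dl * (u t n - u s n)) ----> dl * (t - s)" unfolding u_def by (intro tendsto_intros grid_up_tendsto)
		ultimately show "X t w - X s w <= dl * (t - s)" by (intro LIMSEQ_le) auto
	qed
qed

text \<open>Otherwise \<open>X t - dl t\<close> would almost surely be nonincreasing. Then the paths
  have bounded variation, so \<open>dl < bv_drift ga nu\<close> by assumption, while
  \<open>triplet_bv_drift_le\<close> gives the opposite inequality. The drift condition of the
  theorem enters through this lemma.\<close>

lemma exponent_exceeds_drift:
	assumes "0 <= dl" "levy_triplet M X ga si nu" "bounded_variation_paths M X ==> dl < bv_drift ga nu"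
	shows "EX th>=0. dl * th < ps th"
proof (rule ccontr)
	assume "~ ?thesis"
	hence le: "!!th. 0 <= th ==> ps th <= dl * th" by force
	have AE: "AE w in M. ALL s t. 0 <= s --> s <= t --> X t w - X s w <= dl * (t - s)"
		by (rule drift_bound_if_exponent_le) (rule le)
	have "bounded_variation_paths M X"
		unfolding bounded_variation_paths_def
		using AE
	proof (rule eventually_mono, intro allI impI)
		fix w T assume *: "ALL s t. 0 <= s --> s <= t --> X t w - X s w <= dl * (t - s)" and T: "0 <= (T :: real)"
		show "finite_variation_on 0 T (%t. X t w)"
			using * by (intro finite_variation_if_drift_bound[OF assms(1) T]) blast
	qed
	hence "dl < bv_drift ga nu" by (rule assms(3))
	moreover have "bv_drift ga nu <= dl"
		by (rule triplet_bv_drift_le) (use assms(2) le in "auto simp: levy_triplet_def ps_def")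
	ultimately show False by simp
qed

lemma climbs:
	assumes "EX th>=0. dl * th < ps th"
	obtains et where "0 < et" "0 < prob {w\<in>space M. et <= X 1 w - dl}"
proof -
	obtain th where th: "0 <= th" "dl * th < ps th" using assms by blast
	have "EX j. 0 < prob {w\<in>space M. mesh j <= X 1 w - dl}"
	proof (rule ccontr)
		assume "~ ?thesis"
		hence z: "prob {w\<in>space M. mesh j <= X 1 w - dl} = 0" for j
			by (metis measure_nonneg less_le)
		have "AE w in M. ALL j. ~ (mesh j <= X 1 w - dl)"
			unfolding AE_all_countable
		proof
			fix j
			have "{w\<in>space M. mesh j <= X 1 w - dl} \<in> null_sets M"
				using z[of j] by (intro null_setsI) (auto simp: emeasure_eq_measure)
			thus "AE w in M. ~ (mesh j <= X 1 w - dl)" by (rule AE_I') auto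
		qed
		hence "AE w in M. exp (th * X 1 w) <= exp (th * dl)"
		proof (rule eventually_mono)
			fix w assume *: "ALL j. ~ (mesh j <= X 1 w - dl)"
			have "X 1 w <= dl"
			proof (rule ccontr)
				assume "~ ?thesis"
				hence "0 < X 1 w - dl" by simp
				from reals_Archimedean[OF this] obtain j where "inverse (real (Suc j)) < X 1 w - dl" by blast
				thus False using *[rule_format, of j] by (simp add: inverse_eq_divide)
			qed
			thus "exp (th * X 1 w) <= exp (th * dl)" using th by (simp add: mult_left_mono)
		qed
		hence "(LINT w|M. exp (th * X 1 w)) <= (LINT w|M. exp (th * dl))"
			using th by (intro integral_mono_AE exp_integrable integrable_const) auto
		hence "exp (1 * ps th) <= exp (th * dl)" using exp_moment[of 1 th] th by (simp add: prob_space)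
		thus False using th by (simp add: mult.commute)
	qed
	then obtain j where "0 < prob {w\<in>space M. mesh j <= X 1 w - dl}" by blast
	thus ?thesis by (intro that[of "mesh j"]) auto
qed

text \<open>With some probability \<open>p > 0\<close> the increment \<open>X 1 - dl\<close> is at
  least \<open>et\<close>, so the exponent of \<open>X t - dl t\<close> is at least
  \<open>th et + ln p\<close>. With \<open>c = q\<close> this yields the range on which the
  transforms of the scale functions are positive.\<close>

lemma exponent_grows:
	assumes "EX th>=0. dl * th < ps th"
	shows "EX th0>=0. ALL th>=th0. c < ps th - dl * th"
proof -
	obtain et where et: "0 < et" "0 < prob {w\<in>space M. et <= X 1 w - dl}" using climbs[OF assms] .
	let ?A = "{w\<in>space M. et <= X 1 w - dl}"
	define p where "p = prob ?A"
	have A: "?A \<in> sets M" by measurable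
	have key: "th * et + ln p <= ps th - dl * th" if th: "0 <= th" for th
	proof -
		have "exp (th * (et + dl)) * p = (LINT w|M. exp (th * (et + dl)) * indicator ?A w)"
			using A by (simp add: p_def)
		also have "... <= (LINT w|M. exp (th * X 1 w))"
		proof (rule integral_mono)
			show "integrable M (%w. exp (th * (et + dl)) * indicator ?A w)"
				using A by (intro integrable_mult_right integrable_real_indicator) (auto simp: emeasure_eq_measure)
			show "exp (th * (et + dl)) * indicator ?A w <= exp (th * X 1 w)" for w
				using th by (auto simp: indicator_def intro!: mult_left_mono)
		qed (rule exp_integrable[OF zero_le_one th])
		also have "... = exp (ps th)" using exp_moment[of 1 th] th by simp
		finally have "ln (exp (th * (et + dl)) * p) <= ln (exp (ps th))"
			using et(2) by (subst ln_le_cancel_iff) (auto simp: p_def)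
		thus ?thesis using et(2) by (simp add: ln_mult p_def algebra_simps)
	qed
	define th0 where "th0 = max 0 ((c - ln p) / et + 1)"
	have "c < ps th - dl * th" if "th0 <= th" for th
	proof -
		have "(c - ln p) / et < th" "0 <= th" using that by (auto simp: th0_def)
		hence "c - ln p < th * et" using et(1) by (simp add: pos_divide_less_eq)
		thus ?thesis using key[OF `0 <= th`] by linarith
	qed
	thus ?thesis by (intro exI[of _ th0]) (auto simp: th0_def)
qed

end

lemma norm_exp_minus_1_le: "norm (exp z - 1) <= norm z * exp (norm z)" for z :: complex
proof -
	have "norm (exp z - exp 0) <= exp (norm z) * norm (z - 0)"
	proof (rule field_differentiable_bound[of "cball 0 (norm z)" exp exp])
		show "norm (exp ww) <= exp (norm z)" if "ww \<in> cball 0 (norm z)" for ww :: complex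
			using that complex_Re_le_cmod[of ww] by (simp add: norm_exp)
		show "(exp has_field_derivative exp ww) (at ww within cball 0 (norm z))" for ww :: complex
			by (rule DERIV_subset[OF DERIV_exp]) simp
	qed auto
	thus ?thesis by (simp add: mult.commute)
qed

lemma exp_abs_le_sum: "exp \<bar>x\<bar> <= exp x + exp (- x)" for x :: real
	by (cases "0 <= x") auto

section \<open>Laplace inversion and Dynkin formulas\<close>

text \<open>Two-sided Laplace transforms on a half-plane are analytic, so vanishing on a real half-line
	forces the characteristic function of an exponentially tilted signed density to vanish.\<close>
lemma laplace_uniqueness:
	fixes D :: "real => real"
	assumes [measurable]: "D \<in> borel_measurable borel"
		and int: "!!th. ka < th ==> integrable lborel (%y. exp (- th * y) * D y)"
		and zero: "!!th. ka < th ==> (LINT y|lborel. exp (- th * y) * D y) = 0"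
	shows "AE y in lborel. D y = 0"
proof -
	let ?H = "{z. ka < Re z}"
	define F where "F z = (CLINT y|lborel. exp (- z * of_real y) * of_real (D y))" for z :: complex
	have nrm: "norm (exp (- z * of_real y) * of_real (D y)) = exp (- Re z * y) * \<bar>D y\<bar>" for z :: complex and y
		by (simp add: norm_mult norm_exp)
	have intc: "complex_integrable lborel (%y. exp (- z * of_real y) * of_real (D y))" if "ka < Re z" for z
	proof (rule integrable_bound[OF int[OF that]])
		show "AE y in lborel. norm (exp (- z * complex_of_real y) * complex_of_real (D y)) <= norm (exp (- Re z * y) * D y)"
			unfolding nrm by (simp add: abs_mult)
	qed measurable
	have F_real: "F (of_real th) = 0" if "ka < th" for th
	proof -
		have "F (of_real th) = (CLINT y|lborel. complex_of_real (exp (- th * y) * D y))"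
			unfolding F_def by (intro integral_cong) (simp_all add: exp_of_real[symmetric])
		also have "... = 0" unfolding integral_complex_of_real zero[OF that] by simp
		finally show ?thesis .
	qed
	have "F holomorphic_on ?H"
		unfolding holomorphic_on_def
	proof
		fix z assume "z \<in> ?H"
		\<comment> \<open>A third of the distance to the boundary: one \<open>et\<close> bounds the
		  displacement of \<open>z\<close>, a second one absorbs the factor \<open>y\<close> produced by
		  the difference quotient, and the transforms at \<open>Re z - 2 * et\<close> and
		  \<open>Re z + 2 * et\<close> still converge.\<close>
		define et where "et = (Re z - ka) / 3"
		have et: "0 < et" "ka < Re z - 2 * et" "ka < Re z + 2 * et"
			using `z \<in> _` by (auto simp: et_def field_simps)
		define F' where "F' = (CLINT y|lborel. - of_real y * exp (- z * of_real y) * of_real (D y))"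
		define ww where "ww y = (exp (- (Re z - 2 * et) * y) * D y) " for y
		define ww' where "ww' y = (exp (- (Re z + 2 * et) * y) * D y) " for y
		let ?B = "%y. (\<bar>ww y\<bar> + \<bar>ww' y\<bar>) / et"
		have "(F has_field_derivative F') (at z)"
			unfolding has_field_derivative_iff tendsto_at_iff_sequentially comp_def
		proof (intro allI impI)
			fix u :: "nat => complex" assume uz: "ALL i. u i \<in> UNIV - {z}" and u: "u ----> z"
			have "eventually (%n. dist (u n) z < min et (Re z - ka)) sequentially"
				using tendstoD[OF u, of "min et (Re z - ka)"] et(1) `z \<in> _` by simp
			then obtain n0 where n0: "!!n. norm (u (n + n0) - z) < min et (Re z - ka)"
				unfolding eventually_sequentially dist_norm by (metis le_add2)
			let ?d = "%n y. exp (- u (n + n0) * of_real y) - exp (- z * of_real y)"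
			let ?g = "%n y. ?d n y / (u (n + n0) - z) * of_real (D y)"
			have Re_u: "ka < Re (u (n + n0))" for n
				using n0[of n] abs_Re_le_cmod[of "u (n + n0) - z"] unfolding minus_complex.simps by linarith
			have "(%n. CLINT y|lborel. ?g n y) ----> F'"
				unfolding F'_def
			proof (rule integral_dominated_convergence[where w = "%y. ?B y"])
				have wi: "integrable lborel ww" "integrable lborel ww'" unfolding ww_def ww'_def by (intro int et)+
				show "integrable lborel (%y. ?B y)"
					using wi by (intro integrable_divide integrable_add integrable_abs)
				show "AE y in lborel. (%n. ?g n y)
						----> - of_real y * exp (- z * of_real y) * of_real (D y)"
				proof (rule AE_I2)
					fix y
					have "((%v. exp (- v * of_real y)) has_field_derivative - of_real y * exp (- z * of_real y)) (at z)"
						by (auto intro!: derivative_eq_intros)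
					hence "(%n. (exp (- u n * of_real y) - exp (- z * of_real y)) / (u n - z)) ----> - of_real y * exp (- z * of_real y)"
						unfolding has_field_derivative_iff tendsto_at_iff_sequentially comp_def using uz u by blast
					thus "(%n. ?g n y)
						----> - of_real y * exp (- z * of_real y) * of_real (D y)"
						by (intro tendsto_mult tendsto_const LIMSEQ_ignore_initial_segment)
				qed
				fix n
				show "AE y in lborel. norm (?g n y) <= ?B y"
				proof (rule AE_I2)
					fix y :: real
					let ?h = "u (n + n0) - z"
					have h: "norm ?h <= et" "0 < norm ?h" using n0[of n] uz by auto
					have "?d n y = exp (- z * of_real y) * (exp (- ?h * of_real y) - 1)"
						by (simp add: right_diff_distrib exp_add[symmetric] algebra_simps)
					hence "norm (?d n y) = exp (- Re z * y) * norm (exp (- ?h * of_real y) - 1)"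
						by (simp add: norm_mult norm_exp)
					also have "... <= exp (- Re z * y) * (norm (- ?h * of_real y) * exp (norm (- ?h * of_real y)))"
						by (intro mult_left_mono norm_exp_minus_1_le) simp
					also have "... <= exp (- Re z * y) * ((norm ?h * \<bar>y\<bar>) * exp (et * \<bar>y\<bar>))"
						using h by (intro mult_left_mono mult_mono) (auto simp: norm_mult mult_right_mono norm_minus_commute)
					finally have a: "norm (?d n y / ?h) <= exp (- Re z * y) * (\<bar>y\<bar> * exp (et * \<bar>y\<bar>))"
						using h(2) by (simp add: norm_divide divide_le_eq mult_ac)
					have "et * \<bar>y\<bar> <= exp (et * \<bar>y\<bar>)" using exp_ge_add_one_self[of "et * \<bar>y\<bar>"] by linarith
					hence "\<bar>y\<bar> <= exp (et * \<bar>y\<bar>) / et" using et(1) by (simp add: le_divide_eq mult.commute)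
					hence "exp (- Re z * y) * (\<bar>y\<bar> * exp (et * \<bar>y\<bar>)) <= exp (- Re z * y) * (exp (et * \<bar>y\<bar>) / et * exp (et * \<bar>y\<bar>))"
						by (intro mult_left_mono mult_right_mono) auto
					also have "... = exp (- Re z * y) * exp \<bar>2 * et * y\<bar> / et"
						using et(1) by (simp add: exp_add[symmetric] abs_mult)
					also have "... <= exp (- Re z * y) * (exp (2 * et * y) + exp (- (2 * et * y))) / et"
						using et(1) exp_abs_le_sum by (intro divide_right_mono mult_left_mono) auto
					also have "... = (exp (- (Re z - 2 * et) * y) + exp (- (Re z + 2 * et) * y)) / et"
						by (simp add: distrib_left exp_add[symmetric] algebra_simps)
					finally have b: "norm (?d n y / ?h) <= (exp (- (Re z - 2 * et) * y) + exp (- (Re z + 2 * et) * y)) / et"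
						using a by linarith
					show "norm (?g n y) <= ?B y"
						using mult_right_mono[OF b, of "\<bar>D y\<bar>"] unfolding ww_def ww'_def norm_mult[of _ "of_real (D y)"]
						by (simp add: abs_mult add_divide_distrib distrib_right)
				qed
			qed measurable
			moreover have "(CLINT y|lborel. ?g n y)
					= (F (u (n + n0)) - F z) / (u (n + n0) - z)" for n
			proof -
				have "F (u (n + n0)) - F z = (CLINT y|lborel. exp (- u (n + n0) * of_real y) * of_real (D y) - exp (- z * of_real y) * of_real (D y))"
					unfolding F_def using `z \<in> _` by (intro integral_diff[symmetric] intc Re_u) simp
				thus ?thesis by (simp only: integral_divide_zero[symmetric] left_diff_distrib times_divide_eq_left)
			qed
			ultimately have "(%n. (F (u (n + n0)) - F z) / (u (n + n0) - z)) ----> F'" by (simp only:)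
			thus "(%n. (F (u n) - F z) / (u n - z)) ----> F'" by (rule LIMSEQ_offset)
		qed
		thus "F field_differentiable at z within ?H"
			using field_differentiable_at_within field_differentiable_def by blast
	qed
	moreover have "open ?H" by (rule open_halfspace_Re_gt)
	moreover have "connected ?H" by (intro convex_connected convex_halfspace_Re_gt)
	moreover have "of_real ` {ka<..} <= ?H" by auto
	moreover have "of_real (ka + 1) \<in> ?H" by simp
	moreover have "complex_of_real (ka + 1) islimpt of_real ` {ka<..}"
	proof -
		have "(%n. of_real (ka + 1 + mesh n)) ----> complex_of_real (ka + 1 + 0)"
			by (intro tendsto_of_real tendsto_add tendsto_const mesh_tendsto)
		moreover have "complex_of_real (ka + 1 + mesh n) \<in> of_real ` {ka<..} - {of_real (ka + 1)}" for n
		proof -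
			have "0 < mesh n" by simp
			hence "ka + 1 + mesh n \<in> {ka<..}" "ka + 1 + mesh n ~= ka + 1"
				unfolding greaterThan_iff by linarith+
			thus ?thesis by (simp only: Diff_iff singleton_iff of_real_eq_iff not_False_eq_True imageI simp_thms)
		qed
		ultimately show ?thesis unfolding islimpt_sequential add_0_right by (intro exI conjI allI)
	qed
	moreover have "F z = 0" if "z \<in> of_real ` {ka<..}" for z using that F_real by auto
	ultimately have F0: "F z = 0" if "ka < Re z" for z
		using analytic_continuation[of F "?H" "of_real ` {ka<..}" "of_real (ka + 1)" z] that by blast
	define th where "th = ka + 1"
	define E where "E y = exp (- th * y) * D y" for y
	have E_meas [measurable]: "E \<in> borel_measurable borel" unfolding E_def by measurable
	have E_int: "integrable lborel E" unfolding E_def by (rule int) (simp add: th_def)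
	have E_zero: "(LINT y|lborel. E y) = 0" unfolding E_def by (rule zero) (simp add: th_def)
	have E_char: "(CLINT y|lborel. iexp (s * y) * of_real (E y)) = 0" for s :: real
	proof -
		have "(CLINT y|lborel. iexp (s * y) * of_real (E y)) = F (of_real th - \<i> * of_real s)"
			unfolding F_def
		proof (intro integral_cong)
			fix y
			have "iexp (s * y) * exp (of_real (- th * y)) = exp (- (of_real th - \<i> * of_real s) * of_real y)"
				unfolding exp_add[symmetric] by (simp add: algebra_simps)
			thus "iexp (s * y) * of_real (E y) = exp (- (of_real th - \<i> * of_real s) * of_real y) * of_real (D y)"
				unfolding E_def of_real_mult exp_of_real[symmetric] by (simp only: mult.assoc[symmetric])
		qed simp
		thus ?thesis using F0[of "of_real th - \<i> * of_real s"] by (simp add: th_def)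
	qed
	define P N where "P y = max (E y) 0" and "N y = max (- E y) 0" for y
	have PN_meas [measurable]: "P \<in> borel_measurable borel" "N \<in> borel_measurable borel" unfolding P_def N_def by measurable
	have PN_int: "integrable lborel P" "integrable lborel N"
		unfolding P_def N_def by (intro integrable_max E_int integrable_zero integrable_minus)+
	have PN: "E y = P y - N y" "0 <= P y" "0 <= N y" for y by (auto simp: P_def N_def)
	define c where "c = (LINT y|lborel. P y)"
	have cN: "(LINT y|lborel. N y) = c"
		using E_zero unfolding PN(1) integral_diff[OF PN_int] c_def by simp
	have c0: "0 <= c" unfolding c_def by (intro integral_nonneg_AE AE_I2 PN)
	have "AE y in lborel. E y = 0"
	proof (cases "c = 0")
		case True
		hence "(LINT y|lborel. P y) = 0" "(LINT y|lborel. N y) = 0" using cN by (simp_all add: c_def)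
		hence "AE y in lborel. P y = 0" "AE y in lborel. N y = 0"
			using integral_nonneg_eq_0_iff_AE[OF PN_int(1) AE_I2[OF PN(2)]]
				integral_nonneg_eq_0_iff_AE[OF PN_int(2) AE_I2[OF PN(3)]] by blast+
		thus ?thesis unfolding PN(1) by eventually_elim simp
	next
		case False
		hence c: "0 < c" using c0 by simp
		\<comment> \<open>The positive and the negative part have the same mass \<open>c\<close>;
		  normalised, they are probability densities with equal characteristic functions.\<close>
		let ?m = "%Q. density lborel (%y. ennreal (Q y / c))"
		have rd: "real_distribution (?m Q)"
			if Q: "integrable lborel Q" "(LINT y|lborel. Q y) = c" "!!y. 0 <= Q y" for Q
		proof -
			have [measurable]: "Q \<in> borel_measurable borel" using borel_measurable_integrable[OF Q(1)] by simp
			have "(\<integral>\<^sup>+y. ennreal (Q y / c) \<partial>lborel) = 1"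
				using Q c by (subst nn_integral_eq_integral) auto
			hence "prob_space (?m Q)"
				by (intro prob_spaceI) (simp add: emeasure_density)
			thus ?thesis by (simp add: real_distribution_def real_distribution_axioms_def)
		qed
		have ch: "char (?m Q) s = (CLINT y|lborel. iexp (s * y) * of_real (Q y)) / c"
			if Q: "integrable lborel Q" "!!y. 0 <= Q y" for Q s
		proof -
			have [measurable]: "Q \<in> borel_measurable borel" using borel_measurable_integrable[OF Q(1)] by simp
			have "char (?m Q) s = (CLINT y|lborel. (Q y / c) *\<^sub>R iexp (s * y))"
				unfolding char_def using Q c by (intro integral_density) auto
			also have "... = (CLINT y|lborel. iexp (s * y) * of_real (Q y) / c)"
				by (intro integral_cong) (simp_all add: scaleR_conv_of_real)
			finally show ?thesis by simp
		qed
		have iQ: "complex_integrable lborel (%y. iexp (s * y) * of_real (Q y))"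
			if Q: "integrable lborel Q" for s Q
		proof (rule integrable_bound[OF Q])
			have [measurable]: "Q \<in> borel_measurable borel" using borel_measurable_integrable[OF Q(1)] by simp
			show "(%y. iexp (s * y) * of_real (Q y)) \<in> borel_measurable lborel" by measurable
		qed (simp add: norm_mult)
		have "char (?m P) = char (?m N)"
		proof
			fix s
			have "(CLINT y|lborel. iexp (s * y) * of_real (P y)) - (CLINT y|lborel. iexp (s * y) * of_real (N y)) = 0"
				unfolding integral_diff[OF iQ[OF PN_int(1)] iQ[OF PN_int(2)], symmetric]
				using E_char[of s] unfolding PN(1) by (simp add: algebra_simps)
			thus "char (?m P) s = char (?m N) s"
				using ch[OF PN_int(1) PN(2)] ch[OF PN_int(2) PN(3)] by simp
		qed
		hence "?m P = ?m N"
			by (intro Levy_uniqueness rd PN_int PN cN) (simp add: c_def)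
		hence "AE y in lborel. ennreal (P y / c) = ennreal (N y / c)"
			by (intro sigma_finite_measure.density_unique[OF sigma_finite_lborel]) auto
		thus ?thesis
		proof eventually_elim
			case (elim y)
			hence "P y / c = N y / c" using PN c by simp
			thus ?case using c PN(1)[of y] by simp
		qed
	qed
	thus ?thesis by eventually_elim (simp add: E_def)
qed

section \<open>Transforms and convolutions of functions supported on the half-line\<close>

definition exp_bdd :: "real => (real => real) => bool" where
	"exp_bdd ka H \<longleftrightarrow> H \<in> borel_measurable borel & (ALL x<0. H x = 0) & (EX C>=0. ALL x. \<bar>H x\<bar> <= C * exp (ka * x))"

definition laplace :: "(real => real) => real => real" where
	"laplace H th = (LINT x|lborel. exp (- th * x) * H x)"

text \<open>Scale functions may jump at \<open>0\<close>, \<open>Heaviside\<close> does, and the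
  restriction of \<open>W\<close> to \<open>[0, b)\<close> may jump at \<open>b\<close>;
  right-continuity accommodates them all. It also turns an identity valid almost everywhere into one
  valid everywhere, see \<open>rcont_AE_zero\<close>.\<close>

definition rcont :: "(real => real) => bool" where
	"rcont H \<longleftrightarrow> (ALL x. (H \<longlongrightarrow> H x) (at_right x))"

lemma exp_bdd_measurable: "exp_bdd ka H ==> H \<in> borel_measurable borel"
	by (simp add: exp_bdd_def)

lemma exp_bdd_neg: "exp_bdd ka H ==> x < 0 ==> H x = 0"
	by (simp add: exp_bdd_def)

lemma exp_bddD: "exp_bdd ka H ==> EX C>=0. ALL x. \<bar>H x\<bar> <= C * exp (ka * x)"
	by (simp add: exp_bdd_def)

lemma exp_bdd_mono:
	assumes "exp_bdd ka H" "ka <= ka'"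
	shows "exp_bdd ka' H"
proof -
	obtain C where C: "0 <= C" "!!x. \<bar>H x\<bar> <= C * exp (ka * x)" using exp_bddD[OF assms(1)] by blast
	have "\<bar>H x\<bar> <= C * exp (ka' * x)" for x
	proof (cases "x < 0")
		case True
		thus ?thesis using exp_bdd_neg[OF assms(1)] C by simp
	next
		case False
		hence "C * exp (ka * x) <= C * exp (ka' * x)" using C assms(2) by (simp add: mult_left_mono mult_right_mono)
		thus ?thesis using C(2)[of x] by linarith
	qed
	thus ?thesis using assms(1) C(1) unfolding exp_bdd_def by blast
qed

lemma exp_bdd_add:
	assumes "exp_bdd ka H" "exp_bdd ka K"
	shows "exp_bdd ka (%x. H x + K x)"
proof -
	obtain C where C: "0 <= C" "!!x. \<bar>H x\<bar> <= C * exp (ka * x)" using exp_bddD[OF assms(1)] by blast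
	obtain D where D: "0 <= D" "!!x. \<bar>K x\<bar> <= D * exp (ka * x)" using exp_bddD[OF assms(2)] by blast
	have "\<bar>H x + K x\<bar> <= (C + D) * exp (ka * x)" for x
		using C(2)[of x] D(2)[of x] abs_triangle_ineq[of "H x" "K x"] by (simp add: distrib_right)
	moreover have "(%x. H x + K x) \<in> borel_measurable borel"
		using assms by (intro borel_measurable_add) (auto simp: exp_bdd_def)
	ultimately show ?thesis using C D exp_bdd_neg[OF assms(1)] exp_bdd_neg[OF assms(2)] unfolding exp_bdd_def
		by (intro conjI exI[of _ "C + D"]) auto
qed

lemma exp_bdd_cmult:
	assumes "exp_bdd ka H"
	shows "exp_bdd ka (%x. c * H x)"
proof -
	obtain C where C: "0 <= C" "!!x. \<bar>H x\<bar> <= C * exp (ka * x)" using exp_bddD[OF assms(1)] by blast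
	have "\<bar>c * H x\<bar> <= (\<bar>c\<bar> * C) * exp (ka * x)" for x
		using mult_left_mono[OF C(2)[of x], of "\<bar>c\<bar>"] by (simp add: abs_mult mult.assoc)
	moreover have "0 <= \<bar>c\<bar> * C" using C(1) by simp
	moreover have "(%x. c * H x) \<in> borel_measurable borel"
		by (rule borel_measurable_times[OF borel_measurable_const exp_bdd_measurable[OF assms]])
	moreover have "ALL x<0. c * H x = 0" using exp_bdd_neg[OF assms(1)] by simp
	ultimately show ?thesis unfolding exp_bdd_def by blast
qed

lemma exp_bdd_bounded:
	assumes "H \<in> borel_measurable borel" "!!x. x < 0 ==> H x = 0" "!!x. \<bar>H x\<bar> <= C" "0 <= ka"
	shows "exp_bdd ka H"
proof -
	have "0 <= C" using assms(3)[of 0] by linarith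
	have "\<bar>H x\<bar> <= C * exp (ka * x)" for x
	proof (cases "x < 0")
		case False
		hence "C * 1 <= C * exp (ka * x)" using assms(4) `0 <= C` by (intro mult_left_mono) auto
		thus ?thesis using assms(3)[of x] by linarith
	qed (use assms(2) `0 <= C` in simp)
	thus ?thesis using assms `0 <= C` unfolding exp_bdd_def by blast
qed

lemma exp_neg_integrable:
	fixes c :: real
	assumes "0 < c"
	shows "integrable lborel (%x. indicator {0..} x * exp (- c * x))"
		"(LINT x|lborel. indicator {0..} x * exp (- c * x)) = 1 / c"
proof -
	interpret prob_space "density lborel (exponential_density c)" using assms by (rule prob_space_exponential_density)
	have "(\<integral>\<^sup>+x. ennreal (exponential_density c x) \<partial>lborel) = 1"
		using emeasure_space_1 by (simp add: emeasure_density)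
	hence hb: "has_bochner_integral lborel (exponential_density c) 1"
		using assms by (intro has_bochner_integral_nn_integral) (auto simp: exponential_density_def)
	have e: "indicator {0..} x * exp (- c * x) = exponential_density c x / c" for x
		using assms by (simp add: exponential_density_def indicator_def mult.commute)
	show "integrable lborel (%x. indicator {0..} x * exp (- c * x))"
		unfolding e using hb by (intro integrable_divide) (auto simp: has_bochner_integral_iff)
	show "(LINT x|lborel. indicator {0..} x * exp (- c * x)) = 1 / c"
		unfolding e using hb by (simp add: has_bochner_integral_iff)
qed

lemma exp_bdd_integrable:
	assumes "exp_bdd ka H" "ka < th"
	shows "integrable lborel (%x. exp (- th * x) * H x)"
proof -
	obtain C where C: "0 <= C" "!!x. \<bar>H x\<bar> <= C * exp (ka * x)" using exp_bddD[OF assms(1)] by blast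
	have [measurable]: "H \<in> borel_measurable borel" using assms(1) by (rule exp_bdd_measurable)
	show ?thesis
	proof (rule integrable_bound[of _ "%x. C * (indicator {0..} x * exp (- (th - ka) * x))"])
		show "integrable lborel (%x. C * (indicator {0..} x * exp (- (th - ka) * x)))"
			using assms(2) by (intro integrable_mult_right exp_neg_integrable) simp
		show "AE x in lborel. norm (exp (- th * x) * H x) <= norm (C * (indicator {0..} x * exp (- (th - ka) * x)))"
		proof (rule AE_I2)
			fix x :: real
			show "norm (exp (- th * x) * H x) <= norm (C * (indicator {0..} x * exp (- (th - ka) * x)))"
			proof (cases "x < 0")
				case False
				have "exp (- th * x) * \<bar>H x\<bar> <= exp (- th * x) * (C * exp (ka * x))" by (intro mult_left_mono C) simp
				also have "... = C * exp (- (th - ka) * x)" by (simp add: exp_add[symmetric] algebra_simps)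
				finally show ?thesis using False C(1) by (simp add: abs_mult)
			qed (simp add: exp_bdd_neg[OF assms(1)])
		qed
	qed measurable
qed

text \<open>A random shift multiplies the transform by the exponential moment of the shift.
  \<open>N\<close> is merely sigma-finite, so that convolution with a density and integration over
  discounted time are covered as well.\<close>

lemma laplace_convolution:
	fixes U :: "'b => real"
	assumes N: "sigma_finite_measure N" and U [measurable]: "U \<in> borel_measurable N"
		and H: "exp_bdd ka H" "ka < th" and i: "integrable N (%n. exp (th * U n))"
	shows "integrable lborel (%y. exp (- th * y) * (LINT n|N. H (y + U n)))"
		"laplace (%y. LINT n|N. H (y + U n)) th = (LINT n|N. exp (th * U n)) * laplace H th"
proof -
	interpret N: sigma_finite_measure N by (rule N)
	interpret P: pair_sigma_finite N lborel by unfold_locales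
	have [measurable]: "H \<in> borel_measurable borel" using H(1) by (rule exp_bdd_measurable)
	note Hi = exp_bdd_integrable[OF H]
	have e: "exp (- th * y) * H (y + u) = exp (th * u) * (exp (- th * (u + 1 * y)) * H (u + 1 * y))" for u y
		by (simp add: mult.assoc[symmetric] exp_add[symmetric] algebra_simps)
	have i1: "integrable lborel (%y. exp (- th * y) * H (y + u))" for u
		unfolding e by (intro integrable_mult_right lborel_integrable_real_affine[OF Hi]) simp
	have I1: "(LINT y|lborel. exp (- th * y) * H (y + u)) = exp (th * u) * laplace H th" for u
		unfolding e laplace_def using lborel_integral_real_affine[of 1 "%x. exp (- th * x) * H x" u] by simp
	have I2: "(LINT y|lborel. norm (exp (- th * y) * H (y + u))) = exp (th * u) * (LINT x|lborel. norm (exp (- th * x) * H x))" for u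
		unfolding e norm_mult[of "exp (th * u)"] using lborel_integral_real_affine[of 1 "%x. norm (exp (- th * x) * H x)" u] by simp
	have int: "integrable (N \<Otimes> lborel) (%(n, y). exp (- th * y) * H (y + U n))"
	proof (rule P.Fubini_integrable)
		show "(%(n, y). exp (- th * y) * H (y + U n)) \<in> borel_measurable (N \<Otimes> lborel)" by measurable
		show "integrable N (%n. LINT y|lborel. norm (case (n, y) of (n, y) => exp (- th * y) * H (y + U n)))"
			unfolding prod.case I2 using i by (rule integrable_mult_left)
		show "AE n in N. integrable lborel (%y. case (n, y) of (n, y) => exp (- th * y) * H (y + U n))"
			unfolding prod.case using i1 by simp
	qed
	show "integrable lborel (%y. exp (- th * y) * (LINT n|N. H (y + U n)))"
		using P.integrable_snd[OF int] by simp
	have "(LINT y|lborel. exp (- th * y) * (LINT n|N. H (y + U n))) = (LINT n|N. LINT y|lborel. exp (- th * y) * H (y + U n))"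
		using P.Fubini_integral[OF int] by simp
	thus "laplace (%y. LINT n|N. H (y + U n)) th = (LINT n|N. exp (th * U n)) * laplace H th"
		unfolding I1 laplace_def[of "%y. LINT n|N. H (y + U n)"] by simp
qed

lemma convolution_integrable:
	fixes U :: "'b => real"
	assumes U [measurable]: "U \<in> borel_measurable N"
		and H: "exp_bdd ka H" and i: "integrable N (%n. exp (ka * U n))"
	shows "integrable N (%n. H (y + U n))"
proof -
	obtain C where C: "0 <= C" "!!x. \<bar>H x\<bar> <= C * exp (ka * x)" using exp_bddD[OF H] by blast
	have [measurable]: "H \<in> borel_measurable borel" using H by (rule exp_bdd_measurable)
	show ?thesis
	proof (rule integrable_bound[of _ "%n. C * exp (ka * y) * exp (ka * U n)"])
		show "integrable N (%n. C * exp (ka * y) * exp (ka * U n))" using i by (rule integrable_mult_right)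
		show "AE n in N. norm (H (y + U n)) <= norm (C * exp (ka * y) * exp (ka * U n))"
		proof (rule AE_I2)
			fix n
			have "\<bar>H (y + U n)\<bar> <= C * exp (ka * (y + U n))" by (rule C)
			thus "norm (H (y + U n)) <= norm (C * exp (ka * y) * exp (ka * U n))"
				using C(1) by (simp add: abs_mult mult.assoc exp_add[symmetric] distrib_left)
		qed
	qed measurable
qed

lemma rcont_sequentially:
	"rcont H \<longleftrightarrow> (ALL x u. (ALL i. x < u i) --> u ----> x --> (%i. H (u i)) ----> H x)"
	unfolding rcont_def tendsto_at_iff_sequentially comp_def by (auto simp: less_imp_neq[symmetric])

lemma rcont_borel:
	assumes "rcont H"
	shows "H \<in> borel_measurable borel"
proof (rule borel_measurable_LIMSEQ_real[where u = "%n t. H (grid n t + mesh n)"])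
	show "(%n. H (grid n t + mesh n)) ----> H t" for t
		using assms by (intro grid_up_right_cont) (simp add: rcont_def)
	show "(%t. H (grid n t + mesh n)) \<in> borel_measurable borel" for n
		unfolding grid_def
		by (rule measurable_compose_countable'[where I = UNIV and g = "%t. \<lfloor>real (Suc n) * t\<rfloor>"]) (rule borel_measurable_const, measurable)
qed

lemma rcont_convolution:
	fixes U :: "'b => real"
	assumes U [measurable]: "U \<in> borel_measurable N" and ka: "0 <= ka"
		and H: "exp_bdd ka H" and i: "integrable N (%n. exp (ka * U n))" and rc: "rcont H"
	shows "rcont (%y. LINT n|N. H (y + U n))"
	unfolding rcont_sequentially
proof (intro allI impI)
	fix x :: real and u assume u: "ALL i. x < u i" "u ----> x"
	obtain C where C: "0 <= C" "!!x. \<bar>H x\<bar> <= C * exp (ka * x)" using exp_bddD[OF H] by blast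
	have [measurable]: "H \<in> borel_measurable borel" using H by (rule exp_bdd_measurable)
	obtain B where B: "!!i. u i <= B"
		using convergent_imp_Bseq[OF convergentI[OF u(2)]] unfolding Bseq_def real_norm_def by (metis abs_le_D1)
	show "(%i. LINT n|N. H (u i + U n)) ----> (LINT n|N. H (x + U n))"
	proof (rule integral_dominated_convergence[where w = "%n. C * exp (ka * B) * exp (ka * U n)"])
		show "integrable N (%n. C * exp (ka * B) * exp (ka * U n))" using i by (rule integrable_mult_right)
		show "AE n in N. (%i. H (u i + U n)) ----> H (x + U n)"
		proof (rule AE_I2)
			fix n
			have "(%i. u i + U n) ----> x + U n" using u(2) by (intro tendsto_intros)
			thus "(%i. H (u i + U n)) ----> H (x + U n)"
				using rc u(1) unfolding rcont_sequentially by (metis add_less_cancel_right)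
		qed
		show "AE n in N. norm (H (u i + U n)) <= C * exp (ka * B) * exp (ka * U n)" for i
		proof (rule AE_I2)
			fix n
			have "\<bar>H (u i + U n)\<bar> <= C * exp (ka * (u i + U n))" by (rule C)
			also have "... <= C * exp (ka * (B + U n))" using B[of i] ka C(1) by (simp add: mult_left_mono)
			finally show "norm (H (u i + U n)) <= C * exp (ka * B) * exp (ka * U n)"
				by (simp add: mult.assoc exp_add[symmetric] distrib_left)
		qed
	qed measurable
qed

lemma rcont_AE_zero:
	assumes "rcont D" "AE y in lborel. D y = 0"
	shows "D y = 0"
proof (rule ccontr)
	assume n: "D y ~= 0"
	have "(D \<longlongrightarrow> D y) (at_right y)" using assms(1) by (simp add: rcont_def)
	then obtain d where d: "0 < d" "!!z. y < z ==> z < y + d ==> \<bar>D z - D y\<bar> < \<bar>D y\<bar>"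
		using n by (elim dist_small_right[of _ _ _ "\<bar>D y\<bar>"]) auto
	have nz: "D z ~= 0" if "y < z" "z < y + d" for z using d(2)[OF that] by auto
	have "AE z in lborel. z \<notin> {y<..<y + d}"
		using assms(2) by eventually_elim (use nz in auto)
	hence "emeasure lborel {y<..<y + d} = 0"
		by (subst (asm) AE_iff_measurable[OF _ refl]) (auto simp: greaterThanLessThan_def greaterThan_def lessThan_def Int_def conj_commute)
	thus False using d(1) by simp
qed

lemma clip_measurable_right_cont:
	fixes V :: "real => 'a => real"
	assumes "0 <= t" and V: "!!s. 0 <= s ==> s <= t ==> V s \<in> borel_measurable N"
		and rc: "!!s w. 0 <= s ==> ((%s. V s w) \<longlongrightarrow> V s w) (at_right s)"
	shows "(%(s, w). V (min t (max 0 s)) w) \<in> borel_measurable (borel \<Otimes> N)"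
proof (rule borel_measurable_LIMSEQ_real)
	fix n
	have "(%p. V (min t (max 0 (real_of_int \<lfloor>real (Suc n) * fst p\<rfloor> / real (Suc n) + mesh n))) (snd p)) \<in> borel_measurable (borel \<Otimes> N)"
	proof (rule measurable_compose_countable'[where I = UNIV and g = "%p. \<lfloor>real (Suc n) * fst p\<rfloor>"])
		fix i :: int
		have "V (min t (max 0 (real_of_int i / real (Suc n) + mesh n))) \<in> borel_measurable N"
			using assms(1) by (intro V) auto
		thus "(%p. V (min t (max 0 (real_of_int i / real (Suc n) + mesh n))) (snd p)) \<in> borel_measurable (borel \<Otimes> N)"
			by (rule measurable_compose[OF measurable_snd])
	next
		show "(%p. \<lfloor>real (Suc n) * fst p\<rfloor>) \<in> borel \<Otimes> N \<rightarrow>\<^sub>M count_space UNIV" by measurable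
	qed simp
	thus "(%p. V (min t (max 0 (grid n (fst p) + mesh n))) (snd p)) \<in> borel_measurable (borel \<Otimes> N)"
		unfolding grid_def .
next
	fix p :: "real \<times> 'a"
	let ?v = "min t (max 0 (fst p))" and ?u = "%n. min t (max 0 (grid n (fst p) + mesh n))"
	have u: "?u ----> ?v" by (intro tendsto_min tendsto_max tendsto_const grid_up_tendsto)
	have v0: "0 <= ?v" using assms(1) by simp
	have le: "?v <= ?u n" for n using less_imp_le[OF grid_gt[of "fst p" n]] by (intro min.mono max.mono) auto
	have "((%s. V s (snd p)) \<longlongrightarrow> V ?v (snd p)) (at_right ?v)" by (rule rc[OF v0])
	hence "((%s. V s (snd p)) \<longlongrightarrow> V ?v (snd p)) (at ?v within {?v..})"
		by (simp add: at_within_Ici_at_right)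
	hence "continuous (at ?v within {?v..}) (%s. V s (snd p))" by (simp add: continuous_within)
	hence "(%n. V (?u n) (snd p)) ----> V ?v (snd p)"
		using le u unfolding continuous_within_sequentially comp_def by auto
	thus "(%n. V (?u n) (snd p)) ----> (case p of (s, w) => V (min t (max 0 s)) w)"
		by (simp add: case_prod_unfold)
qed

section \<open>Dynkin formulas over deterministic time intervals\<close>

context good_levy
begin

lemma clip_measurable:
	assumes "0 <= t"
	shows "(%(s, w). X (min t (max 0 s)) w) \<in> borel_measurable (borel \<Otimes> M)"
	using X_cadlag by (intro clip_measurable_right_cont[OF assms] X_meas) (auto simp: cadlag_def)

lemma exp_integrable_drift:
	assumes "0 <= s" "0 <= th"
	shows "integrable M (%w. exp (th * (X s w - d * s)))"
		"(LINT w|M. exp (th * (X s w - d * s))) = exp (s * (ps th - d * th))"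
proof -
	have e: "exp (th * (X s w - d * s)) = exp (- th * d * s) * exp (th * X s w)" for w
		by (simp add: exp_add[symmetric] algebra_simps)
	show "integrable M (%w. exp (th * (X s w - d * s)))"
		unfolding e by (intro integrable_mult_right exp_integrable assms)
	show "(LINT w|M. exp (th * (X s w - d * s))) = exp (s * (ps th - d * th))"
		unfolding e integral_mult_right_zero exp_moment[OF assms] by (simp add: exp_add[symmetric] algebra_simps)
qed

lemma integral_exp_Icc:
	fixes c :: real
	assumes "0 <= t"
	shows "c * (LINT s|lborel. indicator {0..t} s * exp (s * c)) = exp (t * c) - 1"
		"integrable lborel (%s. indicator {0..t} s * exp (s * c))"
proof -
	have i: "integrable lborel (%s. indicator {0..t} s *\<^sub>R exp (s * c))"
		by (intro borel_integrable_compact continuous_intros) simp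
	thus i': "integrable lborel (%s. indicator {0..t} s * exp (s * c))" by simp
	have "(LINT s|lborel. indicator {0..t} s *\<^sub>R (c * exp (s * c))) = exp (t * c) - exp (0 * c)"
		by (rule integral_FTC_atLeastAtMost[OF assms])
			(auto intro!: derivative_eq_intros continuous_intros simp: has_real_derivative_iff_has_vector_derivative[symmetric])
	moreover have "(LINT s|lborel. indicator {0..t} s *\<^sub>R (c * exp (s * c))) = (LINT s|lborel. c * (indicator {0..t} s * exp (s * c)))"
		by (intro integral_cong) auto
	ultimately show "c * (LINT s|lborel. indicator {0..t} s * exp (s * c)) = exp (t * c) - 1" by simp
qed

text \<open>\<open>Lap\<close> expresses that \<open>g\<close> is the image of \<open>H\<close>
  under (generator of \<open>X t - d t\<close>) - \<open>q\<close>. After a transform in the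
  starting point \<open>y\<close>, with \<open>c = ps th - d * th - q\<close>, the claim becomes the
  elementary fact that \<open>exp (t * c) - 1\<close> is \<open>c\<close> times the integral of
  \<open>exp (s * c)\<close> over \<open>[0, t]\<close>. \<open>laplace_uniqueness\<close> gives the
  identity for almost every \<open>y\<close>, right-continuity for every \<open>y\<close>.\<close>

lemma resolvent_step:
	assumes t: "0 <= t" and ka: "0 <= ka" and H: "exp_bdd ka H" "rcont H" and g: "exp_bdd ka g" "rcont g"
		and Lap: "!!th. ka < th ==> laplace g th = (ps th - d * th - q) * laplace H th"
	shows "exp (- q * t) * (LINT w|M. H (y + (X t w - d * t))) =
		H y + (LINT s|lborel. disc {0..t} q s * (LINT w|M. g (y + (X s w - d * s))))"
proof -
	let ?G = "%s. LINT w|M. g (y + (X s w - d * s))"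
	\<comment> \<open>Discounted time as a finite measure: the time integral becomes one more random
	  shift, by \<open>U\<close> on \<open>T \<Otimes> M\<close>.\<close>
	define T where "T = density lborel (%s. ennreal (disc {0..t} q s))"
	let ?TM = "T \<Otimes> M"
	define U where "U p = X (min t (max 0 (fst p))) (snd p) - d * fst p" for p
	have [measurable_cong]: "sets T = sets borel" by (simp add: T_def)
	have T_int: "integral\<^sup>L T h = (LINT s|lborel. disc {0..t} q s * h s)"
		and T_integrable: "integrable T h \<longleftrightarrow> integrable lborel (%s. disc {0..t} q s * h s)"
		if "h \<in> borel_measurable borel" for h :: "real => real"
		unfolding T_def using that by (simp_all add: integral_density integrable_density)
	have "emeasure T (space T) ~= \<infinity>"
	proof -
		have "integrable lborel (%s. indicator {0..t} s * exp (s * - q))" by (rule integral_exp_Icc(2)[OF t])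
		hence "(\<integral>\<^sup>+s. ennreal (indicator {0..t} s * exp (s * - q)) \<partial>lborel) < \<infinity>"
			by (simp add: integrable_iff_bounded abs_mult)
		thus ?thesis by (simp add: T_def emeasure_density mult.commute)
	qed
	then interpret T: finite_measure T by (rule finite_measureI)
	interpret P: pair_sigma_finite T M by unfold_locales
	have U_meas: "U \<in> borel_measurable (?TM)"
	proof -
		have "(%(s, w). X (min t (max 0 s)) w) \<in> borel_measurable (borel \<Otimes> M)"
			by (rule clip_measurable[OF t])
		hence [measurable]: "(%p. X (min t (max 0 (fst p))) (snd p)) \<in> borel_measurable (borel \<Otimes> M)"
			by (simp only: case_prod_unfold)
		have "U \<in> borel_measurable (borel \<Otimes> M)" unfolding U_def by measurable
		thus ?thesis by (subst measurable_cong_sets[OF sets_pair_measure_cong[OF `sets T = sets borel` refl] refl])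
	qed
	note U_meas [measurable]
	have U_eq: "U (s, w) = X s w - d * s" if "s \<in> {0..t}" for s w using that by (simp add: U_def)
	have U_exp: "integrable (?TM) (%p. exp (th * U p))"
		and U_exp_int: "(LINT p|(?TM). exp (th * U p)) = (LINT s|lborel. indicator {0..t} s * exp (s * (ps th - d * th - q)))"
		if th: "0 <= th" for th
	proof -
		have m [measurable]: "(%s. LINT w|M. exp (th * U (s, w))) \<in> borel_measurable borel"
			using borel_measurable_lebesgue_integral[of "%s w. exp (th * U (s, w))" T] U_meas by simp
		have e: "disc {0..t} q s * (LINT w|M. exp (th * U (s, w))) = indicator {0..t} s * exp (s * (ps th - d * th - q))" for s
		proof (cases "s \<in> {0..t}")
			case True
			thus ?thesis using exp_integrable_drift(2)[of s th d] th
				by (simp only: U_eq atLeastAtMost_iff indicator_simps) (simp add: exp_add[symmetric] algebra_simps)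
		qed simp
		have AE_T: "AE s in T. s \<in> {0..t}"
			unfolding T_def by (subst AE_density) (auto simp: indicator_def)
		show *: "integrable (?TM) (%p. exp (th * U p))"
		proof (rule P.Fubini_integrable)
			show "(%p. exp (th * U p)) \<in> borel_measurable (?TM)" by measurable
			show "integrable T (%s. LINT w|M. norm (exp (th * U (s, w))))"
				unfolding real_norm_def abs_exp_cancel T_integrable[OF m] e by (rule integral_exp_Icc(2)[OF t])
			show "AE s in T. integrable M (%w. exp (th * U (s, w)))"
				using AE_T
			proof (rule eventually_mono)
				fix s assume s: "s \<in> {0..t}"
				show "integrable M (%w. exp (th * U (s, w)))"
					unfolding U_eq[OF s] using s th by (intro exp_integrable_drift) auto
			qed
		qed
		show "(LINT p|(?TM). exp (th * U p)) = (LINT s|lborel. indicator {0..t} s * exp (s * (ps th - d * th - q)))"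
			unfolding P.integral_fst'[OF *, symmetric] T_int[OF m] e ..
	qed
	have sf: "sigma_finite_measure (?TM)" "sigma_finite_measure M" by unfold_locales
	define Z where "Z w = X t w - d * t" for w
	have Z_meas [measurable]: "Z \<in> borel_measurable M" unfolding Z_def by measurable
	have Z_exp: "integrable M (%w. exp (th * Z w))" "(LINT w|M. exp (th * Z w)) = exp (t * (ps th - d * th))"
		if "0 <= th" for th unfolding Z_def by (rule exp_integrable_drift[OF t that])+
	define I1 where "I1 y = (LINT w|M. H (y + Z w))" for y
	define I2 where "I2 y = (LINT p|(?TM). g (y + U p))" for y
	define D where "D y = exp (- q * t) * I1 y - H y - I2 y" for y
	have r1: "rcont I1" unfolding I1_def by (rule rcont_convolution[OF Z_meas ka H(1) Z_exp(1)[OF ka] H(2)])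
	have r2: "rcont I2" unfolding I2_def by (rule rcont_convolution[OF U_meas ka g(1) U_exp[OF ka] g(2)])
	have D_rcont: "rcont D"
		using r1 r2 H(2) unfolding rcont_def D_def by (intro allI tendsto_diff tendsto_mult tendsto_const) auto
	have D_meas: "D \<in> borel_measurable borel"
		by (rule rcont_borel[OF D_rcont])
	have eD: "exp (- th * y) * D y = exp (- q * t) * (exp (- th * y) * I1 y) - exp (- th * y) * H y - exp (- th * y) * I2 y" for th y
		by (simp add: D_def algebra_simps)
	have "AE y in lborel. D y = 0"
	proof (rule laplace_uniqueness[OF D_meas])
		fix th assume th: "ka < th"
		hence th0: "0 <= th" using ka by simp
		have i1: "integrable lborel (%y. exp (- th * y) * I1 y)" and l1: "laplace I1 th = exp (t * (ps th - d * th)) * laplace H th"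
			unfolding I1_def Z_exp(2)[OF th0, symmetric]
			by (rule laplace_convolution[OF sf(2) Z_meas H(1) th Z_exp(1)[OF th0]])+
		have i2: "integrable lborel (%y. exp (- th * y) * I2 y)" and l2: "laplace I2 th = (LINT p|(?TM). exp (th * U p)) * laplace g th"
			unfolding I2_def
			by (rule laplace_convolution[OF sf(1) U_meas g(1) th U_exp[OF th0]])+
		note i3 = exp_bdd_integrable[OF H(1) th]
		show "integrable lborel (%y. exp (- th * y) * D y)"
			unfolding eD by (intro integrable_diff integrable_mult_right i1 i2 i3)
		let ?c = "ps th - d * th - q"
		have "laplace I2 th = (?c * (LINT s|lborel. indicator {0..t} s * exp (s * ?c))) * laplace H th"
			unfolding l2 U_exp_int[OF th0] Lap[OF th] by (simp add: mult_ac)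
		also have "... = (exp (t * ?c) - 1) * laplace H th" unfolding integral_exp_Icc(1)[OF t] ..
		finally have l2': "laplace I2 th = (exp (t * ?c) - 1) * laplace H th" .
		have "(LINT y|lborel. exp (- th * y) * D y) = exp (- q * t) * laplace I1 th - laplace H th - laplace I2 th"
			unfolding eD laplace_def
			by (simp only: integral_diff integrable_diff integrable_mult_right integral_mult_right_zero i1 i2 i3)
		also have "exp (- q * t) * laplace I1 th = exp (t * ?c) * laplace H th"
			unfolding l1 mult.assoc[symmetric] exp_add[symmetric] by (simp add: algebra_simps)
		finally show "(LINT y|lborel. exp (- th * y) * D y) = 0" unfolding l2' by (simp add: left_diff_distrib)
	qed
	from rcont_AE_zero[OF D_rcont this, of y] have "exp (- q * t) * I1 y = H y + I2 y" by (simp add: D_def)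
	also have "I2 y = (LINT s|lborel. disc {0..t} q s * ?G s)"
	proof -
		have Gm: "g \<in> borel_measurable borel" using g(1) by (rule exp_bdd_measurable)
		have "integrable (?TM) (%p. g (y + U p))" by (rule convolution_integrable[OF U_meas g(1) U_exp[OF ka]])
		hence "I2 y = (LINT s|T. LINT w|M. g (y + U (s, w)))" unfolding I2_def by (rule P.integral_fst'[symmetric])
		also have "... = (LINT s|lborel. disc {0..t} q s * (LINT w|M. g (y + U (s, w))))"
		proof (rule T_int)
			have "(%p. g (y + U p)) \<in> borel_measurable (?TM)"
				by (rule measurable_compose[OF borel_measurable_add[OF borel_measurable_const U_meas] Gm])
			thus "(%s. LINT w|M. g (y + U (s, w))) \<in> borel_measurable borel"
				using borel_measurable_lebesgue_integral[of "%s w. g (y + U (s, w))" T] by simp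
		qed
		also have "... = (LINT s|lborel. disc {0..t} q s * ?G s)"
		proof (rule integral_cong[OF refl])
			fix s show "disc {0..t} q s * (LINT w|M. g (y + U (s, w))) = disc {0..t} q s * ?G s"
				by (cases "s \<in> {0..t}") (simp_all add: U_eq)
		qed
		finally show ?thesis .
	qed
	finally show ?thesis unfolding I1_def Z_def .
qed

lemma increment_integrable:
	assumes t: "0 <= t" "0 <= s" and A: "A \<in> sets (F t)" and U: "U \<in> borel_measurable (F t)"
		and ka: "0 <= ka" and f: "exp_bdd ka f" and i: "integrable M (%w. indicator A w * exp (ka * U w))"
	shows "integrable M (%w. indicator A w * f (U w + (X (t + s) w - X t w - d * s)))"
proof -
	let ?d = "%w. X (t + s) w - X t w"
	let ?g = "%w. indicator A w * exp (ka * U w) * exp (ka * ?d w)"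
	obtain C where C: "0 <= C" "!!x. \<bar>f x\<bar> <= C * exp (ka * x)" using exp_bddD[OF f] by blast
	have [measurable]: "f \<in> borel_measurable borel" "A \<in> sets M" "U \<in> borel_measurable M"
		using exp_bdd_measurable[OF f] A F_sub[of t] measurable_F[OF U] by auto
	have [measurable]: "X t \<in> borel_measurable M" "X (t + s) \<in> borel_measurable M" by (rule X_meas)+
	have iv: "indep_var borel (%w. indicator A w * exp (ka * U w)) borel (%w. exp (ka * ?d w))"
	proof (rule indep_var_FG[OF t(1)])
		show "(%w. indicator A w * exp (ka * U w)) \<in> borel_measurable (F t)" using A U by measurable
		have "?d \<in> borel_measurable (G t)" using t by (intro X_G_diff) auto
		thus "(%w. exp (ka * ?d w)) \<in> borel_measurable (G t)" by measurable
	qed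
	have "integrable M (%w. exp (ka * ?d w))"
	proof -
		have "integrable (distr M borel (X s)) (%x. exp (ka * x))"
			using exp_integrable[OF t(2) ka] by (subst integrable_distr_eq) auto
		thus ?thesis unfolding distr_increment[OF t, symmetric] by (subst (asm) integrable_distr_eq) auto
	qed
	from indep_var_integrable[OF iv i this]
	have i2: "integrable M ?g" .
	show ?thesis
	proof (rule integrable_bound)
		show "integrable M (%w. C * exp (- ka * d * s) * ?g w)"
			using i2 by (rule integrable_mult_right)
		show "(%w. indicator A w * f (U w + (?d w - d * s))) \<in> borel_measurable M" by measurable
		show "AE w in M. norm (indicator A w * f (U w + (?d w - d * s)))
			<= norm (C * exp (- ka * d * s) * ?g w)"
		proof (rule AE_I2)
			fix w
			let ?x = "U w + (?d w - d * s)"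
			have e: "exp (- ka * d * s) * (exp (ka * U w) * exp (ka * ?d w)) = exp (ka * ?x)"
				unfolding exp_add[symmetric] by (simp add: algebra_simps)
			have "\<bar>f ?x\<bar> <= C * exp (ka * ?x)" by (rule C)
			thus "norm (indicator A w * f ?x)
				<= norm (C * exp (- ka * d * s) * ?g w)"
				unfolding e[symmetric] using C(1) by (cases "w \<in> A") (simp_all add: abs_mult mult.assoc)
		qed
	qed
qed

text \<open>\<open>resolvent_step\<close> from the random starting point \<open>U w\<close>,
  averaged over an event of the past; Fubini's theorem then exchanges time and expectation.\<close>

lemma dynkin_step:
	assumes t: "0 <= t" "0 <= h" and A: "A \<in> sets (F t)" and U: "U \<in> borel_measurable (F t)"
		and ka: "0 <= ka" and H: "exp_bdd ka H" "rcont H" and g: "exp_bdd ka g" "rcont g"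
		and Lap: "!!th. ka < th ==> laplace g th = (ps th - d * th - q) * laplace H th"
		and i: "integrable M (%w. indicator A w * exp (ka * U w))"
	shows "exp (- q * h) * (LINT w|M. indicator A w * H (U w + (X (t + h) w - X t w - d * h))) =
		(LINT w|M. indicator A w * H (U w)) +
		(LINT s|lborel. disc {0..h} q s * (LINT w|M. indicator A w * g (U w + (X (t + s) w - X t w - d * s))))" (is ?eq)
		and "integrable lborel (%s. disc {0..h} q s * (LINT w|M. indicator A w * g (U w + (X (t + s) w - X t w - d * s))))" (is ?int)
proof -
	let ?d = "%s w. X (t + s) w - X t w - d * s" and ?LM = "lborel \<Otimes> M"
	let ?E = "%s. LINT w|M. indicator A w * g (U w + ?d s w)"
	have [measurable]: "H \<in> borel_measurable borel" "g \<in> borel_measurable borel" "A \<in> sets M" "U \<in> borel_measurable M"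
		using exp_bdd_measurable[OF H(1)] exp_bdd_measurable[OF g(1)] A F_sub[of t] measurable_F[OF U] by auto
	define K where "K s u = (LINT w'|M. g (u + (X s w' - d * s)))" for s u
	have inc: "(LINT w|M. indicator A w * f (U w + ?d s w)) =
			(LINT w|M. indicator A w * (LINT w'|M. f (U w + (X s w' - d * s))))"
		if f: "exp_bdd ka f" and s: "0 <= s" for f s
	proof -
		have e: "f (x + (y - d * s)) = f (x + y - d * s)" "x + (y - z - d * s) = x + (y - z) - d * s" for x y z
			by (simp_all add: algebra_simps)
		have [measurable]: "f \<in> borel_measurable borel" by (rule exp_bdd_measurable[OF f])
		show ?thesis
			unfolding e using expectation_increment(1)[OF t(1) s A U, of "%x. f (x - d * s)"]
				increment_integrable[OF t(1) s A U ka f i, of d, unfolded e] by simp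
	qed
	have KA: "?E s = (LINT w|M. indicator A w * K s (U w))"
		if "0 <= s" for s unfolding K_def by (rule inc[OF g(1) that])
	define Q where "Q s w = disc {0..h} q s * (indicator A w * K s (U w))" for s w
	interpret P: pair_sigma_finite lborel M by unfold_locales
	obtain C where C: "0 <= C" "!!x. \<bar>g x\<bar> <= C * exp (ka * x)" using exp_bddD[OF g(1)] by blast
	define c where "c = ps ka - d * ka - q"
	have Q_meas: "(%p. Q (fst p) (snd p)) \<in> borel_measurable (?LM)"
	proof -
		define K' where "K' p = (LINT w'|M. g (snd p + (X (min h (max 0 (fst p))) w' - d * fst p)))" for p
		have "(%(s, w). X (min h (max 0 s)) w) \<in> borel_measurable (borel \<Otimes> M)"
			by (rule clip_measurable[OF t(2)])
		hence "(%p. X (min h (max 0 (fst p))) (snd p)) \<in> borel_measurable (borel \<Otimes> M)"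
			by (simp only: case_prod_unfold)
		from measurable_compose[OF _ this, of "%p. (fst (fst p), snd p)" "(borel \<Otimes> borel) \<Otimes> M"]
		have 1 [measurable]: "(%p. X (min h (max 0 (fst (fst p)))) (snd p)) \<in> borel_measurable ((borel \<Otimes> (borel :: real measure)) \<Otimes> M)"
			by simp
		have "(%p. g (snd (fst p) + (X (min h (max 0 (fst (fst p)))) (snd p) - d * fst (fst p)))) \<in> borel_measurable ((borel \<Otimes> borel) \<Otimes> M)"
			by measurable
		hence K'm: "K' \<in> borel_measurable (borel \<Otimes> borel)"
			unfolding K'_def using borel_measurable_lebesgue_integral[of "%p w'. g (snd p + (X (min h (max 0 (fst p))) w' - d * fst p))" "borel \<Otimes> borel"]
			by (simp add: case_prod_unfold)
		have "(%p. (fst p, U (snd p))) \<in> (?LM) \<rightarrow>\<^sub>M (borel \<Otimes> borel)" by measurable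
		from measurable_compose[OF this K'm]
		have [measurable]: "(%p. K' (fst p, U (snd p))) \<in> borel_measurable (?LM)" .
		have "Q (fst p) (snd p) = indicator {0..h} (fst p) * exp (- q * fst p) * (indicator A (snd p) * K' (fst p, U (snd p)))" for p
			by (cases "fst p \<in> {0..h}") (simp_all add: Q_def K'_def K_def)
		thus ?thesis by (simp only:) measurable
	qed
	have Qb: "\<bar>Q s w\<bar> <= C * (indicator {0..h} s * exp (s * c) * (indicator A w * exp (ka * U w)))" for s w
	proof (cases "s \<in> {0..h}")
		case True
		hence s: "0 <= s" by simp
		have "\<bar>K s u\<bar> <= C * (exp (ka * u) * exp (s * (ps ka - d * ka)))" for u
		proof -
			have "\<bar>K s u\<bar> <= (LINT w'|M. \<bar>g (u + (X s w' - d * s))\<bar>)" unfolding K_def by (rule integral_abs_bound)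
			also have "... <= (LINT w'|M. C * exp (ka * u) * exp (ka * (X s w' - d * s)))"
			proof (rule integral_mono)
				show "integrable M (%w'. \<bar>g (u + (X s w' - d * s))\<bar>)"
					by (intro integrable_abs convolution_integrable[OF _ g(1) exp_integrable_drift(1)[OF s ka]]) measurable
				show "integrable M (%w'. C * exp (ka * u) * exp (ka * (X s w' - d * s)))"
					by (intro integrable_mult_right exp_integrable_drift(1)[OF s ka])
				show "\<bar>g (u + (X s w' - d * s))\<bar> <= C * exp (ka * u) * exp (ka * (X s w' - d * s))" for w'
					using C(2)[of "u + (X s w' - d * s)"] by (simp add: mult.assoc exp_add[symmetric] distrib_left)
			qed
			also have "... = C * (exp (ka * u) * exp (s * (ps ka - d * ka)))"
				using exp_integrable_drift(2)[OF s ka, of d] by simp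
			finally show ?thesis .
		qed
		from mult_left_mono[OF this[of "U w"], of "exp (- q * s)"]
		have "exp (- q * s) * \<bar>K s (U w)\<bar> <= C * (exp (s * c) * exp (ka * U w))"
			by (simp add: c_def exp_add[symmetric] algebra_simps)
		thus ?thesis using True by (cases "w \<in> A") (simp_all add: Q_def abs_mult)
	qed (simp add: Q_def)
	let ?B = "%s w. (C * (indicator {0..h} s * exp (s * c))) * (indicator A w * exp (ka * U w))"
	have Q_int: "integrable (?LM) (%p. Q (fst p) (snd p))"
	proof (rule integrable_bound[OF _ Q_meas])
		have "integrable (?LM) (%(s, w). ?B s w)"
		proof (rule P.Fubini_integrable)
			show "(%(s, w). ?B s w) \<in> borel_measurable (?LM)"
				by measurable
			have "integrable lborel (%s. C * (indicator {0..h} s * exp (s * c)) * (LINT w|M. indicator A w * exp (ka * U w)))"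
				by (intro integrable_mult_left integrable_mult_right integral_exp_Icc(2)[OF t(2)])
			thus "integrable lborel (%s. LINT w|M. norm (case (s, w) of (s, w) => ?B s w))"
				using C(1) by (simp add: abs_mult)
			show "AE s in lborel. integrable M (%w. case (s, w) of (s, w) => ?B s w)"
				unfolding prod.case using i by simp
		qed
		thus "integrable (?LM) (%p. C * (indicator {0..h} (fst p) * exp (fst p * c) * (indicator A (snd p) * exp (ka * U (snd p)))))"
			by (simp add: case_prod_unfold mult.assoc)
		show "AE p in ?LM. norm (Q (fst p) (snd p)) <= norm (C * (indicator {0..h} (fst p) * exp (fst p * c) * (indicator A (snd p) * exp (ka * U (snd p)))))"
			by (intro AE_I2) (unfold real_norm_def, rule order_trans[OF Qb abs_ge_self])
	qed
	have Qs: "(LINT w|M. Q s w) = disc {0..h} q s * ?E s" for s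
		by (cases "s \<in> {0..h}") (simp_all add: Q_def KA)
	have QM: "integrable M (%w. LINT s|lborel. Q s w)" and QF: "(LINT w|M. LINT s|lborel. Q s w) = (LINT s|lborel. LINT w|M. Q s w)"
		using P.integrable_snd[of Q] P.Fubini_integral[of Q] Q_int by (simp_all add: case_prod_unfold)
	have RS: "exp (- q * h) * (LINT w|M. H (y + (X h w - d * h))) =
		H y + (LINT s|lborel. disc {0..h} q s * (LINT w|M. g (y + (X s w - d * s))))" for y
		by (rule resolvent_step[OF t(2) ka H g]) (rule Lap)
	have HU: "integrable M (%w. indicator A w * H (U w))"
		using increment_integrable[OF t(1) order_refl A U ka H(1) i, of 0] by simp
	have "exp (- q * h) * (LINT w|M. indicator A w * H (U w + (X (t + h) w - X t w - d * h))) =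
		(LINT w|M. indicator A w * (exp (- q * h) * (LINT w'|M. H (U w + (X h w' - d * h)))))"
		unfolding inc[OF H(1) t(2)] integral_mult_right_zero[symmetric] by (simp only: mult.left_commute)
	also have "... = (LINT w|M. indicator A w * H (U w) + (LINT s|lborel. Q s w))"
	proof (rule integral_cong[OF refl])
		fix w
		have "(LINT s|lborel. Q s w) = indicator A w * (LINT s|lborel. disc {0..h} q s * K s (U w))"
			unfolding Q_def integral_mult_right_zero[symmetric] by (simp only: mult.left_commute)
		thus "indicator A w * (exp (- q * h) * (LINT w'|M. H (U w + (X h w' - d * h)))) = indicator A w * H (U w) + (LINT s|lborel. Q s w)"
			unfolding RS K_def by (simp only: distrib_left)
	qed
	also have "... = (LINT w|M. indicator A w * H (U w)) + (LINT s|lborel. LINT w|M. Q s w)"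
		unfolding QF[symmetric] by (rule integral_add[OF HU QM])
	also have "(LINT s|lborel. LINT w|M. Q s w) = (LINT s|lborel. disc {0..h} q s * ?E s)"
		unfolding Qs ..
	finally show ?eq .
	show ?int unfolding Qs[symmetric] using P.integrable_fst[of Q] Q_int by (simp add: case_prod_unfold)
qed

text \<open>The functions to be inserted are \<open>1\<close> on the negative half-line, hence
  \<open>1\<close> plus a function in \<open>exp_bdd\<close>; a constant \<open>c\<close> is sent to
  \<open>- q * c\<close>.\<close>

lemma dynkin_step_const:
	assumes t: "0 <= t" "0 <= h" and A: "A \<in> sets (F t)" and U: "U \<in> borel_measurable (F t)"
		and ka: "0 <= ka" and H: "exp_bdd ka H" "rcont H" and g: "exp_bdd ka g" "rcont g"
		and Lap: "!!th. ka < th ==> laplace g th = (ps th - d * th - q) * laplace H th"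
		and i: "integrable M (%w. indicator A w * exp (ka * U w))"
	shows "exp (- q * h) * (LINT w|M. indicator A w * (c + H (U w + (X (t + h) w - X t w - d * h)))) =
		(LINT w|M. indicator A w * (c + H (U w))) +
		(LINT s|lborel. disc {0..h} q s * (LINT w|M. indicator A w * (g (U w + (X (t + s) w - X t w - d * s)) - q * c)))" (is ?eq)
		and "integrable lborel (%s. disc {0..h} q s * (LINT w|M. indicator A w * (g (U w + (X (t + s) w - X t w - d * s)) - q * c)))" (is ?int)
proof -
	have [measurable]: "A \<in> sets M" using A F_sub by blast
	have ci: "integrable M (%w. indicator A w * c)" for c :: real
		by (intro integrable_mult_left integrable_real_indicator) (auto simp: emeasure_eq_measure)
	have cI: "(LINT w|M. indicator A w * c) = prob A * c" for c :: real by simp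
	define J where "J s = disc {0..h} q s * (LINT w|M. indicator A w * g (U w + (X (t + s) w - X t w - d * s)))" for s
	note D1 = dynkin_step(1)[OF t A U ka H g Lap i, folded J_def]
	note D2 = dynkin_step(2)[OF t A U ka H g Lap i, folded J_def]
	have eJ: "disc {0..h} q s * (LINT w|M. indicator A w * (g (U w + (X (t + s) w - X t w - d * s)) - q * c))
		= J s + (prob A * c) * (- q * (indicator {0..h} s * exp (s * - q)))" for s
	proof (cases "s \<in> {0..h}")
		case True
		hence "0 <= s" by simp
		note ig = increment_integrable[OF t(1) this A U ka g(1) i]
		show ?thesis using True unfolding J_def right_diff_distrib integral_diff[OF ig ci] cI
			by (simp add: algebra_simps)
	qed (simp add: J_def)
	have i3: "integrable lborel (%s. (prob A * c) * (- q * (indicator {0..h} s * exp (s * - q))))"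
		by (intro integrable_mult_right integral_exp_Icc(2)[OF t(2)])
	have I3: "(LINT s|lborel. (prob A * c) * (- q * (indicator {0..h} s * exp (s * - q)))) = (prob A * c) * (exp (h * - q) - 1)"
		unfolding integral_exp_Icc(1)[OF t(2), of "- q", symmetric] by simp
	show ?int unfolding eJ by (intro integrable_add i3) (rule D2)
	have HU: "integrable M (%w. indicator A w * H (U w))"
		using increment_integrable[OF t(1) order_refl A U ka H(1) i, of 0] by simp
	have l: "(LINT w|M. indicator A w * (c + H (U w + (X (t + h) w - X t w - d * h)))) =
		prob A * c + (LINT w|M. indicator A w * H (U w + (X (t + h) w - X t w - d * h)))"
		unfolding distrib_left integral_add[OF ci increment_integrable[OF t A U ka H(1) i]] cI ..
	have r: "(LINT w|M. indicator A w * (c + H (U w))) = prob A * c + (LINT w|M. indicator A w * H (U w))"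
		unfolding distrib_left integral_add[OF ci HU] cI ..
	have "(LINT s|lborel. J s + (prob A * c) * (- q * (indicator {0..h} s * exp (s * - q)))) = (LINT s|lborel. J s) + (prob A * c) * (exp (h * - q) - 1)"
		unfolding I3[symmetric] by (intro integral_add i3) (rule D2)
	moreover have "exp (- q * h) * (LINT w|M. indicator A w * H (U w + (X (t + h) w - X t w - d * h))) =
		(LINT w|M. indicator A w * H (U w)) + (LINT s|lborel. J s)" by (rule D1)
	ultimately show ?eq unfolding eJ l r by (simp add: algebra_simps)
qed

end

text \<open>Monotonicity turns integrability into a pointwise bound: \<open>W x\<close> is at most
  the average of \<open>W\<close> over \<open>[x, x + 1]\<close>.\<close>

lemma scale_exp_bdd:
	assumes W: "!!x. x < 0 ==> W x = 0" "continuous_on {0..} W" "mono_on {0..} W"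
		and i: "integrable lborel (%x. exp (- th * x) * W x)" and th: "0 <= th"
	shows "exp_bdd th W"
proof -
	define K where "K = (LINT x|lborel. \<bar>exp (- th * x) * W x\<bar>)"
	have K0: "0 <= K" unfolding K_def by simp
	have up: "W x <= K * exp th * exp (th * x)" if x: "0 <= x" for x
	proof (cases "W x <= 0")
		case True
		thus ?thesis using K0 by (meson exp_ge_zero mult_nonneg_nonneg order_trans)
	next
		case False
		have "exp (- th * (x + 1)) * W x = (LINT y|lborel. indicator {x..x + 1} y * (exp (- th * (x + 1)) * W x))"
			by simp
		also have "... <= K"
			unfolding K_def
		proof (rule integral_mono[OF _ integrable_abs[OF i]])
			show "integrable lborel (%y. indicator {x..x + 1} y * (exp (- th * (x + 1)) * W x))"
				by (intro integrable_mult_left integrable_real_indicator) auto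
			fix y :: real
			show "indicator {x..x + 1} y * (exp (- th * (x + 1)) * W x) <= \<bar>exp (- th * y) * W y\<bar>"
			proof (cases "y \<in> {x..x + 1}")
				case True
				hence "W x <= W y" using mono_onD[OF W(3), of x y] x by simp
				moreover have "exp (- th * (x + 1)) <= exp (- th * y)" using True th by (simp add: mult_left_mono)
				ultimately have "exp (- th * (x + 1)) * W x <= exp (- th * y) * W y" using False by (intro mult_mono) auto
				thus ?thesis using True by simp
			qed simp
		qed
		finally have "exp (th * (x + 1)) * (exp (- th * (x + 1)) * W x) <= exp (th * (x + 1)) * K" by (rule mult_left_mono) simp
		moreover have "exp (th * (x + 1)) * (exp (- th * (x + 1)) * W x) = W x"
			unfolding mult.assoc[symmetric] exp_add[symmetric] by simp
		ultimately have "W x <= exp (th * (x + 1)) * K" by (simp only:)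
		thus ?thesis by (simp add: distrib_left exp_add mult_ac)
	qed
	define C where "C = K * exp th + \<bar>W 0\<bar>"
	have C0: "0 <= C" using K0 by (simp add: C_def)
	have b: "\<bar>W x\<bar> <= C * exp (th * x)" for x
	proof (cases "x < 0")
		case False
		hence "W 0 <= W x" using mono_onD[OF W(3), of 0 x] by simp
		moreover have "1 <= exp (th * x)" using th False by simp
		hence "\<bar>W 0\<bar> <= \<bar>W 0\<bar> * exp (th * x)" by (simp add: mult_le_cancel_left1)
		moreover have "0 <= K * exp th * exp (th * x)" using K0 by simp
		ultimately show ?thesis using up[of x] False by (simp add: C_def distrib_right)
	qed (use W(1) C0 in simp)
	have "W \<in> borel_measurable borel"
	proof -
		have "(%x. indicator {0..} x *\<^sub>R W x) \<in> borel_measurable borel"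
			by (rule borel_measurable_continuous_on_indicator[OF _ W(2)]) simp
		moreover have "(%x. indicator {0..} x *\<^sub>R W x) = W"
		proof
			fix x show "indicator {0..} x *\<^sub>R W x = W x" using W(1)[of x] by (cases "x < 0") auto
		qed
		ultimately show ?thesis by simp
	qed
	thus ?thesis using b C0 W(1) unfolding exp_bdd_def by blast
qed

lemma rcont_Ici:
	assumes "!!x. x < 0 ==> W x = 0" "continuous_on {0..} W"
	shows "rcont W"
	unfolding rcont_def
proof
	fix x :: real
	show "(W \<longlongrightarrow> W x) (at_right x)"
	proof (cases "x < 0")
		case True
		have "eventually (%y. W y = 0) (at_right x)"
			unfolding eventually_at_right_field using True assms(1) by (intro exI[of _ 0]) auto
		thus ?thesis using assms(1)[OF True] by (simp add: tendsto_eventually)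
	next
		case False
		hence "(W \<longlongrightarrow> W x) (at x within {0..})" using assms(2) by (simp add: continuous_on)
		moreover have "at_right x <= at x within {0..}" using False by (intro at_le) auto
		ultimately show ?thesis by (rule filterlim_mono[OF _ order_refl])
	qed
qed

text \<open>The initial value theorem: \<open>th\<close> times the transform at \<open>th\<close>
  tends to \<open>W 0\<close>. In this way the sign of \<open>W\<close>, on which
  \<open>is_scale_function\<close> is silent, follows from that of its transform.\<close>

lemma laplace_initial_value:
	assumes W: "exp_bdd ka W" "rcont W" and pos: "!!th. ka < th ==> 0 < laplace W th" and ka: "0 <= ka"
	shows "0 <= W 0"
proof -
	obtain C where C: "0 <= C" "!!x. \<bar>W x\<bar> <= C * exp (ka * x)" using exp_bddD[OF W(1)] by blast
	have [measurable]: "W \<in> borel_measurable borel" by (rule exp_bdd_measurable[OF W(1)])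
	\<comment> \<open>Beyond \<open>2 * ka\<close> the growth \<open>exp (ka * (u / m n))\<close> costs
	  at most half of the decay \<open>exp (- u)\<close>.\<close>
	define k where "k = nat \<lceil>2 * ka\<rceil> + 1"
	define m where "m n = real (n + k)" for n
	have m: "2 * ka < m n" "0 < m n" for n unfolding m_def k_def using ka by linarith+
	have m_lim: "(%n. x / m n) ----> 0" for x :: real
		unfolding m_def using LIMSEQ_ignore_initial_segment[OF lim_const_over_n[of x], of k] by simp
	have e: "m n * laplace W (m n) = (LINT u|lborel. exp (- u) * W (u / m n))" for n
		using lborel_integral_real_affine[of "1 / m n" "%x. exp (- m n * x) * W x" 0] m[of n]
		by (simp add: laplace_def)
	have "(%n. LINT u|lborel. exp (- u) * W (u / m n)) ----> (LINT u|lborel. indicator {0..} u * exp (- 1 * u) * W 0)"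
	proof (rule integral_dominated_convergence[where w = "%u. C * (indicator {0..} u * exp (- (1 / 2) * u))"])
		show "integrable lborel (%u. C * (indicator {0..} u * exp (- (1 / 2) * u)))"
			by (intro integrable_mult_right exp_neg_integrable) simp
		show "AE u in lborel. (%n. exp (- u) * W (u / m n)) ----> indicator {0..} u * exp (- 1 * u) * W 0"
		proof (rule AE_mp[OF AE_lborel_singleton[of 0]], intro AE_I2 impI)
			fix u :: real assume u: "u ~= 0"
			show "(%n. exp (- u) * W (u / m n)) ----> indicator {0..} u * exp (- 1 * u) * W 0"
			proof (cases "u < 0")
				case True
				hence "W (u / m n) = 0" for n using m(2)[of n] by (intro exp_bdd_neg[OF W(1)]) (simp add: divide_neg_pos)
				thus ?thesis using True by simp
			next
				case False
				hence *: "0 < u / m n" for n using u m(2)[of n] by simp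
				have "(%n. W (u / m n)) ----> W 0"
					by (rule W(2)[unfolded rcont_sequentially, rule_format]) (rule *, rule m_lim)
				thus ?thesis using False by (simp add: tendsto_mult_left)
			qed
		qed
		fix n
		show "AE u in lborel. norm (exp (- u) * W (u / m n)) <= C * (indicator {0..} u * exp (- (1 / 2) * u))"
		proof (rule AE_I2)
			fix u :: real
			show "norm (exp (- u) * W (u / m n)) <= C * (indicator {0..} u * exp (- (1 / 2) * u))"
			proof (cases "u < 0")
				case True
				hence "W (u / m n) = 0" using m(2)[of n] by (intro exp_bdd_neg[OF W(1)]) (simp add: divide_neg_pos)
				thus ?thesis using C(1) by simp
			next
				case False
				have "ka * (u / m n) <= (1 / 2) * u"
				proof -
					have "ka / m n <= 1 / 2" using m[of n] by (simp add: field_simps)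
					from mult_right_mono[OF this, of u] False show ?thesis by (simp only: not_less times_divide_eq_left times_divide_eq_right)
				qed
				hence "exp (- u) * exp (ka * (u / m n)) <= exp (- (1 / 2) * u)"
					unfolding exp_add[symmetric] exp_le_cancel_iff by linarith
				hence "C * (exp (- u) * exp (ka * (u / m n))) <= C * exp (- (1 / 2) * u)" by (rule mult_left_mono[OF _ C(1)])
				moreover have "exp (- u) * \<bar>W (u / m n)\<bar> <= exp (- u) * (C * exp (ka * (u / m n)))" by (intro mult_left_mono C) simp
				ultimately have "exp (- u) * \<bar>W (u / m n)\<bar> <= C * exp (- (1 / 2) * u)" by (simp only: mult.left_commute)
				thus ?thesis using False by (simp add: abs_mult)
			qed
		qed
	qed measurable
	also have "(LINT u|lborel. indicator {0..} u * exp (- 1 * u) * W 0) = W 0"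
		by (simp only: integral_mult_left_zero exp_neg_integrable(2)[OF zero_less_one] div_by_1 mult_1)
	finally have "(%n. m n * laplace W (m n)) ----> W 0" unfolding e .
	moreover have "0 <= m n * laplace W (m n)" for n using pos[of "m n"] m[of n] ka by simp
	ultimately show ?thesis by (intro LIMSEQ_le_const) auto
qed

section \<open>Scale functions\<close>

definition cv :: "(real => real) => (real => real) => real => real" where
	"cv H ww x = (LINT y|lborel. H (x - y) * ww y)"

text \<open>\<open>ww\<close> is read as a density, so that \<open>laplace_convolution\<close>
  applies with the shift \<open>- y\<close>. The rate increases by \<open>1\<close> because the
  convolution of two functions of rate \<open>ka\<close> may carry an additional factor
  \<open>x\<close>.\<close>

lemma
	assumes H: "exp_bdd ka H" and ww: "exp_bdd ka ww" "!!y. 0 <= ww y" and ka: "0 <= ka"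
	shows cv_exp_bdd: "exp_bdd (ka + 1) (cv H ww)"
		and cv_laplace: "ka + 1 < th ==> laplace (cv H ww) th = laplace H th * laplace ww th"
		and cv_rcont: "rcont H ==> rcont (cv H ww)"
		and cv_integrable: "integrable lborel (%y. H (x - y) * ww y)"
proof -
	have [measurable]: "ww \<in> borel_measurable borel" "H \<in> borel_measurable borel"
		using exp_bdd_measurable[OF ww(1)] exp_bdd_measurable[OF H] by auto
	define N where "N = density lborel (%y. ennreal (ww y))"
	have sf: "sigma_finite_measure N"
		unfolding N_def by (subst sigma_finite_measure.sigma_finite_iff_density_finite[OF sigma_finite_lborel]) auto
	have um: "(%y. - y) \<in> borel_measurable N" unfolding N_def by measurable
	have Ni: "integral\<^sup>L N f = (LINT y|lborel. ww y * f y)" and Nint: "integrable N f \<longleftrightarrow> integrable lborel (%y. ww y * f y)"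
		if "f \<in> borel_measurable borel" for f :: "real => real"
		unfolding N_def using that ww(2) by (simp_all add: integral_density integrable_density)
	have Nexp: "integrable N (%y. exp (th * (- y)))" if "ka < th" for th
		using exp_bdd_integrable[OF ww(1) that] by (subst Nint) (simp_all add: mult.commute)
	have cve: "cv H ww = (%x. LINT y|N. H (x + (- y)))"
	proof
		fix x show "cv H ww x = (LINT y|N. H (x + (- y)))"
			unfolding cv_def by (subst Ni) (simp_all add: mult.commute)
	qed
	have H': "exp_bdd (ka + 1) H" by (rule exp_bdd_mono[OF H]) simp
	have int: "integrable N (%y. H (x + (- y)))" for x
		by (rule convolution_integrable[OF um H' Nexp]) simp
	thus "integrable lborel (%y. H (x - y) * ww y)"
		by (subst (asm) Nint) (simp_all add: mult.commute)
	show "rcont (cv H ww)" if "rcont H"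
		unfolding cve by (rule rcont_convolution[OF um _ H' Nexp that]) (use ka in simp_all)
	show "laplace (cv H ww) th = laplace H th * laplace ww th" if th: "ka + 1 < th"
	proof -
		have "laplace (cv H ww) th = (LINT y|N. exp (th * (- y))) * laplace H th"
			unfolding cve by (rule laplace_convolution(2)[OF sf um H' th Nexp]) (use th in simp_all)
		also have "(LINT y|N. exp (th * (- y))) = laplace ww th"
			unfolding laplace_def by (subst Ni) (simp_all add: mult.commute)
		finally show ?thesis by simp
	qed
	obtain C where C: "0 <= C" "!!x. \<bar>H x\<bar> <= C * exp ((ka + 1) * x)" using exp_bddD[OF H'] by blast
	define D where "D = (LINT y|N. exp ((ka + 1) * (- y)))"
	have D0: "0 <= D" unfolding D_def by (rule integral_nonneg_AE) simp
	have "\<bar>cv H ww x\<bar> <= C * D * exp ((ka + 1) * x)" for x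
	proof -
		have "\<bar>cv H ww x\<bar> <= (LINT y|N. \<bar>H (x + (- y))\<bar>)" unfolding cve by (rule integral_abs_bound)
		also have "... <= (LINT y|N. C * exp ((ka + 1) * x) * exp ((ka + 1) * (- y)))"
		proof (rule integral_mono[OF integrable_abs[OF int]])
			show "integrable N (%y. C * exp ((ka + 1) * x) * exp ((ka + 1) * (- y)))"
				by (rule integrable_mult_right[OF Nexp]) simp
			show "\<bar>H (x + (- y))\<bar> <= C * exp ((ka + 1) * x) * exp ((ka + 1) * (- y))" for y
				using C(2)[of "x + (- y)"] unfolding distrib_left exp_add by (simp only: mult.assoc)
		qed
		also have "... = C * D * exp ((ka + 1) * x)" unfolding D_def integral_mult_right_zero by (simp only: mult_ac)
		finally show ?thesis .
	qed
	moreover have "cv H ww x = 0" if "x < 0" for x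
	proof -
		have "H (x - y) * ww y = 0" for y
			using exp_bdd_neg[OF ww(1), of y] exp_bdd_neg[OF H, of "x - y"] that by (cases "y < 0") auto
		thus ?thesis unfolding cv_def by (simp only: integral_zero)
	qed
	moreover have "cv H ww \<in> borel_measurable borel"
	proof -
		interpret N: sigma_finite_measure N by (rule sf)
		have "(%p. H (fst p - snd p)) \<in> borel_measurable (borel \<Otimes> N)"
			by (rule measurable_compose[of "%p. fst p - snd p" _ borel]) (auto simp: N_def)
		thus ?thesis unfolding cve using N.borel_measurable_lebesgue_integral[of "%x y. H (x + (- y))" borel]
			by (simp add: case_prod_unfold)
	qed
	ultimately show "exp_bdd (ka + 1) (cv H ww)" using C(1) D0 unfolding exp_bdd_def
		by (intro conjI exI[of _ "C * D"]) auto
qed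

abbreviation Heaviside :: "real => real" where "Heaviside \<equiv> indicator {0..}"

lemma Heaviside: "0 <= ka ==> exp_bdd ka Heaviside" "rcont Heaviside" "0 < th ==> laplace Heaviside th = 1 / th"
proof -
	show "exp_bdd ka Heaviside" if "0 <= ka"
		by (rule exp_bdd_bounded[of _ 1]) (use that in "auto simp: indicator_def")
	show "rcont Heaviside"
		by (rule rcont_Ici) (auto intro: continuous_on_eq[of _ "%_. 1"])
	show "laplace Heaviside th = 1 / th" if "0 < th"
		using exp_neg_integrable(2)[OF that] by (simp add: laplace_def mult.commute)
qed

lemma cv_mono:
	assumes "exp_bdd ka H" "mono H" "exp_bdd ka ww" "!!y. 0 <= ww y" "0 <= ka"
	shows "mono (cv H ww)"
proof (rule monoI)
	fix x y :: real assume "x <= y"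
	thus "cv H ww x <= cv H ww y" unfolding cv_def
		by (intro integral_mono cv_integrable[OF assms(1,3,4,5)] mult_right_mono monoD[OF assms(2)] assms(4)) auto
qed

lemma cv_diff_le:
	assumes "exp_bdd ka H" "mono H" "exp_bdd ka ww" "!!y. 0 <= ww y" "0 <= ka" "x <= y" "!!z. z <= y ==> ww z <= B * v z"
		"exp_bdd ka v" "!!y. 0 <= v y"
	shows "cv H ww y - cv H ww x <= B * (cv H v y - cv H v x)"
proof -
	note iw = cv_integrable[OF assms(1,3,4,5)] and iv = cv_integrable[OF assms(1,8,9,5)]
	have "cv H ww y - cv H ww x = (LINT z|lborel. (H (y - z) - H (x - z)) * ww z)"
		unfolding cv_def left_diff_distrib by (simp only: integral_diff[OF iw iw])
	also have "... <= (LINT z|lborel. B * ((H (y - z) - H (x - z)) * v z))"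
	proof (rule integral_mono)
		show "integrable lborel (%z. (H (y - z) - H (x - z)) * ww z)"
			unfolding left_diff_distrib by (intro integrable_diff iw)
		show "integrable lborel (%z. B * ((H (y - z) - H (x - z)) * v z))"
			unfolding left_diff_distrib by (intro integrable_mult_right integrable_diff iv)
		fix z
		show "(H (y - z) - H (x - z)) * ww z <= B * ((H (y - z) - H (x - z)) * v z)"
		proof (cases "z <= y")
			case True
			have "0 <= H (y - z) - H (x - z)" using monoD[OF assms(2), of "x - z" "y - z"] assms(6) by simp
			from mult_left_mono[OF assms(7)[OF True] this] show ?thesis by (simp add: mult_ac)
		next
			case False
			thus ?thesis using exp_bdd_neg[OF assms(1), of "y - z"] exp_bdd_neg[OF assms(1), of "x - z"] assms(6) by simp
		qed
	qed
	also have "... = B * (cv H v y - cv H v x)"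
		unfolding cv_def left_diff_distrib integral_mult_right_zero by (simp only: integral_diff[OF iv iv])
	finally show ?thesis .
qed


text \<open>\<open>Ps\<close> is the exponent of \<open>X\<close> or of \<open>X t - dl t\<close>.
  The rate \<open>ka\<close> is so large that \<open>Ps th > q\<close> beyond it;
  \<open>scale_function_I\<close> derives this form, with sign and monotonicity on the whole
  line.\<close>

locale scale_function =
	fixes Ps :: "real => real" and q ka :: real and W :: "real => real"
	assumes q: "0 <= q" and ka: "0 <= ka" and bdd: "exp_bdd ka W" and rc: "rcont W"
		and mono_W: "mono W" and nonneg: "0 <= W x"
		and lap: "ka < th ==> q < Ps th" "ka < th ==> laplace W th = 1 / (Ps th - q)"
begin

definition prim :: "real => real" where "prim = cv Heaviside W"

lemma Hv: "exp_bdd ka Heaviside" by (rule Heaviside(1)[OF ka])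

lemma mono_Heaviside: "mono Heaviside" by (rule monoI) (auto simp: indicator_def)

lemma prim_bdd: "exp_bdd (ka + 1) prim" unfolding prim_def by (rule cv_exp_bdd[OF Hv bdd nonneg ka])

lemma prim_laplace: "ka + 1 < th ==> laplace prim th = 1 / (th * (Ps th - q))"
	unfolding prim_def using cv_laplace[OF Hv bdd nonneg ka, of th] Heaviside(3)[of th] lap[of th] ka by simp

lemma prim_rcont: "rcont prim" unfolding prim_def by (rule cv_rcont[OF Hv bdd nonneg ka Heaviside(2)])

lemma prim_mono: "mono prim" unfolding prim_def by (rule cv_mono[OF Hv mono_Heaviside bdd nonneg ka])

lemma prim_eq: "prim x = (LINT y:{0..x}|lborel. W y)"
	unfolding prim_def cv_def set_lebesgue_integral_def
proof (rule integral_cong[OF refl])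
	fix y show "Heaviside (x - y) * W y = indicator {0..x} y *\<^sub>R W y"
		using exp_bdd_neg[OF bdd, of y] by (cases "y < 0") (auto simp: indicator_def)
qed

lemma prim_Lipschitz:
	assumes "x <= y" "y <= B"
	shows "prim y - prim x <= W B * (y - x)"
proof -
	have i: "integrable lborel (%z. Heaviside (x - z) * W z)" for x by (rule cv_integrable[OF Hv bdd nonneg ka])
	have "prim y - prim x = (LINT z|lborel. Heaviside (y - z) * W z - Heaviside (x - z) * W z)"
		unfolding prim_def cv_def by (simp only: integral_diff[OF i i])
	also have "... <= (LINT z|lborel. indicator {x<..y} z * W B)"
	proof (rule integral_mono)
		show "integrable lborel (%z. Heaviside (y - z) * W z - Heaviside (x - z) * W z)" by (intro integrable_diff i)
		show "integrable lborel (%z. indicator {x<..y} z * W B)"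
			by (intro integrable_mult_left integrable_real_indicator) (use assms(1) in auto)
		fix z
		show "Heaviside (y - z) * W z - Heaviside (x - z) * W z <= indicator {x<..y} z * W B"
			using monoD[OF mono_W, of z B] assms by (auto simp: indicator_def)
	qed
	also have "... = W B * (y - x)" using assms(1) by simp
	finally show ?thesis .
qed

lemma prim_nonpos: "x <= 0 ==> prim x = 0"
proof (cases "x < 0")
	case False
	assume "x <= 0"
	hence "x = 0" using False by simp
	have "prim 0 - prim (- 1 / real (Suc n)) <= W 0 * (0 - (- 1 / real (Suc n)))" for n by (rule prim_Lipschitz) auto
	moreover have "prim (- 1 / real (Suc n)) = 0" for n by (rule exp_bdd_neg[OF prim_bdd]) (simp add: divide_neg_pos)
	ultimately have "prim 0 <= W 0 * mesh n" for n by simp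
	moreover have "(%n. W 0 * mesh n) ----> W 0 * 0" by (intro tendsto_mult tendsto_const mesh_tendsto)
	ultimately have "prim 0 <= 0" by (intro LIMSEQ_le_const) auto
	moreover have "prim (-1) <= prim 0" by (rule monoD[OF prim_mono]) simp
	moreover have "prim (-1) = 0" by (rule exp_bdd_neg[OF prim_bdd]) simp
	ultimately show ?thesis using `x = 0` by simp
qed (rule exp_bdd_neg[OF prim_bdd])

lemma prim_nonneg: "0 <= prim x"
proof -
	have "prim (min x 0) <= prim x" by (rule monoD[OF prim_mono]) simp
	thus ?thesis using prim_nonpos[of "min x 0"] by simp
qed

text \<open>In terms of generators: (generator) - \<open>q\<close> sends the primitive of
  \<open>W\<close> to \<open>Heaviside\<close>. Both the formula for \<open>Z\<close> and the
  occupation bound rest on this.\<close>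

lemma prim_relation: "ka + 1 < th ==> laplace Heaviside th = (Ps th - q) * laplace prim th"
	using prim_laplace[of th] Heaviside(3)[of th] lap(1)[of th] ka by simp

end

lemma scale_function_I:
	assumes W: "!!x. x < 0 ==> W x = 0" "continuous_on {0..} W" "mono_on {0..} W" and q: "0 <= q"
		and lap: "!!th. Ph < th ==> integrable lborel (%x. exp (- th * x) * W x)"
			"!!th. Ph < th ==> laplace W th = 1 / (Ps th - q)"
		and ex: "EX th0>=0. ALL th>=th0. q < Ps th"
	shows "EX ka0. ALL ka>=ka0. scale_function Ps q ka W"
proof -
	obtain th0 where th0: "0 <= th0" "!!th. th0 <= th ==> q < Ps th" using ex by blast
	define ka where "ka = max th0 (Ph + 1)"
	have ka0: "0 <= ka" using th0(1) by (simp add: ka_def)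
	have b: "exp_bdd ka W" by (rule scale_exp_bdd[OF W lap(1) ka0]) (auto simp: ka_def)
	have l1: "q < Ps th" if "ka < th" for th using that by (intro th0) (auto simp: ka_def)
	have l2: "laplace W th = 1 / (Ps th - q)" if "ka < th" for th using that by (intro lap) (auto simp: ka_def)
	have rc: "rcont W" by (rule rcont_Ici[OF W(1,2)])
	have W0: "0 <= W 0" by (rule laplace_initial_value[OF b rc _ ka0]) (use l1 l2 in auto)
	have nn: "0 <= W x" for x using W(1)[of x] mono_onD[OF W(3), of 0 x] W0 by (cases "x < 0") auto
	have m: "mono W"
	proof (rule monoI)
		fix x y :: real assume "x <= y"
		thus "W x <= W y" using W(1)[of x] nn[of y] mono_onD[OF W(3), of x y] by (cases "x < 0") auto
	qed
	have "scale_function Ps q ka' W" if "ka <= ka'" for ka'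
		using that ka0 q rc m nn l1 l2 exp_bdd_mono[OF b that] by unfold_locales auto
	thus ?thesis by blast
qed


lemma laplace_add:
	assumes "exp_bdd ka f" "exp_bdd ka g" "ka < th"
	shows "laplace (%x. f x + g x) th = laplace f th + laplace g th"
	unfolding laplace_def distrib_left
	by (rule integral_add[OF exp_bdd_integrable[OF assms(1,3)] exp_bdd_integrable[OF assms(2,3)]])

lemma laplace_cmult: "laplace (%x. c * f x) th = c * laplace f th"
	unfolding laplace_def by (simp only: mult.left_commute[of _ c] integral_mult_right_zero)

lemma rcont_add: "rcont f ==> rcont g ==> rcont (%x. f x + g x)"
	unfolding rcont_def by (intro allI tendsto_add) auto

lemma rcont_cmult: "rcont f ==> rcont (%x. c * f x)"
	unfolding rcont_def by (intro allI tendsto_mult_left) auto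

lemma rcont_mult: "rcont f ==> rcont g ==> rcont (%x. f x * g x)"
	unfolding rcont_def by (intro allI tendsto_mult) auto

lemma rcont_lessThan: "rcont (indicat_real {..<b})"
	unfolding rcont_def
proof
	fix x
	show "(indicat_real {..<b} \<longlongrightarrow> indicat_real {..<b} x) (at_right x)"
	proof (rule tendsto_eventually)
		show "eventually (%y. indicat_real {..<b} y = indicat_real {..<b} x) (at_right x)"
			unfolding eventually_at_right_field
			by (cases "x < b") (auto simp: indicator_def intro: exI[of _ b] exI[of _ "x + 1"])
	qed
qed

section \<open>The function \<open>r\<close> and its transform identity\<close>

locale refraction_scales =
	X: scale_function Ps q ka W + Y: scale_function "%th. Ps th - dl * th" q ka WW
	for Ps :: "real => real" and q ka dl :: real and W WW :: "real => real" +
	fixes b :: real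
	assumes dl: "0 <= dl" and b: "0 < b"
begin

definition Wb :: "real => real" where "Wb y = indicator {b..} y * W y"
definition Wc :: "real => real" where "Wc y = W y * indicator {..<b} y"
text \<open>\<open>Zs\<close> and \<open>rs\<close> are \<open>Z - 1\<close> and
  \<open>r - 1\<close>: without the constant they vanish on the negative half-line, as the
  transforms require.\<close>

definition Zs :: "real => real" where "Zs x = q * X.prim x"
definition rs :: "real => real" where "rs x = q * X.prim x + q * dl * cv WW Wb x"
text \<open>The image of \<open>rs\<close> under (generator of \<open>X t - dl t\<close>) -
  \<open>q\<close>, see \<open>rs_relation\<close>. With the constant restored,
  \<open>gr - q\<close> vanishes from \<open>b\<close> on, equals \<open>- q * dl * W\<close> on
  \<open>[0, b)\<close> and \<open>- q\<close> below \<open>0\<close>.\<close>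

definition gr :: "real => real" where "gr x = q * Heaviside x + - (q * dl) * Wc x"

lemma Wb_bdd: "exp_bdd ka Wb" and Wc_bdd: "exp_bdd ka Wc"
proof -
	obtain C where C: "0 <= C" "!!x. \<bar>W x\<bar> <= C * exp (ka * x)" using exp_bddD[OF X.bdd] by blast
	have m [measurable]: "W \<in> borel_measurable borel" by (rule exp_bdd_measurable[OF X.bdd])
	have "Wb \<in> borel_measurable borel" "Wc \<in> borel_measurable borel" unfolding Wb_def Wc_def by measurable
	moreover have "\<bar>Wb x\<bar> <= C * exp (ka * x)" "\<bar>Wc x\<bar> <= C * exp (ka * x)" for x
		using C(2)[of x] C(1) by (auto simp: Wb_def Wc_def indicator_def)
	moreover have "Wb x = 0" "Wc x = 0" if "x < 0" for x
		using exp_bdd_neg[OF X.bdd that] by (simp_all add: Wb_def Wc_def)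
	ultimately show "exp_bdd ka Wb" "exp_bdd ka Wc" using C(1) unfolding exp_bdd_def by blast+
qed

lemma Wb_nonneg: "0 <= Wb x" and Wc_nonneg: "0 <= Wc x"
	using X.nonneg by (simp_all add: Wb_def Wc_def)

lemma qdl: "0 <= q * dl" using X.q dl by simp

lemma Zs_bdd: "exp_bdd (ka + 1) Zs" unfolding Zs_def by (rule exp_bdd_cmult[OF X.prim_bdd])
lemma Zs_rcont: "rcont Zs" unfolding Zs_def by (rule rcont_cmult[OF X.prim_rcont])
lemma Zs_mono: "mono Zs" unfolding Zs_def by (intro monoI mult_left_mono monoD[OF X.prim_mono] X.q)
lemma Zs_nonpos: "x <= 0 ==> Zs x = 0" by (simp add: Zs_def X.prim_nonpos)
lemma Zs_nonneg: "0 <= Zs x" by (simp add: Zs_def X.prim_nonneg X.q)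

lemma cv_bdd: "exp_bdd (ka + 1) (cv WW Wb)" by (rule cv_exp_bdd[OF Y.bdd Wb_bdd Wb_nonneg X.ka])
lemma cv_mono': "mono (cv WW Wb)" by (rule cv_mono[OF Y.bdd Y.mono_W Wb_bdd Wb_nonneg X.ka])
lemma cv_le_b: "x < b ==> cv WW Wb x = 0"
proof -
	assume "x < b"
	hence "WW (x - y) * Wb y = 0" for y using exp_bdd_neg[OF Y.bdd, of "x - y"] by (cases "y < b") (auto simp: Wb_def)
	thus ?thesis unfolding cv_def by (simp only: integral_zero)
qed

text \<open>Up to \<open>B\<close>, \<open>Wb\<close> is at most \<open>W B\<close> times
  \<open>Heaviside\<close>, and convolving \<open>WW\<close> with \<open>Heaviside\<close> gives its
  primitive, which is Lipschitz even if \<open>WW\<close> jumps at \<open>0\<close>.\<close>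

lemma cv_Lipschitz:
	assumes "x <= y" "y <= B"
	shows "cv WW Wb y - cv WW Wb x <= W B * WW B * (y - x)"
proof -
	have e: "cv WW Heaviside z = Y.prim z" for z
	proof -
		have "cv WW Heaviside z = (LINT u|lborel. WW (z - (z + -1 * u)) * Heaviside (z + -1 * u))"
			unfolding cv_def using lborel_integral_real_affine[of "-1" "%y. WW (z - y) * Heaviside y" z] by simp
		thus ?thesis unfolding Y.prim_def cv_def by (simp add: mult.commute)
	qed
	have "cv WW Wb y - cv WW Wb x <= W B * (Y.prim y - Y.prim x)"
		unfolding e[symmetric]
	proof (rule cv_diff_le[OF Y.bdd Y.mono_W Wb_bdd Wb_nonneg X.ka assms(1) _ X.Hv])
		fix z assume "z <= y"
		thus "Wb z <= W B * Heaviside z"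
			using monoD[OF X.mono_W, of z B] assms(2) X.nonneg[of B] exp_bdd_neg[OF X.bdd, of z]
			by (cases "z < 0") (auto simp: Wb_def indicator_def)
	qed simp
	also have "W B * (Y.prim y - Y.prim x) <= W B * (WW B * (y - x))"
		by (intro mult_left_mono Y.prim_Lipschitz assms X.nonneg)
	finally show ?thesis by (simp add: mult.assoc)
qed

lemma rs_bdd: "exp_bdd (ka + 1) rs"
	unfolding rs_def by (intro exp_bdd_add exp_bdd_cmult X.prim_bdd cv_bdd)
lemma rs_rcont: "rcont rs"
	unfolding rs_def by (intro rcont_add rcont_cmult X.prim_rcont cv_rcont[OF Y.bdd Wb_bdd Wb_nonneg X.ka Y.rc])
lemma rs_mono: "mono rs"
	unfolding rs_def by (intro monoI add_mono mult_left_mono monoD[OF X.prim_mono] monoD[OF cv_mono'] X.q qdl)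
lemma rs_eq_Zs_less: "x < b ==> rs x = Zs x" by (simp add: rs_def Zs_def cv_le_b)
lemma rs_nonpos: "x <= 0 ==> rs x = 0" using b by (simp add: rs_eq_Zs_less Zs_nonpos)
lemma rs_nonneg: "0 <= rs x"
proof -
	have "rs (min x 0) <= rs x" by (rule monoD[OF rs_mono]) simp
	thus ?thesis by (simp add: rs_nonpos)
qed

lemma Lipschitz:
	obtains L where "0 <= L" "!!x y. x <= y ==> y <= B ==> rs y - rs x <= L * (y - x)"
		"!!x y. x <= y ==> y <= B ==> Zs y - Zs x <= L * (y - x)"
proof (rule that)
	let ?L = "q * W B + q * dl * (W B * WW B)"
	have n: "0 <= q * dl * (W B * WW B)" by (intro mult_nonneg_nonneg X.q dl X.nonneg Y.nonneg)
	show "0 <= ?L" by (intro add_nonneg_nonneg n mult_nonneg_nonneg X.q X.nonneg)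
	fix x y :: real assume xy: "x <= y" "y <= B"
	have 1: "q * (X.prim y - X.prim x) <= q * (W B * (y - x))" by (intro mult_left_mono X.prim_Lipschitz xy X.q)
	have 2: "q * dl * (cv WW Wb y - cv WW Wb x) <= q * dl * (W B * WW B * (y - x))" by (intro mult_left_mono cv_Lipschitz xy qdl)
	show "rs y - rs x <= ?L * (y - x)" using 1 2 by (simp add: rs_def algebra_simps)
	have "0 <= q * dl * (W B * WW B) * (y - x)" using n xy by (simp add: zero_le_mult_iff)
	thus "Zs y - Zs x <= ?L * (y - x)" using 1 by (simp add: Zs_def algebra_simps)
qed

lemma rs_eq_Zs: "x <= b ==> rs x = Zs x"
proof (cases "x < b")
	case False
	assume "x <= b"
	obtain L where L: "0 <= L" "!!x y. x <= y ==> y <= b ==> rs y - rs x <= L * (y - x)"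
		"!!x y. x <= y ==> y <= b ==> Zs y - Zs x <= L * (y - x)" using Lipschitz[of b] by blast
	have le: "\<bar>rs b - Zs b\<bar> <= L * mesh n" for n
	proof -
		let ?x = "b - 1 / real (Suc n)"
		have x: "?x < b" by simp
		have "rs b - rs ?x <= L * (b - ?x)" "Zs b - Zs ?x <= L * (b - ?x)" using x by (intro L; simp)+
		moreover have "rs ?x <= rs b" "Zs ?x <= Zs b" using x by (intro monoD[OF rs_mono] monoD[OF Zs_mono]; simp)+
		moreover have "b - ?x = mesh n" by simp
		ultimately show ?thesis using rs_eq_Zs_less[OF x] by (simp only:)
	qed
	have "(%n. L * mesh n) ----> L * 0" by (intro tendsto_mult tendsto_const mesh_tendsto)
	hence "\<bar>rs b - Zs b\<bar> <= 0" using le by (intro LIMSEQ_le_const) auto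
	moreover have "x = b" using False `x <= b` by simp
	ultimately show ?thesis by simp
qed (rule rs_eq_Zs_less)

lemma gr_bdd: "exp_bdd (ka + 1) gr"
	unfolding gr_def by (intro exp_bdd_add exp_bdd_cmult exp_bdd_mono[OF X.Hv] exp_bdd_mono[OF Wc_bdd]) simp_all
lemma gr_rcont: "rcont gr"
	unfolding gr_def Wc_def by (intro rcont_add rcont_cmult rcont_mult Heaviside(2) X.rc rcont_lessThan)
lemma qH_bdd: "exp_bdd (ka + 1) (%x. q * Heaviside x)"
	by (intro exp_bdd_cmult exp_bdd_mono[OF X.Hv]) simp
lemma qH_rcont: "rcont (%x. q * Heaviside x)" by (intro rcont_cmult Heaviside(2))

lemma Zs_relation: "ka + 1 < th ==> laplace (%x. q * Heaviside x) th = (Ps th - 0 * th - q) * laplace Zs th"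
	unfolding Zs_def laplace_cmult X.prim_relation by simp

text \<open>Under the exponent \<open>Ps th - dl * th\<close>, the primitive part of
  \<open>rs\<close> leaves a defect of \<open>- q * dl\<close> times the transform of
  \<open>W\<close>. As \<open>W = Wb + Wc\<close>, the convolution term cancels the part of this
  defect that belongs to \<open>[b, \<infinity>)\<close>, and \<open>Wc\<close> remains.\<close>

lemma rs_relation:
	assumes th: "ka + 1 < th"
	shows "laplace gr th = (Ps th - dl * th - q) * laplace rs th"
proof -
	have th': "ka < th" "0 < th" using th X.ka by auto
	have c: "Ps th - q ~= 0" "Ps th - dl * th - q ~= 0" using X.lap(1)[OF th'(1)] Y.lap(1)[OF th'(1)] by auto
	have "(%x. Wb x + Wc x) = W" by (auto simp: Wb_def Wc_def indicator_def)
	with laplace_add[OF Wb_bdd Wc_bdd th'(1)] have W: "laplace Wb th + laplace Wc th = 1 / (Ps th - q)"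
		using X.lap(2)[OF th'(1)] by simp
	have "laplace rs th = q * laplace X.prim th + q * dl * (laplace WW th * laplace Wb th)"
		unfolding rs_def
		by (subst laplace_add[OF exp_bdd_cmult[OF X.prim_bdd] exp_bdd_cmult[OF cv_bdd] th])
			(simp add: laplace_cmult cv_laplace[OF Y.bdd Wb_bdd Wb_nonneg X.ka th])
	also have "... = q * (1 / (th * (Ps th - q))) + q * dl * (1 / (Ps th - dl * th - q) * laplace Wb th)"
		using X.prim_laplace[OF th] Y.lap(2)[OF th'(1)] by simp
	finally have "(Ps th - dl * th - q) * laplace rs th =
		q * ((Ps th - dl * th - q) / (th * (Ps th - q))) + q * dl * laplace Wb th"
		using c by (simp add: distrib_left)
	also have "(Ps th - dl * th - q) / (th * (Ps th - q)) = 1 / th - dl * (1 / (Ps th - q))"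
		using c th'(2) by (simp add: field_simps)
	also have "q * (1 / th - dl * (1 / (Ps th - q))) + q * dl * laplace Wb th = q * (1 / th) - q * dl * laplace Wc th"
		unfolding W[symmetric] by (simp add: algebra_simps)
	also have "... = laplace gr th"
		unfolding gr_def laplace_add[OF exp_bdd_cmult[OF X.Hv] exp_bdd_cmult[OF Wc_bdd] th'(1)] laplace_cmult
		using th' by (simp add: Heaviside(3))
	finally show ?thesis by simp
qed

lemma r_fun_eq: "r_fun q dl b W WW x = 1 + rs x"
proof -
	have "(LINT y:{b..x}|lborel. WW (x - y) * W y) = cv WW Wb x"
		unfolding cv_def set_lebesgue_integral_def
	proof (rule integral_cong[OF refl])
		fix y show "indicator {b..x} y *\<^sub>R (WW (x - y) * W y) = WW (x - y) * Wb y"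
			using exp_bdd_neg[OF Y.bdd, of "x - y"] by (auto simp: Wb_def indicator_def)
	qed
	thus ?thesis by (simp add: r_fun_def Z_fun_def rs_def X.prim_eq)
qed

end

section \<open>Adaptedness of the Euler limits\<close>

text \<open>Reduces the running supremum to countably many times, for measurability. The endpoint
  \<open>e\<close> is kept because no rational times to its right are available.\<close>

lemma SUP_right_cont_rational:
	fixes f :: "real => real"
	assumes rc: "!!s. 0 <= s ==> (f \<longlongrightarrow> f s) (at_right s)" and e: "0 <= e" and b: "bdd_above (f ` {0..e})"
	shows "(SUP s\<in>{0..e}. f s) = (SUP s\<in>insert e ({0..e} \<inter> \<rat>). f s)"
proof (rule antisym)
	let ?I = "insert e ({0..e} \<inter> \<rat>)"
	let ?R = "SUP s\<in>?I. f s"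
	have sub: "?I <= {0..e}" using e by auto
	hence b': "bdd_above (f ` ?I)" using b by (meson bdd_above_mono image_mono)
	show "?R <= (SUP s\<in>{0..e}. f s)"
		by (rule cSUP_subset_mono[OF _ b sub]) auto
	show "(SUP s\<in>{0..e}. f s) <= ?R"
	proof (rule cSUP_least)
		fix s assume s: "s \<in> {0..e}"
		show "f s <= ?R"
		proof (cases "s = e")
			case True
			thus ?thesis by (intro cSUP_upper b') auto
		next
			case False
			hence "s < e" using s by simp
			have ev: "eventually (%n. grid n s + mesh n <= e) sequentially"
				using order_tendstoD(2)[OF grid_up_tendsto[of s], of e] `s < e` by (auto elim: eventually_mono)
			have "(%n. f (grid n s + mesh n)) ----> f s" using s by (intro grid_up_right_cont rc) simp
			moreover have "eventually (%n. f (grid n s + mesh n) <= ?R) sequentially"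
				using ev
			proof eventually_elim
				case (elim n)
				have "grid n s + mesh n \<in> \<rat>" unfolding grid_def by (intro Rats_add Rats_divide) auto
				moreover have "0 <= grid n s + mesh n" using s grid_nonneg[of s n] by (simp add: add_nonneg_nonneg)
				ultimately show ?case using elim by (intro cSUP_upper b') auto
			qed
			ultimately show ?thesis by (intro tendsto_upperbound[OF _ _ sequentially_bot])
		qed
	qed (use e in auto)
qed

lemma occ_right_cont:
	assumes "density01 h" "0 <= s"
	shows "(occ h \<longlongrightarrow> occ h s) (at_right s)"
proof (rule tendsto_sandwich)
	show "eventually (%t. occ h s <= occ h t) (at_right s)"
		using eventually_at_right_less[of s]
		by eventually_elim (use occ_mono(1)[OF assms] in "auto dest: less_imp_le")
	show "eventually (%t. occ h t <= occ h s + (t - s)) (at_right s)"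
		using eventually_at_right_less[of s]
	proof eventually_elim
		case (elim t)
		thus ?case using occ_mono(2)[OF assms, of t] by simp
	qed
	show "((%t. occ h s + (t - s)) \<longlongrightarrow> occ h s) (at_right s)"
		by (auto intro!: tendsto_eq_intros)
qed simp

context good_levy
begin

lemma occ_adapted:
	fixes V :: "real => 'a => real"
	assumes t: "0 <= t" and V: "!!s. 0 <= s ==> s <= t ==> V s \<in> borel_measurable (F t)"
	shows "(%w. occ (%s. indicat_real {b<..} (V (grid n s) w)) t) \<in> borel_measurable (F t)"
proof -
	define v where "v p = V (min t (max 0 (grid n (snd p)))) (fst p)" for p
	define h where "h p = indicator {0..<t} (snd p) * indicat_real {b<..} (v p)" for p
	have "h \<in> borel_measurable (F t \<Otimes> lborel)"
	proof -
		have "(%p. V (min t (max 0 (real_of_int \<lfloor>real (Suc n) * snd p\<rfloor> / real (Suc n)))) (fst p)) \<in> borel_measurable (F t \<Otimes> borel)"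
		proof (rule measurable_compose_countable'[where I = UNIV and g = "%p. \<lfloor>real (Suc n) * snd p\<rfloor>"])
			fix i :: int
			have "V (min t (max 0 (real_of_int i / real (Suc n)))) \<in> borel_measurable (F t)" using t by (intro V) auto
			thus "(%p. V (min t (max 0 (real_of_int i / real (Suc n)))) (fst p)) \<in> borel_measurable (F t \<Otimes> borel)"
				by (rule measurable_compose[OF measurable_fst])
		next
			show "(%p. \<lfloor>real (Suc n) * snd p\<rfloor>) \<in> F t \<Otimes> borel \<rightarrow>\<^sub>M count_space UNIV" by measurable
		qed simp
		hence [measurable]: "v \<in> borel_measurable (F t \<Otimes> borel)" unfolding v_def grid_def .
		have "h \<in> borel_measurable (F t \<Otimes> borel)" unfolding h_def by measurable
		thus ?thesis by (subst measurable_cong_sets[OF sets_pair_measure_cong[OF refl sets_lborel] refl])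
	qed
	hence "(%w. LINT s|lborel. h (w, s)) \<in> borel_measurable (F t)"
		using sigma_finite_measure.borel_measurable_lebesgue_integral[OF sigma_finite_lborel, of "%w s. h (w, s)" "F t"] by simp
	moreover have "(LINT s|lborel. h (w, s)) = occ (%s. indicat_real {b<..} (V (grid n s) w)) t" for w
		unfolding occ_def set_lebesgue_integral_def
	proof (rule integral_cong[OF refl])
		fix s
		show "h (w, s) = indicator {0..<t} s *\<^sub>R indicat_real {b<..} (V (grid n s) w)"
			using grid_nonneg[of s n] grid_le[of n s] by (cases "s \<in> {0..<t}") (auto simp: h_def v_def)
	qed
	ultimately show ?thesis by simp
qed

lemma proc_adapted:
	assumes K: "K = {0..} | (EX r>=0. K = {0..r})" and t: "0 <= t"
		and H: "!!s. 0 <= s ==> s <= t ==> H s \<in> borel_measurable (F t)"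
		and h: "!!w. density01 (h w)" "!!s w. H s w = occ (h w) s" and dl: "0 <= dl"
	shows "(%w. proc K (%s. X s w) x dl (%s. H s w) t) \<in> borel_measurable (F t)"
proof -
	obtain e where e: "K \<inter> {0..t} = {0..e}" "0 <= e" "e <= t"
	proof (cases "K = {0..}")
		case True
		thus ?thesis using t by (intro that[of t]) auto
	next
		case False
		then obtain r where "0 <= r" "K = {0..r}" using K by blast
		thus ?thesis using t by (intro that[of "min r t"]) auto
	qed
	define z where "z w s = x + X s w - dl * H s w" for w s
	have z_meas: "(%w. z w s) \<in> borel_measurable (F t)" if "0 <= s" "s <= t" for s
		unfolding z_def using H[OF that] X_F[OF that] by measurable
	have z_rc: "(z w \<longlongrightarrow> z w s) (at_right s)" if "0 <= s" for w s
		unfolding z_def h(2) using X_cadlag[of w] that by (intro tendsto_intros occ_right_cont h(1)) (auto simp: cadlag_def)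
	have z_b: "bounded (z w ` {0..t})" for w
		unfolding z_def h(2) by (rule proc_bounded[OF X_cadlag h(1) dl])
	have f_b: "bdd_above ((%s. max 0 (- z w s)) ` {0..e})" for w
	proof -
		obtain B where B: "!!s. s \<in> {0..t} ==> \<bar>z w s\<bar> <= B" using z_b[of w] unfolding bounded_real by blast
		show ?thesis
		proof (rule bdd_aboveI2)
			fix s assume "s \<in> {0..e}"
			thus "max 0 (- z w s) <= \<bar>B\<bar>" using B[of s] e by auto
		qed
	qed
	have eq: "(SUP s\<in>K \<inter> {0..t}. max 0 (- z w s)) = (SUP s\<in>insert e ({0..e} \<inter> \<rat>). max 0 (- z w s))" for w
		unfolding e(1) by (rule SUP_right_cont_rational[OF tendsto_max[OF tendsto_const tendsto_minus[OF z_rc]] e(2) f_b])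
	have "(%w. SUP s\<in>insert e ({0..e} \<inter> \<rat>). max 0 (- z w s)) \<in> borel_measurable (F t)"
	proof (rule borel_measurable_cSUP)
		show "countable (insert e ({0..e} \<inter> \<rat>))" using countable_rat by (intro countable_insert countable_Int2) simp
		show "(%w. max 0 (- z w s)) \<in> borel_measurable (F t)" if "s \<in> insert e ({0..e} \<inter> \<rat>)" for s
			using that e by (intro borel_measurable_max borel_measurable_const borel_measurable_uminus z_meas) auto
		show "bdd_above ((%s. max 0 (- z w s)) ` insert e ({0..e} \<inter> \<rat>))" for w
			by (rule bdd_above_mono[OF f_b]) (use e in auto)
	qed
	hence "(%w. z w t + (SUP s\<in>insert e ({0..e} \<inter> \<rat>). max 0 (- z w s))) \<in> borel_measurable (F t)"
		by (intro borel_measurable_add z_meas t) auto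
	from this[folded eq] show ?thesis unfolding proc_def refl_def z_def .
qed

text \<open>Up to time \<open>t\<close> an Euler scheme is a finite iteration of \<open>eop\<close>,
  each iteration preserves adaptedness, and pointwise limits do too.\<close>

lemma limV_adapted:
	assumes K: "K = {0..} | (EX r>=0. K = {0..r})" and dl: "0 <= dl" and t: "0 <= t"
	shows "(%w. limV K (%s. X s w) x dl b t) \<in> borel_measurable (F t)"
proof (rule borel_measurable_LIMSEQ_real)
	have dK: "down K" using K by auto
	show "(%n. euV K (%s. X s w) x dl b n t) ----> limV K (%s. X s w) x dl b t" for w
		by (rule euV_tendsto[OF X_cadlag dl dK t])
	fix n
	let ?E = "%k w. (eop K (%s. X s w) x dl b n ^^ k) (%_. 0)"
	have ex: "EX h. (ALL w. density01 (h w)) & (ALL s w. ?E k w s = occ (h w) s)" for k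
	proof (cases k)
		case 0
		have "density01 (%_. 0)" by (simp add: density01_def)
		moreover have "occ (%_. 0) s = 0" for s by (simp add: occ_def set_lebesgue_integral_def)
		ultimately show ?thesis using 0 by (intro exI[of _ "%_ _. 0"]) simp
	next
		case (Suc j)
		thus ?thesis
			by (intro exI[of _ "%w s. indicat_real {b<..} (proc K (%s. X s w) x dl (?E j w) (grid n s))"])
				(simp add: density01_grid eop_def)
	qed
	have PA: "(%w. proc K (%s. X s w) x dl (?E k w) u) \<in> borel_measurable (F u)"
		if E: "!!s. 0 <= s ==> s <= u ==> (%w. ?E k w s) \<in> borel_measurable (F u)" and "0 <= u" for k u
	proof -
		obtain h where h: "!!w. density01 (h w)" "!!s w. ?E k w s = occ (h w) s" using ex[of k] by blast
		show ?thesis by (rule proc_adapted[OF K `0 <= u` E h dl])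
	qed
	have EA: "(%w. ?E k w u) \<in> borel_measurable (F u)" if "0 <= u" for k u
		using that
	proof (induction k arbitrary: u)
		case 0
		show ?case by simp
	next
		case (Suc k)
		have "(%w. proc K (%s. X s w) x dl (?E k w) s) \<in> borel_measurable (F u)" if "0 <= s" "s <= u" for s
			using that by (intro measurable_F_mono[OF PA, where s = s and t = u]) (auto intro: measurable_F_mono[OF Suc.IH])
		thus ?case unfolding funpow.simps comp_def eop_def by (intro occ_adapted Suc.prems)
	qed
	define k where "k = nat \<lceil>real (Suc n) * t\<rceil>"
	have "t <= real k / real (Suc n)"
	proof -
		have "real (Suc n) * t <= real k" unfolding k_def by linarith
		thus ?thesis by (simp add: le_divide_eq mult.commute del: of_nat_Suc)
	qed
	hence "euV K (%s. X s w) x dl b n t = proc K (%s. X s w) x dl (?E k w) t" for w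
		unfolding euV_def by (intro proc_cong euH_eq t) auto
	moreover have "(%w. proc K (%s. X s w) x dl (?E k w) t) \<in> borel_measurable (F t)"
		using t by (intro PA) (auto intro: measurable_F_mono[OF EA])
	ultimately show "(%w. euV K (%s. X s w) x dl b n t) \<in> borel_measurable (F t)" by simp
qed

end

text \<open>By the substitution \<open>u = k h + s\<close> the discounted integrals over the steps
  form one discounted integral over \<open>[0, m h)\<close>. The right end of each closed step is a
  null set and belongs to the next step.\<close>

lemma grid_sum:
	fixes Ph :: "nat => real => real" and Ps :: "real => real"
	assumes h: "0 < h"
		and int: "!!k. k < m ==> integrable lborel (%s. disc {0..h} q s * Ph k s)"
		and eq: "!!k s. k < m ==> 0 <= s ==> s < h ==> Ps (real k * h + s) = Ph k s"
	shows "(\<Sum>k<m. exp (- q * (real k * h)) * (LINT s|lborel. disc {0..h} q s * Ph k s)) =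
			(LINT u|lborel. disc {0..<real m * h} q u * Ps u)"
		and "integrable lborel (%u. disc {0..<real m * h} q u * Ps u)"
proof -
	let ?e = "%k. exp (- q * (real k * h))"
	let ?L = "%k. ?e k * (LINT s|lborel. disc {0..h} q s * Ph k s)"
	let ?R = "%m. LINT u|lborel. disc {0..<real m * h} q u * Ps u" and ?I = "%m. integrable lborel (%u. disc {0..<real m * h} q u * Ps u)"
	have *: "m' <= m ==> ?I m' &
		(\<Sum>k<m'. ?L k) =
			?R m'" for m'
	proof (induction m')
		case 0
		show ?case by simp
	next
		case (Suc k)
		hence k: "k < m" by simp
		define G where "G u = disc {real k * h..<real (Suc k) * h} q u * Ps u" for u
		define J where "J s = ?e k * (disc {0..h} q s * Ph k s)" for s
		have GJ: "G (real k * h + 1 * s) = indicator (- {h}) s * J s" for s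
		proof (cases "0 <= s & s < h")
			case True
			hence "real k * h + 1 * s \<in> {real k * h..<real (Suc k) * h}" by (simp add: distrib_right)
			moreover have "exp (- q * (real k * h + 1 * s)) = ?e k * exp (- q * s)"
				unfolding exp_add[symmetric] by (simp add: distrib_left)
			moreover have "Ps (real k * h + 1 * s) = Ph k s" using eq[OF k, of s] True by simp
			ultimately have "G (real k * h + 1 * s) = ?e k * exp (- q * s) * Ph k s" unfolding G_def by simp
			thus ?thesis using True by (simp add: J_def mult.assoc)
		next
			case False
			hence "real k * h + 1 * s \<notin> {real k * h..<real (Suc k) * h}" by (auto simp: distrib_right)
			thus ?thesis using False h by (auto simp: G_def J_def indicator_def)
		qed
		have Ji: "integrable lborel J" unfolding J_def by (rule integrable_mult_right[OF int[OF k]])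
		have AE: "AE s in lborel. indicator (- {h}) s * J s = J s"
			using AE_lborel_singleton[of h] by eventually_elim simp
		have Jm: "J \<in> borel_measurable lborel" by (rule borel_measurable_integrable[OF Ji])
		hence Jm': "(%s. indicator (- {h}) s * J s) \<in> borel_measurable lborel" by measurable
		have "integrable lborel (%s. G (real k * h + 1 * s))"
			unfolding GJ using integrable_cong_AE[OF Jm' Jm AE] Ji by simp
		hence Gi: "integrable lborel G" by (subst (asm) lborel_integrable_real_affine_iff) simp_all
		have GI: "integral\<^sup>L lborel G = integral\<^sup>L lborel J"
		proof -
			have "integral\<^sup>L lborel G = (LINT s|lborel. G (real k * h + 1 * s))"
				using lborel_integral_real_affine[of 1 G "real k * h"] by simp
			also have "... = integral\<^sup>L lborel J" unfolding GJ by (rule integral_cong_AE[OF Jm' Jm AE])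
			finally show ?thesis .
		qed
		have split: "disc {0..<real (Suc k) * h} q u * Ps u = disc {0..<real k * h} q u * Ps u + G u" for u
		proof -
			have "real k * h <= real (Suc k) * h" "0 <= real k * h" using h by (auto simp: distrib_right)
			thus ?thesis by (auto simp: G_def indicator_def simp del: of_nat_Suc)
		qed
		have IH: "?I k"
			"(\<Sum>k<k. ?L k) =
			?R k" using Suc by auto
		have "integral\<^sup>L lborel J = ?L k"
			unfolding J_def by simp
		thus ?case
			unfolding split sum.lessThan_Suc integral_add[OF IH(1) Gi] IH(2) GI
			using integrable_add[OF IH(1) Gi] by simp
	qed
	show "(\<Sum>k<m. ?L k) = ?R m" and "?I m"
		using *[OF order_refl] by auto
qed

text \<open>Convexity of the primitive of an increasing function; in
  \<open>occupation_discrete\<close> it converts the comparison of \<open>S\<close> with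
  \<open>V\<close> into one of expectations.\<close>

lemma (in scale_function) prim_increment_mono:
	assumes "0 <= a" "x <= y"
	shows "prim (x + a) - prim x <= prim (y + a) - prim y"
proof -
	have i: "integrable lborel (%z. Heaviside (x - z) * W z)" for x by (rule cv_integrable[OF Hv bdd nonneg ka])
	have e: "prim (x + a) - prim x = (LINT u|lborel. indicator {0<..a} u * W (x + u))"
		and ei: "integrable lborel (%u. indicator {0<..a} u * W (x + u))" for x
	proof -
		let ?D = "%z. Heaviside (x + a - z) * W z - Heaviside (x - z) * W z"
		have D: "?D (x + 1 * u) = indicator {0<..a} u * W (x + u)" for u using assms(1) by (auto simp: indicator_def)
		have Di: "integrable lborel ?D" by (intro integrable_diff i)
		show "integrable lborel (%u. indicator {0<..a} u * W (x + u))"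
			using lborel_integrable_real_affine[OF Di, of 1 x] unfolding D by simp
		have "prim (x + a) - prim x = integral\<^sup>L lborel ?D"
			unfolding prim_def cv_def by (simp only: integral_diff[OF i i])
		also have "... = (LINT u|lborel. ?D (x + 1 * u))" using lborel_integral_real_affine[of 1 ?D x] by simp
		finally show "prim (x + a) - prim x = (LINT u|lborel. indicator {0<..a} u * W (x + u))" unfolding D .
	qed
	show ?thesis unfolding e using assms(2)
		by (intro integral_mono ei mult_left_mono monoD[OF mono_W]) auto
qed

section \<open>Occupation times\<close>

locale tame_process = good_levy M X for M :: "'a measure" and X :: "real => 'a => real" +
	fixes V :: "real => 'a => real" and dl v0 :: real
	assumes dl: "0 <= dl" and adapted: "0 <= t ==> V t \<in> borel_measurable (F t)"
		and V_tame: "tame (%t. X t w) dl (%t. V t w)" and V_0: "V 0 w <= v0"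
begin

lemma V_le: "0 <= t ==> t <= N ==> V t w <= v0 + DU N w"
	using tame_upper[OF V_tame order_refl, of t w "DU N w"] DU_ge[of N _ t w] V_0[of w] by auto

lemma V_measurable: "0 <= t ==> V t \<in> borel_measurable M"
	by (rule measurable_F[OF adapted])

lemma V_exp_integrable:
	assumes "0 <= t" "0 <= ka"
	shows "integrable M (%w. exp (ka * V t w))"
proof (rule integrable_bound)
	show "integrable M (%w. exp (ka * v0) * exp (ka * DU t w))" by (intro integrable_mult_right DU_exp assms)
	show "(%w. exp (ka * V t w)) \<in> borel_measurable M" using V_measurable[OF assms(1)] by measurable
	show "AE w in M. norm (exp (ka * V t w)) <= norm (exp (ka * v0) * exp (ka * DU t w))"
	proof (rule AE_I2)
		fix w
		have "ka * V t w <= ka * v0 + ka * DU t w"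
			using mult_left_mono[OF V_le[OF assms(1) order_refl, of w] assms(2)] by (simp add: distrib_left)
		thus "norm (exp (ka * V t w)) <= norm (exp (ka * v0) * exp (ka * DU t w))"
			by (simp add: exp_add[symmetric])
	qed
qed

text \<open>The process that follows \<open>X\<^sub>u - dl u\<close> from the last grid point on, without reflection or refraction.\<close>
definition S :: "nat => real => 'a => real" where
	"S n u w = V (grid n u) w + (X u w - X (grid n u) w - dl * (u - grid n u))"

lemma joint_measurable:
	assumes "0 <= N"
	shows "(%(u, w). X (min N (max 0 u)) w) \<in> borel_measurable (borel \<Otimes> M)"
		"(%(u, w). V (min N (max 0 u)) w) \<in> borel_measurable (borel \<Otimes> M)"
		"(%(u, w). V (min N (max 0 (grid n u))) w) \<in> borel_measurable (borel \<Otimes> M)"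
		"(%(u, w). X (min N (max 0 (grid n u))) w) \<in> borel_measurable (borel \<Otimes> M)"
proof -
	show 1: "(%(u, w). X (min N (max 0 u)) w) \<in> borel_measurable (borel \<Otimes> M)" by (rule clip_measurable[OF assms])
	show 2: "(%(u, w). V (min N (max 0 u)) w) \<in> borel_measurable (borel \<Otimes> M)"
		by (rule clip_measurable_right_cont[OF assms V_measurable]) (auto intro: tame_right_cont[OF V_tame X_cadlag _ dl])
	have g: "(%p. (grid n (fst p), snd p)) \<in> (borel \<Otimes> M) \<rightarrow>\<^sub>M (borel \<Otimes> M)"
		by (rule measurable_Pair[OF measurable_compose[OF measurable_fst grid_measurable[of "%x. x"]] measurable_snd])
	show "(%(u, w). V (min N (max 0 (grid n u))) w) \<in> borel_measurable (borel \<Otimes> M)"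
		using measurable_compose[OF g 2] by (simp add: case_prod_unfold)
	show "(%(u, w). X (min N (max 0 (grid n u))) w) \<in> borel_measurable (borel \<Otimes> M)"
		using measurable_compose[OF g 1] by (simp add: case_prod_unfold)
qed

lemma grid_clip: "0 <= u ==> u <= N ==> min N (max 0 (grid n u)) = grid n u"
	using grid_nonneg[of u n] grid_le[of n u] by simp

lemma functional_measurable:
	assumes "0 <= N" and f: "f \<in> borel_measurable (borel \<Otimes> borel \<Otimes> borel \<Otimes> borel \<Otimes> borel)"
	shows "(%p. indicator {0..<N} (fst p) * (f (fst p, V (fst p) (snd p), S n (fst p) (snd p), V (grid n (fst p)) (snd p), X (fst p) (snd p) - X (grid n (fst p)) (snd p)) :: real))
		\<in> borel_measurable (borel \<Otimes> M)"
proof -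
	let ?BM = "borel_measurable (borel \<Otimes> M)"
	note [measurable] = joint_measurable[OF assms(1), unfolded case_prod_unfold]
	define v x v' x' where "v p = V (min N (max 0 (fst p))) (snd p)" and "x p = X (min N (max 0 (fst p))) (snd p)"
		and "v' p = V (min N (max 0 (grid n (fst p)))) (snd p)" and "x' p = X (min N (max 0 (grid n (fst p)))) (snd p)" for p
	have [measurable]: "v \<in> ?BM" "x \<in> ?BM"
		"v' \<in> ?BM" "x' \<in> ?BM"
		unfolding v_def x_def v'_def x'_def by measurable
	have [measurable]: "(%p. grid n (fst p)) \<in> ?BM"
		by (rule measurable_compose[OF measurable_fst grid_measurable[of "%x. x"]])
	let ?t = "%p. (fst p, v p, v' p + (x p - x' p - dl * (fst p - grid n (fst p))), v' p, x p - x' p)"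
	have t: "?t \<in>
		(borel \<Otimes> M) \<rightarrow>\<^sub>M (borel \<Otimes> borel \<Otimes> borel \<Otimes> borel \<Otimes> borel)" by measurable
	have [measurable]: "(%p. f (?t p)) \<in> ?BM"
		by (rule measurable_compose[OF t f])
	have "(%p. indicator {0..<N} (fst p) * f (?t p)) \<in> ?BM"
		by measurable
	moreover have "indicator {0..<N} (fst p) * f (?t p) =
		indicator {0..<N} (fst p) * f (fst p, V (fst p) (snd p), S n (fst p) (snd p), V (grid n (fst p)) (snd p), X (fst p) (snd p) - X (grid n (fst p)) (snd p))" for p
		by (cases "fst p \<in> {0..<N}") (simp_all add: v_def x_def v'_def x'_def S_def grid_clip)
	ultimately show ?thesis by simp
qed

lemma S_tendsto:
	assumes "isCont (%t. X t w) u" "0 < u"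
	shows "(%n. S n u w) ----> V u w" "(%n. V (grid n u) w) ----> V u w"
proof -
	show V: "(%n. V (grid n u) w) ----> V u w"
		by (rule isCont_tendsto_compose[OF tame_isCont[OF V_tame assms dl] grid_tendsto])
	have "(%n. X (grid n u) w) ----> X u w" by (rule isCont_tendsto_compose[OF assms(1) grid_tendsto])
	hence "(%n. S n u w) ----> V u w + (X u w - X u w - dl * (u - u))"
		unfolding S_def by (intro tendsto_intros V grid_tendsto)
	thus "(%n. S n u w) ----> V u w" by simp
qed

lemma integral_indicator_space: "(LINT w|M. indicator (space M) w * f w) = (LINT w|M. f w :: real)"
	by (intro integral_cong) simp_all

text \<open>(Generator of \<open>X t - dl t\<close>) - \<open>q\<close> sends the difference of the
  primitives shifted by \<open>et\<close> and \<open>- et\<close> to the indicator of the window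
  around \<open>c\<close>, so Dynkin's formula over a step yields the expected time that
  \<open>S\<close> spends there. At the end of the step \<open>V\<close> is at least
  \<open>S\<close> by tameness, and convexity of the primitive makes the passage from
  \<open>S\<close> to \<open>V\<close> an inequality in the right direction. The steps telescope,
  and the final term is of order \<open>et\<close> because the primitive is Lipschitz.\<close>

lemma occupation_discrete:
	assumes sc: "scale_function (%th. ps th - dl * th) q ka WW"
	obtains C where "0 <= C" "!!et n. 0 < et ==> et <= 1 ==>
		integrable lborel (%u. disc {0..<real N} q u * (LINT w|M. indicat_real {c - et..<c + et} (S n u w))) &
		(LINT u|lborel. disc {0..<real N} q u * (LINT w|M. indicat_real {c - et..<c + et} (S n u w))) <= C * et"
proof -
	let ?I = "%et. {c - et..<c + et}"
	let ?p = "%et n u. LINT w|M. indicat_real (?I et) (S n u w)"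
	interpret Y: scale_function "%th. ps th - dl * th" q ka WW by (rule sc)
	have ka1: "0 <= ka + 1" using Y.ka by simp
	obtain C0 where C0: "0 <= C0" "!!x. \<bar>WW x\<bar> <= C0 * exp (ka * x)" using exp_bddD[OF Y.bdd] by blast
	\<comment> \<open>\<open>2 * et\<close> is the distance of the two arguments in the final term. The
	  other factor bounds \<open>WW\<close> at \<open>V - c + et\<close>, where \<open>1\<close> covers
	  \<open>et <= 1\<close>.\<close>
	define C where "C = 2 * (C0 * exp (ka * (v0 - c + 1)) * (LINT w|M. exp (ka * DU (real N) w)))"
	have C_nn: "0 <= C" unfolding C_def by (intro mult_nonneg_nonneg C0 integral_nonneg_AE AE_I2) simp_all
	have main: "integrable lborel (%u. disc {0..<real N} q u * ?p et n u) &
		(LINT u|lborel. disc {0..<real N} q u * ?p et n u) <= C * et"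
		if et: "0 < et" "et <= 1" for et n
	proof -
		define h where "h = mesh n"
		define m where "m = N * Suc n"
		define t where "t k = real k * h" for k
		have h: "0 < h" by (simp add: h_def)
		have mh: "real m * h = real N" unfolding m_def h_def of_nat_mult by (simp del: of_nat_Suc)
		have t0: "0 <= t k" for k using h by (simp add: t_def)
		have tS: "t (Suc k) = t k + h" for k by (simp add: t_def distrib_right)
		define U where "U e k w = V (t k) w - c + e" for e k w
		have U_meas: "U e k \<in> borel_measurable (F (t k))" for e k
			unfolding U_def[abs_def] using adapted[OF t0[of k]] by measurable
		have U_measM [measurable]: "U e k \<in> borel_measurable M" for e k by (rule measurable_F[OF U_meas])
		have spF: "space M \<in> sets (F (t k))" for k using sets.top[of "F (t k)"] by simp
		have U_exp: "integrable M (%w. exp ((ka + 1) * U e k w))" for e k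
		proof -
			have "exp ((ka + 1) * U e k w) = exp ((ka + 1) * (e - c)) * exp ((ka + 1) * V (t k) w)" for w
				unfolding U_def exp_add[symmetric] by (simp add: algebra_simps)
			thus ?thesis using V_exp_integrable[OF t0 ka1] by simp
		qed
		have U_exp': "integrable M (%w. indicator (space M) w * exp ((ka + 1) * U e k w))" for e k
			using integrable_mult_indicator[OF sets.top U_exp] by simp
		define I where "I e k s w = U e k w + (X (t k + s) w - X (t k) w - dl * s)" for e k s w
		define A where "A e k = (LINT w|M. Y.prim (U e k w))" for e k
		define B where "B e k = (LINT w|M. Y.prim (I e k h w))" for e k
		define L where "L e k = (LINT s|lborel. disc {0..h} q s * (LINT w|M. Heaviside (I e k s w)))" for e k
		have L_int: "integrable lborel (%s. disc {0..h} q s * (LINT w|M. Heaviside (I e k s w)))"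
			and dyn: "exp (- q * h) * B e k = A e k + L e k" for e k
		proof -
			note dyn = dynkin_step[OF t0[of k] less_imp_le[OF h] spF U_meas[of e k] ka1 Y.prim_bdd Y.prim_rcont Heaviside(1)[OF ka1] Heaviside(2) Y.prim_relation U_exp'[of e k],
				unfolded integral_indicator_space, folded I_def]
			show "integrable lborel (%s. disc {0..h} q s * (LINT w|M. Heaviside (I e k s w)))" by (rule dyn(2))
			show "exp (- q * h) * B e k = A e k + L e k" unfolding A_def B_def L_def by (rule dyn(1))
		qed
		have prim_int: "integrable M (%w. Y.prim (U e k w))" for e k
			using convolution_integrable[OF U_measM Y.prim_bdd U_exp, of 0] by simp
		have primI_int: "integrable M (%w. Y.prim (I e k h w))" for e k
			using increment_integrable[OF t0[of k] less_imp_le[OF h] spF U_meas[of e k] ka1 Y.prim_bdd U_exp'[of e k], of dl]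
			by (subst integrable_cong[OF refl, of M _ "%w. indicator (space M) w * Y.prim (I e k h w)"])
				(simp_all add: I_def)
		have Im [measurable]: "I e k s \<in> borel_measurable M" if "0 <= s" for e k s unfolding I_def by measurable
		have Hv_int: "integrable M (%w. Heaviside (I e k s w))" if "0 <= s" for e k s
		proof (rule integrable_const_bound[of _ 1])
			show "(%w. Heaviside (I e k s w)) \<in> borel_measurable M"
				by (rule measurable_compose[OF Im[OF that]]) simp
		qed (simp add: indicator_def)
		define Ph where "Ph k s = (LINT w|M. Heaviside (I et k s w)) - (LINT w|M. Heaviside (I (- et) k s w))" for k s
		have Ph: "(LINT w|M. indicat_real (?I et) (S n (t k + s) w)) = Ph k s" if "0 <= s" "s < h" for k s
		proof -
			have g: "grid n (t k + s) = t k"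
				unfolding t_def h_def using grid_eqI[of k n "t k + s"] that by (simp add: t_def h_def add_divide_distrib del: of_nat_Suc) (simp add: algebra_simps add_divide_distrib)
			have "indicator (?I et) (S n (t k + s) w) = Heaviside (I et k s w) - Heaviside (I (- et) k s w)" for w
				using et(1) by (auto simp: S_def g I_def U_def indicator_def)
			thus ?thesis unfolding Ph_def using integral_diff[OF Hv_int[OF that(1)] Hv_int[OF that(1)]] by simp
		qed
		have ePh: "disc {0..h} q s * Ph k s = disc {0..h} q s * (LINT w|M. Heaviside (I et k s w)) -
				disc {0..h} q s * (LINT w|M. Heaviside (I (- et) k s w))" for k s
			unfolding Ph_def by (rule right_diff_distrib)
		have Ph_int: "integrable lborel (%s. disc {0..h} q s * Ph k s)" for k
			unfolding ePh by (rule integrable_diff[OF L_int L_int])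
		have Ph_I: "(LINT s|lborel. disc {0..h} q s * Ph k s) = L et k - L (- et) k" for k
			unfolding ePh L_def by (rule integral_diff[OF L_int L_int])
		define a where "a k = A et k - A (- et) k" for k
		have a_eq: "a k = (LINT w|M. Y.prim (U et k w) - Y.prim (U (- et) k w))" for k
			unfolding a_def A_def by (rule integral_diff[OF prim_int prim_int, symmetric])
		have a_nn: "0 <= a k" for k
			unfolding a_eq using et(1) by (intro integral_nonneg_AE AE_I2) (auto simp: U_def intro: monoD[OF Y.prim_mono])
		have step: "a k + (L et k - L (- et) k) <= exp (- q * h) * a (Suc k)" for k
		proof -
			have "B et k - B (- et) k = (LINT w|M. Y.prim (I et k h w) - Y.prim (I (- et) k h w))"
				unfolding B_def by (rule integral_diff[OF primI_int primI_int, symmetric])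
			also have "... <= a (Suc k)"
				unfolding a_eq
			proof (rule integral_mono)
				show "integrable M (%w. Y.prim (I et k h w) - Y.prim (I (- et) k h w))"
					by (rule integrable_diff[OF primI_int primI_int])
				show "integrable M (%w. Y.prim (U et (Suc k) w) - Y.prim (U (- et) (Suc k) w))"
					by (rule integrable_diff[OF prim_int prim_int])
				fix w
				have "X (t k + h) w - X (t k) w - dl * (t k + h - t k) <= V (t k + h) w - V (t k) w"
					using h by (intro tame_lower[OF V_tame] t0) simp
				hence "I (- et) k h w <= U (- et) (Suc k) w" by (simp add: I_def U_def tS)
				from Y.prim_increment_mono[OF _ this, of "2 * et"] et(1)
				show "Y.prim (I et k h w) - Y.prim (I (- et) k h w) <= Y.prim (U et (Suc k) w) - Y.prim (U (- et) (Suc k) w)"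
					by (simp add: I_def U_def algebra_simps)
			qed
			finally have "exp (- q * h) * (B et k - B (- et) k) <= exp (- q * h) * a (Suc k)" by (intro mult_left_mono) simp_all
			thus ?thesis unfolding right_diff_distrib dyn a_def by simp
		qed
		have sum: "(\<Sum>k<m'. exp (- q * (real k * h)) * (LINT s|lborel. disc {0..h} q s * Ph k s)) <= exp (- q * t m') * a m' - a 0" for m'
		proof (induction m')
			case (Suc k)
			have "exp (- q * t k) * (a k + (L et k - L (- et) k)) <= exp (- q * t k) * (exp (- q * h) * a (Suc k))"
				by (intro mult_left_mono step) simp
			also have "... = exp (- q * t (Suc k)) * a (Suc k)"
				unfolding mult.assoc[symmetric] exp_add[symmetric] tS by (simp add: distrib_left)
			finally show ?case using Suc.IH unfolding sum.lessThan_Suc Ph_I t_def by (simp only: distrib_left)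
		qed (simp add: t_def)
		have am: "a m <= C * et"
		proof -
			have tm: "t m = real N" by (simp only: t_def mh)
			have "a m <= (LINT w|M. 2 * et * (C0 * exp (ka * (v0 - c + 1)) * exp (ka * DU (real N) w)))"
				unfolding a_eq
			proof (rule integral_mono)
				show "integrable M (%w. Y.prim (U et m w) - Y.prim (U (- et) m w))"
					by (rule integrable_diff[OF prim_int prim_int])
				show "integrable M (%w. 2 * et * (C0 * exp (ka * (v0 - c + 1)) * exp (ka * DU (real N) w)))"
					by (intro integrable_mult_right DU_exp Y.ka) simp
				fix w
				have le: "U et m w <= v0 - c + 1 + DU (real N) w" using V_le[of "real N" "real N" w] et(2) by (simp add: U_def tm)
				have "Y.prim (U et m w) - Y.prim (U (- et) m w) <= WW (U et m w) * (U et m w - U (- et) m w)"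
					using et(1) by (intro Y.prim_Lipschitz) (simp_all add: U_def)
				also have "... = 2 * et * WW (U et m w)" by (simp add: U_def)
				also have "... <= 2 * et * (C0 * exp (ka * U et m w))"
					using et(1) C0(2)[of "U et m w"] by (intro mult_left_mono) auto
				also have "... <= 2 * et * (C0 * exp (ka * (v0 - c + 1 + DU (real N) w)))"
					using et(1) C0(1) le Y.ka by (intro mult_left_mono) (auto intro: mult_left_mono)
				also have "exp (ka * (v0 - c + 1 + DU (real N) w)) = exp (ka * (v0 - c + 1)) * exp (ka * DU (real N) w)"
					unfolding exp_add[symmetric] by (simp add: distrib_left)
				finally show "Y.prim (U et m w) - Y.prim (U (- et) m w) <= 2 * et * (C0 * exp (ka * (v0 - c + 1)) * exp (ka * DU (real N) w))"
					by (simp only: mult.assoc)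
			qed
			also have "... = C * et" by (simp add: C_def)
			finally show ?thesis .
		qed
		define Ps where "Ps u = ?p et n u" for u
		have PsPh: "Ps (real k * h + s) = Ph k s" if "0 <= s" "s < h" for k s
			using Ph[OF that, of k] unfolding Ps_def t_def .
		note gs = grid_sum[where m = m and Ph = Ph and Ps = Ps and h = h and q = q, OF h Ph_int PsPh, unfolded mh]
		have "exp (- q * t m) * a m <= 1 * a m" using a_nn Y.q t0[of m] by (intro mult_right_mono) auto
		hence "(LINT u|lborel. disc {0..<real N} q u * Ps u) <= C * et"
			using gs(1) sum[of m] a_nn[of 0] am by linarith
		thus ?thesis using gs(2) unfolding Ps_def by blast
	qed
	show ?thesis by (rule that[OF C_nn main])
qed

end

context tame_process
begin

text \<open>At continuity points of the path \<open>S n\<close> tends to \<open>V\<close>. By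
  Fatou's lemma the expected discounted time of \<open>V\<close> at \<open>c\<close> is bounded by
  that of \<open>S n\<close> in a window, hence by \<open>C * et\<close> for every small
  \<open>et\<close>.\<close>

lemma occupation_null:
	assumes sc: "scale_function (%th. ps th - dl * th) q ka WW"
	shows "AE w in M. AE u in lborel. 0 <= u --> V u w ~= c"
proof -
	let ?I = "%et. {c - et..<c + et}"
	let ?p = "%et n u. LINT w|M. indicat_real (?I et) (S n u w)"
	interpret Y: scale_function "%th. ps th - dl * th" q ka WW by (rule sc)
	interpret P: pair_sigma_finite lborel M by unfold_locales
	have N: "AE w in M. AE u in lborel. u \<in> {0..<real N} --> V u w ~= c" for N :: nat
	proof -
		obtain C where C: "0 <= C" "!!et n. 0 < et ==> et <= 1 ==>
			integrable lborel (%u. disc {0..<real N} q u * ?p et n u) &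
			(LINT u|lborel. disc {0..<real N} q u * ?p et n u) <= C * et"
			by (rule occupation_discrete[OF sc, where N = N and c = c]) (rule that)
		define ph where "ph p = indicator {0..<real N} (fst p) * (exp (- q * fst p) * indicat_real {c} (V (fst p) (snd p)))" for p
		define phn where "phn et n p = indicator {0..<real N} (fst p) * (exp (- q * fst p) * indicat_real (?I et) (S n (fst p) (snd p)))" for et n p
		have sb: "sets (lborel \<Otimes> M) = sets (borel \<Otimes> M)" by (rule sets_pair_measure_cong) simp_all
		have f: "(%p. exp (- q * fst p) * indicat_real {c} (fst (snd p))) \<in> borel_measurable (borel \<Otimes> borel \<Otimes> borel \<Otimes> (borel :: real measure) \<Otimes> (borel :: real measure))"
			and fn: "(%p. exp (- q * fst p) * indicat_real (?I et) (fst (snd (snd p)))) \<in> borel_measurable (borel \<Otimes> borel \<Otimes> borel \<Otimes> (borel :: real measure) \<Otimes> (borel :: real measure))" for et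
			by measurable
		have ph_meas: "ph \<in> borel_measurable (lborel \<Otimes> M)"
			unfolding measurable_cong_sets[OF sb refl] ph_def[abs_def]
			by (rule functional_measurable[OF of_nat_0_le_iff f, unfolded fst_conv snd_conv])
		have phn_meas: "phn et n \<in> borel_measurable (lborel \<Otimes> M)" for et n
			unfolding measurable_cong_sets[OF sb refl] phn_def[abs_def]
			by (rule functional_measurable[OF of_nat_0_le_iff fn, unfolded fst_conv snd_conv])
		note [measurable] = ph_meas phn_meas
		define J where "J = (\<integral>\<^sup>+w. \<integral>\<^sup>+u. ennreal (ph (u, w)) \<partial>lborel \<partial>M)"
		have le: "J <= ennreal (C * et)" if et: "0 < et" "et <= 1" for et
		proof -
			have "J <= (\<integral>\<^sup>+w. \<integral>\<^sup>+u. liminf (%n. ennreal (phn et n (u, w))) \<partial>lborel \<partial>M)"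
				unfolding J_def
			proof (rule nn_integral_mono, rule nn_integral_mono_AE)
				fix w
				show "AE u in lborel. ennreal (ph (u, w)) <= liminf (%n. ennreal (phn et n (u, w)))"
					using AE_isCont_cadlag[OF X_cadlag[of w]] AE_lborel_singleton[of 0]
				proof eventually_elim
					case (elim u)
					show ?case
					proof (cases "u \<in> {0..<real N} & V u w = c")
						case True
						hence u: "0 < u" "isCont (%t. X t w) u" using elim by auto
						have "eventually (%n. S n u w \<in> ?I et) sequentially"
							using order_tendstoD[OF S_tendsto(1)[OF u(2,1)]] et True
							by (intro eventually_mono[OF eventually_conj[OF order_tendstoD(1)[OF S_tendsto(1)[OF u(2,1)], of "c - et"] order_tendstoD(2)[OF S_tendsto(1)[OF u(2,1)], of "c + et"]]]) auto
						hence "eventually (%n. ennreal (ph (u, w)) <= ennreal (phn et n (u, w))) sequentially"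
							by eventually_elim (simp add: ph_def phn_def True)
						thus ?thesis by (rule Liminf_bounded)
					next
						case False
						hence "ph (u, w) = 0" by (auto simp: ph_def)
						thus ?thesis by simp
					qed
				qed
			qed
			also have "... <= (\<integral>\<^sup>+w. liminf (%n. \<integral>\<^sup>+u. ennreal (phn et n (u, w)) \<partial>lborel) \<partial>M)"
				by (intro nn_integral_mono nn_integral_liminf) simp
			also have "... <= liminf (%n. \<integral>\<^sup>+w. \<integral>\<^sup>+u. ennreal (phn et n (u, w)) \<partial>lborel \<partial>M)"
				by (rule nn_integral_liminf) simp
			also have "... <= liminf (%n. ennreal (C * et))"
			proof (intro Liminf_mono always_eventually allI)
				fix n
				have "(\<integral>\<^sup>+w. \<integral>\<^sup>+u. ennreal (phn et n (u, w)) \<partial>lborel \<partial>M) = (\<integral>\<^sup>+u. \<integral>\<^sup>+w. ennreal (phn et n (u, w)) \<partial>M \<partial>lborel)"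
					by (rule P.Fubini') simp
				also have "... = (\<integral>\<^sup>+u. ennreal (disc {0..<real N} q u * ?p et n u) \<partial>lborel)"
				proof (rule nn_integral_cong)
					fix u
					have m: "(%w. phn et n (u, w)) \<in> borel_measurable M"
						by (rule measurable_compose[OF measurable_Pair1' phn_meas]) simp
					have "integrable M (%w. phn et n (u, w))"
						by (rule integrable_const_bound[of _ "exp (- q * u)", OF _ m]) (simp add: phn_def indicator_def)
					hence "(\<integral>\<^sup>+w. ennreal (phn et n (u, w)) \<partial>M) = ennreal (LINT w|M. phn et n (u, w))"
						by (rule nn_integral_eq_integral) (simp add: phn_def)
					thus "(\<integral>\<^sup>+w. ennreal (phn et n (u, w)) \<partial>M) =
						ennreal (disc {0..<real N} q u * ?p et n u)"
						by (simp add: phn_def mult.assoc)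
				qed
				also have "... = ennreal (LINT u|lborel. disc {0..<real N} q u * ?p et n u)"
					using C(2)[OF et, of n] by (intro nn_integral_eq_integral AE_I2 mult_nonneg_nonneg integral_nonneg_AE) auto
				also have "... <= ennreal (C * et)" using C(2)[OF et, of n] by (intro ennreal_leI) blast
				finally show "(\<integral>\<^sup>+w. \<integral>\<^sup>+u. ennreal (phn et n (u, w)) \<partial>lborel \<partial>M) <= ennreal (C * et)" .
			qed
			finally show ?thesis by (simp add: Liminf_const)
		qed
		have "J <= ennreal 0"
		proof (rule tendsto_lowerbound[of "%n. ennreal (C * mesh n)" _ sequentially])
			have "(%n. C * mesh n) ----> C * 0" by (intro tendsto_mult tendsto_const mesh_tendsto)
			thus "(%n. ennreal (C * mesh n)) ----> ennreal 0" by (intro tendsto_ennrealI) simp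
			show "eventually (%n. J <= ennreal (C * mesh n)) sequentially" by (intro always_eventually allI le) auto
		qed simp
		hence "J = 0" by simp
		moreover have jm: "(%w. \<integral>\<^sup>+u. ennreal (ph (u, w)) \<partial>lborel) \<in> borel_measurable M" by simp
		ultimately have "AE w in M. (\<integral>\<^sup>+u. ennreal (ph (u, w)) \<partial>lborel) = 0"
			unfolding J_def by (simp only: nn_integral_0_iff_AE)
		thus ?thesis using AE_space
		proof eventually_elim
			case (elim w)
			have "(%u. ennreal (ph (u, w))) \<in> borel_measurable lborel"
				by (rule measurable_compose[OF measurable_compose[OF measurable_Pair2'[OF elim(2)] ph_meas] measurable_ennreal])
			from elim(1)[unfolded nn_integral_0_iff_AE[OF this]] show ?case
			proof (rule eventually_mono, intro impI notI)
				fix u assume "ennreal (ph (u, w)) = 0" "u \<in> {0..<real N}" "V u w = c"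
				thus False by (simp add: ph_def)
			qed
		qed
	qed
	have "AE w in M. ALL N::nat. AE u in lborel. u \<in> {0..<real N} --> V u w ~= c"
		unfolding AE_all_countable by (intro allI N)
	thus ?thesis
	proof (rule eventually_mono)
		fix w assume "ALL N::nat. AE u in lborel. u \<in> {0..<real N} --> V u w ~= c"
		hence "AE u in lborel. ALL N::nat. u \<in> {0..<real N} --> V u w ~= c" unfolding AE_all_countable .
		thus "AE u in lborel. 0 <= u --> V u w ~= c"
		proof (rule eventually_mono, intro impI)
			fix u assume *: "ALL N::nat. u \<in> {0..<real N} --> V u w ~= c" "0 <= u"
			obtain N :: nat where "u < real N" using reals_Archimedean2 by blast
			thus "V u w ~= c" using *(1)[rule_format, of N] *(2) by simp
		qed
	qed
qed

lemma expected_time_tendsto_0: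
	assumes m: "!!n. (%p. indicator {0..<real N} (fst p) * ph n p :: real) \<in> borel_measurable (borel \<Otimes> M)"
		and b: "!!n p. 0 <= ph n p" "!!n p. ph n p <= 1"
		and lim: "AE w in M. AE u in lborel. 0 < u --> (%n. ph n (u, w)) ----> 0"
	shows "(%n. LINT w|M. LINT u|lborel. indicator {0..<real N} u * ph n (u, w)) ----> 0"
		"integrable M (%w. LINT u|lborel. indicator {0..<real N} u * ph n (u, w))"
		"(LINT w|M. LINT u|lborel. indicator {0..<real N} u * ph n (u, w)) = (LINT u|lborel. LINT w|M. indicator {0..<real N} u * ph n (u, w))"
		"integrable lborel (%u. LINT w|M. indicator {0..<real N} u * ph n (u, w))"
proof -
	interpret P: pair_sigma_finite lborel M by unfold_locales
	define f where "f n p = indicator {0..<real N} (fst p) * ph n p" for n p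
	have sb: "sets (lborel \<Otimes> M) = sets (borel \<Otimes> M)" by (rule sets_pair_measure_cong) simp_all
	have fm [measurable]: "f n \<in> borel_measurable (lborel \<Otimes> M)" for n
		unfolding measurable_cong_sets[OF sb refl] f_def[abs_def] by (rule m)
	have f0: "0 <= f n p" for n p unfolding f_def using b by simp
	have fb: "f n p <= indicator {0..<real N} (fst p)" for n p
		unfolding f_def using b(2)[of n p] by (cases "fst p \<in> {0..<real N}") auto
	have ii: "integrable lborel (indicat_real {0..<real N})" by simp
	have iI: "(LINT u|lborel. indicat_real {0..<real N} u) = real N" by simp
	have fmu: "(%u. f n (u, w)) \<in> borel_measurable lborel" if "w \<in> space M" for n w
		by (rule measurable_compose[OF measurable_Pair2'[OF that] fm])
	have fiu: "integrable lborel (%u. f n (u, w))" if "w \<in> space M" for n w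
	proof (rule integrable_bound[OF ii fmu[OF that]])
		show "AE u in lborel. norm (f n (u, w)) <= norm (indicat_real {0..<real N} u)"
			using f0 fb[of n "(_, w)"] by (intro AE_I2) simp
	qed
	have Jm: "(%w. LINT u|lborel. f n (u, w)) \<in> borel_measurable M" for n
	proof -
		have "(%(w, u). f n (u, w)) \<in> borel_measurable (M \<Otimes> lborel)"
			using measurable_compose[OF measurable_pair_swap' fm] by (simp add: case_prod_unfold)
		thus ?thesis using sigma_finite_measure.borel_measurable_lebesgue_integral[OF sigma_finite_lborel, of "%w u. f n (u, w)" M] by simp
	qed
	have Jb: "0 <= (LINT u|lborel. f n (u, w))" "(LINT u|lborel. f n (u, w)) <= real N" if "w \<in> space M" for n w
	proof -
		show "0 <= (LINT u|lborel. f n (u, w))" by (intro integral_nonneg_AE AE_I2 f0)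
		have "(LINT u|lborel. f n (u, w)) <= (LINT u|lborel. indicat_real {0..<real N} u)"
			using fb[of n "(_, w)"] by (intro integral_mono fiu[OF that] ii) simp
		thus "(LINT u|lborel. f n (u, w)) <= real N" unfolding iI .
	qed
	have fpi: "integrable (lborel \<Otimes> M) (%(u, w). f n (u, w))" for n
	proof (rule P.Fubini_integrable)
		show "(%(u, w). f n (u, w)) \<in> borel_measurable (lborel \<Otimes> M)" by (simp add: case_prod_unfold)
		show "AE u in lborel. integrable M (%w. case (u, w) of (u, w) => f n (u, w))"
		proof (rule AE_I2)
			fix u
			have mm: "(%w. f n (u, w)) \<in> borel_measurable M" by (rule measurable_compose[OF measurable_Pair1' fm]) simp
			have "norm (f n (u, w)) <= 1" for w
				using f0[of n "(u, w)"] fb[of n "(u, w)"] order_trans[OF fb[of n "(u, w)"] indicator_le_1] by simp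
			thus "integrable M (%w. case (u, w) of (u, w) => f n (u, w))"
				unfolding prod.case by (intro integrable_const_bound[of _ 1, OF _ mm]) simp
		qed
		show "integrable lborel (%u. LINT w|M. norm (case (u, w) of (u, w) => f n (u, w)))"
			unfolding prod.case real_norm_def abs_of_nonneg[OF f0]
		proof (rule integrable_bound[OF ii])
			show "(%u. LINT w|M. f n (u, w)) \<in> borel_measurable lborel"
				using borel_measurable_lebesgue_integral[of "%u w. f n (u, w)" lborel] fm by (simp add: case_prod_unfold)
			have "(LINT w|M. f n (u, w)) <= indicat_real {0..<real N} u" for u
			proof -
				have mm: "(%w. f n (u, w)) \<in> borel_measurable M" by (rule measurable_compose[OF measurable_Pair1' fm]) simp
				have "norm (f n (u, w)) <= 1" for w
					using f0[of n "(u, w)"] order_trans[OF fb[of n "(u, w)"] indicator_le_1] by simp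
				hence i: "integrable M (%w. f n (u, w))" by (intro integrable_const_bound[of _ 1, OF _ mm]) simp
				have "(LINT w|M. f n (u, w)) <= (LINT w|M. indicat_real {0..<real N} u)"
					using fb[of n "(u, _)"] by (intro integral_mono i) auto
				thus ?thesis by (simp add: prob_space)
			qed
			moreover have "0 <= (LINT w|M. f n (u, w))" for u by (intro integral_nonneg_AE AE_I2 f0)
			ultimately show "AE u in lborel. norm (LINT w|M. f n (u, w)) <= norm (indicat_real {0..<real N} u)" by simp
		qed
	qed
	have "(%n. LINT w|M. LINT u|lborel. f n (u, w)) ----> (LINT w|M. 0)"
	proof (rule integral_dominated_convergence[where w = "%_. real N"])
		show "AE w in M. (%n. LINT u|lborel. f n (u, w)) ----> 0"
			using lim AE_space
		proof eventually_elim
			case (elim w)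
			have "(%n. LINT u|lborel. f n (u, w)) ----> integral\<^sup>L lborel (%u::real. 0::real)"
			proof (rule integral_dominated_convergence[where w = "indicat_real {0..<real N}"])
				show "(%u. f n (u, w)) \<in> borel_measurable lborel" for n by (rule fmu[OF elim(2)])
				show "integrable lborel (indicat_real {0..<real N})" by (rule ii)
				show "AE u in lborel. (%n. f n (u, w)) ----> 0"
					using elim(1) AE_lborel_singleton[of 0]
				proof eventually_elim
					case (elim u)
					show ?case
					proof (cases "0 < u")
						case True
						hence "(%n. ph n (u, w)) ----> 0" using elim by simp
						thus ?thesis unfolding f_def by (rule tendsto_mult_right_zero)
					next
						case False
						thus ?thesis using elim by (simp add: f_def)
					qed
				qed
				show "AE u in lborel. norm (f n (u, w)) <= indicat_real {0..<real N} u" for n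
					using f0 fb[of n "(_, w)"] by (intro AE_I2) simp
			qed simp
			thus ?case by simp
		qed
		show "AE w in M. norm (LINT u|lborel. f n (u, w)) <= real N" for n
			using AE_space by eventually_elim (use Jb in simp)
	qed (simp_all add: Jm)
	thus "(%n. LINT w|M. LINT u|lborel. indicator {0..<real N} u * ph n (u, w)) ----> 0"
		by (simp add: f_def)
	show "integrable M (%w. LINT u|lborel. indicator {0..<real N} u * ph n (u, w))"
		using P.integrable_snd[OF fpi[of n]] by (simp add: f_def)
	show "(LINT w|M. LINT u|lborel. indicator {0..<real N} u * ph n (u, w)) = (LINT u|lborel. LINT w|M. indicator {0..<real N} u * ph n (u, w))"
		using P.Fubini_integral[OF fpi[of n]] by (simp only: f_def fst_conv)
	show "integrable lborel (%u. LINT w|M. indicator {0..<real N} u * ph n (u, w))"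
		using P.integrable_fst[OF fpi[of n]] by (simp only: f_def fst_conv)
qed

end

section \<open>Passage times and blocks of climbs\<close>

lemma passage_above_rational:
	assumes rc: "!!s. 0 <= s ==> (v \<longlongrightarrow> v s) (at_right s)"
	shows "passage_above a v = (INF s\<in>\<rat> \<inter> {0<..}. if a < v s then ereal s else \<infinity>)"
proof (rule antisym)
	let ?I = "INF s\<in>\<rat> \<inter> {0<..}. if a < v s then ereal s else \<infinity>"
	show "passage_above a v <= ?I"
		unfolding passage_above_def by (intro INF_greatest) (auto intro!: Inf_lower)
	show "?I <= passage_above a v"
		unfolding passage_above_def
	proof (rule Inf_greatest)
		fix y assume "y \<in> ereal ` {t. 0 < t & a < v t}"
		then obtain t where t: "y = ereal t" "0 < t" "a < v t" by auto
		have "eventually (%s. a < v s) (at_right t)" using order_tendstoD(1)[OF rc[of t] t(3)] t(2) by simp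
		then obtain c where c: "t < c" "!!s. t < s ==> s < c ==> a < v s" unfolding eventually_at_right_field by blast
		have *: "?I <= ereal t + ereal e" if "0 < e" for e
		proof -
			have "t < min c (t + e)" using c(1) that by simp
			then obtain s where s: "s \<in> \<rat>" "t < s" "s < min c (t + e)" using Rats_dense_in_real by blast
			have "?I <= (if a < v s then ereal s else \<infinity>)"
				using s t(2) by (intro INF_lower) auto
			also have "... <= ereal t + ereal e" using c(2)[of s] s by simp
			finally show ?thesis .
		qed
		show "?I <= y"
			unfolding t(1) by (rule ereal_le_epsilon2) (rule *)
	qed
qed

context good_levy
begin

definition climb :: "real => real => nat => 'a set" where
	"climb et dl k = {w\<in>space M. et <= X (real (Suc k)) w - X (real k) w - dl}"

lemma climb_F: "k < n ==> climb et dl k \<in> sets (F (real n))"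
proof -
	assume "k < n"
	hence [measurable]: "X (real (Suc k)) \<in> borel_measurable (F (real n))" "X (real k) \<in> borel_measurable (F (real n))"
		by (intro X_F; simp)+
	have "{w\<in>space (F (real n)). et <= X (real (Suc k)) w - X (real k) w - dl} \<in> sets (F (real n))" by measurable
	thus ?thesis by (simp only: climb_def space_F)
qed

lemma climb_G: "n <= k ==> climb et dl k \<in> sets (G (real n))"
proof -
	assume "n <= k"
	hence [measurable]: "(%w. X (real (Suc k)) w - X (real k) w) \<in> borel_measurable (G (real n))"
		by (intro X_G_diff) simp_all
	have "{w\<in>space (G (real n)). et <= X (real (Suc k)) w - X (real k) w - dl} \<in> sets (G (real n))" by measurable
	thus ?thesis by (simp only: climb_def space_G)
qed

lemma prob_climb: "prob (climb et dl k) = prob {w\<in>space M. et <= X 1 w - dl}"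
proof -
	have m: "{x. et <= x - dl} \<in> sets (borel :: real measure)" by measurable
	have "prob (climb et dl k) = measure (distr M borel (%w. X (real k + 1) w - X (real k) w)) {x. et <= x - dl}"
		by (subst measure_distr[OF _ m]) (auto simp: climb_def add.commute intro!: arg_cong[where f = prob])
	also have "... = measure (distr M borel (X 1)) {x. et <= x - dl}" by (simp add: distr_increment)
	also have "... = prob {w\<in>space M. et <= X 1 w - dl}"
		by (subst measure_distr[OF _ m]) (auto intro!: arg_cong[where f = prob])
	finally show ?thesis .
qed

lemma climb_block:
	fixes p et dl :: real
	defines "p \<equiv> prob {w\<in>space M. et <= X 1 w - dl}"
	defines "B \<equiv> %k n. {w\<in>space M. ALL l<n. w \<in> climb et dl (k + l)}"
	shows "B k n \<in> sets (F (real (k + n)))" "B k n \<in> sets (G (real k))" "prob (B k n) = p ^ n"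
proof -
	have B0: "B k 0 = space M" for k by (simp add: B_def)
	have BS: "B k (Suc n) = B k n \<inter> climb et dl (k + n)" for k n
		by (auto simp: B_def less_Suc_eq climb_def)
	have F: "B k n \<in> sets (F (real (k + n)))" for n
	proof (induction n)
		case 0
		show ?case unfolding B0 using sets.top[of "F (real (k + 0))"] by simp
	next
		case (Suc n)
		have "B k n \<in> sets (F (real (k + Suc n)))" using Suc F_mono[of "real (k + n)" "real (k + Suc n)"] by auto
		thus ?case unfolding BS by (intro sets.Int climb_F) simp_all
	qed
	thus "B k n \<in> sets (F (real (k + n)))" .
	show "B k n \<in> sets (G (real k))"
	proof (induction n)
		case 0
		show ?case unfolding B0 using sets.top[of "G (real k)"] by simp
	next
		case (Suc n)
		thus ?case unfolding BS by (intro sets.Int climb_G) simp_all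
	qed
	show "prob (B k n) = p ^ n"
	proof (induction n)
		case 0
		show ?case unfolding B0 by (simp add: prob_space)
	next
		case (Suc n)
		thus ?case unfolding BS using indep_FG[OF of_nat_0_le_iff F[of n] climb_G[OF order_refl]] by (simp add: prob_climb p_def)
	qed
qed

text \<open>The blocks of length \<open>j\<close> starting at multiples of \<open>j\<close> are
  independent, and each consists of climbs only with the same positive probability; so almost surely
  one of them does.\<close>

lemma AE_climb_block:
	assumes p: "0 < prob {w\<in>space M. et <= X 1 w - dl}"
	shows "AE w in M. EX k. ALL l<j. w \<in> climb et dl (k + l)"
proof -
	define p where "p = prob {w\<in>space M. et <= X 1 w - dl}"
	define B where "B i = {w\<in>space M. ALL l<j. w \<in> climb et dl (i * j + l)}" for i
	define C where "C m = {w\<in>space M. ALL i<m. w \<notin> B i}" for m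
	have BF: "B i \<in> sets (F (real (i * j + j)))" "B i \<in> sets (G (real (i * j)))" "prob (B i) = p ^ j" for i
		unfolding B_def p_def by (rule climb_block)+
	have C0: "C 0 = space M" by (simp add: C_def)
	have CS: "C (Suc m) = C m \<inter> (space M - B m)" for m by (auto simp: C_def less_Suc_eq)
	have CF: "C m \<in> sets (F (real (m * j)))" for m
	proof (induction m)
		case 0
		show ?case unfolding C0 using sets.top[of "F (real (0 * j))"] by simp
	next
		case (Suc m)
		have "C m \<in> sets (F (real (Suc m * j)))" using Suc F_mono[of "real (m * j)" "real (Suc m * j)"] by auto
		moreover have "space M - B m \<in> sets (F (real (Suc m * j)))"
			using sets.compl_sets[OF BF(1)[of m]] by (simp add: add.commute)
		ultimately show ?case unfolding CS by (rule sets.Int)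
	qed
	have PC: "prob (C m) = (1 - p ^ j) ^ m" for m
	proof (induction m)
		case 0
		show ?case unfolding C0 by (simp add: prob_space)
	next
		case (Suc m)
		have "space M - B m \<in> sets (G (real (m * j)))" using sets.compl_sets[OF BF(2)[of m]] by simp
		from indep_FG[OF of_nat_0_le_iff CF[of m] this] have "prob (C (Suc m)) = prob (C m) * prob (space M - B m)" unfolding CS .
		moreover have "prob (space M - B m) = 1 - p ^ j"
			using prob_compl[of "B m"] BF(2)[of m] G_sub BF(3)[of m] by auto
		ultimately show ?case using Suc by simp
	qed
	have pj: "0 < p ^ j" "p ^ j <= 1" using p by (auto simp: p_def power_le_one)
	have AEC: "AE w in M. ~ (ALL m. w \<in> C m)"
	proof -
		have s: "(\<Inter>m. C m) \<in> sets M" using CF F_sub by (intro sets.countable_INT) blast+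
		have "prob (\<Inter>m. C m) <= (1 - p ^ j) ^ m" for m
			unfolding PC[symmetric] using CF F_sub by (intro finite_measure_mono) blast+
		moreover have "(%m. (1 - p ^ j) ^ m) ----> 0" using pj by (intro LIMSEQ_power_zero) simp
		ultimately have "prob (\<Inter>m. C m) <= 0" by (intro LIMSEQ_le_const) auto
		hence "prob (\<Inter>m. C m) = 0" using measure_nonneg[of M "\<Inter>m. C m"] by linarith
		hence "(\<Inter>m. C m) \<in> null_sets M" using s by (intro null_setsI) (auto simp: emeasure_eq_measure)
		thus ?thesis by (rule AE_I') auto
	qed
	thus ?thesis using AE_space
	proof eventually_elim
		case (elim w)
		then obtain m where "w \<notin> C m" by blast
		then obtain i where "w \<in> B i" using elim(2) by (auto simp: C_def)
		thus ?case by (auto simp: B_def)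
	qed
qed

end

section \<open>The discretised martingale\<close>

locale rr_levy = good_levy M X for M :: "'a measure" and X :: "real => 'a => real" +
	fixes q ka dl b x a :: real and W WW :: "real => real"
	assumes scales: "refraction_scales ps q ka dl W WW b" and a: "0 < a" and x: "x <= a"
		and exponent: "EX th>=0. dl * th < ps th"
begin

sublocale S: refraction_scales ps q ka dl W WW b by (rule scales)

text \<open>A start below \<open>0\<close> enters Step 2 at level \<open>0\<close>; correspondingly
  \<open>r\<close> is constant on the negative half-line.\<close>

definition x0 :: real where "x0 = max x 0"

definition VK :: "real set => real => 'a => real" where
	"VK K t w = limV K (%s. X s w) x0 dl b t"

lemma x0: "0 <= x0" "x0 <= a" using a x by (auto simp: x0_def)

lemma VK_0:
	assumes "down K"
	shows "VK K 0 w = x0"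
proof -
	have "K \<inter> {0..0} = {0}" using assms by (auto simp: down_def)
	hence "euV K (%s. X s w) x0 dl b n 0 = x0" for n
		using x0 X_0[of w] by (simp add: euV_eq proc_def refl_def)
	with euV_tendsto[OF X_cadlag S.dl assms order_refl, of w x0 b] have "(%n::nat. x0) ----> VK K 0 w"
		by (simp add: VK_def)
	thus ?thesis by (simp add: LIMSEQ_const_iff)
qed

lemma VK_process: "K = {0..} | (EX r>=0. K = {0..r}) ==> tame_process M X (VK K) dl x0"
proof (unfold_locales)
	assume K: "K = {0..} | (EX r>=0. K = {0..r})"
	hence d: "down K" by auto
	show "0 <= dl" by (rule S.dl)
	show "VK K t \<in> borel_measurable (F t)" if "0 <= t" for t
		unfolding VK_def[abs_def] by (rule limV_adapted[OF K S.dl that])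
	show "tame (%t. X t w) dl (%t. VK K t w)" for w
		unfolding VK_def using limV_tame[OF X_cadlag S.dl d, of w x0 b] by simp
	show "VK K 0 w <= x0" for w by (simp add: VK_0[OF d])
qed

abbreviation "V \<equiv> VK {0..}"

sublocale V: tame_process M X V dl x0 by (rule VK_process) simp

lemma Y_scale: "scale_function (%th. ps th - dl * th) q ka WW" by unfold_locales

text \<open>\<open>occupation_null\<close> applies to every tame process, hence to Euler limits that
  are not yet known to solve an equation. Rational horizons keep the number of exceptional sets
  countable.\<close>

lemma AE_regular: "AE w in M. regular_path (%t. X t w) x dl b"
proof -
	have "AE w in M. AE u in lborel. 0 <= u --> V u w ~= b" by (rule V.occupation_null[OF Y_scale])
	moreover have "AE w in M. ALL r:\<rat> \<inter> {0..}. AE u in lborel. 0 <= u --> VK {0..r} u w ~= b"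
		unfolding AE_ball_countable[OF countable_Int1[OF countable_rat]]
	proof
		fix r :: real assume "r \<in> \<rat> \<inter> {0..}"
		then interpret r: tame_process M X "VK {0..r}" dl x0 by (intro VK_process) auto
		show "AE w in M. AE u in lborel. 0 <= u --> VK {0..r} u w ~= b" by (rule r.occupation_null[OF Y_scale])
	qed
	ultimately show ?thesis
	proof eventually_elim
		case (elim w)
		thus ?case using good S.dl S.b unfolding VK_def x0_def by unfold_locales auto
	qed
qed

lemma V_0: "V 0 w = x0" by (rule VK_0) simp

lemma V_nonneg:
	assumes "0 <= t"
	shows "0 <= V t w"
proof (rule LIMSEQ_le_const)
	show "(%n. euV {0..} (%s. X s w) x0 dl b n t) ----> V t w"
		unfolding VK_def by (rule euV_tendsto[OF X_cadlag S.dl _ assms]) simp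
	have "0 <= euV {0..} (%s. X s w) x0 dl b n t" for n
		unfolding euV_eq[OF assms] proc_def
		by (rule refl_nonneg[OF _ assms proc_bounded[OF X_cadlag euh_density S.dl]]) (use assms in auto)
	thus "EX N. ALL n>=N. 0 <= euV {0..} (%s. X s w) x0 dl b n t" by blast
qed

lemma V_right_cont: "0 <= s ==> ((%t. V t w) \<longlongrightarrow> V s w) (at_right s)"
	by (rule tame_right_cont[OF V.V_tame X_cadlag _ S.dl])

definition T :: "'a => ereal" where "T w = passage_above a (%t. V t w)"

lemma T_measurable [measurable]: "T \<in> borel_measurable M"
proof -
	have "(%w. INF s\<in>\<rat> \<inter> {0<..}. if a < V s w then ereal s else \<infinity>) \<in> borel_measurable M"
	proof (rule borel_measurable_INF)
		show "countable (\<rat> \<inter> {0<..} :: real set)" by (rule countable_Int1[OF countable_rat])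
		fix s :: real assume "s \<in> \<rat> \<inter> {0<..}"
		hence [measurable]: "V s \<in> borel_measurable M" by (intro V.V_measurable) auto
		show "(%w. if a < V s w then ereal s else \<infinity>) \<in> borel_measurable M" by measurable
	qed
	moreover have "T w = (INF s\<in>\<rat> \<inter> {0<..}. if a < V s w then ereal s else \<infinity>)" for w
		unfolding T_def by (rule passage_above_rational) (rule V_right_cont)
	ultimately have "(%w. T w) \<in> borel_measurable M" by (simp only:)
	thus ?thesis .
qed

lemma T_nonneg: "0 <= T w"
	unfolding T_def passage_above_def by (rule Inf_greatest) auto

text \<open>\<open>V\<close> is nonnegative and its increments dominate those of
  \<open>X t - dl t\<close>, so \<open>j\<close> consecutive climbs by \<open>et\<close> lift it
  above \<open>a\<close>.\<close>

lemma AE_T_finite: "AE w in M. T w < \<infinity>"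
proof -
	obtain et where et: "0 < et" "0 < prob {w\<in>space M. et <= X 1 w - dl}" using climbs[OF exponent] .
	obtain j :: nat where j: "a / et < real j" using reals_Archimedean2 by blast
	from AE_climb_block[OF et(2), of j] show ?thesis
	proof (rule eventually_mono)
		fix w assume "EX k. ALL l<j. w \<in> climb et dl (k + l)"
		then obtain k where k: "!!l. l < j ==> w \<in> climb et dl (k + l)" by blast
		have up: "n <= j ==> real n * et <= V (real (k + n)) w" for n
		proof (induction n)
			case 0
			show ?case using V_nonneg[of "real k" w] by simp
		next
			case (Suc n)
			have "et <= X (real (Suc (k + n))) w - X (real (k + n)) w - dl" using k[of n] Suc by (simp add: climb_def)
			also have "... = X (real (Suc (k + n))) w - X (real (k + n)) w - dl * (real (Suc (k + n)) - real (k + n))" by simp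
			also have "... <= V (real (Suc (k + n))) w - V (real (k + n)) w" by (intro tame_lower[OF V.V_tame]) simp_all
			finally show ?case using Suc by (simp add: distrib_right)
		qed
		have "a < real j * et" using j et(1) by (simp add: pos_divide_less_eq)
		hence "a < V (real (k + j)) w" using up[of j] by simp
		moreover have "0 < real (k + j)"
		proof -
			have "0 < a / et" using a et(1) by simp
			thus ?thesis using j by simp
		qed
		ultimately have "T w <= ereal (real (k + j))" unfolding T_def passage_above_def by (intro Inf_lower) auto
		thus "T w < \<infinity>" by (rule le_less_trans) simp
	qed
qed

end

lemma right_cont_le_rational:
	fixes f :: "real => real"
	assumes "(f \<longlongrightarrow> f s) (at_right s)" "s < e" "!!r. r \<in> \<rat> ==> s < r ==> r < e ==> f r <= c"
	shows "f s <= c"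
proof (rule ccontr)
	assume "~ ?thesis"
	hence "eventually (%r. c < f r) (at_right s)" using order_tendstoD(1)[OF assms(1)] by simp
	then obtain d where d: "s < d" "!!r. s < r ==> r < d ==> c < f r" unfolding eventually_at_right_field by blast
	have "s < min d e" using d(1) assms(2) by simp
	then obtain r where "r \<in> \<rat>" "s < r" "r < min d e" using Rats_dense_in_real by blast
	thus False using d(2)[of r] assms(3)[of r] by simp
qed

context refraction_scales
begin

definition ff :: "real => real => real" where "ff ep y = 1 + rs (y - ep)"
definition fz :: "real => real => real" where "fz ep y = 1 + Zs (y - ep)"

lemma Zs_le_rs: "Zs y <= rs y"
proof -
	have "cv WW Wb (min y (b - 1)) <= cv WW Wb y" by (rule monoD[OF cv_mono']) simp
	hence "0 <= cv WW Wb y" using cv_le_b[of "min y (b - 1)"] by simp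
	thus ?thesis using qdl by (simp add: Zs_def rs_def)
qed

lemma ff_mono: "y <= z ==> ff ep y <= ff ep z" by (simp add: ff_def monoD[OF rs_mono])
lemma ff_ge_1: "1 <= ff ep y" by (simp add: ff_def rs_nonneg)
lemma ff_eq_1: "y <= ep ==> ff ep y = 1" by (simp add: ff_def rs_nonpos)
lemma fz_ge_1: "1 <= fz ep y" by (simp add: fz_def Zs_nonneg)
lemma fz_le_ff: "fz ep y <= ff ep y" by (simp add: ff_def fz_def Zs_le_rs)
lemma fz_eq_ff: "y <= b + ep ==> fz ep y = ff ep y" by (simp add: ff_def fz_def rs_eq_Zs)

end

section \<open>One grid step and its error\<close>

context rr_levy
begin

definition tk :: "nat => nat => real" where "tk n k = real k / real (Suc n)"

lemma tk_nonneg: "0 <= tk n k" by (simp add: tk_def)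
lemma tk_0: "tk n 0 = 0" by (simp add: tk_def)
lemma tk_Suc: "tk n (Suc k) = tk n k + mesh n" by (simp add: tk_def add_divide_distrib)
lemma tk_less: "tk n k < tk n (Suc k)" unfolding tk_Suc by simp
lemma tk_mono: "j <= k ==> tk n j <= tk n k" unfolding tk_def by (intro divide_right_mono) auto
lemma tk_Rats: "tk n k \<in> \<rat>" unfolding tk_def by (intro Rats_divide) auto
lemma tk_grid: "tk n k <= u ==> u < tk n (Suc k) ==> grid n u = tk n k"
	unfolding tk_def by (rule grid_eqI)
lemma tk_end: "tk n (N * Suc n) = real N" unfolding tk_def of_nat_mult by (simp del: of_nat_Suc)
lemma tk_le_N: "k <= N * Suc n ==> tk n k <= real N" using tk_mono[of k "N * Suc n" n] by (simp only: tk_end)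

text \<open>Rational pairs of times make the event measurable; \<open>good_step_le\<close> recovers
  all pairs by right-continuity.\<close>

definition good_step :: "real => nat => nat => 'a set" where
	"good_step ep n k = {w\<in>space M. ALL p:\<rat> \<inter> {tk n k..tk n (Suc k)}. ALL r:\<rat> \<inter> {p..tk n (Suc k)}. X r w - X p w <= ep}"

lemma good_step_F: "good_step ep n k \<in> sets (F (tk n (Suc k)))"
proof -
	let ?t = "tk n (Suc k)"
	have "{w\<in>space (F ?t). ALL p:\<rat> \<inter> {tk n k..?t}. ALL r:\<rat> \<inter> {p..?t}. X r w - X p w <= ep} \<in> sets (F ?t)"
	proof (intro sets.sets_Collect_countable_All' countable_Int1[OF countable_rat])
		fix p r assume "p \<in> \<rat> \<inter> {tk n k..?t}" "r \<in> \<rat> \<inter> {p..?t}"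
		hence [measurable]: "X p \<in> borel_measurable (F ?t)" "X r \<in> borel_measurable (F ?t)"
			using tk_nonneg[of n k] by (intro X_F; simp)+
		show "{w\<in>space (F ?t). X r w - X p w <= ep} \<in> sets (F ?t)" by measurable
	qed
	thus ?thesis by (simp only: good_step_def space_F)
qed

lemma good_step_le:
	assumes w: "w \<in> good_step ep n k" and ep: "0 <= ep" and uv: "tk n k <= u" "u <= v" "v <= tk n (Suc k)"
	shows "X v w - X u w <= ep"
proof -
	have 0: "X r w - X p w <= ep" if "p \<in> \<rat>" "r \<in> \<rat>" "tk n k <= p" "p <= r" "r <= tk n (Suc k)" for p r
		using w that unfolding good_step_def by auto
	have rc: "((%s. X s w) \<longlongrightarrow> X t w) (at_right t)" if "0 <= t" for t using X_cadlag[of w] that by (simp add: cadlag_def)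
	have u0: "0 <= u" using uv(1) tk_nonneg[of n k] by linarith
	have 1: "X r w - X u w <= ep" if r: "r \<in> \<rat>" "u < r" "r <= tk n (Suc k)" for r
	proof (rule right_cont_le_rational[where f = "%u. X r w - X u w" and e = r])
		show "((%u. X r w - X u w) \<longlongrightarrow> X r w - X u w) (at_right u)" by (intro tendsto_intros rc u0)
		show "X r w - X p w <= ep" if "p \<in> \<rat>" "u < p" "p < r" for p using that r uv by (intro 0) auto
	qed (rule r(2))
	show ?thesis
	proof (cases "u = v | v = tk n (Suc k)")
		case True
		thus ?thesis
		proof
			assume "v = tk n (Suc k)"
			thus ?thesis using 1[of v] uv ep tk_Rats by (cases "u = v") auto
		qed (use ep in simp)
	next
		case False
		show ?thesis
		proof (rule right_cont_le_rational[where f = "%v. X v w - X u w" and e = "tk n (Suc k)"])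
			show "((%v. X v w - X u w) \<longlongrightarrow> X v w - X u w) (at_right v)" using u0 uv by (intro tendsto_intros rc) simp
			show "X r w - X u w <= ep" if "r \<in> \<rat>" "v < r" "r < tk n (Suc k)" for r using that uv by (intro 1) auto
		qed (use False uv in simp)
	qed
qed

lemma eventually_good_step:
	assumes "0 < ep" "w \<in> space M"
	shows "eventually (%n. ALL k<N * Suc n. w \<in> good_step ep n k) sequentially"
proof -
	obtain d where d: "0 < d" "ALL s t. 0 <= s --> s <= real N --> s <= t --> t < s + d --> X t w - X s w < ep"
		using good_path_up_modulus[OF good assms(1), of "real N" w] by auto
	have "eventually (%n. mesh n < d) sequentially"
		using order_tendstoD(2)[OF mesh_tendsto d(1)] .
	thus ?thesis
	proof eventually_elim
		case (elim n)
		show ?case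
		proof (intro allI impI)
			fix k assume k: "k < N * Suc n"
			have "X r w - X p w <= ep" if "p \<in> \<rat> \<inter> {tk n k..tk n (Suc k)}" "r \<in> \<rat> \<inter> {p..tk n (Suc k)}" for p r
			proof -
				have "0 <= p" "p <= real N" "p <= r" "r < p + d"
					using that tk_nonneg[of n k] tk_le_N[of "Suc k" N n] k elim unfolding tk_Suc by auto
				thus ?thesis using d(2) by (auto intro: less_imp_le)
			qed
			thus "w \<in> good_step ep n k" using assms(2) unfolding good_step_def by blast
		qed
	qed
qed

text \<open>Only steps before \<open>k\<close> are asked to be good, so the event belongs to the
  past of \<open>tk n k\<close> and Dynkin's formula can be applied on it.\<close>

definition act :: "real => nat => nat => 'a set" where
	"act ep n k = {w\<in>space M. (ALL j<=k. V (tk n j) w <= a) & (ALL j<k. w \<in> good_step ep n j)}"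

lemma act_0: "act ep n 0 = space M"
	using x0 by (auto simp: act_def tk_0 V_0)

lemma act_Suc: "act ep n (Suc k) = act ep n k \<inter> good_step ep n k \<inter> {w\<in>space M. V (tk n (Suc k)) w <= a}"
	by (auto simp: act_def le_Suc_eq less_Suc_eq)

lemma act_F: "act ep n k \<in> sets (F (tk n k))"
proof (induction k)
	case 0
	show ?case unfolding act_0 using sets.top[of "F (tk n 0)"] by simp
next
	case (Suc k)
	have c: "{w\<in>space (F (tk n (Suc k))). V (tk n (Suc k)) w <= a} \<in> sets (F (tk n (Suc k)))"
		using V.adapted[OF tk_nonneg[of n "Suc k"]] by measurable
	have "act ep n k \<in> sets (F (tk n (Suc k)))" using Suc F_mono[OF less_imp_le[OF tk_less[of n k]]] by blast
	from sets.Int[OF sets.Int[OF this good_step_F] c[unfolded space_F]] show ?case unfolding act_Suc .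
qed

text \<open>The value after one step without reflection, with the drift frozen. Below \<open>b\<close> the function \<open>Z\<close> replaces \<open>r\<close>, since
	only \<open>Z\<close> satisfies a Dynkin formula under \<open>X\<close>.\<close>
definition proxy :: "real => nat => nat => 'a => real" where
	"proxy ep n k w = (if V (tk n k) w <= b then S.fz ep (V (tk n k) w + (X (tk n (Suc k)) w - X (tk n k) w))
		else S.ff ep (V (tk n k) w + (X (tk n (Suc k)) w - X (tk n k) w - dl * mesh n)))"

definition lag :: "nat => real \<times> 'a => real" where
	"lag n p = \<bar>indicat_real {b<..} (V (grid n (fst p)) (snd p)) - indicat_real {b<..} (V (fst p) (snd p))\<bar>"

text \<open>\<open>dH\<close> is the true time above \<open>b\<close> during the step. Freezing the
  drift replaces it by \<open>0\<close> or by the whole mesh, and the lag integrates to the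
  discrepancy.\<close>

lemma lag_integral:
	fixes n k :: nat
	assumes "regular_path (%t. X t w) x dl b"
	defines "dH \<equiv> occ (above b (%t. V t w)) (tk n (Suc k)) - occ (above b (%t. V t w)) (tk n k)"
	shows "(LINT u:{tk n k..<tk n (Suc k)}|lborel. lag n (u, w)) = (if V (tk n k) w <= b then dH else mesh n - dH)"
		"0 <= dH" "dH <= mesh n"
proof -
	interpret R: regular_path "%t. X t w" x dl b by fact
	have Vd: "density01 (above b (%t. V t w))" using R.V_density by (simp add: VK_def x0_def)
	note si = density01_integrable[OF Vd tk_nonneg[of n k], of "tk n (Suc k)"]
	have dH: "dH = (LINT u:{tk n k..<tk n (Suc k)}|lborel. above b (%t. V t w) u)"
		unfolding dH_def by (rule occ_diff[OF Vd tk_nonneg less_imp_le[OF tk_less]])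
	show "0 <= dH" "dH <= mesh n"
		using occ_mono[OF Vd tk_nonneg[of n k] less_imp_le[OF tk_less]] unfolding dH_def tk_Suc by simp_all
	have l: "(LINT u:{tk n k..<tk n (Suc k)}|lborel. lag n (u, w)) =
		(LINT u:{tk n k..<tk n (Suc k)}|lborel. if V (tk n k) w <= b then above b (%t. V t w) u else 1 - above b (%t. V t w) u)"
		by (rule set_lebesgue_integral_cong) (auto simp: lag_def tk_grid above_def)
	show "(LINT u:{tk n k..<tk n (Suc k)}|lborel. lag n (u, w)) = (if V (tk n k) w <= b then dH else mesh n - dH)"
	proof (cases "V (tk n k) w <= b")
		case True
		thus ?thesis unfolding l dH by simp
	next
		case False
		have "set_integrable lborel {tk n k..<tk n (Suc k)} (%_. 1 :: real)"
			unfolding set_integrable_def using tk_less[of n k] by simp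
		hence "(LINT u:{tk n k..<tk n (Suc k)}|lborel. 1 - above b (%t. V t w) u) = (LINT u:{tk n k..<tk n (Suc k)}|lborel. 1) - dH"
			unfolding dH by (rule set_integral_diff(2)[OF _ si])
		also have "(LINT u:{tk n k..<tk n (Suc k)}|lborel. 1) = mesh n"
			using tk_less[of n k] unfolding set_lebesgue_integral_def by (simp add: tk_Suc)
		finally show ?thesis unfolding l using False by simp
	qed
qed

text \<open>If reflection acts during a good step, \<open>V\<close> ends at level at most
  \<open>ep\<close>, where \<open>r (y - ep)\<close> is \<open>1\<close> both at \<open>V\<close>
  and at the lower value without the new push: reflection is invisible. What remains is the
  difference between true and frozen drift, which the Lipschitz constant turns into
  \<open>lag\<close>.\<close>

lemma step_bound_good:
	assumes reg: "regular_path (%t. X t w) x dl b" and ep: "0 < ep"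
		and w: "w \<in> act ep n k" "w \<in> good_step ep n k"
		and L: "0 <= L" "!!x y. x <= y ==> y <= max a b ==> S.rs y - S.rs x <= L * (y - x)"
	shows "\<bar>S.ff ep (V (tk n (Suc k)) w) - proxy ep n k w\<bar> <= L * dl * (LINT u:{tk n k..<tk n (Suc k)}|lborel. lag n (u, w))"
proof -
	interpret R: regular_path "%t. X t w" x dl b by fact
	let ?s = "tk n k" and ?t = "tk n (Suc k)"
	define H where "H = occ (above b (%t. V t w))"
	define z where "z u = x0 + X u w - dl * H u" for u
	define dH where "dH = H ?t - H ?s"
	define ww where "ww = V ?s w + (X ?t w - X ?s w) - dl * dH"
	have Vd: "density01 (above b (%t. V t w))" using R.V_density by (simp add: VK_def x0_def)
	have zZ: "z = R.Z (above b R.V)" by (rule ext) (simp add: z_def H_def x0_def VK_def)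
	have Vz: "V u w = refl {0..} z u" if "0 <= u" for u
		using R.V_eq[OF that] unfolding zZ R.PP_unfold by (simp only: VK_def x0_def)
	have zb: "bounded (z ` {0..?t})"
		unfolding z_def H_def by (rule proc_bounded[OF X_cadlag Vd S.dl])
	have st: "0 <= ?s" "?s <= ?t" by (rule tk_nonneg, rule less_imp_le[OF tk_less])
	have d0: "down {0..}" by simp
	have wz: "ww = V ?s w + (z ?t - z ?s)" by (simp add: ww_def z_def dH_def algebra_simps)
	have w_le: "ww <= V ?t w"
		using refl_push[OF d0 st zb] unfolding wz Vz[OF st(1)] Vz[OF order_trans[OF st]] by simp
	have eq: "S.ff ep (V ?t w) = S.ff ep ww"
	proof (cases "refl {0..} z ?t - z ?t = refl {0..} z ?s - z ?s")
		case True
		hence "V ?t w = ww" unfolding wz Vz[OF st(1)] Vz[OF order_trans[OF st]] by simp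
		thus ?thesis by simp
	next
		case False
		have "refl {0..} z ?t <= ep"
		proof (rule refl_pushed_le[OF d0 st zb False])
			fix u assume u: "?s <= u" "u <= ?t"
			have "X ?t w - X u w <= ep" using ep u by (intro good_step_le[OF w(2)]) auto
			moreover have "0 <= dl * (H ?t - H u)"
				unfolding H_def using occ_mono(1)[OF Vd, of u ?t] u st S.dl by (intro mult_nonneg_nonneg) auto
			ultimately show "z ?t - z u <= ep" by (simp add: z_def algebra_simps)
		qed
		hence "V ?t w <= ep" unfolding Vz[OF order_trans[OF st]] .
		thus ?thesis using w_le by (simp add: S.ff_eq_1)
	qed
	note lagI = lag_integral[OF reg, of n k, folded H_def, folded dH_def]
	have Va: "V ?s w <= a" using w(1) by (auto simp: act_def)
	have XI: "X ?t w - X ?s w <= ep" using ep st by (intro good_step_le[OF w(2)]) auto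
	show ?thesis
	proof (cases "V ?s w <= b")
		case True
		define v where "v = V ?s w + (X ?t w - X ?s w)"
		have vw: "v = ww + dl * dH" by (simp add: v_def ww_def)
		have dd: "0 <= dl * dH" using lagI(2) S.dl by simp
		\<comment> \<open>The climb of the step is at most \<open>ep\<close>, which the shift compensates:
		  the arguments of \<open>rs\<close> stay where \<open>L\<close> is valid, and \<open>Z\<close>
		  and \<open>r\<close> agree there.\<close>
		have vb: "v <= b + ep" using True XI by (simp add: v_def)
		have "S.rs (v - ep) - S.rs (ww - ep) <= L * ((v - ep) - (ww - ep))" using vb dd vw by (intro L) auto
		hence "S.ff ep v - S.ff ep ww <= L * dl * dH" by (simp add: S.ff_def vw mult.assoc)
		moreover have "S.ff ep ww <= S.ff ep v" using dd vw by (intro S.ff_mono) simp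
		moreover have "proxy ep n k w = S.ff ep v" using True S.fz_eq_ff[OF vb] by (simp add: proxy_def v_def)
		ultimately show ?thesis unfolding eq lagI(1) using True by simp
	next
		case False
		let ?h = "mesh n"
		define v where "v = V ?s w + (X ?t w - X ?s w - dl * ?h)"
		have vw: "ww = v + dl * (?h - dH)" by (simp add: v_def ww_def right_diff_distrib del: of_nat_Suc)
		have dd: "0 <= dl * (?h - dH)" using lagI(3) S.dl by simp
		have "0 <= dl * dH" using lagI(2) S.dl by simp
		hence wa: "ww <= a + ep" using Va XI by (simp add: ww_def)
		have "S.rs (ww - ep) - S.rs (v - ep) <= L * ((ww - ep) - (v - ep))" using wa dd vw by (intro L) auto
		hence "S.ff ep ww - S.ff ep v <= L * dl * (?h - dH)" by (simp add: S.ff_def vw mult.assoc del: of_nat_Suc)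
		moreover have "S.ff ep v <= S.ff ep ww" using dd vw by (intro S.ff_mono) simp
		moreover have "proxy ep n k w = S.ff ep v" using False by (simp add: proxy_def v_def)
		ultimately show ?thesis unfolding eq lagI(1) using False by simp
	qed
qed

text \<open>For a bad step a crude bound is enough: it is integrable by \<open>DU_exp\<close>, and
  bad steps become rare as the mesh shrinks.\<close>

lemma step_bound_any:
	assumes k: "k < N * Suc n"
	shows "\<bar>S.ff ep (V (tk n (Suc k)) w) - proxy ep n k w\<bar> <= S.ff ep (x0 + 2 * DU (real N) w)"
		"0 <= proxy ep n k w" "proxy ep n k w <= S.ff ep (x0 + 2 * DU (real N) w)"
proof -
	let ?s = "tk n k" and ?t = "tk n (Suc k)" and ?B = "x0 + 2 * DU (real N) w"
	have st: "0 <= ?s" "?s <= ?t" "?t <= real N" using tk_nonneg less_imp_le[OF tk_less] tk_le_N[of "Suc k" N n] k by auto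
	have D0: "0 <= DU (real N) w" by (rule DU_nonneg) simp
	have XI: "X ?t w - X ?s w <= DU (real N) w" by (rule DU_ge[OF _ st]) simp
	have Vs: "V ?s w <= x0 + DU (real N) w" using st by (intro V.V_le) auto
	have Vt: "V ?t w <= ?B" using V.V_le[of ?t "real N" w] st D0 by simp
	have "0 <= dl * mesh n" using S.dl by (intro mult_nonneg_nonneg) auto
	hence l: "V ?s w + (X ?t w - X ?s w) <= ?B" "V ?s w + (X ?t w - X ?s w - dl * mesh n) <= ?B"
		using XI Vs by linarith+
	show p: "proxy ep n k w <= S.ff ep ?B"
		unfolding proxy_def using order_trans[OF S.fz_le_ff S.ff_mono[OF l(1), of ep]] S.ff_mono[OF l(2), of ep] by (simp del: of_nat_Suc)
	show p0: "0 <= proxy ep n k w"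
		unfolding proxy_def using S.ff_ge_1 S.fz_ge_1 by (auto intro: order_trans[OF zero_le_one])
	show "\<bar>S.ff ep (V ?t w) - proxy ep n k w\<bar> <= S.ff ep ?B"
		using p p0 S.ff_mono[OF Vt, of ep] S.ff_ge_1[of ep "V ?t w"] by linarith
qed

end

section \<open>The generator error of a step\<close>

context rr_levy
begin

text \<open>Together with the window of radius \<open>ep\<close> around \<open>0\<close> this covers
  \<open>S < ep\<close>, where the shifted functions fail to be harmonic.\<close>

definition err_low :: "real => nat => real \<times> 'a => real" where
	"err_low ep n p = indicat_real {..<- ep} (V.S n (fst p) (snd p))"

text \<open>The analogue at \<open>b\<close>: the step started above \<open>b\<close>, but
  \<open>S\<close> has dropped below the window around \<open>b\<close>. Such excursions disappear
  as the mesh shrinks, whereas the windows are charged to occupation times.\<close>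

definition err_b :: "real => nat => real \<times> 'a => real" where
	"err_b ep n p = indicat_real {b<..} (V (grid n (fst p)) (snd p)) * indicat_real {..<b - ep} (V.S n (fst p) (snd p))"

lemma err_measurable:
	"(%p. indicator {0..<real N} (fst p) * err_low ep n p :: real) \<in> borel_measurable (borel \<Otimes> M)"
	"(%p. indicator {0..<real N} (fst p) * err_b ep n p :: real) \<in> borel_measurable (borel \<Otimes> M)"
	"(%p. indicator {0..<real N} (fst p) * lag n p :: real) \<in> borel_measurable (borel \<Otimes> M)"
proof -
	let ?B = "borel \<Otimes> borel \<Otimes> borel \<Otimes> borel \<Otimes> borel :: (real \<times> real \<times> real \<times> real \<times> real) measure"
	have 1: "(%p. indicat_real {..<- ep} (fst (snd (snd p)))) \<in> borel_measurable ?B"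
		"(%p. indicat_real {b<..} (fst (snd (snd (snd p)))) * indicat_real {..<b - ep} (fst (snd (snd p)))) \<in> borel_measurable ?B"
		"(%p. \<bar>indicat_real {b<..} (fst (snd (snd (snd p)))) - indicat_real {b<..} (fst (snd p))\<bar>) \<in> borel_measurable ?B"
		by measurable
	show "(%p. indicator {0..<real N} (fst p) * err_low ep n p :: real) \<in> borel_measurable (borel \<Otimes> M)"
		unfolding err_low_def by (rule V.functional_measurable[OF of_nat_0_le_iff 1(1), unfolded fst_conv snd_conv])
	show "(%p. indicator {0..<real N} (fst p) * err_b ep n p :: real) \<in> borel_measurable (borel \<Otimes> M)"
		unfolding err_b_def by (rule V.functional_measurable[OF of_nat_0_le_iff 1(2), unfolded fst_conv snd_conv])
	show "(%p. indicator {0..<real N} (fst p) * lag n p :: real) \<in> borel_measurable (borel \<Otimes> M)"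
		unfolding lag_def by (rule V.functional_measurable[OF of_nat_0_le_iff 1(3), unfolded fst_conv snd_conv])
qed

lemma err_bounds: "0 <= err_low ep n p" "err_low ep n p <= 1" "0 <= err_b ep n p" "err_b ep n p <= 1" "0 <= lag n p" "lag n p <= 1"
	by (auto simp: err_low_def err_b_def lag_def indicator_def)

lemma err_limits:
	assumes "0 < ep"
	shows "AE w in M. AE u in lborel. 0 < u --> (%n. err_low ep n (u, w)) ----> 0" (is ?A)
		"AE w in M. AE u in lborel. 0 < u --> (%n. err_b ep n (u, w)) ----> 0" (is ?B)
		"AE w in M. AE u in lborel. 0 < u --> (%n. lag n (u, w)) ----> 0" (is ?C)
proof -
	have c: "AE u in lborel. 0 < u --> isCont (%t. X t w) u" for w by (rule AE_isCont_cadlag[OF X_cadlag])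
	have 1: "(%n. err_low ep n (u, w)) ----> 0" if u: "0 < u" "isCont (%t. X t w) u" for u w
	proof -
		have "eventually (%n. - ep < V.S n u w) sequentially"
			using V_nonneg[of u w] u assms by (intro order_tendstoD(1)[OF V.S_tendsto(1)[OF u(2,1)]]) linarith
		hence "eventually (%n. err_low ep n (u, w) = 0) sequentially"
			by eventually_elim (simp add: err_low_def)
		thus ?thesis by (rule tendsto_eventually)
	qed
	have 2: "(%n. err_b ep n (u, w)) ----> 0" if u: "0 < u" "isCont (%t. X t w) u" for u w
	proof -
		have "eventually (%n. err_b ep n (u, w) = 0) sequentially"
		proof (cases "V u w < b")
			case True
			from order_tendstoD(2)[OF V.S_tendsto(2)[OF u(2,1)] this] show ?thesis
				by eventually_elim (simp add: err_b_def)
		next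
			case False
			hence "b - ep < V u w" using assms by simp
			from order_tendstoD(1)[OF V.S_tendsto(1)[OF u(2,1)] this] show ?thesis
				by eventually_elim (simp add: err_b_def)
		qed
		thus ?thesis by (rule tendsto_eventually)
	qed
	have 3: "(%n. lag n (u, w)) ----> 0" if u: "0 < u" "isCont (%t. X t w) u" "V u w ~= b" for u w
	proof -
		have "eventually (%n. lag n (u, w) = 0) sequentially"
		proof (cases "V u w < b")
			case True
			from order_tendstoD(2)[OF V.S_tendsto(2)[OF u(2,1)] this] show ?thesis
				by eventually_elim (use True in "simp add: lag_def")
		next
			case False
			hence *: "b < V u w" using u(3) by simp
			from order_tendstoD(1)[OF V.S_tendsto(2)[OF u(2,1)] this] show ?thesis
				by eventually_elim (use * in "simp add: lag_def")
		qed
		thus ?thesis by (rule tendsto_eventually)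
	qed
	show ?A by (intro AE_I2 eventually_mono[OF c]) (blast intro: 1)
	show ?B by (intro AE_I2 eventually_mono[OF c]) (blast intro: 2)
	show ?C
		using V.occupation_null[OF Y_scale, of b]
	proof (rule eventually_mono)
		fix w assume "AE u in lborel. 0 <= u --> V u w ~= b"
		thus "AE u in lborel. 0 < u --> (%n. lag n (u, w)) ----> 0"
			using c[of w] by eventually_elim (auto intro: 3)
	qed
qed

definition act_lo :: "real => nat => nat => 'a set" where
	"act_lo ep n k = act ep n k \<inter> {w\<in>space M. V (tk n k) w <= b}"

definition act_hi :: "real => nat => nat => 'a set" where
	"act_hi ep n k = act ep n k \<inter> {w\<in>space M. b < V (tk n k) w}"

lemma act_lo_F: "act_lo ep n k \<in> sets (F (tk n k))" and act_hi_F: "act_hi ep n k \<in> sets (F (tk n k))"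
proof -
	have "{w\<in>space (F (tk n k)). V (tk n k) w <= b} \<in> sets (F (tk n k))" "{w\<in>space (F (tk n k)). b < V (tk n k) w} \<in> sets (F (tk n k))"
		using V.adapted[OF tk_nonneg[of n k]] by measurable
	from sets.Int[OF act_F this(1)[unfolded space_F]] sets.Int[OF act_F this(2)[unfolded space_F]]
	show "act_lo ep n k \<in> sets (F (tk n k))" "act_hi ep n k \<in> sets (F (tk n k))" unfolding act_lo_def act_hi_def .
qed

lemma ka1: "0 <= ka + 1" using S.X.ka by simp

lemma indicator_exp_integrable:
	assumes "A \<in> sets (F (tk n k))"
	shows "integrable M (%w. indicator A w * exp ((ka + 1) * (V (tk n k) w - ep)))"
proof -
	have A: "A \<in> sets M" using assms F_sub by blast
	have "exp ((ka + 1) * (V (tk n k) w - ep)) = exp (- (ka + 1) * ep) * exp ((ka + 1) * V (tk n k) w)" for w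
		unfolding exp_add[symmetric] by (simp add: algebra_simps)
	hence "integrable M (%w. exp ((ka + 1) * (V (tk n k) w - ep)))"
		using V.V_exp_integrable[OF tk_nonneg ka1] by simp
	from integrable_mult_indicator[OF A this] show ?thesis by simp
qed

lemma U_measurable: "(%w. V (tk n k) w - ep) \<in> borel_measurable (F (tk n k))"
	using V.adapted[OF tk_nonneg[of n k]] by measurable

text \<open>The terms \<open>0 * s\<close> and \<open>q * 1\<close> match instances of the general Dynkin formula \<open>dynkin_step_const\<close>.\<close>
definition gen :: "real => nat => nat => real => real" where
	"gen ep n k s =
		(LINT w|M. indicator (act_lo ep n k) w * (q * Heaviside ((V (tk n k) w - ep) + (X (tk n k + s) w - X (tk n k) w - 0 * s)) - q * 1)) +
		(LINT w|M. indicator (act_hi ep n k) w * (S.gr ((V (tk n k) w - ep) + (X (tk n k + s) w - X (tk n k) w - dl * s)) - q * 1))"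

text \<open>Starts up to \<open>b\<close> use Dynkin's formula for \<open>Z\<close> under
  \<open>X\<close>, starts above \<open>b\<close> the one for \<open>r\<close> under
  \<open>X t - dl t\<close>. At the beginning of the step \<open>Z\<close> and \<open>r\<close>
  agree on the lower part, so the two halves add up to one formula for \<open>ff\<close>.\<close>

lemma step_identity:
	assumes ep: "0 < ep"
	defines "h \<equiv> %n. mesh n"
	shows "exp (- q * h n) * (LINT w|M. indicator (act ep n k) w * proxy ep n k w) =
			(LINT w|M. indicator (act ep n k) w * S.ff ep (V (tk n k) w)) +
			(LINT s|lborel. disc {0..h n} q s * gen ep n k s)"
		"integrable lborel (%s. disc {0..h n} q s * gen ep n k s)"
		"integrable M (%w. indicator (act ep n k) w * proxy ep n k w)"
		"integrable M (%w. indicator (act ep n k) w * S.ff ep (V (tk n k) w))"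
proof -
	let ?t = "tk n k"
	define U where "U w = V ?t w - ep" for w
	have U: "U \<in> borel_measurable (F ?t)" unfolding U_def[abs_def] by (rule U_measurable)
	have h0: "0 <= h n" by (simp add: h_def)
	have i1: "integrable M (%w. indicator (act_lo ep n k) w * exp ((ka + 1) * U w))"
		and i2: "integrable M (%w. indicator (act_hi ep n k) w * exp ((ka + 1) * U w))"
		unfolding U_def by (intro indicator_exp_integrable act_lo_F act_hi_F)+
	note D1 = dynkin_step_const[OF tk_nonneg h0 act_lo_F U ka1 S.Zs_bdd S.Zs_rcont S.qH_bdd S.qH_rcont S.Zs_relation i1, of 1]
	note D2 = dynkin_step_const[OF tk_nonneg h0 act_hi_F U ka1 S.rs_bdd S.rs_rcont S.gr_bdd S.gr_rcont S.rs_relation i2, of 1]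
	have sM: "act_lo ep n k \<in> sets M" "act_hi ep n k \<in> sets M" using act_lo_F act_hi_F F_sub by blast+
	have ind: "integrable M (indicat_real A)" if "A \<in> sets M" for A
		using that by (intro integrable_real_indicator) (auto simp: emeasure_eq_measure)
	define P1 where "P1 w = indicator (act_lo ep n k) w * (1 + S.Zs (U w + (X (?t + h n) w - X ?t w - 0 * h n)))" for w
	define P2 where "P2 w = indicator (act_hi ep n k) w * (1 + S.rs (U w + (X (?t + h n) w - X ?t w - dl * h n)))" for w
	define Q1 where "Q1 w = indicator (act_lo ep n k) w * (1 + S.Zs (U w))" for w
	define Q2 where "Q2 w = indicator (act_hi ep n k) w * (1 + S.rs (U w))" for w
	have P1i: "integrable M P1" unfolding P1_def[abs_def] distrib_left mult_1_right
		by (intro integrable_add ind sM increment_integrable[OF tk_nonneg h0 act_lo_F U ka1 S.Zs_bdd i1])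
	have P2i: "integrable M P2" unfolding P2_def[abs_def] distrib_left mult_1_right
		by (intro integrable_add ind sM increment_integrable[OF tk_nonneg h0 act_hi_F U ka1 S.rs_bdd i2])
	have Q1i: "integrable M Q1" unfolding Q1_def[abs_def] distrib_left mult_1_right
		using increment_integrable[OF tk_nonneg order_refl act_lo_F U ka1 S.Zs_bdd i1, of 0] by (intro integrable_add ind sM) simp
	have Q2i: "integrable M Q2" unfolding Q2_def[abs_def] distrib_left mult_1_right
		using increment_integrable[OF tk_nonneg order_refl act_hi_F U ka1 S.rs_bdd i2, of 0] by (intro integrable_add ind sM) simp
	have P: "indicator (act ep n k) w * proxy ep n k w = P1 w + P2 w" if "w \<in> space M" for w
	proof -
		have e: "?t + h n = tk n (Suc k)" by (simp only: h_def tk_Suc)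
		show ?thesis
			unfolding P1_def P2_def proxy_def act_lo_def act_hi_def e S.ff_def S.fz_def U_def h_def[symmetric] using that
			by (cases "w \<in> act ep n k"; cases "V ?t w <= b") (simp_all add: algebra_simps h_def)
	qed
	have Q: "indicator (act ep n k) w * S.ff ep (V (tk n k) w) = Q1 w + Q2 w" if "w \<in> space M" for w
		unfolding Q1_def Q2_def act_lo_def act_hi_def S.ff_def U_def using that ep S.rs_eq_Zs[of "V ?t w - ep"]
		by (cases "w \<in> act ep n k"; cases "V ?t w <= b") simp_all
	show "integrable M (%w. indicator (act ep n k) w * proxy ep n k w)"
		using integrable_add[OF P1i P2i]
		by (rule iffD2[OF integrable_cong[OF refl], rotated]) (rule P)
	show "integrable M (%w. indicator (act ep n k) w * S.ff ep (V (tk n k) w))"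
		using integrable_add[OF Q1i Q2i]
		by (rule iffD2[OF integrable_cong[OF refl], rotated]) (rule Q)
	define J1 where "J1 s = disc {0..h n} q s * (LINT w|M. indicator (act_lo ep n k) w * (q * Heaviside (U w + (X (?t + s) w - X ?t w - 0 * s)) - q * 1))" for s
	define J2 where "J2 s = disc {0..h n} q s * (LINT w|M. indicator (act_hi ep n k) w * (S.gr (U w + (X (?t + s) w - X ?t w - dl * s)) - q * 1))" for s
	have Ji: "integrable lborel J1" "integrable lborel J2" unfolding J1_def[abs_def] J2_def[abs_def] by (rule D1(2), assumption) (rule D2(2), assumption)
	have DD: "exp (- q * h n) * integral\<^sup>L M P1 = integral\<^sup>L M Q1 + integral\<^sup>L lborel J1"
		"exp (- q * h n) * integral\<^sup>L M P2 = integral\<^sup>L M Q2 + integral\<^sup>L lborel J2"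
		unfolding P1_def[abs_def] P2_def[abs_def] Q1_def[abs_def] Q2_def[abs_def] J1_def[abs_def] J2_def[abs_def]
		by (rule D1(1), assumption) (rule D2(1), assumption)
	have J: "disc {0..h n} q s * gen ep n k s = J1 s + J2 s" for s
		unfolding gen_def J1_def J2_def U_def by (rule distrib_left)
	show "integrable lborel (%s. disc {0..h n} q s * gen ep n k s)"
		unfolding J by (rule integrable_add[OF Ji])
	have "(LINT w|M. indicator (act ep n k) w * proxy ep n k w) = integral\<^sup>L M P1 + integral\<^sup>L M P2"
		unfolding integral_add[OF P1i P2i, symmetric] by (rule integral_cong[OF refl]) (rule P)
	moreover have "(LINT w|M. indicator (act ep n k) w * S.ff ep (V (tk n k) w)) = integral\<^sup>L M Q1 + integral\<^sup>L M Q2"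
		unfolding integral_add[OF Q1i Q2i, symmetric] by (rule integral_cong[OF refl]) (rule Q)
	moreover have "(LINT s|lborel. J1 s + J2 s) = integral\<^sup>L lborel J1 + integral\<^sup>L lborel J2"
		by (rule integral_add[OF Ji])
	ultimately show "exp (- q * h n) * (LINT w|M. indicator (act ep n k) w * proxy ep n k w) =
			(LINT w|M. indicator (act ep n k) w * S.ff ep (V (tk n k) w)) +
			(LINT s|lborel. disc {0..h n} q s * gen ep n k s)"
		unfolding J using DD by (simp add: distrib_left)
qed

lemma S_measurable: "0 <= u ==> V.S n u \<in> borel_measurable M"
proof -
	assume u: "0 <= u"
	have [measurable]: "V (grid n u) \<in> borel_measurable M" by (rule V.V_measurable[OF grid_nonneg[OF u]])
	show ?thesis unfolding V.S_def[abs_def] by measurable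
qed

lemma bounded_indicator_integrable:
	assumes "f \<in> borel_measurable M" "!!w. 0 <= f w" "!!w. f w <= (1 :: real)"
	shows "integrable M f"
	using assms by (intro integrable_const_bound[of _ 1]) auto

lemma err_slice_measurable:
	assumes "0 <= u"
	shows "(%w. err_low ep n (u, w)) \<in> borel_measurable M" "(%w. err_b ep n (u, w)) \<in> borel_measurable M"
		"(%w. indicat_real {c..<d} (V.S n u w)) \<in> borel_measurable M"
proof -
	have [measurable]: "V (grid n u) \<in> borel_measurable M" by (rule V.V_measurable[OF grid_nonneg[OF assms]])
	note S_measurable[OF assms, of n, measurable]
	show "(%w. err_low ep n (u, w)) \<in> borel_measurable M" "(%w. err_b ep n (u, w)) \<in> borel_measurable M"
		"(%w. indicat_real {c..<d} (V.S n u w)) \<in> borel_measurable M"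
		unfolding err_low_def err_b_def fst_conv snd_conv by measurable
qed

definition Th :: "real => nat => real => real" where
	"Th ep n u = q * ((LINT w|M. indicat_real {0 - ep..<0 + ep} (V.S n u w)) + (LINT w|M. err_low ep n (u, w))) +
		q * dl * W b * ((LINT w|M. indicat_real {b - ep..<b + ep} (V.S n u w)) + (LINT w|M. err_b ep n (u, w)))"

text \<open>For starts up to \<open>b\<close> the integrand is \<open>- q\<close> where the value
  without the drift \<open>dl\<close> is below \<open>ep\<close>, and \<open>S\<close> is lower
  still since \<open>dl * s >= 0\<close>. For starts above \<open>b\<close> there is in addition
  \<open>- q * dl * W\<close> on \<open>[0, b)\<close>, where \<open>W <= W b\<close>; having
  started above \<open>b\<close>, the process can get there only through the window around
  \<open>b\<close> or through \<open>err_b\<close>.\<close>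

lemma gen_bound:
	assumes s: "0 <= s" "s < mesh n"
	shows "\<bar>gen ep n k s\<bar> <= Th ep n (tk n k + s)"
proof -
	let ?t = "tk n k"
	define u where "u = ?t + s"
	have u0: "0 <= u" using s tk_nonneg[of n k] by (simp add: u_def)
	have g: "grid n u = ?t" using s by (intro tk_grid) (simp_all add: u_def tk_Suc)
	have Su: "V.S n u w = V ?t w + (X (?t + s) w - X ?t w - dl * s)" for w
		by (simp add: V.S_def g) (simp add: u_def)
	define U where "U w = V ?t w - ep" for w
	have U: "U \<in> borel_measurable (F ?t)" unfolding U_def[abs_def] by (rule U_measurable)
	have i1: "integrable M (%w. indicator (act_lo ep n k) w * exp ((ka + 1) * U w))"
		and i2: "integrable M (%w. indicator (act_hi ep n k) w * exp ((ka + 1) * U w))"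
		unfolding U_def by (intro indicator_exp_integrable act_lo_F act_hi_F)+
	have sM: "act_lo ep n k \<in> sets M" "act_hi ep n k \<in> sets M" using act_lo_F act_hi_F F_sub by blast+
	define f1 where "f1 w = indicator (act_lo ep n k) w * (q * Heaviside (U w + (X (?t + s) w - X ?t w - 0 * s)) - q * 1)" for w
	define f2 where "f2 w = indicator (act_hi ep n k) w * (S.gr (U w + (X (?t + s) w - X ?t w - dl * s)) - q * 1)" for w
	have ci: "integrable M (%w. indicator A w * (q * 1))" if "A \<in> sets M" for A
		using that by (intro integrable_mult_left integrable_real_indicator) (auto simp: emeasure_eq_measure)
	have f1i: "integrable M f1" unfolding f1_def[abs_def] right_diff_distrib[where a = "indicator _ _"]
		by (intro integrable_diff ci sM increment_integrable[OF tk_nonneg s(1) act_lo_F U ka1 S.qH_bdd i1])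
	have f2i: "integrable M f2" unfolding f2_def[abs_def] right_diff_distrib[where a = "indicator _ _"]
		by (intro integrable_diff ci sM increment_integrable[OF tk_nonneg s(1) act_hi_F U ka1 S.gr_bdd i2])
	define z1 z2 z3 z4 where "z1 w = indicat_real {0 - ep..<0 + ep} (V.S n u w)" and "z2 w = err_low ep n (u, w)"
		and "z3 w = indicat_real {b - ep..<b + ep} (V.S n u w)" and "z4 w = err_b ep n (u, w)" for w
	have zi: "integrable M z1" "integrable M z2" "integrable M z3" "integrable M z4"
		unfolding z1_def[abs_def] z2_def[abs_def] z3_def[abs_def] z4_def[abs_def]
		by (intro bounded_indicator_integrable err_slice_measurable[OF u0] err_bounds; simp add: indicator_def)+
	have q0: "0 <= q" by (rule S.X.q)
	have c0: "0 <= q * dl * W b" by (intro mult_nonneg_nonneg S.qdl S.X.nonneg)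
	have b1: "\<bar>f1 w\<bar> + \<bar>f2 w\<bar> <= q * (z1 w + z2 w) + q * dl * W b * (z3 w + z4 w)" for w
	proof -
		have rhs0: "0 <= q * (z1 w + z2 w)" "0 <= q * dl * W b * (z3 w + z4 w)"
			using q0 c0 err_bounds by (auto simp: z1_def z2_def z3_def z4_def intro!: mult_nonneg_nonneg add_nonneg_nonneg)
		have low: "q * indicat_real {..<ep} (V.S n u w) <= q * (z1 w + z2 w)"
			using q0 by (intro mult_left_mono) (auto simp: z1_def z2_def err_low_def indicator_def)
		consider "w \<in> act_lo ep n k" | "w \<in> act_hi ep n k" | "w \<notin> act_lo ep n k" "w \<notin> act_hi ep n k" by blast
		thus ?thesis
		proof cases
			case 1
			hence "w \<notin> act_hi ep n k" by (auto simp: act_lo_def act_hi_def)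
			hence f2: "f2 w = 0" by (simp add: f2_def)
			have "0 <= dl * s" using S.dl s(1) by simp
			hence "\<bar>f1 w\<bar> <= q * indicat_real {..<ep} (V.S n u w)"
				using 1 q0 by (auto simp: f1_def U_def Su indicator_def)
			thus ?thesis using f2 low rhs0 by simp
		next
			case 2
			hence "w \<notin> act_lo ep n k" by (auto simp: act_lo_def act_hi_def)
			hence f1: "f1 w = 0" by (simp add: f1_def)
			have Vb: "b < V ?t w" using 2 by (auto simp: act_hi_def)
			let ?y = "V.S n u w - ep"
			have "f2 w = S.gr ?y - q" using 2 by (simp add: f2_def U_def Su algebra_simps)
			also have "... = (q * Heaviside ?y - q) - q * dl * S.Wc ?y" by (simp add: S.gr_def)
			finally have "\<bar>f2 w\<bar> <= \<bar>q * Heaviside ?y - q\<bar> + \<bar>q * dl * S.Wc ?y\<bar>" by linarith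
			also have "\<bar>q * Heaviside ?y - q\<bar> = q * indicat_real {..<ep} (V.S n u w)" using q0 by (auto simp: indicator_def)
			also have "\<bar>q * dl * S.Wc ?y\<bar> = q * dl * S.Wc ?y" by (rule abs_of_nonneg[OF mult_nonneg_nonneg[OF S.qdl S.Wc_nonneg]])
			also have "q * dl * S.Wc ?y <= q * dl * (W b * (z3 w + z4 w))"
			proof (intro mult_left_mono S.qdl)
				show "S.Wc ?y <= W b * (z3 w + z4 w)"
				proof (cases "?y < b")
					case True
					hence "z3 w + z4 w = 1" using Vb by (auto simp: z3_def z4_def err_b_def g indicator_def)
					moreover have "W ?y <= W b" using True by (intro monoD[OF S.X.mono_W]) simp
					ultimately show ?thesis using True by (simp add: S.Wc_def)
				next
					case False
					have "0 <= z3 w + z4 w" using err_bounds by (simp add: z3_def z4_def)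
					thus ?thesis using False S.X.nonneg[of b] by (simp add: S.Wc_def)
				qed
			qed
			finally show ?thesis using f1 low by (simp add: mult.assoc)
		next
			case 3
			hence "f1 w = 0" "f2 w = 0" by (simp_all add: f1_def f2_def)
			thus ?thesis using rhs0 by simp
		qed
	qed
	have "\<bar>gen ep n k s\<bar> = \<bar>integral\<^sup>L M f1 + integral\<^sup>L M f2\<bar>" unfolding gen_def f1_def f2_def U_def ..
	also have "... <= (LINT w|M. \<bar>f1 w\<bar>) + (LINT w|M. \<bar>f2 w\<bar>)"
		using integral_abs_bound[of M f1] integral_abs_bound[of M f2] by linarith
	also have "... = (LINT w|M. \<bar>f1 w\<bar> + \<bar>f2 w\<bar>)"
		by (rule integral_add[OF integrable_abs[OF f1i] integrable_abs[OF f2i], symmetric])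
	also have "... <= (LINT w|M. q * (z1 w + z2 w) + q * dl * W b * (z3 w + z4 w))"
		by (intro integral_mono b1 integrable_add integrable_mult_right zi integrable_abs f1i f2i)
	also have "... = q * (integral\<^sup>L M z1 + integral\<^sup>L M z2) + q * dl * W b * (integral\<^sup>L M z3 + integral\<^sup>L M z4)"
		using zi by simp
	also have "... = Th ep n u" unfolding Th_def z1_def z2_def z3_def z4_def ..
	finally show ?thesis by (simp add: u_def)
qed

definition E_low :: "nat => real => nat => real" where
	"E_low N ep n = (LINT w|M. LINT u|lborel. indicator {0..<real N} u * err_low ep n (u, w))"

definition E_b :: "nat => real => nat => real" where
	"E_b N ep n = (LINT w|M. LINT u|lborel. indicator {0..<real N} u * err_b ep n (u, w))"

text \<open>By \<open>occupation_discrete\<close> the windows around \<open>0\<close> and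
  \<open>b\<close> have expected discounted occupation of order \<open>ep\<close>, uniformly in
  \<open>n\<close>. This gives \<open>K * ep\<close>, the only term that survives the refinement of
  the grid.\<close>

lemma generator_bound:
	obtains K where "0 <= K" "!!ep n. 0 < ep ==> ep <= 1 ==>
		\<bar>\<Sum>k<N * Suc n. exp (- q * tk n k) * (LINT s|lborel. disc {0..mesh n} q s * gen ep n k s)\<bar>
			<= K * ep + q * E_low N ep n + q * dl * W b * E_b N ep n"
proof -
	have q0: "0 <= q" by (rule S.X.q)
	have c0: "0 <= q * dl * W b" by (intro mult_nonneg_nonneg S.qdl S.X.nonneg)
	define D where "D c ep n u = disc {0..<real N} q u * (LINT w|M. indicat_real {c - ep..<c + ep} (V.S n u w))" for c ep n u
	have occ: "EX C>=0. ALL ep n. 0 < ep --> ep <= 1 --> integrable lborel (D c ep n) & integral\<^sup>L lborel (D c ep n) <= C * ep" for c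
		unfolding D_def by (rule V.occupation_discrete[OF Y_scale, where N = N and c = c]) blast
	obtain C0 where C0: "0 <= C0" "!!ep n. 0 < ep ==> ep <= 1 ==> integrable lborel (D 0 ep n) & integral\<^sup>L lborel (D 0 ep n) <= C0 * ep"
		using occ[of 0] by blast
	obtain Cb where Cb: "0 <= Cb" "!!ep n. 0 < ep ==> ep <= 1 ==> integrable lborel (D b ep n) & integral\<^sup>L lborel (D b ep n) <= Cb * ep"
		using occ[of b] by blast
	define K where "K = q * C0 + q * dl * W b * Cb"
	have K0: "0 <= K" unfolding K_def using q0 c0 C0(1) Cb(1) by simp
	have main: "\<bar>\<Sum>k<N * Suc n. exp (- q * tk n k) * (LINT s|lborel. disc {0..mesh n} q s * gen ep n k s)\<bar>
			<= K * ep + q * E_low N ep n + q * dl * W b * E_b N ep n" if ep: "0 < ep" "ep <= 1" for ep n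
	proof -
		let ?h = "mesh n"
		have h0: "0 < ?h" by simp
		have mh: "real (N * Suc n) * ?h = real N" unfolding of_nat_mult by (simp del: of_nat_Suc)
		have tkh: "tk n k = real k * ?h" for k by (simp add: tk_def)
		\<comment> \<open>The index of the step containing \<open>u\<close>, used to paste the functions
		  \<open>gen ep n k\<close> into one function of time.\<close>
		define ix where "ix u = nat \<lfloor>real (Suc n) * u\<rfloor>" for u
		define Ps where "Ps u = gen ep n (ix u) (u - grid n u)" for u
		have Ps: "Ps (real k * ?h + s) = gen ep n k s" if s: "0 <= s" "s < ?h" for k s
		proof -
			have g: "grid n (real k * ?h + s) = real k * ?h"
				unfolding tkh[symmetric] using s by (intro tk_grid) (simp_all add: tk_Suc)
			have "real (Suc n) * (real k * ?h + s) = real k + real (Suc n) * s" by (simp add: distrib_left del: of_nat_Suc)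
			moreover have "0 <= real (Suc n) * s" "real (Suc n) * s < 1" using s by (auto simp: field_simps)
			ultimately have "\<lfloor>real (Suc n) * (real k * ?h + s)\<rfloor> = int k" by (intro floor_unique) auto
			hence "ix (real k * ?h + s) = k" unfolding ix_def by simp
			thus ?thesis unfolding Ps_def g by simp
		qed
		note gs = grid_sum[where m = "N * Suc n" and Ph = "gen ep n" and Ps = Ps and h = ?h and q = q, OF h0 step_identity(2)[OF ep(1)] Ps, unfolded mh]
		have b: "\<bar>Ps u\<bar> <= Th ep n u" if u: "0 <= u" for u
		proof -
			have i: "real (ix u) = real_of_int \<lfloor>real (Suc n) * u\<rfloor>" unfolding ix_def using u by simp
			have g: "grid n u = tk n (ix u)" unfolding grid_def tk_def i ..
			have "0 <= u - grid n u" "u - grid n u < ?h" using grid_le[of n u] grid_gt[of u n] by auto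
			from gen_bound[OF this, of ep "ix u"] show ?thesis unfolding Ps_def g by simp
		qed
		define l1 l2 where "l1 u = (LINT w|M. indicator {0..<real N} u * err_low ep n (u, w))"
			and "l2 u = (LINT w|M. indicator {0..<real N} u * err_b ep n (u, w))" for u
		note e1 = V.expected_time_tendsto_0(3,4)[OF err_measurable(1) err_bounds(1,2) err_limits(1)[OF ep(1)], of N n]
		note e2 = V.expected_time_tendsto_0(3,4)[OF err_measurable(2) err_bounds(3,4) err_limits(2)[OF ep(1)], of N n]
		have l: "integrable lborel l1" "integrable lborel l2" "integral\<^sup>L lborel l1 = E_low N ep n" "integral\<^sup>L lborel l2 = E_b N ep n"
			unfolding l1_def[abs_def] l2_def[abs_def] E_low_def E_b_def using e1 e2 by simp_all
		define rhs where "rhs u = q * (D 0 ep n u + l1 u) + q * dl * W b * (D b ep n u + l2 u)" for u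
		have rhs_i: "integrable lborel rhs"
			unfolding rhs_def[abs_def] using C0(2)[OF ep] Cb(2)[OF ep] l
			by (intro integrable_add integrable_mult_right) auto
		have rhs_I: "integral\<^sup>L lborel rhs = q * (integral\<^sup>L lborel (D 0 ep n) + E_low N ep n) + q * dl * W b * (integral\<^sup>L lborel (D b ep n) + E_b N ep n)"
			unfolding rhs_def[abs_def] l(3,4)[symmetric] using C0(2)[OF ep, of n] Cb(2)[OF ep, of n] l(1,2) by simp
		have le: "\<bar>disc {0..<real N} q u * Ps u\<bar> <= rhs u" for u
		proof (cases "u \<in> {0..<real N}")
			case True
			hence u: "0 <= u" by simp
			have ex: "0 <= exp (- q * u)" "exp (- q * u) <= 1" using q0 u by auto
			let ?e1 = "LINT w|M. err_low ep n (u, w)" and ?e2 = "LINT w|M. err_b ep n (u, w)"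
			have nn: "0 <= ?e1" "0 <= ?e2" by (intro integral_nonneg_AE AE_I2 err_bounds)+
			have m: "exp (- q * u) * ?e1 <= ?e1" "exp (- q * u) * ?e2 <= ?e2" using ex nn by (auto intro: mult_left_le_one_le)
			have "\<bar>disc {0..<real N} q u * Ps u\<bar> <= exp (- q * u) * Th ep n u"
				using True mult_left_mono[OF b[OF u] ex(1)] by (simp add: abs_mult)
			also have "... = q * (D 0 ep n u + exp (- q * u) * ?e1) + q * dl * W b * (D b ep n u + exp (- q * u) * ?e2)"
				using True unfolding Th_def D_def by (simp add: algebra_simps)
			also have "... <= q * (D 0 ep n u + ?e1) + q * dl * W b * (D b ep n u + ?e2)"
				using m q0 c0 by (intro add_mono mult_left_mono order_refl) auto
			also have "... = rhs u" unfolding rhs_def l1_def l2_def using True by simp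
			finally show ?thesis .
		qed (simp add: rhs_def D_def l1_def l2_def)
		have "\<bar>\<Sum>k<N * Suc n. exp (- q * tk n k) * (LINT s|lborel. disc {0..?h} q s * gen ep n k s)\<bar> =
			\<bar>LINT u|lborel. disc {0..<real N} q u * Ps u\<bar>"
			using gs(1) unfolding tkh by simp
		also have "... <= (LINT u|lborel. \<bar>disc {0..<real N} q u * Ps u\<bar>)" by (rule integral_abs_bound)
		also have "... <= integral\<^sup>L lborel rhs" by (intro integral_mono integrable_abs gs(2) rhs_i le)
		also have "... <= q * (C0 * ep + E_low N ep n) + q * dl * W b * (Cb * ep + E_b N ep n)"
			unfolding rhs_I using C0(2)[OF ep] Cb(2)[OF ep] q0 c0 by (intro add_mono mult_left_mono order_refl) auto
		also have "... = K * ep + q * E_low N ep n + q * dl * W b * E_b N ep n" by (simp add: K_def algebra_simps)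
		finally show ?thesis .
	qed
	show ?thesis by (rule that[OF K0 main])
qed

end

section \<open>The stopped discounted process on the grid\<close>

context rr_levy
begin

text \<open>A discrete stochastic integral rather than a value at a random index, so that each
  summand belongs to one fixed time. \<open>stopped_eq\<close> identifies it with the discounted
  value at the first index that is not active, or at the horizon.\<close>

definition stopped :: "real => nat => nat => 'a => real" where
	"stopped ep N n w = S.ff ep x0 + (\<Sum>k<N * Suc n. indicator (act ep n k) w *
		(exp (- q * tk n (Suc k)) * S.ff ep (V (tk n (Suc k)) w) - exp (- q * tk n k) * S.ff ep (V (tk n k) w)))"

definition E_lag :: "nat => nat => real" where
	"E_lag N n = (LINT w|M. LINT u|lborel. indicator {0..<real N} u * lag n (u, w))"

definition all_good :: "real => nat => nat => 'a set" where
	"all_good ep N n = {w\<in>space M. ALL k<N * Suc n. w \<in> good_step ep n k}"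

definition E_bad :: "nat => real => nat => real" where
	"E_bad N ep n = (LINT w|M. indicator (space M - all_good ep N n) w * S.ff ep (x0 + 2 * DU (real N) w))"

lemma all_good_sets: "all_good ep N n \<in> sets M"
proof -
	have "{w\<in>space M. ALL k:{..<N * Suc n}. w \<in> good_step ep n k} \<in> sets M"
	proof (rule sets.sets_Collect_countable_All'[OF _ countable_finite[OF finite_lessThan]])
		fix k
		have "good_step ep n k \<in> sets M" using good_step_F F_sub by blast
		moreover have "{w\<in>space M. w \<in> good_step ep n k} = good_step ep n k" by (auto simp: good_step_def)
		ultimately show "{w\<in>space M. w \<in> good_step ep n k} \<in> sets M" by (simp only:)
	qed
	thus ?thesis unfolding all_good_def lessThan_iff Ball_def .
qed

lemma DU_ff_integrable: "integrable M (%w. S.ff ep (x0 + 2 * DU (real N) w))"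
proof -
	have U: "(%w. x0 - ep + 2 * DU (real N) w) \<in> borel_measurable M" using DU_measurable[of "real N"] by measurable
	have "integrable M (%w. exp ((ka + 1) * (x0 - ep + 2 * DU (real N) w)))"
	proof -
		have "exp ((ka + 1) * (x0 - ep + 2 * DU (real N) w)) = exp ((ka + 1) * (x0 - ep)) * exp (2 * (ka + 1) * DU (real N) w)" for w
			unfolding exp_add[symmetric] by (simp add: algebra_simps)
		thus ?thesis using DU_exp[of "real N" "2 * (ka + 1)"] ka1 by simp
	qed
	from convolution_integrable[OF U S.rs_bdd this, of 0]
	have "integrable M (%w. S.rs (x0 + 2 * DU (real N) w - ep))" by (simp add: algebra_simps)
	thus ?thesis unfolding S.ff_def by (intro integrable_add integrable_const)
qed

lemma lag_u_integrable:
	assumes "w \<in> space M"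
	shows "integrable lborel (%u. indicator {0..<real N} u * lag n (u, w))"
proof (rule integrable_bound[of _ "indicat_real {0..<real N}"])
	have "(%u. (u, w)) \<in> borel \<rightarrow>\<^sub>M (borel \<Otimes> M)" by (rule measurable_Pair2'[OF assms])
	from measurable_compose[OF this err_measurable(3)[of N n]]
	show "(%u. indicator {0..<real N} u * lag n (u, w)) \<in> borel_measurable lborel" by simp
	show "AE u in lborel. norm (indicator {0..<real N} u * lag n (u, w)) <= norm (indicat_real {0..<real N} u)"
		using err_bounds(5,6) by (intro AE_I2) (simp add: abs_mult mult_left_le)
qed simp

lemma indicator_tk_sum: "(\<Sum>k<m. indicat_real {tk n k..<tk n (Suc k)} u) = indicator {0..<tk n m} u"
proof (induction m)
	case 0
	show ?case by (simp add: tk_0)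
next
	case (Suc m)
	thus ?case using tk_nonneg[of n m] tk_less[of n m] by (auto simp: indicator_def)
qed

lemma lag_sum:
	assumes "w \<in> space M"
	shows "(\<Sum>k<N * Suc n. LINT u:{tk n k..<tk n (Suc k)}|lborel. lag n (u, w)) = (LINT u|lborel. indicator {0..<real N} u * lag n (u, w))"
proof -
	let ?g = "%k u. indicat_real {tk n k..<tk n (Suc k)} u * (indicator {0..<real N} u * lag n (u, w))"
	have i: "integrable lborel (?g k)" for k
		using integrable_mult_indicator[OF _ lag_u_integrable[OF assms, of N n], of "{tk n k..<tk n (Suc k)}"] by simp
	have e: "(LINT u:{tk n k..<tk n (Suc k)}|lborel. lag n (u, w)) = integral\<^sup>L lborel (?g k)" if "k < N * Suc n" for k
		unfolding set_lebesgue_integral_def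
	proof (rule integral_cong[OF refl])
		fix u
		have "u \<in> {0..<real N}" if "u \<in> {tk n k..<tk n (Suc k)}"
			using that tk_nonneg[of n k] tk_le_N[of "Suc k" N n] `k < N * Suc n` by auto
		thus "indicator {tk n k..<tk n (Suc k)} u *\<^sub>R lag n (u, w) = ?g k u" by (cases "u \<in> {tk n k..<tk n (Suc k)}") auto
	qed
	have "(\<Sum>k<N * Suc n. LINT u:{tk n k..<tk n (Suc k)}|lborel. lag n (u, w)) = (\<Sum>k<N * Suc n. integral\<^sup>L lborel (?g k))"
		by (rule sum.cong[OF refl]) (simp only: lessThan_iff e)
	also have "... = (LINT u|lborel. (\<Sum>k<N * Suc n. ?g k u))" by (rule integral_sum[symmetric]) (rule i)
	also have "... = (LINT u|lborel. indicator {0..<real N} u * lag n (u, w))"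
		unfolding sum_distrib_right[symmetric] indicator_tk_sum tk_end
		by (rule integral_cong[OF refl]) (simp add: indicator_def)
	finally show ?thesis .
qed

text \<open>Good steps contribute their lags, which add up to an integral over
  \<open>[0, N]\<close>. A bad step ends the activity, so at most one active step is bad and the
  crude bound is paid once.\<close>

lemma step_error_sum:
	assumes reg: "regular_path (%t. X t w) x dl b" and w: "w \<in> space M" and ep: "0 < ep"
		and L: "0 <= L" "!!x y. x <= y ==> y <= max a b ==> S.rs y - S.rs x <= L * (y - x)"
	shows "(\<Sum>k<N * Suc n. indicator (act ep n k) w * \<bar>S.ff ep (V (tk n (Suc k)) w) - proxy ep n k w\<bar>) <=
		L * dl * (LINT u|lborel. indicator {0..<real N} u * lag n (u, w)) +
		indicator (space M - all_good ep N n) w * S.ff ep (x0 + 2 * DU (real N) w)"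
proof -
	let ?m = "N * Suc n" and ?B = "S.ff ep (x0 + 2 * DU (real N) w)"
	define e where "e k = \<bar>S.ff ep (V (tk n (Suc k)) w) - proxy ep n k w\<bar>" for k
	define bad where "bad k = indicat_real (act ep n k - good_step ep n k) w" for k
	have B0: "0 <= ?B" using S.ff_ge_1[of ep "x0 + 2 * DU (real N) w"] by linarith
	define lk where "lk k = (LINT u:{tk n k..<tk n (Suc k)}|lborel. lag n (u, w))" for k
	have lk0: "0 <= lk k" for k
		unfolding lk_def set_lebesgue_integral_def using err_bounds(5) by (intro integral_nonneg_AE AE_I2) simp
	have Ld: "0 <= L * dl" using L(1) S.dl by simp
	have tm: "indicator (act ep n k) w * e k <= L * dl * lk k + bad k * ?B" if k: "k < ?m" for k
	proof -
		consider "w \<notin> act ep n k" | "w \<in> act ep n k" "w \<in> good_step ep n k" | "w \<in> act ep n k" "w \<notin> good_step ep n k" by blast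
		thus ?thesis
		proof cases
			case 1
			thus ?thesis using mult_nonneg_nonneg[OF Ld lk0[of k]] by (simp add: bad_def)
		next
			case 2
			have "e k <= L * dl * lk k" unfolding e_def lk_def by (rule step_bound_good[OF reg ep 2 L])
			thus ?thesis using 2 by (simp add: bad_def)
		next
			case 3
			have "e k <= ?B" unfolding e_def by (rule step_bound_any(1)[OF k])
			thus ?thesis using 3 mult_nonneg_nonneg[OF Ld lk0[of k]] by (simp add: bad_def)
		qed
	qed
	have bs: "(\<Sum>k<m. bad k) + indicator (act ep n m) w <= 1" for m
	proof (induction m)
		case 0
		show ?case by (simp add: indicator_def)
	next
		case (Suc m)
		have "bad m + indicator (act ep n (Suc m)) w <= (indicator (act ep n m) w :: real)"
			unfolding act_Suc bad_def by (auto simp: indicator_def)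
		thus ?case using Suc by simp
	qed
	have bad_sum: "(\<Sum>k<?m. bad k) <= indicator (space M - all_good ep N n) w"
	proof (cases "w \<in> all_good ep N n")
		case True
		hence "bad k = 0" if "k < ?m" for k using that by (simp add: bad_def all_good_def)
		thus ?thesis by simp
	next
		case False
		have "0 <= indicat_real (act ep n ?m) w" by simp
		hence "(\<Sum>k<?m. bad k) <= 1" using bs[of ?m] by linarith
		thus ?thesis using False w by simp
	qed
	have "(\<Sum>k<?m. indicator (act ep n k) w * e k) <= (\<Sum>k<?m. L * dl * lk k + bad k * ?B)"
		by (rule sum_mono) (use tm in simp)
	also have "... = L * dl * (\<Sum>k<?m. lk k) + (\<Sum>k<?m. bad k) * ?B"
		by (simp add: sum.distrib sum_distrib_left sum_distrib_right)
	also have "... <= L * dl * (\<Sum>k<?m. lk k) + indicator (space M - all_good ep N n) w * ?B"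
		using bad_sum B0 by (intro add_left_mono mult_right_mono)
	finally show ?thesis unfolding e_def lk_def lag_sum[OF w] .
qed

lemma ff_V_measurable: "0 <= t ==> (%w. S.ff ep (V t w)) \<in> borel_measurable M"
proof -
	assume "0 <= t"
	hence "(%w. V t w - ep) \<in> borel_measurable M" using V.V_measurable by measurable
	from measurable_compose[OF this exp_bdd_measurable[OF S.rs_bdd]] show ?thesis unfolding S.ff_def by measurable
qed

lemma ff_V_integrable:
	assumes "0 <= t"
	shows "integrable M (%w. S.ff ep (V t w))"
proof -
	have U: "(%w. V t w - ep) \<in> borel_measurable M" using V.V_measurable[OF assms] by measurable
	have "exp ((ka + 1) * (V t w - ep)) = exp (- (ka + 1) * ep) * exp ((ka + 1) * V t w)" for w
		unfolding exp_add[symmetric] by (simp add: algebra_simps)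
	hence "integrable M (%w. exp ((ka + 1) * (V t w - ep)))" using V.V_exp_integrable[OF assms ka1] by simp
	from convolution_integrable[OF U S.rs_bdd this, of 0] show ?thesis unfolding S.ff_def
		by (intro integrable_add integrable_const) simp
qed

text \<open>Replacing each new value by its proxy costs the step errors; what is then left of the
  increments is, by \<open>step_identity\<close>, the sum of the generator terms.\<close>

lemma stopped_estimate:
	assumes ep: "0 < ep"
		and L: "0 <= L" "!!x y. x <= y ==> y <= max a b ==> S.rs y - S.rs x <= L * (y - x)"
	shows "integrable M (stopped ep N n)"
		"\<bar>(LINT w|M. stopped ep N n w) - S.ff ep x0\<bar> <=
			\<bar>\<Sum>k<N * Suc n. exp (- q * tk n k) * (LINT s|lborel. disc {0..mesh n} q s * gen ep n k s)\<bar> +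
			(L * dl * E_lag N n + E_bad N ep n)" (is ?est)
proof -
	let ?D = "(LINT w|M. stopped ep N n w) - S.ff ep x0" and ?e = "%k. exp (- q * tk n k)"
	let ?bad = "%w. indicator (space M - all_good ep N n) w * S.ff ep (x0 + 2 * DU (real N) w)"
		and ?lag = "%w. LINT u|lborel. indicator {0..<real N} u * lag n (u, w)"
	let ?m = "N * Suc n" and ?h = "mesh n"
	have q0: "0 <= q" by (rule S.X.q)
	define A where "A k w = indicat_real (act ep n k) w" for k w
	define f where "f k w = S.ff ep (V (tk n k) w)" for k w
	let ?d = "%k w. ?e (Suc k) * (A k w * f (Suc k) w) - ?e k * (A k w * f k w)"
	have As: "act ep n k \<in> sets M" for k using act_F F_sub by blast
	have Ai: "integrable M (%w. A k w * g w)" if "integrable M g" for k g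
		using integrable_mult_indicator[OF As that] by (simp add: A_def)
	have fi: "integrable M (f k)" for k unfolding f_def[abs_def] by (rule ff_V_integrable[OF tk_nonneg])
	have Pi: "integrable M (%w. A k w * proxy ep n k w)" for k unfolding A_def by (rule step_identity(3)[OF ep])
	define G where "G k = (LINT s|lborel. disc {0..?h} q s * gen ep n k s)" for k
	have id: "exp (- q * ?h) * (LINT w|M. A k w * proxy ep n k w) = (LINT w|M. A k w * f k w) + G k" for k
		unfolding A_def f_def G_def by (rule step_identity(1)[OF ep])
	have st: "stopped ep N n w = S.ff ep x0 + (\<Sum>k<?m. ?d k w)" for w
		unfolding stopped_def A_def f_def by (simp add: right_diff_distrib mult.left_commute)
	have ti: "integrable M (%w. ?d k w)" for k
		by (intro integrable_diff integrable_mult_right Ai fi)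
	show "integrable M (stopped ep N n)"
		unfolding st[abs_def] by (intro integrable_add integrable_const integrable_sum ti)
	have tS: "?e (Suc k) = ?e k * exp (- q * ?h)" for k
		unfolding exp_add[symmetric] tk_Suc by (simp add: distrib_left del: of_nat_Suc)
	define e where "e k w = A k w * (f (Suc k) w - proxy ep n k w)" for k w
	let ?i = "%k. integral\<^sup>L M (e k)"
	have ei: "integrable M (e k)" for k unfolding e_def[abs_def] right_diff_distrib by (intro integrable_diff Ai fi Pi)
	have tm: "(LINT w|M. ?d k w) =
		?e (Suc k) * ?i k + ?e k * G k" for k
	proof -
		have "(LINT w|M. ?d k w) =
			?e (Suc k) * (LINT w|M. A k w * f (Suc k) w) - ?e k * (LINT w|M. A k w * f k w)"
			unfolding integral_mult_right_zero[symmetric]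
			by (rule integral_diff) (intro integrable_mult_right Ai fi)+
		moreover have "?i k = (LINT w|M. A k w * f (Suc k) w) - (LINT w|M. A k w * proxy ep n k w)"
			unfolding e_def right_diff_distrib by (rule integral_diff[OF Ai[OF fi] Pi])
		moreover have "?e (Suc k) * (LINT w|M. A k w * proxy ep n k w) = ?e k * ((LINT w|M. A k w * f k w) + G k)"
			unfolding tS mult.assoc id ..
		ultimately show ?thesis by (simp add: right_diff_distrib distrib_left)
	qed
	have "(LINT w|M. stopped ep N n w) = (LINT w|M. S.ff ep x0) + (LINT w|M. (\<Sum>k<?m. ?d k w))"
		unfolding st by (intro integral_add integrable_const integrable_sum ti)
	also have "(LINT w|M. (\<Sum>k<?m. ?d k w)) =
		(\<Sum>k<?m. ?e (Suc k) * ?i k + ?e k * G k)"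
		unfolding tm[symmetric] by (rule integral_sum) (rule ti)
	finally have "?D = (\<Sum>k<?m. ?e (Suc k) * ?i k) + (\<Sum>k<?m. ?e k * G k)"
		by (simp add: prob_space sum.distrib)
	hence 1: "\<bar>?D\<bar> <= \<bar>\<Sum>k<?m. ?e (Suc k) * ?i k\<bar> + \<bar>\<Sum>k<?m. ?e k * G k\<bar>"
		by linarith
	note lagi = V.expected_time_tendsto_0(2)[OF err_measurable(3) err_bounds(5,6) err_limits(3)[OF zero_less_one], of N n]
	have badi: "integrable M (%w. ?bad w)"
		using integrable_mult_indicator[OF sets.compl_sets[OF all_good_sets] DU_ff_integrable, of ep N n ep N] by simp
	have "\<bar>\<Sum>k<?m. ?e (Suc k) * ?i k\<bar> <= (\<Sum>k<?m. (LINT w|M. \<bar>e k w\<bar>))"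
	proof (rule order_trans[OF sum_abs sum_mono])
		fix k
		have "0 <= ?e (Suc k)" "?e (Suc k) <= 1" using q0 tk_nonneg[of n "Suc k"] by auto
		hence "\<bar>?e (Suc k) * ?i k\<bar> <= \<bar>?i k\<bar>"
			unfolding abs_mult by (simp add: mult_left_le_one_le)
		also have "... <= (LINT w|M. \<bar>e k w\<bar>)" by (rule integral_abs_bound)
		finally show "\<bar>?e (Suc k) * ?i k\<bar> <= (LINT w|M. \<bar>e k w\<bar>)" .
	qed
	also have "... = (LINT w|M. (\<Sum>k<?m. \<bar>e k w\<bar>))" by (rule integral_sum[symmetric]) (rule integrable_abs[OF ei])
	also have "... <= (LINT w|M. L * dl * ?lag w +
		?bad w)"
	proof (rule integral_mono_AE)
		show "integrable M (%w. \<Sum>k<?m. \<bar>e k w\<bar>)" by (intro integrable_sum integrable_abs ei)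
		show "integrable M (%w. L * dl * ?lag w +
			?bad w)"
			by (intro integrable_add integrable_mult_right lagi badi)
		show "AE w in M. (\<Sum>k<?m. \<bar>e k w\<bar>) <= L * dl * ?lag w +
			?bad w"
			using AE_regular AE_space
		proof eventually_elim
			case (elim w)
			have "\<bar>e k w\<bar> = indicator (act ep n k) w * \<bar>S.ff ep (V (tk n (Suc k)) w) - proxy ep n k w\<bar>" for k
				by (simp add: e_def A_def f_def abs_mult)
			thus ?case using step_error_sum[OF elim ep L, of n N] by simp
		qed
	qed
	also have "... = L * dl * E_lag N n + E_bad N ep n"
		unfolding E_lag_def E_bad_def
		by (subst integral_add[OF integrable_mult_right[OF lagi] badi]) simp_all
	finally show ?est using 1 unfolding G_def by linarith
qed

lemma error_limits:
	assumes ep: "0 < ep"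
	shows "(%n. E_low N ep n) ----> 0" "(%n. E_b N ep n) ----> 0" "(%n. E_lag N n) ----> 0" "(%n. E_bad N ep n) ----> 0"
proof -
	show "(%n. E_low N ep n) ----> 0"
		unfolding E_low_def by (rule V.expected_time_tendsto_0(1)[OF err_measurable(1) err_bounds(1,2) err_limits(1)[OF ep]])
	show "(%n. E_b N ep n) ----> 0"
		unfolding E_b_def by (rule V.expected_time_tendsto_0(1)[OF err_measurable(2) err_bounds(3,4) err_limits(2)[OF ep]])
	show "(%n. E_lag N n) ----> 0"
		unfolding E_lag_def by (rule V.expected_time_tendsto_0(1)[OF err_measurable(3) err_bounds(5,6) err_limits(3)[OF ep]])
	let ?B = "%w. S.ff ep (x0 + 2 * DU (real N) w)"
	have B0: "0 <= ?B w" for w using S.ff_ge_1 order_trans[OF zero_le_one] by blast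
	have "(%n. E_bad N ep n) ----> (LINT w|M. 0)"
		unfolding E_bad_def
	proof (rule integral_dominated_convergence[where w = ?B])
		show "(%w. indicator (space M - all_good ep N n) w * ?B w) \<in> borel_measurable M" for n
			using all_good_sets[of ep N n] borel_measurable_integrable[OF DU_ff_integrable]
			by (intro borel_measurable_times borel_measurable_indicator sets.compl_sets)
		show "AE w in M. (%n. indicator (space M - all_good ep N n) w * ?B w) ----> 0"
		proof (rule AE_I2)
			fix w assume w: "w \<in> space M"
			have "eventually (%n. indicator (space M - all_good ep N n) w * ?B w = 0) sequentially"
				using eventually_good_step[OF ep w, of N] by eventually_elim (use w in "simp add: all_good_def")
			thus "(%n. indicator (space M - all_good ep N n) w * ?B w) ----> 0" by (rule tendsto_eventually)
		qed
		show "AE w in M. norm (indicator (space M - all_good ep N n) w * ?B w) <= ?B w" for n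
			using B0 by (intro AE_I2) (simp add: abs_mult indicator_def)
	qed (simp_all add: DU_ff_integrable)
	thus "(%n. E_bad N ep n) ----> 0" by simp
qed

end

section \<open>Refining the grid and removing the shift\<close>

lemma (in refraction_scales) rs_isCont: "isCont rs y"
proof -
	obtain L where L: "0 <= L" "!!u v. u <= v ==> v <= y + 1 ==> rs v - rs u <= L * (v - u)"
		"!!u v. u <= v ==> v <= y + 1 ==> Zs v - Zs u <= L * (v - u)"
		by (rule Lipschitz[of "y + 1"]) (rule that)
	have b: "\<bar>rs z - rs y\<bar> <= L * \<bar>z - y\<bar>" if "z <= y + 1" for z
	proof (cases "z <= y")
		case True
		have "rs z <= rs y" using True by (rule monoD[OF rs_mono])
		moreover have "rs y - rs z <= L * (y - z)" using True by (intro L) auto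
		ultimately show ?thesis using True by (simp add: abs_if)
	next
		case False
		hence "rs y <= rs z" by (intro monoD[OF rs_mono]) simp
		moreover have "rs z - rs y <= L * (z - y)" using False that by (intro L) auto
		ultimately show ?thesis using False by (simp add: abs_if)
	qed
	have "((%z. rs z - rs y) \<longlongrightarrow> 0) (at y)"
	proof (rule Lim_null_comparison)
		have "eventually (%z. z < y + 1) (at y)" by (rule order_tendstoD(2)[OF tendsto_ident_at]) simp
		thus "eventually (%z. norm (rs z - rs y) <= L * \<bar>z - y\<bar>) (at y)" by eventually_elim (simp add: b)
		show "((%z. L * \<bar>z - y\<bar>) \<longlongrightarrow> 0) (at y)" by (auto intro!: tendsto_eq_intros)
	qed
	thus ?thesis unfolding isCont_def by (rule LIM_zero_cancel)
qed

context rr_levy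
begin

lemma act_decreasing:
	assumes "w \<notin> act ep n j" "j <= k"
	shows "w \<notin> act ep n k"
	using assms(2,1) by (induction rule: dec_induct) (auto simp: act_Suc)

lemma stopped_eq:
	assumes j: "j <= N * Suc n" and act: "!!k. k < j ==> w \<in> act ep n k" and n: "j < N * Suc n ==> w \<notin> act ep n j"
	shows "stopped ep N n w = exp (- q * tk n j) * S.ff ep (V (tk n j) w)"
proof -
	define g where "g k = exp (- q * tk n k) * S.ff ep (V (tk n k) w)" for k
	have "(\<Sum>k<N * Suc n. indicator (act ep n k) w * (g (Suc k) - g k)) = (\<Sum>k<j. g (Suc k) - g k)"
	proof (rule sum.mono_neutral_cong_right)
		show "ALL k:{..<N * Suc n} - {..<j}. indicator (act ep n k) w * (g (Suc k) - g k) = 0"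
		proof
			fix k assume "k \<in> {..<N * Suc n} - {..<j}"
			hence "j < N * Suc n" "j <= k" by auto
			hence "w \<notin> act ep n k" using n act_decreasing by blast
			thus "indicator (act ep n k) w * (g (Suc k) - g k) = 0" by simp
		qed
	qed (use j act in auto)
	also have "... = g j - g 0" by (rule sum_lessThan_telescope)
	also have "g 0 = S.ff ep x0" by (simp add: g_def tk_0 V_0)
	finally show ?thesis unfolding stopped_def g_def by simp
qed

lemma stopped_bounds:
	assumes "w \<in> space M"
	shows "0 <= stopped ep N n w" "stopped ep N n w <= S.ff ep (x0 + 2 * DU (real N) w)"
proof -
	define j where "j = (LEAST k. k = N * Suc n | w \<notin> act ep n k)"
	have j: "j = N * Suc n | w \<notin> act ep n j" unfolding j_def by (rule LeastI[of _ "N * Suc n"]) simp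
	have le: "j <= N * Suc n" unfolding j_def by (rule Least_le) simp
	have lt: "w \<in> act ep n k" if "k < j" for k using not_less_Least[OF that[unfolded j_def]] by simp
	have s: "stopped ep N n w = exp (- q * tk n j) * S.ff ep (V (tk n j) w)"
		by (rule stopped_eq[OF le lt]) (use j in auto)
	have f: "1 <= S.ff ep (V (tk n j) w)" by (rule S.ff_ge_1)
	thus "0 <= stopped ep N n w" unfolding s by simp
	have "exp (- q * tk n j) <= 1" using S.X.q tk_nonneg[of n j] by simp
	hence "stopped ep N n w <= 1 * S.ff ep (V (tk n j) w)" unfolding s using f by (intro mult_right_mono) auto
	also have "1 * S.ff ep (V (tk n j) w) <= S.ff ep (x0 + 2 * DU (real N) w)"
		unfolding mult_1 using V.V_le[OF tk_nonneg tk_le_N[OF le], of w] DU_nonneg[of "real N" w] by (intro S.ff_mono) simp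
	finally show "stopped ep N n w <= S.ff ep (x0 + 2 * DU (real N) w)" .
qed

lemma V_le_before: "0 <= t ==> ereal t < T w ==> V t w <= a"
proof (rule ccontr)
	assume t: "0 <= t" "ereal t < T w" "~ V t w <= a"
	hence "t ~= 0" using V_0 x0 by auto
	hence "T w <= ereal t" unfolding T_def passage_above_def using t by (intro Inf_lower) auto
	thus False using t(2) by simp
qed

text \<open>Shortly before \<open>t\<close> the process is at most \<open>a\<close>, and in the
  remaining time it climbs by at most \<open>e\<close>.\<close>

lemma V_no_jump_above:
	assumes t: "0 <= t" and le: "!!s. 0 <= s ==> s < t ==> V s w <= a"
	shows "V t w <= a"
proof (cases "t = 0")
	case True
	thus ?thesis using V_0 x0 by simp
next
	case False
	show ?thesis
	proof (rule field_le_epsilon)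
		fix e :: real assume e: "0 < e"
		obtain d where d: "0 < d" "ALL s u. 0 <= s --> s <= t --> s <= u --> u < s + d --> X u w - X s w < e"
			using good_path_up_modulus[OF good e t] by blast
		define s where "s = max 0 (t - d / 2)"
		have s: "0 <= s" "s < t" "t < s + d" using False t d(1) by (auto simp: s_def)
		have "V t w - V s w <= e"
		proof (rule tame_upper[OF V.V_tame s(1) less_imp_le[OF s(2)]])
			fix u assume "s <= u" "u <= t"
			hence "X t w - X u w < e" using d(2) s by auto
			thus "X t w - X u w <= e" by simp
		qed
		thus "V t w <= a + e" using le[OF s(1,2)] by simp
	qed
qed

text \<open>The value at passage is \<open>S.ff ep a\<close> because the process sits at
  \<open>a\<close> exactly at that time.\<close>

definition stop_limit :: "real => nat => 'a => real" where
	"stop_limit ep N w = (if T w < ereal (real N) then exp (- q * real_of_ereal (T w)) * S.ff ep a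
		else exp (- q * real N) * S.ff ep (V (real N) w))"

lemma V_le_at_horizon: "~ T w < ereal (real N) ==> V (real N) w <= a"
proof (rule V_no_jump_above)
	fix s assume "~ T w < ereal (real N)" "0 <= s" "s < real N"
	moreover from this have "ereal s < T w" using less_le_trans[of "ereal s" "ereal (real N)" "T w"] by simp
	ultimately show "V s w <= a" by (intro V_le_before)
qed simp

text \<open>The scheme notices passage at the first grid time with a value above \<open>a\<close>.
  The process is above \<open>a\<close> on intervals arbitrarily soon after passage, and a fine grid
  meets them; right-continuity of the discounted value then gives the limit.\<close>

lemma stopped_tendsto:
	assumes ep: "0 < ep" and w: "w \<in> space M"
	shows "(%n. stopped ep N n w) ----> stop_limit ep N w"
proof -
	have act: "w \<in> act ep n k \<longleftrightarrow> (ALL j<=k. V (tk n j) w <= a)"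
		if "ALL k<N * Suc n. w \<in> good_step ep n k" "k <= N * Suc n" for n k
		using that w unfolding act_def by auto
	note evg = eventually_good_step[OF ep w, of N]
	show ?thesis
	proof (cases "T w < ereal (real N)")
		case False
		have le: "V t w <= a" if "0 <= t" "t <= real N" for t
		proof (cases "t = real N")
			case True
			thus ?thesis using V_le_at_horizon[OF False] by simp
		next
			case ne: False
			hence "ereal t < ereal (real N)" using that by simp
			hence "ereal t < T w" using False by (meson less_le_trans not_less)
			thus ?thesis by (rule V_le_before[OF that(1)])
		qed
		have "eventually (%n. stopped ep N n w = stop_limit ep N w) sequentially"
			using evg
		proof eventually_elim
			case (elim n)
			have "stopped ep N n w = exp (- q * tk n (N * Suc n)) * S.ff ep (V (tk n (N * Suc n)) w)"
			proof (rule stopped_eq[OF order_refl])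
				fix k assume k: "k < N * Suc n"
				show "w \<in> act ep n k"
					unfolding act[OF elim less_imp_le[OF k]] using k by (auto intro!: le tk_nonneg tk_le_N)
			qed simp
			thus ?case unfolding tk_end stop_limit_def using False by simp
		qed
		thus ?thesis by (rule tendsto_eventually)
	next
		case True
		define ta where "ta = real_of_ereal (T w)"
		have ta: "T w = ereal ta" unfolding ta_def using T_nonneg[of w] True by (cases "T w") auto
		have ta0: "0 <= ta" "ta < real N" using T_nonneg[of w] True unfolding ta by auto
		have before: "V t w <= a" if "0 <= t" "t <= ta" for t
		proof (cases "t = ta")
			case t: True
			show ?thesis unfolding t by (rule V_no_jump_above[OF ta0(1)]) (rule V_le_before, simp_all add: ta)
		next
			case False
			thus ?thesis using that by (intro V_le_before) (simp_all add: ta)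
		qed
		\<comment> \<open>The infimum is not attained, since the process is still at most \<open>a\<close>
		  at time \<open>ta\<close>; so the interval above \<open>a\<close> begins at some slightly later
		  \<open>s\<close>.\<close>
		have after: "EX s d. ta < s & 0 < d & s + d < ta + e & (ALL u. s <= u --> u < s + d --> a < V u w)" if e: "0 < e" for e
		proof -
			have "T w < ereal (ta + e)" using e by (simp add: ta)
			then obtain s where s: "0 < s" "a < V s w" "s < ta + e"
				unfolding T_def passage_above_def Inf_less_iff by auto
			have "ta < s" using before[of s] s by (meson less_imp_le not_less)
			have "eventually (%u. a < V u w) (at_right s)" using order_tendstoD(1)[OF V_right_cont s(2)] s(1) by simp
			then obtain c where c: "s < c" "!!u. s < u ==> u < c ==> a < V u w" unfolding eventually_at_right_field by blast
			define d where "d = min (c - s) ((ta + e - s) / 2)"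
			have "0 < d" "s + d < ta + e" "s + d <= c" using c(1) s(3) by (auto simp: d_def min_def field_simps)
			moreover have "a < V u w" if "s <= u" "u < s + d" for u
				using c(2)[of u] s(2) that `s + d <= c` by (cases "u = s") auto
			ultimately show ?thesis using `ta < s` by blast
		qed
		have a_eq: "V ta w = a"
		proof (rule antisym)
			show "V ta w <= a" by (rule before[OF ta0(1) order_refl])
			show "a <= V ta w"
			proof (rule ccontr)
				assume "~ ?thesis"
				hence "eventually (%u. V u w < a) (at_right ta)" using order_tendstoD(2)[OF V_right_cont[OF ta0(1)]] by simp
				then obtain c where c: "ta < c" "!!u. ta < u ==> u < c ==> V u w < a" unfolding eventually_at_right_field by blast
				obtain s d where "ta < s" "0 < d" "s + d < ta + (c - ta)" "ALL u. s <= u --> u < s + d --> a < V u w" using after[of "c - ta"] c(1) by auto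
				thus False using c(2)[of s] by force
			qed
		qed
		define G where "G u = exp (- q * u) * S.ff ep (V u w)" for u
		have lim: "stop_limit ep N w = G ta" unfolding stop_limit_def G_def a_eq ta_def[symmetric] using True by simp
		have "((%u. S.rs (V u w - ep)) \<longlongrightarrow> S.rs (V ta w - ep)) (at_right ta)"
			by (rule isCont_tendsto_compose[OF S.rs_isCont]) (intro tendsto_intros V_right_cont ta0)
		hence G: "(G \<longlongrightarrow> G ta) (at_right ta)"
			unfolding G_def S.ff_def by (intro tendsto_intros)
		show ?thesis
			unfolding lim
		proof (rule tendstoI)
			fix r :: real assume "0 < r"
			from tendstoD[OF G this] obtain c where c: "ta < c" "!!u. ta < u ==> u < c ==> dist (G u) (G ta) < r"
				unfolding eventually_at_right_field by blast
			obtain s d where sd: "ta < s" "0 < d" "s + d < ta + min (c - ta) (real N - ta)" "ALL u. s <= u --> u < s + d --> a < V u w"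
				using after[of "min (c - ta) (real N - ta)"] c(1) ta0(2) by auto
			have "eventually (%n. mesh n < d) sequentially"
				using order_tendstoD(2)[OF mesh_tendsto sd(2)] .
			with evg show "eventually (%n. dist (stopped ep N n w) (G ta) < r) sequentially"
			proof eventually_elim
				case (elim n)
				define i where "i = nat \<lceil>real (Suc n) * s\<rceil>"
				have i: "s <= tk n i" "tk n i < s + d"
				proof -
					have "0 <= real (Suc n) * s" using sd(1) ta0(1) by simp
					hence "real (Suc n) * s <= real i" "real i < real (Suc n) * s + 1" unfolding i_def by linarith+
					thus "s <= tk n i" unfolding tk_def by (simp add: le_divide_eq mult.commute del: of_nat_Suc)
					have "tk n i < (real (Suc n) * s + 1) / real (Suc n)"
						unfolding tk_def using `real i < _` by (intro divide_strict_right_mono) auto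
					also have "... = s + mesh n" by (simp add: add_divide_distrib del: of_nat_Suc)
					finally show "tk n i < s + d" using elim(2) by simp
				qed
				define j where "j = (LEAST k. a < V (tk n k) w)"
				have ex: "a < V (tk n i) w" using sd(4) i by blast
				have j: "a < V (tk n j) w" unfolding j_def by (rule LeastI[of "%k. a < V (tk n k) w", OF ex])
				have ji: "j <= i" unfolding j_def by (rule Least_le[of "%k. a < V (tk n k) w", OF ex])
				have tj: "tk n j < s + d" using tk_mono[OF ji, of n] i(2) by simp
				have "tk n j < tk n (N * Suc n)" unfolding tk_end using tj sd(3) by simp
				hence jm: "j < N * Suc n" using tk_mono[of "N * Suc n" j n] by (meson not_less)
				have taj: "ta < tk n j" using before[OF tk_nonneg[of n j]] j by (meson not_less)
				have "stopped ep N n w = G (tk n j)"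
					unfolding G_def
				proof (rule stopped_eq[OF less_imp_le[OF jm]])
					fix k assume k: "k < j"
					have "V (tk n l) w <= a" if "l <= k" for l
						using not_less_Least[of l "%k. a < V (tk n k) w"] that k unfolding j_def[symmetric] by simp
					thus "w \<in> act ep n k" using act[OF elim(1), of k] k jm by simp
				next
					show "w \<notin> act ep n j" using act[OF elim(1) less_imp_le[OF jm]] j by (meson not_less order_refl)
				qed
				thus ?case using c(2)[OF taj] tj sd(3) by simp
			qed
		qed
	qed
qed

lemma stop_limit_measurable: "stop_limit ep N \<in> borel_measurable M"
proof -
	note [measurable] = ff_V_measurable[of "real N" ep]
	have "(%w. if T w < ereal (real N) then exp (- q * real_of_ereal (T w)) * S.ff ep a
		else exp (- q * real N) * S.ff ep (V (real N) w)) \<in> borel_measurable M" by measurable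
	thus ?thesis unfolding stop_limit_def[abs_def] .
qed

lemma stop_limit_estimate:
	obtains K where "0 <= K" "!!ep. 0 < ep ==> ep <= 1 ==> \<bar>(LINT w|M. stop_limit ep N w) - S.ff ep x0\<bar> <= K * ep"
proof -
	obtain L where L: "0 <= L" "!!u v. u <= v ==> v <= max a b ==> S.rs v - S.rs u <= L * (v - u)"
		"!!u v. u <= v ==> v <= max a b ==> S.Zs v - S.Zs u <= L * (v - u)"
		by (rule S.Lipschitz[of "max a b"]) (rule that)
	obtain K where K: "0 <= K" "!!ep n. 0 < ep ==> ep <= 1 ==>
		\<bar>\<Sum>k<N * Suc n. exp (- q * tk n k) * (LINT s|lborel. disc {0..mesh n} q s * gen ep n k s)\<bar>
			<= K * ep + q * E_low N ep n + q * dl * W b * E_b N ep n"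
		by (rule generator_bound[of N]) (rule that)
	have "\<bar>(LINT w|M. stop_limit ep N w) - S.ff ep x0\<bar> <= K * ep" if ep: "0 < ep" "ep <= 1" for ep
	proof -
		have le: "\<bar>(LINT w|M. stopped ep N n w) - S.ff ep x0\<bar> <=
			K * ep + q * E_low N ep n + q * dl * W b * E_b N ep n + (L * dl * E_lag N n + E_bad N ep n)" for n
			using stopped_estimate(2)[OF ep(1) L(1,2), of N n] K(2)[OF ep, of n] by linarith
		have r: "(%n. K * ep + q * E_low N ep n + q * dl * W b * E_b N ep n + (L * dl * E_lag N n + E_bad N ep n))
			----> K * ep + q * 0 + q * dl * W b * 0 + (L * dl * 0 + 0)"
			by (intro tendsto_intros error_limits(1,2,4)[OF ep(1)] error_limits(3)[OF zero_less_one])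
		have "(%n. LINT w|M. stopped ep N n w) ----> (LINT w|M. stop_limit ep N w)"
		proof (rule integral_dominated_convergence[where w = "%w. S.ff ep (x0 + 2 * DU (real N) w)"])
			show "stop_limit ep N \<in> borel_measurable M" by (rule stop_limit_measurable)
			show "(%w. stopped ep N n w) \<in> borel_measurable M" for n
				by (rule borel_measurable_integrable[OF stopped_estimate(1)[OF ep(1) L(1,2)]])
			show "AE w in M. (%n. stopped ep N n w) ----> stop_limit ep N w" by (intro AE_I2 stopped_tendsto ep)
			show "AE w in M. norm (stopped ep N n w) <= S.ff ep (x0 + 2 * DU (real N) w)" for n
				using stopped_bounds by (intro AE_I2) simp
		qed (rule DU_ff_integrable)
		hence l: "(%n. \<bar>(LINT w|M. stopped ep N n w) - S.ff ep x0\<bar>) ----> \<bar>(LINT w|M. stop_limit ep N w) - S.ff ep x0\<bar>"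
			by (intro tendsto_intros)
		have "\<bar>(LINT w|M. stop_limit ep N w) - S.ff ep x0\<bar> <= K * ep + q * 0 + q * dl * W b * 0 + (L * dl * 0 + 0)"
			by (rule LIMSEQ_le[OF l r]) (use le in blast)
		thus ?thesis by simp
	qed
	thus ?thesis using K(1) by (intro that)
qed

lemma stop_limit_bounds:
	assumes "0 <= ep"
	shows "0 <= stop_limit ep N w" "stop_limit ep N w <= 1 + S.rs a"
proof -
	have fa: "S.ff ep y <= 1 + S.rs a" if "y <= a" for y
		using that assms by (simp add: S.ff_def monoD[OF S.rs_mono])
	have f0: "0 <= S.ff ep y" for y using S.ff_ge_1[of ep y] by linarith
	show "0 <= stop_limit ep N w" unfolding stop_limit_def using f0 by simp
	have e: "exp (- q * t) * y <= y" if "0 <= t" "0 <= y" for t y :: real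
		using that S.X.q by (simp add: mult_left_le_one_le)
	have "0 <= real_of_ereal (T w)" by (rule real_of_ereal_pos[OF T_nonneg])
	thus "stop_limit ep N w <= 1 + S.rs a"
		unfolding stop_limit_def using order_trans[OF e[OF _ f0] fa[OF order_refl]] order_trans[OF e[OF _ f0] fa[OF V_le_at_horizon]]
		by simp
qed

lemma stop_limit_integrable: "0 <= ep ==> integrable M (stop_limit ep N)"
	using stop_limit_bounds by (intro integrable_const_bound[of _ "1 + S.rs a"] stop_limit_measurable) simp

text \<open>The constant of \<open>stop_limit_estimate\<close> depends on \<open>N\<close> but not
  on \<open>ep\<close>, and \<open>rs\<close> is Lipschitz up to \<open>a\<close>; as
  \<open>ep\<close> tends to \<open>0\<close> all errors vanish and the martingale identity becomes
  exact.\<close>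

lemma stop_limit_0: "(LINT w|M. stop_limit 0 N w) = 1 + S.rs x0"
proof -
	obtain L where L: "0 <= L" "!!u v. u <= v ==> v <= a ==> S.rs v - S.rs u <= L * (v - u)"
		"!!u v. u <= v ==> v <= a ==> S.Zs v - S.Zs u <= L * (v - u)"
		by (rule S.Lipschitz[of a]) (rule that)
	obtain K where K: "0 <= K" "!!ep. 0 < ep ==> ep <= 1 ==> \<bar>(LINT w|M. stop_limit ep N w) - S.ff ep x0\<bar> <= K * ep"
		by (rule stop_limit_estimate[of N]) (rule that)
	have ff: "\<bar>S.ff 0 y - S.ff ep y\<bar> <= L * ep" if "y <= a" "0 <= ep" for y ep
		using L(2)[of "y - ep" y] monoD[OF S.rs_mono, of "y - ep" y] that by (simp add: S.ff_def)
	have le: "\<bar>(LINT w|M. stop_limit 0 N w) - (1 + S.rs x0)\<bar> <= (K + 2 * L) * ep" if ep: "0 < ep" "ep <= 1" for ep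
	proof -
		have p: "\<bar>stop_limit 0 N w - stop_limit ep N w\<bar> <= L * ep" for w
		proof -
			have e: "\<bar>exp (- q * t) * S.ff 0 y - exp (- q * t) * S.ff ep y\<bar> <= L * ep" if "0 <= t" "y <= a" for t y
			proof -
				have "\<bar>exp (- q * t) * S.ff 0 y - exp (- q * t) * S.ff ep y\<bar> = exp (- q * t) * \<bar>S.ff 0 y - S.ff ep y\<bar>"
					by (simp add: right_diff_distrib[symmetric] abs_mult)
				also have "... <= \<bar>S.ff 0 y - S.ff ep y\<bar>" using that(1) S.X.q by (simp add: mult_left_le_one_le)
				also have "... <= L * ep" using ep by (intro ff that) simp
				finally show ?thesis .
			qed
			show ?thesis
				unfolding stop_limit_def using e[OF real_of_ereal_pos[OF T_nonneg[of w]] order_refl] e[OF _ V_le_at_horizon, of "real N" w N] by auto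
		qed
		have "\<bar>(LINT w|M. stop_limit 0 N w) - (LINT w|M. stop_limit ep N w)\<bar> <= L * ep"
		proof -
			have "\<bar>(LINT w|M. stop_limit 0 N w) - (LINT w|M. stop_limit ep N w)\<bar> = \<bar>LINT w|M. stop_limit 0 N w - stop_limit ep N w\<bar>"
				using ep by (subst integral_diff) (simp_all add: stop_limit_integrable)
			also have "... <= (LINT w|M. \<bar>stop_limit 0 N w - stop_limit ep N w\<bar>)" by (rule integral_abs_bound)
			also have "... <= (LINT w|M. L * ep)"
				using ep by (intro integral_mono p integrable_const integrable_abs integrable_diff stop_limit_integrable) auto
			finally show ?thesis by (simp add: prob_space)
		qed
		moreover have "\<bar>S.ff 0 x0 - S.ff ep x0\<bar> <= L * ep" using ep x0 by (intro ff) auto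
		moreover have "S.ff 0 x0 = 1 + S.rs x0" by (simp add: S.ff_def)
		ultimately show ?thesis using K(2)[OF ep] unfolding distrib_right by linarith
	qed
	have "(%n. (K + 2 * L) * mesh n) ----> (K + 2 * L) * 0" by (intro tendsto_mult tendsto_const mesh_tendsto)
	hence lim: "(%n. (K + 2 * L) * mesh n) ----> 0" by (simp only: mult_zero_right)
	have "\<bar>(LINT w|M. stop_limit 0 N w) - (1 + S.rs x0)\<bar> <= 0"
	proof (rule LIMSEQ_le_const[OF lim])
		show "EX N0. ALL n>=N0. \<bar>(LINT w|M. stop_limit 0 N w) - (1 + S.rs x0)\<bar> <= (K + 2 * L) * mesh n"
			by (intro exI allI impI le) simp_all
	qed
	thus ?thesis by simp
qed

lemma exp_discount_measurable: "(%w. exp_discount q (T w)) \<in> borel_measurable M"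
	unfolding exp_discount_def by measurable

text \<open>Passage is almost surely finite and the stopped values are bounded by
  \<open>r a\<close>, so the horizon \<open>N\<close> can tend to infinity under the
  integral.\<close>

lemma passage_laplace: "(LINT w|M. exp_discount q (T w)) * (1 + S.rs a) = 1 + S.rs x0"
proof -
	have "(%N. LINT w|M. stop_limit 0 N w) ----> (LINT w|M. exp_discount q (T w) * (1 + S.rs a))"
	proof (rule integral_dominated_convergence[where w = "%_. 1 + S.rs a"])
		show "(%w. exp_discount q (T w) * (1 + S.rs a)) \<in> borel_measurable M"
			by (intro borel_measurable_times exp_discount_measurable borel_measurable_const)
		show "AE w in M. (%N. stop_limit 0 N w) ----> exp_discount q (T w) * (1 + S.rs a)"
			using AE_T_finite
		proof eventually_elim
			case (elim w)
			then obtain ta where ta: "T w = ereal ta" using T_nonneg[of w] by (cases "T w") auto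
			obtain N0 :: nat where N0: "ta < real N0" using reals_Archimedean2 by blast
			have "stop_limit 0 N w = exp_discount q (T w) * (1 + S.rs a)" if "N0 <= N" for N
			proof -
				have "ta < real N" using N0 that by (meson less_le_trans of_nat_mono)
				thus ?thesis by (simp add: stop_limit_def exp_discount_def ta S.ff_def)
			qed
			thus ?case by (intro tendsto_eventually) (auto simp: eventually_sequentially)
		qed
		show "AE w in M. norm (stop_limit 0 N w) <= 1 + S.rs a" for N
			using stop_limit_bounds[OF order_refl] by (intro AE_I2) simp
	qed (simp_all add: stop_limit_measurable)
	hence "(LINT w|M. exp_discount q (T w) * (1 + S.rs a)) = 1 + S.rs x0"
		unfolding stop_limit_0 by (simp add: LIMSEQ_const_iff)
	thus ?thesis by simp
qed

end

section \<open>Transfer from the good version back to the original process\<close>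

context
	fixes xi xi' :: "real => real" and dl b :: real
	assumes eq: "!!t. 0 <= t ==> xi t = xi' t"
begin

text \<open>\<open>SOME\<close> is sure to select the same path only from equal predicates; the two
  refraction equations coincide because the starting time is nonnegative.\<close>

lemma stage_path_cong:
	assumes "0 <= start_time S" "0 <= t"
	shows "stage_path dl b xi S t = stage_path dl b xi' S t"
proof (cases S)
	case (Refract ta x)
	hence "0 <= real_of_ereal ta" using assms(1) by (simp add: real_of_ereal_pos)
	hence "refracted_solution dl b xi (real_of_ereal ta) x = refracted_solution dl b xi' (real_of_ereal ta) x"
		unfolding refracted_solution_def by (intro ext) (simp add: eq)
	thus ?thesis using Refract by (simp add: refracted_def)
next
	case (Reflect ta)
	hence ta: "0 <= real_of_ereal ta" using assms(1) by (simp add: real_of_ereal_pos)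
	have "(SUP s\<in>{real_of_ereal ta..t}. - (xi s - xi (real_of_ereal ta))) = (SUP s\<in>{real_of_ereal ta..t}. - (xi' s - xi' (real_of_ereal ta)))"
		using ta by (intro arg_cong[where f = Sup] image_cong) (simp_all add: eq)
	thus ?thesis using Reflect ta assms(2) by (simp add: reflected_def eq)
qed

lemma next_stage_cong:
	assumes "0 <= start_time S"
	shows "next_stage dl b xi S = next_stage dl b xi' S" "0 <= start_time (next_stage dl b xi S)"
proof -
	have t: "0 <= t" if "start_time S < ereal t" for t
		using order.strict_trans1[OF assms that] by simp
	have key: "{t. start_time S < ereal t & P (stage_path dl b xi S t)} = {t. start_time S < ereal t & P (stage_path dl b xi' S t)}" for P
		using stage_path_cong[OF assms t] by auto
	have nonneg: "0 <= Inf (ereal ` {t. start_time S < ereal t & P t})" for P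
		by (rule Inf_greatest) (use t in auto)
	show "next_stage dl b xi S = next_stage dl b xi' S"
	proof (cases S)
		case (Refract ta x)
		show ?thesis using key[of "%v. v < 0"] unfolding Refract next_stage.simps start_time.simps by (rule arg_cong)
	next
		case (Reflect ta)
		show ?thesis using key[of "%v. b < v"] unfolding Reflect next_stage.simps start_time.simps by (rule arg_cong)
	qed
	show "0 <= start_time (next_stage dl b xi S)"
	proof (cases S)
		case (Refract ta x)
		show ?thesis using nonneg unfolding Refract next_stage.simps start_time.simps .
	next
		case (Reflect ta)
		show ?thesis using nonneg unfolding Reflect next_stage.simps start_time.simps .
	qed
qed

lemma stages_cong: "stages dl b xi n = stages dl b xi' n" "0 <= start_time (stages dl b xi n)"
proof -
	have "stages dl b xi n = stages dl b xi' n & 0 <= start_time (stages dl b xi n)"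
	proof (induction n)
		case 0
		show ?case by (simp add: eq)
	next
		case (Suc n)
		show ?case unfolding stages.simps conjunct1[OF Suc, symmetric] using next_stage_cong[OF conjunct2[OF Suc]] by blast
	qed
	thus "stages dl b xi n = stages dl b xi' n" "0 <= start_time (stages dl b xi n)" by auto
qed

lemma refracted_reflected_cong: "0 <= t ==> refracted_reflected dl b xi t = refracted_reflected dl b xi' t"
	unfolding refracted_reflected_def stages_cong(1)[symmetric] by (rule stage_path_cong[OF stages_cong(2)])

end

lemma finite_variation_on_cong:
	assumes "!!t. 0 <= t ==> xi t = xi' t"
	shows "finite_variation_on 0 T xi \<longleftrightarrow> finite_variation_on 0 T xi'"
proof -
	have "{(\<Sum>i<n. \<bar>xi (s (Suc i)) - xi (s i)\<bar>) | (n :: nat) (s :: nat => real). mono s & range s <= {0..T}} =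
		{(\<Sum>i<n. \<bar>xi' (s (Suc i)) - xi' (s i)\<bar>) | (n :: nat) (s :: nat => real). mono s & range s <= {0..T}}"
	proof -
		have "xi (s i) = xi' (s i)" if "range s <= {0..T}" for s :: "nat => real" and i
			using subsetD[OF that rangeI[of s i]] by (intro assms) simp
		thus ?thesis by (intro Collect_cong) (metis (no_types, lifting) sum.cong)
	qed
	thus ?thesis unfolding finite_variation_on_def by simp
qed

lemma borel_measurable_completion_AE_eq:
	fixes f g :: "'a => real"
	assumes g: "g \<in> borel_measurable M" and eq: "AE x in M. f x = g x"
	shows "f \<in> borel_measurable (completion M)"
proof (rule measurableI)
	fix A :: "real set" assume A: "A \<in> sets borel"
	show "f -` A \<inter> space (completion M) \<in> sets (completion M)"
	proof (rule completion.in_sets_AE)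
		show "AE x in completion M. x \<in> g -` A \<inter> space M \<longleftrightarrow> x \<in> f -` A \<inter> space (completion M)"
			using AE_completion[OF eq] by eventually_elim simp
		show "g -` A \<inter> space M \<in> sets (completion M)" using measurable_sets[OF g A] by (rule sets_completionI_sets)
	qed simp
qed simp

lemma is_scale_function_scale:
	assumes W: "is_scale_function M X q W" and q: "0 <= q"
		and ex: "EX th0>=0. ALL th>=th0. q < Ps th" and Ps: "!!th. 0 <= th ==> laplace_exponent M X th = Ps th"
	shows "EX ka0. ALL ka>=ka0. scale_function Ps q ka W"
proof -
	have neg: "W x = 0" if "x < 0" for x using W that by (simp add: is_scale_function_def)
	have e: "indicator {0..} x *\<^sub>R (exp (- th * x) * W x) = exp (- th * x) * W x" for th x
		using neg[of x] by (cases "x < 0") auto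
	show ?thesis
	proof (rule scale_function_I[where Ph = "max 0 (laplace_inverse M X q)"])
		show "continuous_on {0..} W" "mono_on {0..} W" using W by (auto simp: is_scale_function_def)
		fix th assume "max 0 (laplace_inverse M X q) < th"
		hence th: "laplace_inverse M X q < th" "0 <= th" by auto
		hence "set_integrable lborel {0..} (%x. exp (- th * x) * W x)"
			"(LINT x:{0..}|lborel. exp (- th * x) * W x) = 1 / (laplace_exponent M X th - q)"
			using W by (auto simp: is_scale_function_def)
		thus "integrable lborel (%x. exp (- th * x) * W x)" "laplace W th = 1 / (Ps th - q)"
			unfolding set_integrable_def set_lebesgue_integral_def e laplace_def Ps[OF th(2)] by auto
	qed (rule neg q ex | assumption)+
qed

theorem corollary4p2:
  fixes M :: "'a measure" and X :: "real \<Rightarrow> 'a \<Rightarrow> real"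
    and \<gamma> \<sigma> \<delta> b q a x :: real and \<nu> :: "real measure"
    and W WW :: "real \<Rightarrow> real"
  assumes "spectrally_negative M X"
    and "levy_triplet M X \<gamma> \<sigma> \<nu>"
    and "b > 0" and "\<delta> \<ge> 0"
    and "bounded_variation_paths M X \<Longrightarrow> \<delta> < bv_drift \<gamma> \<nu>"
    and "q \<ge> 0" and "a > 0" and "x \<le> a"
    and "is_scale_function M X q W"
    and "is_scale_function M (\<lambda>t \<omega>. X t \<omega> - \<delta> * t) q WW"
  shows "(LINT \<omega>|completion M. exp_discount q (T_plus X \<delta> b x a \<omega>)) =
           r_fun q \<delta> b W WW x / r_fun q \<delta> b W WW a \<and>
         (AE \<omega> in M. T_plus X \<delta> b x a \<omega> < \<infinity>)"
proof -
	obtain X' where X': "good_levy M X'" and AE: "AE w in M. ALL t>=0. X t w = X' t w"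
		using spectrally_negative_modification[OF assms(1)] .
	interpret good_levy M X' by (rule X')
	have Xm: "X 1 \<in> borel_measurable M"
		using assms(1) by (simp add: spectrally_negative_def levy_process_def)
	have E1: "(LINT w|M. exp (th * (X 1 w - c))) = (LINT w|M. exp (th * (X' 1 w - c)))" for th c
	proof (rule integral_cong_AE)
		show "(%w. exp (th * (X 1 w - c))) \<in> borel_measurable M" using Xm by measurable
		show "AE w in M. exp (th * (X 1 w - c)) = exp (th * (X' 1 w - c))" using AE by eventually_elim simp
	qed measurable
	have lX: "laplace_exponent M X th = ps th" for th
		using E1[of th 0] by (simp add: laplace_exponent_def ps_def)
	have lY: "laplace_exponent M (%t w. X t w - \<delta> * t) th = ps th - \<delta> * th" if "0 <= th" for th
		using E1[of th \<delta>] exp_integrable_drift(2)[OF zero_le_one that, of \<delta>] by (simp add: laplace_exponent_def)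
	have trip: "levy_triplet M X' \<gamma> \<sigma> \<nu>"
		using assms(2) lX unfolding levy_triplet_def ps_def by simp
	have bv: "\<delta> < bv_drift \<gamma> \<nu>" if "bounded_variation_paths M X'"
	proof (rule assms(5))
		show "bounded_variation_paths M X"
			using that AE unfolding bounded_variation_paths_def
		proof eventually_elim
			case (elim w)
			thus ?case using finite_variation_on_cong[of "%t. X t w" "%t. X' t w"] by simp
		qed
	qed
	have exdl: "EX th>=0. \<delta> * th < ps th" by (rule exponent_exceeds_drift[OF assms(4) trip bv])
	hence ex0: "EX th>=0. 0 * th < ps th"
		using assms(4) by (metis mult_nonneg_nonneg mult_zero_left order.strict_trans1)
	obtain ka1 where ka1: "!!ka. ka1 <= ka ==> scale_function ps q ka W"
		using is_scale_function_scale[OF assms(9,6) exponent_grows[OF ex0, of q, simplified] lX] by blast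
	obtain ka2 where ka2: "!!ka. ka2 <= ka ==> scale_function (%th. ps th - \<delta> * th) q ka WW"
		using is_scale_function_scale[OF assms(10,6) exponent_grows[OF exdl] lY] by blast
	\<comment> \<open>One rate that serves both scale functions.\<close>
	define ka where "ka = max ka1 ka2"
	have "refraction_scales ps q ka \<delta> W WW b"
		unfolding refraction_scales_def refraction_scales_axioms_def using ka1[of ka] ka2[of ka] assms(3,4) by (simp add: ka_def)
	hence "rr_levy M X' q ka \<delta> b x a W WW"
		by (intro rr_levy.intro X' rr_levy_axioms.intro assms(7,8) exdl)
	then interpret rr_levy M X' q ka \<delta> b x a W WW .
	have T_eq: "AE w in M. T_plus X \<delta> b x a w = T w"
		using AE AE_regular
	proof eventually_elim
		case (elim w)
		interpret R: regular_path "%t. X' t w" x \<delta> b by (rule elim(2))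
		have "refracted_reflected \<delta> b (%t. x + X t w) t = V t w" if "0 < t" for t
			using refracted_reflected_cong[of "%t. x + X t w" "%t. x + X' t w" t \<delta> b] elim(1) that R.refracted_reflected_eq[of t]
			by (simp add: VK_def x0_def)
		hence "{t. 0 < t & a < refracted_reflected \<delta> b (%t. x + X t w) t} = {t. 0 < t & a < V t w}" by auto
		thus ?case unfolding T_plus_def T_def passage_above_def by simp
	qed
	have AE_d: "AE w in M. exp_discount q (T_plus X \<delta> b x a w) = exp_discount q (T w)"
		using T_eq by eventually_elim simp
	\<comment> \<open>\<open>T_plus\<close> is known to equal the measurable \<open>T\<close> only
	  almost everywhere, hence the completion.\<close>
	have "(LINT w|completion M. exp_discount q (T_plus X \<delta> b x a w)) = (LINT w|completion M. exp_discount q (T w))"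
		by (rule integral_cong_AE[OF borel_measurable_completion_AE_eq[OF exp_discount_measurable AE_d]
				measurable_completion[OF exp_discount_measurable] AE_completion[OF AE_d]])
	also have "... = (LINT w|M. exp_discount q (T w))" by (rule integral_completion[OF exp_discount_measurable])
	also have "... = (1 + S.rs x0) / (1 + S.rs a)"
		using passage_laplace S.rs_nonneg[of a] by (simp add: field_simps)
	\<comment> \<open>For \<open>x <= 0\<close> both sides vanish, as \<open>rs\<close> is
	  \<open>0\<close> on the nonpositive half-line.\<close>
	also have "S.rs x0 = S.rs x" by (cases "x <= 0") (simp_all add: x0_def S.rs_nonpos)
	finally have "(LINT w|completion M. exp_discount q (T_plus X \<delta> b x a w)) = r_fun q \<delta> b W WW x / r_fun q \<delta> b W WW a"
		unfolding S.r_fun_eq .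
	moreover have "AE w in M. T_plus X \<delta> b x a w < \<infinity>"
		using T_eq AE_T_finite by eventually_elim simp
	ultimately show ?thesis ..
qed

end
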